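(* As $n\to\infty$, the following convergences hold in distribution in the space $\mathbb{D}([0,1],\mathbb{R}^3)$: (i) $$\left(\frac{h_{0,n}(t)}{2n},\frac{h_{1,n}(t)}{2n},\frac{h_{2,n}(t)}{2n}\right)_{0\le t\le1}\xrightarrow{(d)}\left(\frac t4,\frac t2,\frac t4\right)_{0\le t\le 1};$$ (ii) $$\left(\ell_{0,n}(t),\ell_{1,n}(t),\ell_{2,n}(t)\right)_{0\le t\le1}\xrightarrow{(d)}\left(\frac t8,\frac t2,\frac{3t}8\right)_{0\le t\le 1}.$$
   Context: Let $n\ge3$. Select $n$ i.i.d. points uniformly at random on the unit circle and label them $P_1,\ldots,P_n$ in counterclockwise cyclic order. For $1\le i\le n$ consider the perpendicular bisector of $[P_i,P_{i+1}]$ (indices modulo $n$). Almost surely these $n$ lines are pairwise distinct and contain none of the points; they all pass through the center of the circle and divide the plane, hence the circle, into $2n$ regions (on the circle, arcs). The antipodal region of a region is its image under $z\mapsto -z$. For $k\in\{0,1,2\}$, a region is of type $k$ if the total number of points $P_j$ contained in the union of the region with its antipodal region is $k$. The length of a region is the length of the corresponding arc of the circle, with distances rescaled so that the total length of the circle is $1$. For $k\in\{0,1,2\}$ and $t\in[0,1]$, $h_{k,n}(t)$ (resp. $\ell_{k,n}(t)$) is the number of regions (resp. the sum of the lengths of the regions) of type $k$ whose arc is entirely contained in the counterclockwise arc from $1$ to $e^{2i\pi t}$ (the whole circle when $t=1$). $\mathbb{D}([0,1],\mathbb{R}^3)$ is the space of càdlàg functions from $[0,1]$ to $\mathbb{R}^3$,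 endowed with the Skorokhod $J_1$ topology. *)

theory Defs
  imports "HOL-Probability.Probability"
begin

text \<open>Paths are made extensional so that two paths agreeing on \<open>[0,1]\<close> are equal.\<close>

definition cadlag_paths :: "(real \<Rightarrow> 'a::metric_space) set" where
  "cadlag_paths = {f \<in> extensional {0..1}.
     (\<forall>t. 0 \<le> t \<and> t < 1 \<longrightarrow> (f \<longlongrightarrow> f t) (at_right t)) \<and>
     (\<forall>t. 0 < t \<and> t \<le> 1 \<longrightarrow> (\<exists>l. (f \<longlongrightarrow> l) (at_left t)))}"

definition time_changes :: "(real \<Rightarrow> real) set" where
  "time_changes = {\<phi>. strict_mono_on {0..1} \<phi> \<and> continuous_on {0..1} \<phi> \<and> \<phi> ` {0..1} = {0..1}}"

definition J1_close :: "(real \<Rightarrow> 'a::metric_space) \<Rightarrow> (real \<Rightarrow> 'a) \<Rightarrow> real \<Rightarrow> bool" where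
  "J1_close f g \<epsilon> \<longleftrightarrow> 0 < \<epsilon> \<and>
     (\<exists>\<phi>\<in>time_changes. \<forall>t\<in>{0..1}. \<bar>\<phi> t - t\<bar> \<le> \<epsilon> \<and> dist (f t) (g (\<phi> t)) \<le> \<epsilon>)"

text \<open>The value 0 off \<^const>\<open>cadlag_paths\<close> is a dummy: the locale \<^locale>\<open>Metric_space\<close> asks for
  nonnegativity and symmetry on the whole type.\<close>

definition J1_dist :: "(real \<Rightarrow> 'a::metric_space) \<Rightarrow> (real \<Rightarrow> 'a) \<Rightarrow> real" where
  "J1_dist f g = (if f \<in> cadlag_paths \<and> g \<in> cadlag_paths then Inf {\<epsilon>. J1_close f g \<epsilon>} else 0)"

definition J1_topology :: "(real \<Rightarrow> 'a::metric_space) topology" where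
  "J1_topology = Metric_space.mtopology cadlag_paths J1_dist"

lemma time_change_range: "\<phi> \<in> time_changes \<Longrightarrow> t \<in> {0..1} \<Longrightarrow> \<phi> t \<in> {0..1}"
  unfolding time_changes_def by blast

lemma time_change_id: "(\<lambda>t. t) \<in> time_changes"
  by (auto simp: time_changes_def strict_mono_on_def)

lemma time_change_comp:
  assumes "\<phi> \<in> time_changes" "\<mu> \<in> time_changes"
  shows "(\<lambda>t. \<mu> (\<phi> t)) \<in> time_changes"
proof -
  have s: "strict_mono_on {0..1} \<phi>" "strict_mono_on {0..1} \<mu>"
    and c: "continuous_on {0..1} \<phi>" "continuous_on {0..1} \<mu>"
    and i: "\<phi> ` {0..1} = {0..1}" "\<mu> ` {0..1} = {0..1}"
    using assms by (simp_all add: time_changes_def)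
  have "continuous_on {0..1} (\<lambda>t. \<mu> (\<phi> t))"
    by (rule continuous_on_compose2[OF c(2) c(1)]) (simp add: i)
  moreover have "strict_mono_on {0..1} (\<lambda>t. \<mu> (\<phi> t))"
    by (intro strict_mono_onI strict_mono_onD[OF s(2)] strict_mono_onD[OF s(1)]
        time_change_range[OF assms(1)])
  moreover have "(\<lambda>t. \<mu> (\<phi> t)) ` {0..1} = \<mu> ` (\<phi> ` {0..1})" by (rule image_image[symmetric])
  then have "(\<lambda>t. \<mu> (\<phi> t)) ` {0..1} = {0..1}" by (simp only: i)
  ultimately show ?thesis by (simp add: time_changes_def)
qed

lemma time_change_inv:
  assumes "\<phi> \<in> time_changes"
  obtains \<mu> where "\<mu> \<in> time_changes" "\<And>t. t \<in> {0..1} \<Longrightarrow> \<phi> (\<mu> t) = t"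
proof -
  define \<mu> where "\<mu> = inv_into {0..1} \<phi>"
  have sm: "strict_mono_on {0..1} \<phi>" and co: "continuous_on {0..1} \<phi>"
    and im: "\<phi> ` {0..1} = {0..1}" using assms by (auto simp: time_changes_def)
  have inj: "inj_on \<phi> {0..1}" using sm by (rule strict_mono_on_imp_inj_on)
  have r: "\<mu> t \<in> {0..1}" "\<phi> (\<mu> t) = t" if "t \<in> {0..1}" for t
    using that im by (auto simp: \<mu>_def inv_into_into f_inv_into_f simp del: atLeastAtMost_iff)
  have "strict_mono_on {0..1} \<mu>"
  proof (rule strict_mono_onI)
    fix a b :: real assume ab: "a \<in> {0..1}" "b \<in> {0..1}" "a < b"
    show "\<mu> a < \<mu> b"
    proof (rule ccontr)
      assume "\<not> \<mu> a < \<mu> b"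
      then have "\<phi> (\<mu> b) \<le> \<phi> (\<mu> a)"
        by (intro mono_onD[OF strict_mono_on_imp_mono_on[OF sm] r(1)[OF ab(2)] r(1)[OF ab(1)]]) simp
      then show False using r(2) ab by force
    qed
  qed
  moreover have "continuous_on {0..1} \<mu>"
    using continuous_on_inv[OF co compact_Icc, of \<mu>] inj im
    by (simp add: \<mu>_def inv_into_f_f del: atLeastAtMost_iff)
  moreover have "\<mu> ` {0..1} = {0..1}"
  proof
    show "\<mu> ` {0..1} \<subseteq> {0..1}" using r(1) by blast
    show "{0..1} \<subseteq> \<mu> ` {0..1}"
    proof
      fix x :: real assume x: "x \<in> {0..1}"
      then have "\<phi> x \<in> {0..1}" "\<mu> (\<phi> x) = x"
        using im inv_into_f_f[OF inj] unfolding \<mu>_def by blast+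
      then show "x \<in> \<mu> ` {0..1}" by (metis imageI)
    qed
  qed
  ultimately show ?thesis using that r by (auto simp: time_changes_def)
qed

lemma cadlag_bounded:
  fixes f :: "real \<Rightarrow> 'a::metric_space"
  assumes "f \<in> cadlag_paths"
  shows "bounded (f ` {0..1})"
proof -
  have near: "bounded (f ` S)" if "\<And>x. x \<in> S \<Longrightarrow> dist (f x) c < 1" for S c
    using that by (auto simp: bounded_def dist_commute intro!: exI[of _ c] exI[of _ 1] less_imp_le)
  have "\<exists>U. open U \<and> t \<in> U \<and> bounded (f ` (U \<inter> {0..1}))" if t: "t \<in> {0..1}" for t
  proof -
    have "\<exists>b>t. bounded (f ` ({t<..<b} \<inter> {0..1}))"
    proof (cases "t < 1")
      case True
      then have "(f \<longlongrightarrow> f t) (at_right t)" using assms t by (auto simp: cadlag_paths_def)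
      then have "\<forall>\<^sub>F x in at_right t. dist (f x) (f t) < 1" by (rule tendstoD) simp
      then obtain b where "b > t" "\<And>x. x > t \<Longrightarrow> x < b \<Longrightarrow> dist (f x) (f t) < 1"
        by (auto simp: eventually_at_right_field)
      then show ?thesis by (intro exI[of _ b] conjI near[of _ "f t"]) auto
    next
      case False
      then have "{t<..<t+1} \<inter> {0..1} = {}" by auto
      then show ?thesis by (intro exI[of _ "t + 1"]) simp
    qed
    then obtain b where b: "b > t" "bounded (f ` ({t<..<b} \<inter> {0..1}))" by blast
    have "\<exists>a<t. bounded (f ` ({a<..<t} \<inter> {0..1}))"
    proof (cases "0 < t")
      case True
      then obtain l where "(f \<longlongrightarrow> l) (at_left t)" using assms t by (auto simp: cadlag_paths_def)
      then have "\<forall>\<^sub>F x in at_left t. dist (f x) l < 1" by (rule tendstoD) simp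
      then obtain a where "a < t" "\<And>x. x > a \<Longrightarrow> x < t \<Longrightarrow> dist (f x) l < 1"
        by (auto simp: eventually_at_left_field)
      then show ?thesis by (intro exI[of _ a] conjI near[of _ l]) auto
    next
      case False
      then have "{t - 1<..<t} \<inter> {0..1} = {}" by auto
      then show ?thesis by (intro exI[of _ "t - 1"]) simp
    qed
    then obtain a where a: "a < t" "bounded (f ` ({a<..<t} \<inter> {0..1}))" by blast
    have "f ` ({a<..<b} \<inter> {0..1}) \<subseteq>
        f ` ({a<..<t} \<inter> {0..1}) \<union> f ` ({t<..<b} \<inter> {0..1}) \<union> {f t}"
    proof
      fix y assume "y \<in> f ` ({a<..<b} \<inter> {0..1})"
      then obtain x where "x \<in> {a<..<b} \<inter> {0..1}" "y = f x" by blast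
      moreover have "x < t \<or> x = t \<or> t < x" by linarith
      ultimately show "y \<in> f ` ({a<..<t} \<inter> {0..1}) \<union> f ` ({t<..<b} \<inter> {0..1}) \<union> {f t}"
        by auto
    qed
    then have "bounded (f ` ({a<..<b} \<inter> {0..1}))"
      using a b by (meson bounded_Un bounded_subset bounded_insert bounded_empty)
    then show ?thesis using a b by (intro exI[of _ "{a<..<b}"]) auto
  qed
  then obtain U where U: "\<And>t. t \<in> {0..1} \<Longrightarrow> open (U t)" "\<And>t. t \<in> {0..1} \<Longrightarrow> t \<in> U t"
    "\<And>t. t \<in> {0..1} \<Longrightarrow> bounded (f ` (U t \<inter> {0..1}))" by metis
  have "compact {0..1::real}" by simp
  then obtain C where C: "C \<subseteq> {0..1}" "finite C" "{0..1} \<subseteq> (\<Union>t\<in>C. U t)"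
    by (rule compactE_image[where C = "{0..1}" and f = U]) (use U in auto)
  have "f ` {0..1} \<subseteq> (\<Union>t\<in>C. f ` (U t \<inter> {0..1}))" using C(3) by blast
  moreover have "bounded (\<Union>t\<in>C. f ` (U t \<inter> {0..1}))"
    using C U(3) by (intro bounded_UN) auto
  ultimately show ?thesis by (rule bounded_subset[rotated])
qed

lemma J1_close_exists:
  assumes "f \<in> cadlag_paths" "g \<in> cadlag_paths"
  shows "\<exists>\<epsilon>. J1_close f g \<epsilon>"
proof -
  have "bounded (f ` {0..1} \<union> g ` {0..1})" using assms by (simp add: cadlag_bounded)
  then obtain e where e: "\<And>x y. x \<in> f ` {0..1} \<union> g ` {0..1} \<Longrightarrow> y \<in> f ` {0..1} \<union> g ` {0..1}
      \<Longrightarrow> dist x y \<le> e"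
    unfolding bounded_two_points by blast
  have "J1_close f g (\<bar>e\<bar> + 1)"
    unfolding J1_close_def
  proof (intro conjI bexI[OF _ time_change_id] ballI)
    fix t :: real assume "t \<in> {0..1}"
    then have "dist (f t) (g t) \<le> e" by (intro e) auto
    then show "dist (f t) (g t) \<le> \<bar>e\<bar> + 1" by linarith
  qed auto
  then show ?thesis ..
qed

lemma J1_close_sym:
  assumes "J1_close f g \<epsilon>" shows "J1_close g f \<epsilon>"
proof -
  obtain \<phi> where e: "0 < \<epsilon>" and l: "\<phi> \<in> time_changes"
    "\<And>t. t \<in> {0..1} \<Longrightarrow> \<bar>\<phi> t - t\<bar> \<le> \<epsilon> \<and> dist (f t) (g (\<phi> t)) \<le> \<epsilon>"
    using assms by (auto simp: J1_close_def)
  obtain \<mu> where m: "\<mu> \<in> time_changes" "\<And>t. t \<in> {0..1} \<Longrightarrow> \<phi> (\<mu> t) = t"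
    using time_change_inv[OF l(1)] by blast
  have "\<bar>\<mu> t - t\<bar> \<le> \<epsilon> \<and> dist (g t) (f (\<mu> t)) \<le> \<epsilon>" if "t \<in> {0..1}" for t
    using l(2)[OF time_change_range[OF m(1) that]] m(2)[OF that]
    by (simp add: dist_commute abs_minus_commute)
  then show ?thesis unfolding J1_close_def using e m(1) by blast
qed

lemma J1_close_trans:
  assumes "J1_close f g a" "J1_close g h b" shows "J1_close f h (a + b)"
proof -
  obtain \<phi> where l: "0 < a" "\<phi> \<in> time_changes"
    "\<And>t. t \<in> {0..1} \<Longrightarrow> \<bar>\<phi> t - t\<bar> \<le> a \<and> dist (f t) (g (\<phi> t)) \<le> a"
    using assms by (auto simp: J1_close_def)
  obtain \<mu> where m: "0 < b" "\<mu> \<in> time_changes"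
    "\<And>t. t \<in> {0..1} \<Longrightarrow> \<bar>\<mu> t - t\<bar> \<le> b \<and> dist (g t) (h (\<mu> t)) \<le> b"
    using assms by (auto simp: J1_close_def)
  have "\<bar>\<mu> (\<phi> t) - t\<bar> \<le> a + b \<and> dist (f t) (h (\<mu> (\<phi> t))) \<le> a + b" if "t \<in> {0..1}" for t
    using l(3)[OF that] m(3)[OF time_change_range[OF l(2) that]]
      dist_triangle[of "f t" "h (\<mu> (\<phi> t))" "g (\<phi> t)"] by linarith
  then show ?thesis
    unfolding J1_close_def using l(1) m(1) time_change_comp[OF l(2) m(2)]
    by (intro conjI bexI[of _ "\<lambda>t. \<mu> (\<phi> t)"]) auto
qed

lemma J1_dist_less:
  assumes "f \<in> cadlag_paths" "g \<in> cadlag_paths" "J1_dist f g < e"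
  obtains \<epsilon> where "J1_close f g \<epsilon>" "\<epsilon> < e"
  using assms J1_close_exists[OF assms(1,2)] cInf_lessD[of "{\<epsilon>. J1_close f g \<epsilon>}" e]
  by (auto simp: J1_dist_def)

lemma J1_dist_le:
  assumes "f \<in> cadlag_paths" "g \<in> cadlag_paths" "J1_close f g \<epsilon>"
  shows "J1_dist f g \<le> \<epsilon>"
proof -
  have "bdd_below {\<epsilon>. J1_close f g \<epsilon>}"
    by (rule bdd_belowI[of _ 0]) (auto simp: J1_close_def)
  then show ?thesis using assms by (auto simp: J1_dist_def intro: cInf_lower)
qed

lemma J1_dist_nonneg: "0 \<le> J1_dist f g"
proof (cases "f \<in> cadlag_paths \<and> g \<in> cadlag_paths")
  case True
  show ?thesis
  proof -
    have "0 \<le> Inf {\<epsilon>. J1_close f g \<epsilon>}"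
    proof (rule cInf_greatest)
      show "{\<epsilon>. J1_close f g \<epsilon>} \<noteq> {}" using J1_close_exists[of f g] True by blast
      show "0 \<le> \<epsilon>" if "\<epsilon> \<in> {\<epsilon>. J1_close f g \<epsilon>}" for \<epsilon>
        using that by (simp add: J1_close_def)
    qed
    then show ?thesis using True by (simp add: J1_dist_def)
  qed
qed (auto simp: J1_dist_def)

lemma J1_dist_zero:
  assumes fg: "f \<in> cadlag_paths" "g \<in> cadlag_paths" and z: "J1_dist f g = 0"
  shows "f = g"
proof -
  have eq: "f t = g t" if t: "t \<in> {0..1}" for t
  proof -
    have *: "dist (f t) (g t) \<le> 3 * e" if e: "e > 0" for e
    proof (cases "t < 1")
      case True
      have "\<forall>\<^sub>F x in at_right t. dist (f x) (f t) < e \<and> dist (g x) (g t) < e"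
        using fg t True e unfolding cadlag_paths_def by (intro eventually_conj tendstoD) auto
      then obtain b' where b': "b' > t"
        "\<And>x. x > t \<Longrightarrow> x < b' \<Longrightarrow> dist (f x) (f t) < e \<and> dist (g x) (g t) < e"
        by (auto simp: eventually_at_right_field)
      define b where "b = min b' 1"
      define u where "u = (t + b) / 2"
      have b: "t < b" "b \<le> b'" "b \<le> 1" using b' True by (auto simp: b_def)
      obtain \<epsilon> where \<epsilon>: "J1_close f g \<epsilon>" "\<epsilon> < min e ((b - t) / 2)"
        using J1_dist_less[OF fg, of "min e ((b - t) / 2)"] z e b by auto
      have u: "u \<in> {0..1}" "t < u" "u < b'" using t b by (auto simp: u_def)
      from \<epsilon>(1) u(1) obtain \<phi> where l: "\<bar>\<phi> u - u\<bar> \<le> \<epsilon>" "dist (f u) (g (\<phi> u)) \<le> \<epsilon>"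
        unfolding J1_close_def by blast
      have "t < \<phi> u" "\<phi> u < b'" using l(1) \<epsilon>(2) b unfolding u_def
        by (auto simp: field_simps min_def abs_le_iff split: if_splits)
      then have "dist (g (\<phi> u)) (g t) < e" "dist (f u) (f t) < e" using b'(2) u by auto
      then show ?thesis
        using l(2) \<epsilon>(2) dist_triangle[of "f t" "g t" "f u"] dist_triangle[of "f u" "g t" "g (\<phi> u)"]
        by (simp add: dist_commute)
    next
      case False
      then have t1: "t = 1" using t by auto
      obtain \<epsilon> where \<epsilon>: "J1_close f g \<epsilon>" "\<epsilon> < e"
        using J1_dist_less[OF fg, of e] z e by auto
      obtain \<phi> where l: "\<phi> \<in> time_changes" "dist (f 1) (g (\<phi> 1)) \<le> \<epsilon>"
        using \<epsilon>(1) by (auto simp: J1_close_def)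
      obtain s where s: "s \<in> {0..1}" "\<phi> s = 1"
      proof -
        have "1 \<in> \<phi> ` {0..1}" using l(1) by (simp add: time_changes_def)
        then show ?thesis using that by (metis imageE)
      qed
      have "\<phi> s \<le> \<phi> 1"
      proof -
        have "mono_on {0..1} \<phi>"
          using l(1) by (auto simp: time_changes_def intro: strict_mono_on_imp_mono_on)
        then show ?thesis using s by (intro mono_onD[of "{0..1}" \<phi> s 1]) auto
      qed
      moreover have "\<phi> 1 \<le> 1" using time_change_range[OF l(1), of 1] by simp
      ultimately have "\<phi> 1 = 1" using s by simp
      then show ?thesis using l(2) \<epsilon>(2) e t1 by simp
    qed
    then have "dist (f t) (g t) \<le> 0 + e" if "e > 0" for e
      using *[of "e / 3"] that by simp
    then have "dist (f t) (g t) \<le> 0" by (rule field_le_epsilon)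
    then show ?thesis by simp
  qed
  show ?thesis
    using fg eq by (intro extensionalityI[of f "{0..1}"]) (auto simp: cadlag_paths_def)
qed

lemma Metric_space_J1: "Metric_space cadlag_paths J1_dist"
proof
  fix f g h :: "real \<Rightarrow> 'a"
  show "0 \<le> J1_dist f g" by (rule J1_dist_nonneg)
  have "J1_close f g = J1_close g f" using J1_close_sym by blast
  then show "J1_dist f g = J1_dist g f" by (auto simp: J1_dist_def)
  show "J1_dist f g = 0 \<longleftrightarrow> f = g" if fg: "f \<in> cadlag_paths" "g \<in> cadlag_paths"
  proof
    assume "f = g"
    then have "J1_close f g e" if "e > 0" for e
      using that unfolding J1_close_def by (intro conjI bexI[OF _ time_change_id]) auto
    then have "J1_dist f g \<le> 0 + e" if "e > 0" for e using that J1_dist_le[OF fg] by simp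
    then have "J1_dist f g \<le> 0" by (rule field_le_epsilon)
    then show "J1_dist f g = 0" using J1_dist_nonneg[of f g] by simp
  qed (rule J1_dist_zero[OF fg])
  show "J1_dist f h \<le> J1_dist f g + J1_dist g h"
    if fgh: "f \<in> cadlag_paths" "g \<in> cadlag_paths" "h \<in> cadlag_paths"
  proof (rule field_le_epsilon)
    fix e :: real assume e: "0 < e"
    obtain a where a: "J1_close f g a" "a < J1_dist f g + e / 2"
      using J1_dist_less[OF fgh(1,2), of "J1_dist f g + e / 2"] e by auto
    obtain b where b: "J1_close g h b" "b < J1_dist g h + e / 2"
      using J1_dist_less[OF fgh(2,3), of "J1_dist g h + e / 2"] e by auto
    show "J1_dist f h \<le> J1_dist f g + J1_dist g h + e"
      using J1_dist_le[OF fgh(1,3) J1_close_trans[OF a(1) b(1)]] a(2) b(2) by simp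
  qed
qed

definition borel_of :: "'a topology \<Rightarrow> 'a measure" where
  "borel_of T = sigma (topspace T) {U. openin T U}"

text \<open>The random elements \<open>X n\<close> may live on different probability spaces; \<open>\<nu>\<close> is the law of the
  limit. Measurability is required eventually only, since \<open>X n\<close> need not be a meaningful object
  for small \<open>n\<close>.\<close>

definition converges_in_distribution ::
  "'b topology \<Rightarrow> (nat \<Rightarrow> 'a measure) \<Rightarrow> (nat \<Rightarrow> 'a \<Rightarrow> 'b) \<Rightarrow> 'b measure \<Rightarrow> bool" where
  "converges_in_distribution T M X \<nu> \<longleftrightarrow>
     (\<forall>\<^sub>F n in sequentially. prob_space (M n) \<and> X n \<in> M n \<rightarrow>\<^sub>M borel_of T) \<and>
     prob_space \<nu> \<and> sets \<nu> = sets (borel_of T) \<and>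
     (\<forall>f. continuous_map T euclideanreal f \<and> bounded (f ` topspace T) \<longrightarrow>
        (\<lambda>n. \<integral>\<omega>. f (X n \<omega>) \<partial>M n) \<longlonglongrightarrow> (\<integral>x. f x \<partial>\<nu>))"

definition circle_space :: "complex measure" where
  "circle_space = restrict_space borel (sphere 0 1)"

definition uniform_circle :: "complex measure" where
  "uniform_circle = distr (uniform_measure lborel {0..<1}) circle_space (\<lambda>u. cis (2 * pi * u))"

text \<open>Points are labelled in counterclockwise order starting from 1 (indices \<open>0, \<dots>, n - 1\<close>); the
  regions and their types do not depend on the starting point of the cyclic labelling.\<close>

definition labelled :: "nat \<Rightarrow> (nat \<Rightarrow> complex) \<Rightarrow> nat \<Rightarrow> complex" where
  "labelled n z i = sort_key Arg2pi (map z [0..<n]) ! (i mod n)"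

definition perp_bisector :: "complex \<Rightarrow> complex \<Rightarrow> complex set" where
  "perp_bisector p q = {x. (x - midpoint p q) \<bullet> (q - p) = 0}"

text \<open>Regions are open sectors of the plane (components of the complement of the lines); for
  coinciding neighbours \<open>p = q\<close> the bisector is the whole plane and there are no regions, which
  happens with probability 0.\<close>

definition regions :: "nat \<Rightarrow> (nat \<Rightarrow> complex) \<Rightarrow> complex set set" where
  "regions n z = components (- (\<Union>i<n. perp_bisector (labelled n z i) (labelled n z (i + 1))))"

definition region_type :: "nat \<Rightarrow> (nat \<Rightarrow> complex) \<Rightarrow> complex set \<Rightarrow> nat" where
  "region_type n z R = card {j\<in>{..<n}. labelled n z j \<in> R \<union> uminus ` R}"

definition region_arc :: "complex set \<Rightarrow> complex set" where
  "region_arc R = R \<inter> sphere 0 1"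

text \<open>Normalised so that the circle has length 1; the parametrisation is injective on \<open>[0,1)\<close>.\<close>

definition arc_length :: "complex set \<Rightarrow> real" where
  "arc_length A = measure lborel {u\<in>{0..<1}. cis (2 * pi * u) \<in> A}"

definition ccw_arc :: "real \<Rightarrow> complex set" where
  "ccw_arc t = (\<lambda>s. cis (2 * pi * s)) ` {0..t}"

definition regions_upto :: "nat \<Rightarrow> nat \<Rightarrow> (nat \<Rightarrow> complex) \<Rightarrow> real \<Rightarrow> complex set set" where
  "regions_upto k n z t = {R \<in> regions n z. region_type n z R = k \<and> region_arc R \<subseteq> ccw_arc t}"

definition region_count :: "nat \<Rightarrow> nat \<Rightarrow> (nat \<Rightarrow> complex) \<Rightarrow> real \<Rightarrow> nat" where
  "region_count k n z t = card (regions_upto k n z t)"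

definition region_length :: "nat \<Rightarrow> nat \<Rightarrow> (nat \<Rightarrow> complex) \<Rightarrow> real \<Rightarrow> real" where
  "region_length k n z t = (\<Sum>R\<in>regions_upto k n z t. arc_length (region_arc R))"

definition path3 :: "(real \<Rightarrow> real) \<Rightarrow> (real \<Rightarrow> real) \<Rightarrow> (real \<Rightarrow> real) \<Rightarrow> real \<Rightarrow> real ^ 3" where
  "path3 a b c = (\<lambda>t\<in>{0..1}. vector [a t, b t, c t])"

end

theory Submission
  imports Defs "HOL-Real_Asymp.Real_Asymp"
begin

text \<open>Measure angles in full turns. The regions are the gaps between consecutive directions of the
  bisectors. A gap is the intersection of the Voronoi cell of one point with the Voronoi cell of one
  antipode, and its type is the number of these two generators that lie in it. Hence, up to boundedly
  many gaps, the counts are governed by the numbers of points and of antipodes in \<open>[0, t]\<close> and by the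
  number of points that form a mutually nearest pair with an antipode; the lengths are governed by the
  measure of the locations \<open>u\<close> whose nearest point \<open>p\<close> and nearest antipode \<open>q\<close> satisfy that \<open>q\<close> is
  the antipode nearest to \<open>p\<close>, or vice versa, or both.

  Each of these conditions says that a certain zone around \<open>u\<close> and its antipode contains no further
  point. At scale \<open>1/n\<close> its probability is \<open>exp (- v)\<close> with \<open>v\<close> the volume of the zone, and
  integration over the positions of \<open>p\<close> and \<open>q\<close> gives the constants \<open>5/8\<close> (one condition), \<open>3/8\<close>
  (both) and \<open>1/2\<close> (mutually nearest pairs). Zones of distant locations are disjoint, so second
  moments factorise asymptotically and each statistic converges in probability at fixed times. As the
  paths are nondecreasing and the limits are continuous, the convergence is uniform in time.\<close>

section \<open>The regions in terms of angles\<close>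

text \<open>Linear algebra reduces both statements to a few scalar laws. Let N be the number of
  points and antipodes in [0,t]. Up to O(1), the counts satisfy h0 + h1 + h2 = N, because cuts
  interlace with points and antipodes, and h1 + 2 h2 = N, because each of these lies in one gap.
  With N / n near 2t, the limit t / 2 of h2 / n fixes the others as t and t / 2; the normalisation
  2n halves them. For lengths, l0 + l1 + l2 = t, l1 + 2 l2 = 2 (5/8) t and l2 = (3/8) t. The
  obstacle is the seam of the parametrisation, the angle 0 and its antipode 1/2. Locations are
  restricted to \<open>safe r\<close>, where all neighbourhoods involved stay inside [0,1), at a
  cost of order r. The radius r = 1 / sqrt n tends to 0, yet with high probability every arc of
  length r contains sample points, so the search for neighbours within r misses none. Second moments
  are only bounded above, by 1 - a - b \<le> (1 - a) (1 - b) for disjoint zones of volumes a and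
  b.\<close>

definition turn :: "real \<Rightarrow> complex" where
  "turn s = cis (2 * pi * s)"

lemma norm_turn [simp]: "norm (turn s) = 1"
  by (simp add: turn_def)

lemma turn_eq_iff: "turn s = turn t \<longleftrightarrow> (\<exists>k::int. s = t + of_int k)"
proof -
  have "turn s = turn t \<longleftrightarrow> (\<exists>k::int. 2 * pi * s = 2 * pi * t + 2 * pi * of_int k)"
    using sin_cos_eq_iff[of "2 * pi * s" "2 * pi * t"] by (auto simp: turn_def complex_eq_iff mult.commute)
  also have "\<dots> \<longleftrightarrow> (\<exists>k::int. 2 * pi * s = 2 * pi * (t + of_int k))" by (simp add: distrib_left)
  finally show ?thesis by simp
qed

lemma turn_add_int [simp]: "turn (s + of_int k) = turn s"
  by (auto simp: turn_eq_iff)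

lemma turn_add_half: "turn (s + 1 / 2) = - turn s"
  by (simp add: turn_def distrib_left flip: cis_mult)

lemma scaled_turn_eqD:
  assumes "of_real r * turn s = of_real r' * turn s'" "r > 0" "r' > 0"
  shows "r = r'" "turn s = turn s'"
proof -
  have "norm (of_real r * turn s) = norm (of_real r' * turn s')" using assms(1) by simp
  then show "r = r'" using assms(2,3) by (simp add: norm_mult)
  then show "turn s = turn s'" using assms by simp
qed

lemma polar_in_window:
  assumes "w \<noteq> 0"
  obtains r s where "r > 0" "a \<le> s" "s < a + 1" "w = of_real r * turn s"
proof
  define s0 where "s0 = Arg2pi w / (2 * pi)"
  have "w = of_real (norm w) * exp (\<i> * of_real (Arg2pi w))" by (rule Arg2pi_eq)
  then have w: "w = of_real (norm w) * turn s0" by (simp add: turn_def s0_def cis_conv_exp)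
  show "norm w > 0" using assms by simp
  show "a \<le> s0 + of_int (- \<lfloor>s0 - a\<rfloor>)" "s0 + of_int (- \<lfloor>s0 - a\<rfloor>) < a + 1"
    by (simp_all; linarith)+
  show "w = of_real (norm w) * turn (s0 + of_int (- \<lfloor>s0 - a\<rfloor>))" using w by (simp only: turn_add_int)
qed

section \<open>Sectors as components of the complement of finitely many lines\<close>

definition sector :: "real \<Rightarrow> real \<Rightarrow> complex set" where
  "sector a b = {of_real r * turn s | r s. 0 < r \<and> a < s \<and> s < b}"

lemma turn_in_sector_iff: "turn x \<in> sector a b \<longleftrightarrow> (\<exists>k::int. a < x + of_int k \<and> x + of_int k < b)"
proof
  assume "turn x \<in> sector a b"
  then obtain r s where s: "turn x = of_real r * turn s" "r > 0" "a < s" "s < b"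
    by (auto simp: sector_def)
  then have "turn s = turn x" using scaled_turn_eqD[of 1 x r s] by simp
  then obtain k :: int where "s = x + of_int k" by (auto simp: turn_eq_iff)
  then show "\<exists>k::int. a < x + of_int k \<and> x + of_int k < b" using s by blast
next
  assume "\<exists>k::int. a < x + of_int k \<and> x + of_int k < b"
  then obtain k :: int where k: "a < x + of_int k" "x + of_int k < b" by blast
  have "turn x = of_real 1 * turn (x + of_int k)" by simp
  then show "turn x \<in> sector a b" unfolding sector_def using k zero_less_one by blast
qed

lemma uminus_sector: "uminus ` sector a b = sector (a + 1 / 2) (b + 1 / 2)"
proof -
  have "- (of_real r * turn s) = of_real r * turn (s + 1 / 2)" for r s by (simp add: turn_add_half)
  then have "uminus ` sector a b \<subseteq> sector (a + 1 / 2) (b + 1 / 2)"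
    by (fastforce simp: sector_def)
  moreover have "w \<in> uminus ` sector a b" if w: "w \<in> sector (a + 1 / 2) (b + 1 / 2)" for w
  proof -
    obtain r s where s: "w = of_real r * turn s" "0 < r" "a + 1 / 2 < s" "s < b + 1 / 2"
      using w by (auto simp: sector_def)
    have "w = - (of_real r * turn (s - 1 / 2))" using s(1) turn_add_half[of "s - 1 / 2"] by simp
    moreover have "of_real r * turn (s - 1 / 2) \<in> sector a b"
      unfolding sector_def using s by (intro CollectI exI[of _ r] exI[of _ "s - 1 / 2"]) auto
    ultimately show ?thesis by blast
  qed
  ultimately show ?thesis by blast
qed

lemma connected_sector: "connected (sector a b)"
proof -
  have "sector a b = (\<lambda>(r, s). of_real r * turn s) ` ({0<..} \<times> {a<..<b})"
    by (force simp: sector_def image_iff)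
  moreover have "connected ((\<lambda>(r, s). of_real r * turn s) ` ({0<..} \<times> {a<..<b}))"
    unfolding turn_def split_def
    by (intro connected_continuous_image connected_Times continuous_intros)
      (auto intro: convex_connected)
  ultimately show ?thesis by simp
qed

lemma Im_turn_mult: "Im (of_real r * turn s * turn t) = r * sin (2 * pi * (s + t))"
  by (simp add: turn_def cis_mult distrib_left mult.assoc)

text \<open>Up to half a turn, a sector is the intersection of two open half-planes bounded by lines
  through the origin: multiplication by \<open>turn (- a)\<close> rotates the edge at
  \<open>a\<close> onto the positive real axis, where the sign of the imaginary part tells the side.
  For wider openings this intersection would be too small.\<close>

lemma open_sector:
  assumes "a < b" "b \<le> a + 1 / 2"
  shows "open (sector a b)"
proof -
  have "sector a b = {w. Im (w * turn (- a)) > 0} \<inter> {w. Im (w * turn (- b)) < 0}"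
  proof (intro equalityI subsetI)
    fix w assume "w \<in> sector a b"
    then obtain r s where s: "w = of_real r * turn s" "0 < r" "a < s" "s < b" by (auto simp: sector_def)
    have "2 * pi * (s - a) < 2 * pi * (1 / 2)" using s assms by (intro mult_strict_left_mono) auto
    then have "sin (2 * pi * (s - a)) > 0" using s by (intro sin_gt_zero) auto
    moreover have "2 * pi * (b - s) < 2 * pi * (1 / 2)" using s assms by (intro mult_strict_left_mono) auto
    then have "sin (2 * pi * (b - s)) > 0" using s by (intro sin_gt_zero) auto
    then have "sin (2 * pi * (s - b)) < 0"
      using sin_minus[of "2 * pi * (b - s)"] by (simp add: algebra_simps)
    ultimately show "w \<in> {w. Im (w * turn (- a)) > 0} \<inter> {w. Im (w * turn (- b)) < 0}"
      using s(2) unfolding s(1) by (simp add: Im_turn_mult mult_pos_neg del: times_complex.sel)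
  next
    fix w assume w: "w \<in> {w. Im (w * turn (- a)) > 0} \<inter> {w. Im (w * turn (- b)) < 0}"
    then have "w \<noteq> 0" by auto
    then obtain r s where s: "r > 0" "a \<le> s" "s < a + 1" "w = of_real r * turn s"
      using polar_in_window[of w a] by blast
    have sn: "sin (2 * pi * (s - a)) > 0" "sin (2 * pi * (s - b)) < 0"
      using w s(1) unfolding s(4) Int_iff mem_Collect_eq Im_turn_mult
      by (auto simp: zero_less_mult_iff mult_less_0_iff)
    have "s \<noteq> a" using sn by auto
    moreover have "s - a < 1 / 2"
    proof (rule ccontr)
      assume *: "\<not> s - a < 1 / 2"
      have "2 * pi * (s - a) \<ge> 2 * pi * (1 / 2)" using * by (intro mult_left_mono) auto
      moreover have "2 * pi * (s - a) < 2 * pi * 1" using s by (intro mult_strict_left_mono) auto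
      ultimately have "sin (2 * pi * (s - a)) \<le> 0" by (intro sin_le_zero) auto
      then show False using sn by simp
    qed
    moreover have "s < b"
    proof (rule ccontr)
      assume *: "\<not> s < b"
      have "s - b \<le> 1 / 2" using \<open>s - a < 1 / 2\<close> assms by simp
      then have "2 * pi * (s - b) \<le> 2 * pi * (1 / 2)" by (intro mult_left_mono) auto
      then have "sin (2 * pi * (s - b)) \<ge> 0" using * by (intro sin_ge_zero) auto
      then show False using sn by simp
    qed
    ultimately show "w \<in> sector a b" using s unfolding sector_def by force
  qed
  then show ?thesis
    by (auto intro!: open_Int open_Collect_less continuous_intros)
qed

text \<open>The set of angles, in full turns, of a finite nonempty union of lines through the origin.\<close>

locale line_angles =
  fixes C :: "real set"
  assumes add_half: "c \<in> C \<Longrightarrow> c + 1 / 2 \<in> C" and sub_half: "c \<in> C \<Longrightarrow> c - 1 / 2 \<in> C"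
    and fin: "finite (C \<inter> {a..b})" and nonempty: "C \<noteq> {}"
begin

lemma half_multiple: "c \<in> C \<Longrightarrow> c + of_int k / 2 \<in> C"
proof (induction k rule: int_induct[of _ 0])
  case (step1 i)
  then show ?case using add_half[of "c + of_int i / 2"] by (simp add: add_divide_distrib add.assoc)
next
  case (step2 i)
  then show ?case using sub_half[of "c + of_int i / 2"] by (simp add: diff_divide_distrib algebra_simps)
qed simp

lemma half_multiple_iff: "c + of_int k / 2 \<in> C \<longleftrightarrow> c \<in> C"
  using half_multiple[of c k] half_multiple[of "c + of_int k / 2" "- k"] by auto

lemma int_shift_iff: "c + of_int k \<in> C \<longleftrightarrow> c \<in> C"
  using half_multiple_iff[of c "2 * k"] by simp

text \<open>The half-turn orbit of a single direction is a lattice of mesh 1/2, so it meets every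
  half-open window of that length. This bounds gaps by half a turn, which is what
  \<open>open_sector\<close> asks for.\<close>

lemma ex_in_window: "\<exists>c\<in>C. s < c \<and> c \<le> s + 1 / 2"
proof -
  obtain c where c: "c \<in> C" using nonempty by blast
  obtain z :: int where z: "2 * (c - s) \<le> of_int z" "of_int z < 2 * (c - s) + 1"
    using ceiling_correct[of "2 * (c - s)"] by (intro that[of "\<lceil>2 * (c - s)\<rceil>"]) linarith+
  define k where "k = 1 - z"
  have "s < c + of_int k / 2" "c + of_int k / 2 \<le> s + 1 / 2" using z unfolding k_def by (simp_all add: diff_divide_distrib)
  then show ?thesis using half_multiple[OF c, of k] by blast
qed

text \<open>Normalising the left end to [0,1) gives each gap of the circle exactly one
  representative. The right end stays free: the gap with the direction 0 in its interior ends beyond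
  1.\<close>

definition gaps :: "(real \<times> real) set" where
  "gaps = {(a, b). a \<in> C \<and> b \<in> C \<and> 0 \<le> a \<and> a < 1 \<and> a < b \<and> C \<inter> {a<..<b} = {}}"

lemma gap_length: "(a, b) \<in> gaps \<Longrightarrow> b \<le> a + 1 / 2"
  using ex_in_window[of a] by (force simp: gaps_def)

lemma finite_gaps: "finite gaps"
proof (rule finite_subset)
  show "gaps \<subseteq> (C \<inter> {0..1}) \<times> (C \<inter> {0..2})"
  proof
    fix g assume g: "g \<in> gaps"
    obtain a b where ab: "g = (a, b)" by (cases g)
    show "g \<in> (C \<inter> {0..1}) \<times> (C \<inter> {0..2})"
      using g gap_length[of a b] unfolding ab by (auto simp: gaps_def)
  qed
qed (intro finite_cartesian_product fin)

lemma ex_surrounding: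
  assumes "s \<notin> C"
  obtains a b where "a \<in> C" "b \<in> C" "a < s" "s < b" "C \<inter> {a<..<b} = {}"
proof -
  have ne: "C \<inter> {s..s + 1 / 2} \<noteq> {}" "C \<inter> {s - 1..s} \<noteq> {}"
    using ex_in_window[of s] ex_in_window[of "s - 1"] by fastforce+
  define b where "b = Min (C \<inter> {s..s + 1 / 2})"
  define a where "a = Max (C \<inter> {s - 1..s})"
  have b: "b \<in> C \<inter> {s..s + 1 / 2}" using Min_in[OF fin ne(1)] by (simp add: b_def)
  have a: "a \<in> C \<inter> {s - 1..s}" using Max_in[OF fin ne(2)] by (simp add: a_def)
  have "a \<noteq> s" "b \<noteq> s" using a b assms by blast+
  then have ab: "a < s" "s < b" using a b by simp_all
  have "C \<inter> {a<..<b} = {}"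
  proof (rule ccontr)
    assume "C \<inter> {a<..<b} \<noteq> {}"
    then obtain c where c: "c \<in> C" "a < c" "c < b" by auto
    show False
    proof (cases "c \<le> s")
      case True
      then have "c \<le> a" unfolding a_def using c a by (intro Max_ge fin) auto
      then show False using c by simp
    next
      case False
      then have "b \<le> c" unfolding b_def using c b by (intro Min_le fin) auto
      then show False using c by simp
    qed
  qed
  then show ?thesis using that a b ab by blast
qed

lemma ex_gap:
  assumes "s \<notin> C"
  obtains a b k where "(a, b) \<in> gaps" "a < s + of_int k" "s + of_int k < b"
proof -
  obtain a b where ab: "a \<in> C" "b \<in> C" "a < s" "s < b" "C \<inter> {a<..<b} = {}"
    using ex_surrounding[OF assms] by blast
  define k where "k = - \<lfloor>a\<rfloor>"
  have "C \<inter> {a + of_int k<..<b + of_int k} = {}"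
  proof (rule ccontr)
    assume "C \<inter> {a + of_int k<..<b + of_int k} \<noteq> {}"
    then obtain c where c: "c \<in> C" "a + of_int k < c" "c < b + of_int k" by auto
    have "c + of_int (- k) \<in> C \<inter> {a<..<b}" using c int_shift_iff[of c "- k"] by auto
    then show False using ab by simp
  qed
  moreover have "0 \<le> a + of_int k" "a + of_int k < 1" unfolding k_def by (simp_all; linarith)+
  ultimately have "(a + of_int k, b + of_int k) \<in> gaps"
    using ab int_shift_iff[of a k] int_shift_iff[of b k] by (auto simp: gaps_def)
  then show ?thesis using that[of "a + of_int k" "b + of_int k" k] ab by simp
qed

text \<open>Integer shifts of the ends of one gap are again in \<open>C\<close>, hence never inside
  the other gap. With a common interior point modulo 1 the two intervals must agree up to the shift
  \<open>k\<close>, and the normalisation of the left ends makes \<open>k\<close> zero.\<close>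

lemma gaps_disjoint:
  assumes "(a, b) \<in> gaps" "(a', b') \<in> gaps" "a < s" "s < b" "a' < s + of_int k" "s + of_int k < b'"
  shows "a = a' \<and> b = b' \<and> k = 0"
proof -
  have g: "a \<in> C" "b \<in> C" "a' \<in> C" "b' \<in> C" "0 \<le> a" "a < 1" "0 \<le> a'" "a' < 1"
    "C \<inter> {a<..<b} = {}" "C \<inter> {a'<..<b'} = {}"
    using assms(1,2) by (auto simp: gaps_def)
  have "a + of_int k \<in> C" "b + of_int k \<in> C" "a' + of_int (- k) \<in> C" "b' + of_int (- k) \<in> C"
    using g(1-4) by (simp_all only: int_shift_iff)
  then have "a + of_int k \<notin> {a'<..<b'}" "b + of_int k \<notin> {a'<..<b'}"
    "a' + of_int (- k) \<notin> {a<..<b}" "b' + of_int (- k) \<notin> {a<..<b}" using g(9,10) by blast+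
  then have e: "a' = a + of_int k" "b' = b + of_int k" using assms(3-6) by auto
  then have "k = 0" using g by linarith
  then show ?thesis using e by simp
qed

lemma sector_disjoint:
  assumes "(a, b) \<in> gaps" "(a', b') \<in> gaps" "w \<in> sector a b" "w \<in> sector a' b'"
  shows "a = a' \<and> b = b'"
proof -
  obtain r s where s: "w = of_real r * turn s" "0 < r" "a < s" "s < b" using assms by (auto simp: sector_def)
  obtain r' s' where s': "w = of_real r' * turn s'" "0 < r'" "a' < s'" "s' < b'" using assms by (auto simp: sector_def)
  have "turn s' = turn s" using scaled_turn_eqD[of r' s' r s] s s' by simp
  then obtain k :: int where "s' = s + of_int k" by (auto simp: turn_eq_iff)
  then show ?thesis using gaps_disjoint[OF assms(1,2) s(3,4)] s' by blast
qed

lemma sector_nonempty: "a < b \<Longrightarrow> sector a b \<noteq> {}"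
proof -
  assume "a < b"
  then have "of_real 1 * turn ((a + b) / 2) \<in> sector a b"
    unfolding sector_def by (intro CollectI exI[of _ 1] exI[of _ "(a + b) / 2"]) auto
  then show ?thesis by blast
qed

lemma inj_sector: "inj_on (\<lambda>(a, b). sector a b) gaps"
proof (rule inj_onI, clarify)
  fix a b a' b' assume g: "(a, b) \<in> gaps" "(a', b') \<in> gaps" and e: "sector a b = sector a' b'"
  have "a < b" using g by (auto simp: gaps_def)
  then obtain w where "w \<in> sector a b" using sector_nonempty by blast
  then show "a = a' \<and> b = b'" using sector_disjoint[OF g] e by blast
qed

text \<open>A partition into nonempty open connected pieces is the set of components, so it suffices
  that the sectors are disjoint and cover the rays whose angle avoids \<open>C\<close>.\<close>

lemma components_complement:
  "components {of_real r * turn s | r s. 0 < r \<and> s \<notin> C} = (\<lambda>(a, b). sector a b) ` gaps"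
proof (rule components_open_unique)
  show "pairwise disjnt ((\<lambda>(a, b). sector a b) ` gaps)"
    using sector_disjoint by (fastforce simp: pairwise_def disjnt_def)
  show "\<Union> ((\<lambda>(a, b). sector a b) ` gaps) = {of_real r * turn s | r s. 0 < r \<and> s \<notin> C}"
  proof (intro equalityI subsetI)
    fix w assume "w \<in> \<Union> ((\<lambda>(a, b). sector a b) ` gaps)"
    then obtain a b r s where "(a, b) \<in> gaps" and s: "w = of_real r * turn s" "0 < r" "a < s" "s < b"
      by (auto simp: sector_def)
    then have "s \<notin> C" by (auto simp: gaps_def)
    then show "w \<in> {of_real r * turn s | r s. 0 < r \<and> s \<notin> C}" using s by blast
  next
    fix w assume "w \<in> {of_real r * turn s | r s. 0 < r \<and> s \<notin> C}"
    then obtain r s where s: "w = of_real r * turn s" "0 < r" "s \<notin> C" by blast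
    obtain a b k where k: "(a, b) \<in> gaps" "a < s + of_int k" "s + of_int k < b" using ex_gap[OF s(3)] .
    have "w = of_real r * turn (s + of_int k)" using s by simp
    then have "w \<in> sector a b" unfolding sector_def using k s by blast
    then show "w \<in> \<Union> ((\<lambda>(a, b). sector a b) ` gaps)" using k by blast
  qed
  fix X assume "X \<in> (\<lambda>(a, b). sector a b) ` gaps"
  then obtain a b where X: "X = sector a b" "(a, b) \<in> gaps" by auto
  then have "a < b" by (auto simp: gaps_def)
  then show "open X \<and> connected X \<and> X \<noteq> {}"
    using X open_sector[OF _ gap_length[OF X(2)]] connected_sector sector_nonempty by simp
qed

lemma region_arc_sector: "region_arc (sector a b) = turn ` {a<..<b}"
proof (intro equalityI subsetI)
  fix w assume "w \<in> region_arc (sector a b)"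
  then obtain r s where s: "w = of_real r * turn s" "0 < r" "a < s" "s < b" "norm w = 1"
    by (auto simp: region_arc_def sector_def)
  then have "r = 1" by (simp add: norm_mult)
  then show "w \<in> turn ` {a<..<b}" using s by simp
next
  fix w assume "w \<in> turn ` {a<..<b}"
  then obtain s where s: "w = turn s" "a < s" "s < b" by auto
  then have "w = of_real 1 * turn s" by simp
  then have "w \<in> sector a b" unfolding sector_def using s zero_less_one by blast
  then show "w \<in> region_arc (sector a b)" using s by (simp add: region_arc_def)
qed

lemma region_arc_subset_iff:
  assumes "(a, b) \<in> gaps" "0 \<le> t" "t \<le> 1"
  shows "region_arc (sector a b) \<subseteq> ccw_arc t \<longleftrightarrow> b \<le> t \<or> t = 1"
proof
  have ab: "0 \<le> a" "a < 1" "a < b" using assms by (auto simp: gaps_def)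
  have ccw: "ccw_arc t = turn ` {0..t}" by (simp add: ccw_arc_def turn_def)
  {
    assume "b \<le> t \<or> t = 1"
    then show "region_arc (sector a b) \<subseteq> ccw_arc t"
    proof
      assume "b \<le> t"
      then show ?thesis unfolding region_arc_sector ccw using ab by (intro image_mono) auto
    next
      assume t: "t = 1"
      have "turn s \<in> turn ` {0..t}" for s
      proof -
        have "turn (s + of_int (- \<lfloor>s\<rfloor>)) = turn s" by (rule turn_add_int)
        moreover have "s + of_int (- \<lfloor>s\<rfloor>) \<in> {0..t}" unfolding t by (simp; linarith)
        ultimately show ?thesis by (metis imageI)
      qed
      then show ?thesis unfolding region_arc_sector ccw by blast
    qed
  }
  {
    assume sub: "region_arc (sector a b) \<subseteq> ccw_arc t"
    show "b \<le> t \<or> t = 1"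
    proof (rule ccontr)
      assume no: "\<not> (b \<le> t \<or> t = 1)"
      \<comment> \<open>An interior point of the gap after \<open>t\<close> and before 1: the
        interval from \<open>max a t\<close> to \<open>min b 1\<close> is nonempty, and on [0,1) the
        parametrisation is injective.\<close>
      define s where "s = (max a t + min b 1) / 2"
      have s: "a < s" "s < b" "t < s" "s < 1" using no ab assms unfolding s_def by (auto simp: max_def min_def)
      then have "turn s \<in> turn ` {0..t}" using sub unfolding region_arc_sector ccw by auto
      then obtain u where u: "turn s = turn u" "0 \<le> u" "u \<le> t" by auto
      obtain k :: int where k: "s = u + of_int k" using u(1) by (auto simp: turn_eq_iff)
      have "real_of_int k < 1" "real_of_int k > 0" using k u s by linarith+
      then show False by simp
    qed
  }
qed

text \<open>In parameters from [0,1), a gap across 1 falls into a piece before 1 and a piece of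
  length \<open>b - 1\<close> after 0; they do not overlap because
  \<open>b \<le> a + 1 / 2\<close>.\<close>

lemma arc_length_sector:
  assumes "(a, b) \<in> gaps"
  shows "arc_length (region_arc (sector a b)) = b - a"
proof -
  have ab: "0 \<le> a" "a < 1" "a < b" "b \<le> a + 1 / 2" using assms gap_length[OF assms] by (auto simp: gaps_def)
  have iff: "turn u \<in> turn ` {a<..<b} \<longleftrightarrow> (\<exists>k::int. a < u + of_int k \<and> u + of_int k < b)" for u
  proof
    assume "turn u \<in> turn ` {a<..<b}"
    then obtain s where s: "turn s = turn u" "a < s" "s < b" by (auto simp: eq_commute)
    then obtain k :: int where "s = u + of_int k" by (auto simp: turn_eq_iff)
    then show "\<exists>k::int. a < u + of_int k \<and> u + of_int k < b" using s by blast
  next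
    assume "\<exists>k::int. a < u + of_int k \<and> u + of_int k < b"
    then obtain k :: int where k: "a < u + of_int k" "u + of_int k < b" by blast
    have "turn u = turn (u + of_int k)" by simp
    then show "turn u \<in> turn ` {a<..<b}" using k by (intro image_eqI) auto
  qed
  have "{u\<in>{0..<1}. cis (2 * pi * u) \<in> region_arc (sector a b)} = {a<..<min b 1} \<union> {0..<b - 1}"
  proof (intro equalityI subsetI)
    fix u assume "u \<in> {u\<in>{0..<1}. cis (2 * pi * u) \<in> region_arc (sector a b)}"
    then have u: "0 \<le> u" "u < 1" "turn u \<in> turn ` {a<..<b}" by (auto simp: turn_def region_arc_sector)
    obtain k :: int where k: "a < u + of_int k" "u + of_int k < b" using u(3) iff by blast
    have "k = 0 \<or> k = 1" using k u ab by linarith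
    then show "u \<in> {a<..<min b 1} \<union> {0..<b - 1}" using k u by auto
  next
    fix u assume u: "u \<in> {a<..<min b 1} \<union> {0..<b - 1}"
    have "\<exists>k::int. a < u + of_int k \<and> u + of_int k < b"
      using u ab by (auto intro: exI[of _ 0] exI[of _ 1])
    then show "u \<in> {u\<in>{0..<1}. cis (2 * pi * u) \<in> region_arc (sector a b)}"
      using u ab iff by (auto simp: region_arc_sector turn_def)
  qed
  moreover have "measure lborel ({a<..<min b 1} \<union> {0..<b - 1}) = b - a"
  proof -
    have "emeasure lborel {0..<b - 1} < \<top>" by (cases "1 \<le> b") auto
    then have "measure lborel ({a<..<min b 1} \<union> {0..<b - 1}) = measure lborel {a<..<min b 1} + measure lborel {0..<b - 1}"
      using ab
      by (intro measure_Un_AE) (auto intro!: AE_I2 simp: fmeasurable_def)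
    also have "\<dots> = b - a" using ab by (cases "b \<le> 1") (auto simp: min_def)
    finally show ?thesis .
  qed
  ultimately show ?thesis by (simp add: arc_length_def)
qed

end

text \<open>The bisector of two points of the unit circle at angles u and v points in the directions
  (u + v) / 2 modulo 1/2. The half-integers account both for the two directions of a line and for
  the full turn that is missing when the index wraps around.\<close>

definition cuts :: "nat \<Rightarrow> (nat \<Rightarrow> real) \<Rightarrow> real set" where
  "cuts n x = {(x i + x ((i + 1) mod n)) / 2 + of_int k / 2 | i k. i < n}"

lemma line_angles_cuts:
  assumes "n > 0"
  shows "line_angles (cuts n x)"
proof
  fix c assume "c \<in> cuts n x"
  then obtain i k where c: "c = (x i + x ((i + 1) mod n)) / 2 + of_int k / 2" "i < n" by (auto simp: cuts_def)
  have "c + 1 / 2 = (x i + x ((i + 1) mod n)) / 2 + of_int (k + 1) / 2"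
    "c - 1 / 2 = (x i + x ((i + 1) mod n)) / 2 + of_int (k - 1) / 2"
    using c by (auto simp: field_simps)
  then show "c + 1 / 2 \<in> cuts n x" "c - 1 / 2 \<in> cuts n x" using c(2) unfolding cuts_def by blast+
next
  fix a b
  define m where "m i = (x i + x ((i + 1) mod n)) / 2" for i
  have "cuts n x \<inter> {a..b} \<subseteq> (\<Union>i<n. (\<lambda>k. m i + of_int k / 2) ` {\<lfloor>2 * (a - m i)\<rfloor>..\<lceil>2 * (b - m i)\<rceil>})"
  proof
    fix c assume "c \<in> cuts n x \<inter> {a..b}"
    then obtain i k where c: "c = m i + of_int k / 2" "i < n" "a \<le> c" "c \<le> b" by (auto simp: cuts_def m_def)
    have "k \<in> {\<lfloor>2 * (a - m i)\<rfloor>..\<lceil>2 * (b - m i)\<rceil>}" using c by (simp; linarith)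
    then show "c \<in> (\<Union>i<n. (\<lambda>k. m i + of_int k / 2) ` {\<lfloor>2 * (a - m i)\<rfloor>..\<lceil>2 * (b - m i)\<rceil>})" using c by blast
  qed
  then show "finite (cuts n x \<inter> {a..b})" by (rule finite_subset) auto
next
  show "cuts n x \<noteq> {}" using assms by (auto simp: cuts_def)
qed

lemma midpoint_turn_orthogonal: "midpoint (turn u) (turn v) \<bullet> (turn v - turn u) = 0"
proof -
  have "midpoint (turn u) (turn v) \<bullet> (turn v - turn u) = (turn v \<bullet> turn v - turn u \<bullet> turn u) / 2"
    by (simp add: midpoint_def inner_add_left inner_diff_right inner_commute[of "turn v" "turn u"] field_simps)
  then show ?thesis by (simp flip: power2_norm_eq_inner)
qed

text \<open>The bisector passes through the origin, so membership means orthogonality to the chord.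
  By the sum-to-product formula the inner product is 2 r sin (2 pi s - pi (x + y)) sin (pi (y - x)),
  and the last factor does not vanish for distinct points.\<close>

lemma scaled_turn_in_bisector_iff:
  assumes "r > 0" "\<And>k::int. y \<noteq> x + of_int k"
  shows "of_real r * turn s \<in> perp_bisector (turn x) (turn y) \<longleftrightarrow> (\<exists>k::int. s = (x + y) / 2 + of_int k / 2)"
proof -
  have "(of_real r * turn s - midpoint (turn x) (turn y)) \<bullet> (turn y - turn x) =
      (of_real r * turn s) \<bullet> (turn y - turn x)"
    by (simp only: inner_diff_left midpoint_turn_orthogonal)
  also have "\<dots> = r * (cos (2 * pi * s) * cos (2 * pi * y) + sin (2 * pi * s) * sin (2 * pi * y))
      - r * (cos (2 * pi * s) * cos (2 * pi * x) + sin (2 * pi * s) * sin (2 * pi * x))"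
    by (simp add: inner_complex_def turn_def algebra_simps)
  also have "\<dots> = r * (cos (2 * pi * s - 2 * pi * y) - cos (2 * pi * s - 2 * pi * x))"
    by (simp add: cos_diff right_diff_distrib)
  also have "\<dots> = r * (2 * sin (2 * pi * s - pi * (x + y)) * sin (pi * (y - x)))"
    by (subst cos_diff_cos) (simp add: algebra_simps add_divide_distrib diff_divide_distrib)
  finally have e: "of_real r * turn s \<in> perp_bisector (turn x) (turn y) \<longleftrightarrow>
      sin (2 * pi * s - pi * (x + y)) = 0 \<or> sin (pi * (y - x)) = 0"
    using assms(1) by (simp add: perp_bisector_def)
  have "sin (pi * (y - x)) \<noteq> 0"
  proof
    assume "sin (pi * (y - x)) = 0"
    then obtain k :: int where "pi * (y - x) = of_int k * pi" by (auto simp: sin_zero_iff_int2)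
    then have "pi * (y - x) = pi * of_int k" by (simp add: mult.commute)
    then have "y = x + of_int k" by simp
    then show False using assms(2) by blast
  qed
  moreover have "sin (2 * pi * s - pi * (x + y)) = 0 \<longleftrightarrow> (\<exists>k::int. pi * (2 * s - (x + y)) = pi * of_int k)"
    unfolding sin_zero_iff_int2 by (simp add: algebra_simps)
  moreover have "pi * (2 * s - (x + y)) = pi * of_int k \<longleftrightarrow> s = (x + y) / 2 + of_int k / 2" for k :: int
    by (subst mult_cancel_left) (auto simp: field_simps)
  ultimately show ?thesis unfolding e by simp
qed

text \<open>All bisectors contain the origin, so the complement of their union consists of whole
  open rays, namely those whose angle is not a cut.\<close>

lemma regions_eq_sectors:
  assumes n: "n > 0" and lab: "\<And>i. labelled n z i = turn (x (i mod n))"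
    and distinct: "\<And>i k. i < n \<Longrightarrow> x ((i + 1) mod n) \<noteq> x i + of_int k"
  shows "regions n z = (\<lambda>(a, b). sector a b) ` line_angles.gaps (cuts n x)"
proof -
  interpret line_angles "cuts n x" using n by (rule line_angles_cuts)
  have "- (\<Union>i<n. perp_bisector (labelled n z i) (labelled n z (i + 1))) = {of_real r * turn s | r s. 0 < r \<and> s \<notin> cuts n x}"
  proof (intro equalityI subsetI)
    fix w assume w: "w \<in> - (\<Union>i<n. perp_bisector (labelled n z i) (labelled n z (i + 1)))"
    have "(0 - midpoint (turn u) (turn v)) \<bullet> (turn v - turn u) = 0" for u v
      by (simp add: midpoint_turn_orthogonal)
    then have "0 \<in> perp_bisector (labelled n z 0) (labelled n z (0 + 1))"
      by (simp only: perp_bisector_def lab mem_Collect_eq)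
    then have "w \<noteq> 0" using w n by blast
    then obtain r s where s: "r > 0" "w = of_real r * turn s" using polar_in_window[of w 0] by blast
    have "s \<notin> cuts n x"
    proof
      assume "s \<in> cuts n x"
      then obtain i k where i: "s = (x i + x ((i + 1) mod n)) / 2 + of_int k / 2" "i < n" by (auto simp: cuts_def)
      then have "w \<in> perp_bisector (labelled n z i) (labelled n z (i + 1))"
        using scaled_turn_in_bisector_iff[OF s(1) distinct[OF i(2)]] s(2) by (auto simp: lab)
      then show False using w i by blast
    qed
    then show "w \<in> {of_real r * turn s | r s. 0 < r \<and> s \<notin> cuts n x}" using s by blast
  next
    fix w assume "w \<in> {of_real r * turn s | r s. 0 < r \<and> s \<notin> cuts n x}"
    then obtain r s where s: "w = of_real r * turn s" "0 < r" "s \<notin> cuts n x" by blast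
    have "w \<notin> perp_bisector (labelled n z i) (labelled n z (i + 1))" if "i < n" for i
      using scaled_turn_in_bisector_iff[OF s(2) distinct[OF that]] s(3) that
      unfolding s(1) lab cuts_def by auto
    then show "w \<in> - (\<Union>i<n. perp_bisector (labelled n z i) (labelled n z (i + 1)))" by blast
  qed
  then show ?thesis unfolding regions_def by (simp add: components_complement)
qed

lemma regions_empty:
  assumes "i < n" "labelled n z i = labelled n z (i + 1)"
  shows "regions n z = {}"
proof -
  have "perp_bisector (labelled n z i) (labelled n z (i + 1)) = UNIV"
    using assms(2) by (simp add: perp_bisector_def)
  then have "(\<Union>i<n. perp_bisector (labelled n z i) (labelled n z (i + 1))) = UNIV" using assms(1) by blast
  then show ?thesis by (simp add: regions_def)
qed

text \<open>A point lies in a region or its antipodal region iff the region contains the point or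
  its antipode. The shifts by \<open>k / 2\<close> run through the lifts of the point for even
  \<open>k\<close> and of its antipode for odd \<open>k\<close>; working modulo 1/2 thus replaces
  the union of the two regions.\<close>

definition gap_type :: "nat \<Rightarrow> (nat \<Rightarrow> real) \<Rightarrow> real \<times> real \<Rightarrow> nat" where
  "gap_type n x g = card {j \<in> {..<n}. \<exists>k::int. fst g < x j + of_int k / 2 \<and> x j + of_int k / 2 < snd g}"

definition gaps_upto :: "nat \<Rightarrow> nat \<Rightarrow> (nat \<Rightarrow> real) \<Rightarrow> real \<Rightarrow> (real \<times> real) set" where
  "gaps_upto k n x t = {g \<in> line_angles.gaps (cuts n x). gap_type n x g = k \<and> (snd g \<le> t \<or> t = 1)}"

lemma region_type_sector:
  assumes "\<And>i. labelled n z i = turn (x (i mod n))"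
  shows "region_type n z (sector a b) = gap_type n x (a, b)"
proof -
  have "turn u \<in> sector a b \<union> sector (a + 1 / 2) (b + 1 / 2) \<longleftrightarrow>
      (\<exists>k::int. a < u + of_int k / 2 \<and> u + of_int k / 2 < b)" for u
  proof
    assume "turn u \<in> sector a b \<union> sector (a + 1 / 2) (b + 1 / 2)"
    then consider k :: int where "a < u + of_int k" "u + of_int k < b"
      | k :: int where "a + 1 / 2 < u + of_int k" "u + of_int k < b + 1 / 2"
      by (auto simp: turn_in_sector_iff)
    then show "\<exists>k::int. a < u + of_int k / 2 \<and> u + of_int k / 2 < b"
    proof cases
      case 1
      then show ?thesis by (intro exI[of _ "2 * k"]) simp
    next
      case 2
      then show ?thesis by (intro exI[of _ "2 * k - 1"]) (simp add: diff_divide_distrib)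
    qed
  next
    assume "\<exists>k::int. a < u + of_int k / 2 \<and> u + of_int k / 2 < b"
    then obtain k :: int where k: "a < u + of_int k / 2" "u + of_int k / 2 < b" by blast
    show "turn u \<in> sector a b \<union> sector (a + 1 / 2) (b + 1 / 2)"
    proof (cases "even k")
      case True
      then obtain j where "k = 2 * j" by blast
      then show ?thesis using k by (auto simp: turn_in_sector_iff intro!: exI[of _ j])
    next
      case False
      then obtain j where "k = 2 * j + 1" by (elim oddE)
      then show ?thesis using k
        by (auto simp: turn_in_sector_iff add_divide_distrib intro!: exI[of _ "j + 1"])
    qed
  qed
  then show ?thesis
    unfolding region_type_def gap_type_def uminus_sector assms by (intro arg_cong[where f = card]) auto
qed

lemma regions_upto_eq:
  assumes "n > 0" "\<And>i. labelled n z i = turn (x (i mod n))"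
    "\<And>i k. i < n \<Longrightarrow> x ((i + 1) mod n) \<noteq> x i + of_int k" "0 \<le> t" "t \<le> 1"
  shows "regions_upto k n z t = (\<lambda>(a, b). sector a b) ` gaps_upto k n x t"
proof -
  have *: "region_arc (sector a b) \<subseteq> ccw_arc t \<longleftrightarrow> b \<le> t \<or> t = 1"
    if "(a, b) \<in> line_angles.gaps (cuts n x)" for a b
    using line_angles.region_arc_subset_iff[OF line_angles_cuts[OF assms(1)] that assms(4,5)] .
  have "regions_upto k n z t = {R \<in> (\<lambda>(a, b). sector a b) ` line_angles.gaps (cuts n x).
      region_type n z R = k \<and> region_arc R \<subseteq> ccw_arc t}"
    unfolding regions_upto_def regions_eq_sectors[OF assms(1-3), simplified] by simp
  also have "\<dots> = (\<lambda>(a, b). sector a b) ` {g \<in> line_angles.gaps (cuts n x).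
      region_type n z (sector (fst g) (snd g)) = k \<and> region_arc (sector (fst g) (snd g)) \<subseteq> ccw_arc t}"
    by (auto simp: split_def image_iff)
  also have "{g \<in> line_angles.gaps (cuts n x).
      region_type n z (sector (fst g) (snd g)) = k \<and> region_arc (sector (fst g) (snd g)) \<subseteq> ccw_arc t} = gaps_upto k n x t"
    unfolding gaps_upto_def region_type_sector[OF assms(2)] using * by (intro Collect_cong conj_cong refl) auto
  finally show ?thesis .
qed

lemma region_count_eq:
  assumes "n > 0" "\<And>i. labelled n z i = turn (x (i mod n))"
    "\<And>i k. i < n \<Longrightarrow> x ((i + 1) mod n) \<noteq> x i + of_int k" "0 \<le> t" "t \<le> 1"
  shows "region_count k n z t = card (gaps_upto k n x t)"
  unfolding region_count_def using regions_upto_eq[OF assms, where k = k]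
  by (simp, intro card_image inj_on_subset[OF line_angles.inj_sector[OF line_angles_cuts[OF assms(1)]]])
    (auto simp: gaps_upto_def)

lemma region_length_eq:
  assumes "n > 0" "\<And>i. labelled n z i = turn (x (i mod n))"
    "\<And>i k. i < n \<Longrightarrow> x ((i + 1) mod n) \<noteq> x i + of_int k" "0 \<le> t" "t \<le> 1"
  shows "region_length k n z t = (\<Sum>g\<in>gaps_upto k n x t. snd g - fst g)"
proof -
  interpret line_angles "cuts n x" using assms(1) by (rule line_angles_cuts)
  have "inj_on (\<lambda>(a, b). sector a b) (gaps_upto k n x t)"
    by (rule inj_on_subset[OF inj_sector]) (auto simp: gaps_upto_def)
  then show ?thesis
    unfolding region_length_def using regions_upto_eq[OF assms, where k = k]
    by (simp, subst sum.reindex) (auto simp: gaps_upto_def arc_length_sector intro!: sum.cong)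
qed

section \<open>Convergence and measurability in the Skorokhod space\<close>

definition tent :: "real \<Rightarrow> real \<Rightarrow> real \<Rightarrow> real" where
  "tent \<delta> b t = max 0 (1 - \<bar>t - b\<bar> / \<delta>)"

lemma tent_lipschitz: "\<delta> > 0 \<Longrightarrow> \<bar>tent \<delta> b s - tent \<delta> b t\<bar> \<le> \<bar>s - t\<bar> / \<delta>"
proof -
  assume d: "\<delta> > 0"
  have "\<bar>\<bar>t - b\<bar> / \<delta> - \<bar>s - b\<bar> / \<delta>\<bar> = \<bar>\<bar>t - b\<bar> - \<bar>s - b\<bar>\<bar> / \<delta>"
    using d by (simp add: diff_divide_distrib[symmetric])
  also have "\<dots> \<le> \<bar>s - t\<bar> / \<delta>" using d by (intro divide_right_mono) auto
  finally show ?thesis by (auto simp: tent_def max_def abs_if split: if_splits)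
qed

lemma tent_self: "\<delta> > 0 \<Longrightarrow> tent \<delta> b b = 1"
  by (simp add: tent_def)

lemma tent_far: "\<delta> > 0 \<Longrightarrow> \<bar>t - b\<bar> \<ge> \<delta> \<Longrightarrow> tent \<delta> b t = 0"
  by (simp add: tent_def)

lemma tent_bounds: "\<delta> > 0 \<Longrightarrow> 0 \<le> tent \<delta> b t \<and> tent \<delta> b t \<le> 1"
  by (simp add: tent_def)

text \<open>The identity is perturbed by tents of slope 1 / \<delta> centred at the points of
  \<open>B\<close>. The perturbation has Lipschitz constant below 1 by \<open>small\<close>, so the
  sum stays strictly increasing. Tents vanish at the other centres by \<open>sep\<close>, so each
  \<open>b\<close> moves exactly to \<open>b' b\<close>, and \<open>low\<close> and
  \<open>up\<close> keep 0 and 1 fixed.\<close>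

lemma time_change_moving_points:
  fixes B :: "real set" and b' :: "real \<Rightarrow> real"
  assumes fin: "finite B" and d: "\<delta> > 0"
    and sep: "\<And>b c. b \<in> B \<Longrightarrow> c \<in> B \<Longrightarrow> b \<noteq> c \<Longrightarrow> \<bar>b - c\<bar> \<ge> \<delta>"
    and low: "\<And>b. b \<in> B \<Longrightarrow> \<delta> \<le> b" and up: "\<And>b. b \<in> B \<Longrightarrow> b \<le> 1 - \<delta> \<or> b' b = b"
    and small: "(\<Sum>b\<in>B. \<bar>b' b - b\<bar>) < \<delta>"
  obtains \<phi> where "\<phi> \<in> time_changes" "\<And>b. b \<in> B \<Longrightarrow> \<phi> b = b' b"
    "\<And>t. \<bar>\<phi> t - t\<bar> \<le> (\<Sum>b\<in>B. \<bar>b' b - b\<bar>)"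
proof
  define \<phi> where "\<phi> t = t + (\<Sum>b\<in>B. (b' b - b) * tent \<delta> b t)" for t
  have diff: "\<bar>(\<Sum>b\<in>B. (b' b - b) * tent \<delta> b s) - (\<Sum>b\<in>B. (b' b - b) * tent \<delta> b t)\<bar>
      \<le> (\<Sum>b\<in>B. \<bar>b' b - b\<bar>) * (\<bar>s - t\<bar> / \<delta>)" for s t
    unfolding sum_subtractf[symmetric] sum_distrib_right right_diff_distrib[symmetric]
    by (rule order_trans[OF sum_abs], rule sum_mono, unfold abs_mult,
        rule mult_left_mono[OF tent_lipschitz[OF d]]) simp
  have sm: "\<phi> s < \<phi> t" if "s < t" for s t
  proof -
    have "(\<Sum>b\<in>B. \<bar>b' b - b\<bar>) * (\<bar>s - t\<bar> / \<delta>) < \<delta> * (\<bar>s - t\<bar> / \<delta>)"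
      using that d small by (intro mult_strict_right_mono) auto
    also have "\<dots> = t - s" using d that by simp
    finally show ?thesis using diff[of s t] by (auto simp: \<phi>_def)
  qed
  have cont: "continuous_on {0..1} \<phi>"
    unfolding \<phi>_def tent_def using d by (intro continuous_intros) auto
  have p0: "\<phi> 0 = 0"
    unfolding \<phi>_def using low d by (auto intro!: sum.neutral tent_far simp: abs_of_nonneg order_trans[OF less_imp_le[OF d] low])
  have le1: "b \<le> 1" if "b \<in> B" "b' b \<noteq> b" for b using up[OF that(1)] that d by auto
  have p1: "\<phi> 1 = 1"
    unfolding \<phi>_def
  proof (simp, intro sum.neutral ballI)
    fix b assume b: "b \<in> B"
    show "(b' b - b) * tent \<delta> b 1 = 0"
    proof (cases "b' b = b")
      case False
      then have "tent \<delta> b 1 = 0" using up[OF b] d by (intro tent_far) auto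
      then show ?thesis by simp
    qed simp
  qed
  have "\<phi> ` {0..1} = {0..1}"
  proof
    have m: "\<phi> s \<le> \<phi> t" if "s \<le> t" for s t using sm[of s t] that by (cases "s = t") auto
    show "\<phi> ` {0..1} \<subseteq> {0..1}" using m[of 0] m[of _ 1] p0 p1 by auto
    show "{0..1} \<subseteq> \<phi> ` {0..1}"
      using IVT'[of \<phi> 0 _ 1] cont p0 p1 by (force simp: image_iff)
  qed
  then show "\<phi> \<in> time_changes"
    using cont sm by (auto simp: time_changes_def strict_mono_on_def)
  show "\<phi> b = b' b" if b: "b \<in> B" for b
  proof -
    have "(\<Sum>c\<in>B. (b' c - c) * tent \<delta> c b) = (\<Sum>c\<in>B. if c = b then b' b - b else 0)"
      using sep[OF b] d by (intro sum.cong) (auto simp: tent_self intro!: tent_far)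
    then show ?thesis using fin b by (simp add: \<phi>_def)
  qed
  show "\<bar>\<phi> t - t\<bar> \<le> (\<Sum>b\<in>B. \<bar>b' b - b\<bar>)" for t
  proof -
    have "\<bar>\<phi> t - t\<bar> \<le> (\<Sum>b\<in>B. \<bar>(b' b - b) * tent \<delta> b t\<bar>)"
      by (simp add: \<phi>_def sum_abs)
    also have "\<dots> \<le> (\<Sum>b\<in>B. \<bar>b' b - b\<bar>)"
      using tent_bounds[OF d] by (intro sum_mono) (auto simp: abs_mult intro!: mult_left_le)
    finally show ?thesis .
  qed
qed

text \<open>Paths are described by their jump times rather than by a formula: \<open>f\<close> is constant between
  consecutive elements of \<open>B\<close>.\<close>

definition step_path :: "real set \<Rightarrow> (real \<Rightarrow> 'a) \<Rightarrow> bool" where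
  "step_path B f \<longleftrightarrow> finite B \<and> B \<subseteq> {0<..1} \<and>
     (\<forall>s\<in>{0..1}. \<forall>t\<in>{0..1}. (\<forall>b\<in>B. b \<le> s \<longleftrightarrow> b \<le> t) \<longrightarrow> f s = f t)"

text \<open>Near a time \<open>t\<close> only \<open>t\<close> itself can be a jump, so each
  one-sided neighbourhood crosses none. Jumps enter through \<open>b \<le> t\<close>, hence the
  value just to the right of \<open>t\<close> is \<open>f t\<close>, while on the left there is
  merely some constant.\<close>

lemma step_path_cadlag:
  fixes f :: "real \<Rightarrow> 'a::metric_space"
  assumes "step_path B f" "f \<in> extensional {0..1}"
  shows "f \<in> cadlag_paths"
  unfolding cadlag_paths_def
proof (intro CollectI conjI allI impI)
  have fin: "finite B" and eq: "\<And>s t. s \<in> {0..1} \<Longrightarrow> t \<in> {0..1} \<Longrightarrow> (\<And>b. b \<in> B \<Longrightarrow> b \<le> s \<longleftrightarrow> b \<le> t) \<Longrightarrow> f s = f t"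
    using assms(1) unfolding step_path_def by blast+
  show "f \<in> extensional {0..1}" by fact
  fix t :: real
  {
    assume t: "0 \<le> t \<and> t < 1"
    have "\<forall>\<^sub>F x in at_right t. \<forall>b\<in>B. t < b \<longrightarrow> x < b"
      using fin by (intro eventually_ball_finite ballI) (auto simp: eventually_at_right_field)
    moreover have "\<forall>\<^sub>F x in at_right t. t < x \<and> x < 1" using t by (auto simp: eventually_at_right_field)
    ultimately have "\<forall>\<^sub>F x in at_right t. f t = f x"
    proof eventually_elim
      case (elim x)
      show ?case
      proof (rule eq)
        show "b \<le> t \<longleftrightarrow> b \<le> x" if "b \<in> B" for b using elim that by (cases "t < b") force+
      qed (use elim t in auto)
    qed
    then show "(f \<longlongrightarrow> f t) (at_right t)"
      by (rule Lim_transform_eventually[OF tendsto_const])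
  }
  {
    assume t: "0 < t \<and> t \<le> 1"
    have "\<forall>\<^sub>F x in at_left t. \<forall>b\<in>B. b < t \<longrightarrow> b < x"
      using fin by (intro eventually_ball_finite ballI) (auto simp: eventually_at_left_field)
    moreover have "\<forall>\<^sub>F x in at_left t. 0 < x \<and> x < t" using t by (auto simp: eventually_at_left_field)
    ultimately have ev: "\<forall>\<^sub>F x in at_left t. (\<forall>b\<in>B. b < t \<longrightarrow> b < x) \<and> 0 < x \<and> x < t"
      by eventually_elim auto
    then obtain x0 where x0: "(\<forall>b\<in>B. b < t \<longrightarrow> b < x0) \<and> 0 < x0 \<and> x0 < t"
      using eventually_happens[OF ev] by auto
    have "\<forall>\<^sub>F x in at_left t. f x0 = f x"
      using ev
    proof eventually_elim
      case (elim x)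
      show ?case
      proof (rule eq)
        show "b \<le> x0 \<longleftrightarrow> b \<le> x" if "b \<in> B" for b using elim x0 that by (cases "b < t") force+
      qed (use elim x0 t in auto)
    qed
    then show "\<exists>l. (f \<longlongrightarrow> l) (at_left t)"
      by (intro exI[of _ "f x0"] Lim_transform_eventually[OF tendsto_const])
  }
qed

section \<open>Borel sets of a topology and limits of measurable maps\<close>

lemma J1_topology_topspace: "topspace (J1_topology :: (real \<Rightarrow> 'a::metric_space) topology) = cadlag_paths"
  unfolding J1_topology_def by (rule Metric_space.topspace_mtopology[OF Metric_space_J1])

lemma space_borel_of: "space (borel_of T) = topspace T"
  unfolding borel_of_def by (intro space_measure_of) (auto dest: openin_subset)

lemma borel_of_openin: "openin T U \<Longrightarrow> U \<in> sets (borel_of T)"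
  unfolding borel_of_def by (auto intro!: in_measure_of dest: openin_subset)

lemma measurable_borel_of_iff:
  assumes "\<And>x. x \<in> space M \<Longrightarrow> X x \<in> topspace T"
    "\<And>U. openin T U \<Longrightarrow> X -` U \<inter> space M \<in> sets M"
  shows "X \<in> M \<rightarrow>\<^sub>M borel_of T"
  unfolding borel_of_def
  by (rule measurable_sigma_sets[OF sets_measure_of]) (use assms in \<open>auto dest: openin_subset\<close>)

lemma continuous_map_borel_of_measurable:
  assumes "continuous_map T euclideanreal f"
  shows "f \<in> borel_of T \<rightarrow>\<^sub>M borel"
proof (rule borel_measurableI)
  fix S :: "real set" assume "open S"
  then have "openin T {x \<in> topspace T. f x \<in> S}"
    using assms by (auto simp: continuous_map_def)
  then have "{x \<in> topspace T. f x \<in> S} \<in> sets (borel_of T)" by (rule borel_of_openin)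
  then show "f -` S \<inter> space (borel_of T) \<in> sets (borel_of T)"
    unfolding space_borel_of by (simp add: vimage_def Int_def conj_commute)
qed

text \<open>Membership of the limit in an open set \<open>U\<close> has to be read off from the
  approximants. The sets \<open>V k\<close> of points with a ball of radius more than 1 / (k + 1)
  inside \<open>U\<close> are open and exhaust \<open>U\<close>, and the limit lies in
  \<open>U\<close> iff the approximants are eventually in some \<open>V k\<close>. The fixed margin
  rules out limits on the boundary of \<open>U\<close>.\<close>

lemma (in Metric_space) measurable_borel_of_limit:
  assumes F: "\<And>m. F m \<in> N \<rightarrow>\<^sub>M borel_of mtopology"
    and X: "\<And>x. x \<in> space N \<Longrightarrow> X x \<in> M"
    and lim: "\<And>x. x \<in> space N \<Longrightarrow> (\<lambda>m. d (F m x) (X x)) \<longlonglongrightarrow> 0"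
  shows "X \<in> N \<rightarrow>\<^sub>M borel_of mtopology"
proof (rule measurable_borel_of_iff)
  show "X x \<in> topspace mtopology" if "x \<in> space N" for x using X[OF that] by simp
  fix U assume U: "openin mtopology U"
  have FM: "F m x \<in> M" if "x \<in> space N" for m x
    using measurable_space[OF F that] by (simp add: space_borel_of)
  define V where "V k = {y \<in> M. \<exists>\<delta>>1 / real (Suc k). mball y \<delta> \<subseteq> U}" for k
  have V: "openin mtopology (V k)" for k
    unfolding openin_mtopology
  proof (intro conjI allI impI)
    show "V k \<subseteq> M" by (auto simp: V_def)
    fix y assume "y \<in> V k"
    then obtain \<delta> where y: "y \<in> M" "\<delta> > 1 / real (Suc k)" "mball y \<delta> \<subseteq> U" by (auto simp: V_def)
    \<comment> \<open>A radius strictly between the threshold and \<delta>: the centre may move by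
      \<delta> - \<delta>' and still keep a ball of radius \<delta>' above the threshold.\<close>
    define \<delta>' where "\<delta>' = (\<delta> + 1 / real (Suc k)) / 2"
    have d': "1 / real (Suc k) < \<delta>'" "\<delta>' < \<delta>" using y(2) unfolding \<delta>'_def by (auto simp del: of_nat_Suc)
    have "mball y (\<delta> - \<delta>') \<subseteq> V k"
    proof
      fix w assume w: "w \<in> mball y (\<delta> - \<delta>')"
      have "mball w \<delta>' \<subseteq> mball y \<delta>" using w by (intro mball_subset) (auto simp: commute)
      then show "w \<in> V k" using w y d' by (auto simp: V_def intro!: exI[of _ \<delta>'])
    qed
    then show "\<exists>r>0. mball y r \<subseteq> V k" using d' by (intro exI[of _ "\<delta> - \<delta>'"]) auto
  qed
  have UM: "U \<subseteq> M" using openin_subset[OF U] by simp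
  have iff: "X x \<in> U \<longleftrightarrow> (\<exists>k n. \<forall>m\<ge>n. F m x \<in> V k)" if x: "x \<in> space N" for x
  proof
    assume "X x \<in> U"
    then obtain r where r: "r > 0" "mball (X x) r \<subseteq> U"
      using U unfolding openin_mtopology by blast
    obtain k where k: "1 / real (Suc k) < r / 2"
      using r(1) reals_Archimedean[of "r / 2"] by (auto simp: inverse_eq_divide)
    have "eventually (\<lambda>m. d (F m x) (X x) < r / 2) sequentially"
      using lim[OF x] r(1) by (intro order_tendstoD) auto
    then obtain n where n: "\<And>m. m \<ge> n \<Longrightarrow> d (F m x) (X x) < r / 2" by (auto simp: eventually_sequentially)
    have "F m x \<in> V k" if "m \<ge> n" for m
    proof -
      have "mball (F m x) (r / 2) \<subseteq> mball (X x) r"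
        using n[OF that] FM[OF x] X[OF x] by (intro mball_subset) (auto simp: commute)
      then show ?thesis using r k FM[OF x] by (auto simp: V_def intro!: exI[of _ "r / 2"])
    qed
    then show "\<exists>k n. \<forall>m\<ge>n. F m x \<in> V k" by blast
  next
    assume "\<exists>k n. \<forall>m\<ge>n. F m x \<in> V k"
    then obtain k n where n: "\<And>m. m \<ge> n \<Longrightarrow> F m x \<in> V k" by blast
    have "eventually (\<lambda>m. d (F m x) (X x) < 1 / real (Suc k)) sequentially"
      using lim[OF x] by (intro order_tendstoD) auto
    then obtain n' where n': "\<And>m. m \<ge> n' \<Longrightarrow> d (F m x) (X x) < 1 / real (Suc k)"
      by (auto simp: eventually_sequentially)
    define m where "m = max n n'"
    obtain \<delta> where "\<delta> > 1 / real (Suc k)" "mball (F m x) \<delta> \<subseteq> U" using n[of m] by (auto simp: V_def m_def)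
    moreover have "d (F m x) (X x) < 1 / real (Suc k)" using n'[of m] by (simp add: m_def)
    ultimately show "X x \<in> U" using FM[OF x] X[OF x] by (auto simp: subset_iff)
  qed
  have [measurable]: "{x \<in> space N. F m x \<in> V k} \<in> sets N" for m k
    using measurable_sets[OF F borel_of_openin[OF V], of m k] by (simp add: vimage_def Int_def conj_commute)
  have "X -` U \<inter> space N = {x \<in> space N. \<exists>k n. \<forall>m\<ge>n. F m x \<in> V k}"
    using iff by auto
  also have "\<dots> \<in> sets N" by measurable
  finally show "X -` U \<inter> space N \<in> sets N" .
qed


lemma J1_dist_le_uniform:
  assumes "f \<in> cadlag_paths" "g \<in> cadlag_paths" "\<epsilon> > 0"
    and "\<And>t. t \<in> {0..1} \<Longrightarrow> dist (f t) (g t) \<le> \<epsilon>"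
  shows "J1_dist f g \<le> \<epsilon>"
  by (rule J1_dist_le[OF assms(1,2)])
    (unfold J1_close_def, use assms in \<open>intro conjI bexI[OF _ time_change_id]; auto\<close>)

section \<open>Dyadic rounding of times and values\<close>

definition dyadic_floor :: "nat \<Rightarrow> real \<Rightarrow> real" where
  "dyadic_floor m x = of_int \<lfloor>2 ^ m * x\<rfloor> / 2 ^ m"

lemma dyadic_floor_le: "dyadic_floor m x \<le> x"
  by (simp add: dyadic_floor_def divide_le_eq mult.commute)

lemma dyadic_floor_close: "\<bar>dyadic_floor m x - x\<bar> \<le> 1 / 2 ^ m"
proof -
  have "\<bar>of_int \<lfloor>2 ^ m * x\<rfloor> - 2 ^ m * x\<bar> \<le> 1" by linarith
  then have "\<bar>of_int \<lfloor>2 ^ m * x\<rfloor> - 2 ^ m * x\<bar> / 2 ^ m \<le> 1 / 2 ^ m" by (rule divide_right_mono) simp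
  also have "\<bar>of_int \<lfloor>2 ^ m * x\<rfloor> - 2 ^ m * x\<bar> / 2 ^ m = \<bar>dyadic_floor m x - x\<bar>"
    using abs_divide[of "of_int \<lfloor>2 ^ m * x\<rfloor> - 2 ^ m * x" "2 ^ m :: real"]
    by (simp add: dyadic_floor_def diff_divide_distrib)
  finally show ?thesis .
qed

lemma dyadic_floor_unit: "x \<in> {0..1} \<Longrightarrow> dyadic_floor m x \<in> {0..1}"
proof -
  assume x: "x \<in> {0..1}"
  then have "0 \<le> dyadic_floor m x" by (simp add: dyadic_floor_def)
  then show ?thesis using dyadic_floor_le[of m x] x by simp
qed

lemma step_path_dyadic:
  "step_path {real k / 2 ^ m |k. k \<in> {1..2 ^ m}} (\<lambda>t\<in>{0..1}. h (dyadic_floor m t))"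
  unfolding step_path_def
proof (intro conjI ballI impI)
  show "finite {real k / 2 ^ m |k. k \<in> {1..2 ^ m}}" by simp
  show "{real k / 2 ^ m |k. k \<in> {1..2 ^ m}} \<subseteq> {0<..1}"
    by (auto simp: divide_le_eq)
  fix s t :: real assume st: "s \<in> {0..1}" "t \<in> {0..1}"
  assume *: "\<forall>b\<in>{real k / 2 ^ m |k. k \<in> {1..2 ^ m}}. b \<le> s \<longleftrightarrow> b \<le> t"
  have "\<lfloor>2 ^ m * s\<rfloor> \<le> \<lfloor>2 ^ m * t\<rfloor>"
    if st: "s \<in> {0..1}" "t \<in> {0..1}" and
      *: "\<forall>b\<in>{real k / 2 ^ m |k. k \<in> {1..2 ^ m}}. b \<le> s \<longleftrightarrow> b \<le> t" for s t
  proof (cases "\<lfloor>2 ^ m * s\<rfloor> \<le> 0")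
    case True
    then show ?thesis using st by (smt (verit) zero_le_floor atLeastAtMost_iff mult_nonneg_nonneg zero_le_power)
  next
    case False
    define k where "k = nat \<lfloor>2 ^ m * s\<rfloor>"
    have k: "real k = of_int \<lfloor>2 ^ m * s\<rfloor>" "k \<ge> 1" using False by (simp_all add: k_def) linarith
    have "2 ^ m * s \<le> 2 ^ m" using st by simp
    then have "real k \<le> 2 ^ m" using k(1) by linarith
    then have "k \<le> 2 ^ m" by (metis of_nat_le_iff of_nat_numeral of_nat_power)
    then have "real k / 2 ^ m \<in> {real k / 2 ^ m |k. k \<in> {1..2 ^ m}}" using k(2) by auto
    moreover have "real k / 2 ^ m \<le> s" using k(1) dyadic_floor_le[of m s] by (simp add: dyadic_floor_def)
    ultimately have "real k / 2 ^ m \<le> t" using * by blast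
    then have "of_int \<lfloor>2 ^ m * s\<rfloor> \<le> 2 ^ m * t" using k(1) by (simp add: divide_le_eq mult.commute)
    then show ?thesis by (simp add: le_floor_iff)
  qed
  from this[OF st *] this[OF st(2,1)] * have "\<lfloor>2 ^ m * s\<rfloor> = \<lfloor>2 ^ m * t\<rfloor>" by fastforce
  then show "(\<lambda>t\<in>{0..1}. h (dyadic_floor m t)) s = (\<lambda>t\<in>{0..1}. h (dyadic_floor m t)) t"
    using st by (simp add: dyadic_floor_def)
qed

text \<open>Rounding the time of a step path to the dyadic grid moves each jump time up to the next grid
  point, which a small time change undoes once the grid separates the jumps.\<close>

lemma step_path_discretize:
  fixes f :: "real \<Rightarrow> 'a::metric_space"
  assumes f: "step_path B f" "f \<in> extensional {0..1}"
    and R: "\<And>m x. dist (R m x) x \<le> c / 2 ^ m"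
  shows "(\<lambda>m. J1_dist (\<lambda>t\<in>{0..1}. R m (f (dyadic_floor m t))) f) \<longlonglongrightarrow> 0"
proof -
  have fin: "finite B" and sub: "B \<subseteq> {0<..1}"
    and eq: "\<And>s t. s \<in> {0..1} \<Longrightarrow> t \<in> {0..1} \<Longrightarrow> (\<And>b. b \<in> B \<Longrightarrow> b \<le> s \<longleftrightarrow> b \<le> t) \<Longrightarrow> f s = f t"
    using f(1) unfolding step_path_def by blast+
  define g where "g m = (\<lambda>t\<in>{0..1}. R m (f (dyadic_floor m t)))" for m
  have g: "g m \<in> cadlag_paths" for m
    unfolding g_def using step_path_dyadic[of m "\<lambda>x. R m (f x)"] by (rule step_path_cadlag) simp
  have fc: "f \<in> cadlag_paths" using f by (rule step_path_cadlag)
  \<comment> \<open>All distances that the grid has to resolve: from jumps to 0, from jumps before 1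
    to 1, and between different jumps. The element 1 keeps the set nonempty when there are no
    jumps.\<close>
  define G where "G = insert 1 (B \<union> ((\<lambda>b. 1 - b) ` (B - {1})) \<union> (\<lambda>(b, c). \<bar>b - c\<bar>) ` {(b, c) \<in> B \<times> B. b \<noteq> c})"
  have "finite {(b, c) \<in> B \<times> B. b \<noteq> c}" by (rule finite_subset[of _ "B \<times> B"]) (use fin in auto)
  then have G: "finite G" "G \<noteq> {}" using fin by (auto simp: G_def)
  have Gpos: "x > 0" if "x \<in> G" for x using that sub by (force simp: G_def)
  define \<delta> where "\<delta> = Min G"
  have d: "\<delta> > 0" using Gpos G by (simp add: \<delta>_def)
  have dle: "\<delta> \<le> x" if "x \<in> G" for x using that G by (simp add: \<delta>_def)
  define N where "N = real (card B)"
  \<comment> \<open>Each of the \<open>N\<close> jumps moves by at most 1 / 2^m, and rounding the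
    values costs \<open>c\<close> / 2^m. The additional 1 makes the bound positive, as
    \<open>J1_close\<close> requires.\<close>
  have "(\<lambda>m. (N + \<bar>c\<bar> + 1) / 2 ^ m) \<longlonglongrightarrow> 0"
    using LIMSEQ_divide_realpow_zero[of 2 "N + \<bar>c\<bar> + 1"] by simp
  then have ev: "\<forall>\<^sub>F m in sequentially. (N + \<bar>c\<bar> + 1) / 2 ^ m < \<delta>" using d by (intro order_tendstoD)
  have "\<forall>\<^sub>F m in sequentially. J1_dist (g m) f \<le> (N + \<bar>c\<bar> + 1) / 2 ^ m"
    using ev
  proof eventually_elim
    case (elim m)
    \<comment> \<open>Jumps are rounded up, because the dyadic floor of a time reaches
      \<open>b\<close> exactly when the time reaches the next grid point at or after
      \<open>b\<close>.\<close>
    define b' where "b' b = of_int \<lceil>2 ^ m * b\<rceil> / (2 ^ m :: real)" for b :: real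
    have b': "\<bar>b' b - b\<bar> \<le> 1 / 2 ^ m" for b
    proof -
      have "\<bar>of_int \<lceil>2 ^ m * b\<rceil> - 2 ^ m * b\<bar> \<le> 1" by linarith
      then have "\<bar>of_int \<lceil>2 ^ m * b\<rceil> - 2 ^ m * b\<bar> / 2 ^ m \<le> 1 / 2 ^ m" by (rule divide_right_mono) simp
      also have "\<bar>of_int \<lceil>2 ^ m * b\<rceil> - 2 ^ m * b\<bar> / 2 ^ m = \<bar>b' b - b\<bar>"
        using abs_divide[of "of_int \<lceil>2 ^ m * b\<rceil> - 2 ^ m * b" "2 ^ m :: real"]
        by (simp add: b'_def diff_divide_distrib)
      finally show ?thesis .
    qed
    \<comment> \<open>A jump at time 1 lies on every grid and stays in place, as it must, since time
      changes fix 1.\<close>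
    have b1: "b' 1 = 1"
    proof -
      have "\<lceil>2 ^ m :: real\<rceil> = 2 ^ m" by (metis ceiling_of_int of_int_numeral of_int_power)
      then show ?thesis by (simp add: b'_def)
    qed
    have s: "(\<Sum>b\<in>B. \<bar>b' b - b\<bar>) \<le> N / 2 ^ m"
      using sum_bounded_above[of B "\<lambda>b. \<bar>b' b - b\<bar>" "1 / 2 ^ m"] b' by (simp add: N_def)
    also have "\<dots> \<le> (N + \<bar>c\<bar> + 1) / 2 ^ m" by (intro divide_right_mono) auto
    finally have s': "(\<Sum>b\<in>B. \<bar>b' b - b\<bar>) \<le> (N + \<bar>c\<bar> + 1) / 2 ^ m" .
    obtain \<phi> where \<phi>: "\<phi> \<in> time_changes" "\<And>b. b \<in> B \<Longrightarrow> \<phi> b = b' b"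
      "\<And>t. \<bar>\<phi> t - t\<bar> \<le> (\<Sum>b\<in>B. \<bar>b' b - b\<bar>)"
    proof (rule time_change_moving_points[OF fin d, of b'])
      show "\<bar>b - c\<bar> \<ge> \<delta>" if "b \<in> B" "c \<in> B" "b \<noteq> c" for b c using that by (intro dle) (auto simp: G_def)
      show "\<delta> \<le> b" if "b \<in> B" for b using that by (intro dle) (auto simp: G_def)
      show "b \<le> 1 - \<delta> \<or> b' b = b" if "b \<in> B" for b
      proof (cases "b = 1")
        case False
        then have "\<delta> \<le> 1 - b" using that by (intro dle) (auto simp: G_def)
        then show ?thesis by simp
      qed (simp add: b1)
      show "(\<Sum>b\<in>B. \<bar>b' b - b\<bar>) < \<delta>" using s' elim by simp
    qed blast
    have "J1_close f (g m) ((N + \<bar>c\<bar> + 1) / 2 ^ m)"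
      unfolding J1_close_def
    proof (intro conjI bexI[OF _ \<phi>(1)] ballI)
      show "0 < (N + \<bar>c\<bar> + 1) / 2 ^ m" by (simp add: N_def add_nonneg_pos)
      fix t :: real assume t: "t \<in> {0..1}"
      have \<phi>t: "\<phi> t \<in> {0..1}" using time_change_range[OF \<phi>(1) t] .
      show "\<bar>\<phi> t - t\<bar> \<le> (N + \<bar>c\<bar> + 1) / 2 ^ m" using \<phi>(3) s' by (rule order_trans)
      have sm: "strict_mono_on {0..1} \<phi>" using \<phi>(1) by (simp add: time_changes_def)
      have "f t = f (dyadic_floor m (\<phi> t))"
      proof (rule eq[OF t dyadic_floor_unit[OF \<phi>t]])
        fix b assume b: "b \<in> B"
        then have "b \<in> {0..1}" using sub by auto
        then have "b \<le> t \<longleftrightarrow> \<phi> b \<le> \<phi> t" using sm t by (metis linorder_not_le strict_mono_on_less_eq)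
        also have "\<dots> \<longleftrightarrow> of_int \<lceil>2 ^ m * b\<rceil> \<le> 2 ^ m * \<phi> t"
          using \<phi>(2)[OF b] by (simp add: b'_def divide_le_eq mult.commute)
        also have "\<dots> \<longleftrightarrow> \<lceil>2 ^ m * b\<rceil> \<le> \<lfloor>2 ^ m * \<phi> t\<rfloor>" by (simp add: le_floor_iff)
        also have "\<dots> \<longleftrightarrow> 2 ^ m * b \<le> of_int \<lfloor>2 ^ m * \<phi> t\<rfloor>" by (simp add: ceiling_le_iff)
        also have "\<dots> \<longleftrightarrow> b \<le> dyadic_floor m (\<phi> t)" by (simp add: dyadic_floor_def le_divide_eq mult.commute)
        finally show "b \<le> t \<longleftrightarrow> b \<le> dyadic_floor m (\<phi> t)" .
      qed
      then have "dist (f t) (g m (\<phi> t)) \<le> c / 2 ^ m"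
        using R[of m "f t"] \<phi>t by (simp add: g_def dist_commute)
      also have "\<dots> \<le> (N + \<bar>c\<bar> + 1) / 2 ^ m" by (intro divide_right_mono) (auto simp: N_def)
      finally show "dist (f t) (g m (\<phi> t)) \<le> (N + \<bar>c\<bar> + 1) / 2 ^ m" .
    qed
    then show ?case by (rule J1_dist_le[OF g fc J1_close_sym])
  qed
  then have "(\<lambda>m. J1_dist (g m) f) \<longlonglongrightarrow> 0"
    by (intro tendsto_sandwich[OF _ _ tendsto_const \<open>(\<lambda>m. (N + \<bar>c\<bar> + 1) / 2 ^ m) \<longlonglongrightarrow> 0\<close>])
      (auto simp: J1_dist_nonneg)
  then show ?thesis by (simp add: g_def)
qed

lemma dist_vector3_le:
  "dist (vector [a, b, c] :: real^3) (vector [a', b', c']) \<le> \<bar>a - a'\<bar> + \<bar>b - b'\<bar> + \<bar>c - c'\<bar>"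
  using norm_le_l1_cart[of "vector [a, b, c] - vector [a', b', c'] :: real^3"]
  by (simp add: dist_norm sum_3)

text \<open>Rounding both time and values leaves only countably many possible paths, determined by
  finitely many evaluations; such a map is measurable for any topology on paths. The rounded paths
  converge in J1 to the given ones, and limits of measurable maps are measurable. The Borel sets of
  the Skorokhod space thus need no description through evaluation maps.\<close>

lemma path3_measurable:
  fixes a b c :: "'b \<Rightarrow> real \<Rightarrow> real"
  assumes step: "\<And>\<omega>. \<omega> \<in> space N \<Longrightarrow> \<exists>B. step_path B (path3 (a \<omega>) (b \<omega>) (c \<omega>))"
    and meas: "\<And>t. t \<in> {0..1} \<Longrightarrow> (\<lambda>\<omega>. a \<omega> t) \<in> borel_measurable N"
      "\<And>t. t \<in> {0..1} \<Longrightarrow> (\<lambda>\<omega>. b \<omega> t) \<in> borel_measurable N"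
      "\<And>t. t \<in> {0..1} \<Longrightarrow> (\<lambda>\<omega>. c \<omega> t) \<in> borel_measurable N"
  shows "(\<lambda>\<omega>. path3 (a \<omega>) (b \<omega>) (c \<omega>)) \<in> N \<rightarrow>\<^sub>M borel_of J1_topology"
proof -
  define R :: "nat \<Rightarrow> real^3 \<Rightarrow> real^3" where
    "R m v = vector [dyadic_floor m (v $ 1), dyadic_floor m (v $ 2), dyadic_floor m (v $ 3)]" for m v
  define F where "F m \<omega> = (\<lambda>t\<in>{0..1}. R m (path3 (a \<omega>) (b \<omega>) (c \<omega>) (dyadic_floor m t)))" for m \<omega>
  have R: "dist (R m v) v \<le> 3 / 2 ^ m" for m v
  proof -
    have v: "v = vector [v $ 1, v $ 2, v $ 3]" by (simp add: vec_eq_iff forall_3)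
    have "dist (R m v) v \<le> \<bar>dyadic_floor m (v $ 1) - v $ 1\<bar> + \<bar>dyadic_floor m (v $ 2) - v $ 2\<bar> +
        \<bar>dyadic_floor m (v $ 3) - v $ 3\<bar>"
      using dist_vector3_le[of _ _ _ "v $ 1" "v $ 2" "v $ 3"] unfolding R_def v[symmetric] .
    then show ?thesis
      using dyadic_floor_close[of m "v $ 1"] dyadic_floor_close[of m "v $ 2"] dyadic_floor_close[of m "v $ 3"]
      by simp
  qed
  have cad: "F m \<omega> \<in> cadlag_paths" for m \<omega>
    unfolding F_def
    using step_path_dyadic[of m "\<lambda>x. R m (path3 (a \<omega>) (b \<omega>) (c \<omega>) x)"] by (rule step_path_cadlag) simp
  have F: "F m \<in> N \<rightarrow>\<^sub>M borel_of J1_topology" for m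
  proof -
    define fl where "fl f k = \<lfloor>2 ^ m * (f (real k / 2 ^ m) :: real)\<rfloor>" for f and k :: nat
    \<comment> \<open>The integer code of the rounded path: its three rounded values at the 2^m + 1
      grid times. \<open>\<Psi>\<close> decodes it.\<close>
    define \<kappa> where "\<kappa> \<omega> = map (\<lambda>k. (fl (a \<omega>) k, fl (b \<omega>) k, fl (c \<omega>) k)) [0..<2 ^ m + 1]" for \<omega>
    define \<Psi> :: "(int \<times> int \<times> int) list \<Rightarrow> real \<Rightarrow> real^3" where "\<Psi> l = (\<lambda>t\<in>{0..1}.
        let q = l ! nat \<lfloor>2 ^ m * t\<rfloor> in vector [of_int (fst q) / 2 ^ m, of_int (fst (snd q)) / 2 ^ m,
          of_int (snd (snd q)) / 2 ^ m])" for l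
    have fl: "(\<lambda>\<omega>. fl (f \<omega>) k) \<in> N \<rightarrow>\<^sub>M count_space UNIV"
      if "\<And>t. t \<in> {0..1} \<Longrightarrow> (\<lambda>\<omega>. f \<omega> t) \<in> borel_measurable N" "k \<le> 2 ^ m" for f :: "'b \<Rightarrow> real \<Rightarrow> real" and k
    proof -
      have "real k / 2 ^ m \<in> {0..1}"
        using of_nat_mono[OF that(2), where 'a = real] by simp
      then have [measurable]: "(\<lambda>\<omega>. f \<omega> (real k / 2 ^ m)) \<in> borel_measurable N" by (rule that(1))
      show ?thesis unfolding fl_def by measurable
    qed
    have "\<kappa> \<in> N \<rightarrow>\<^sub>M count_space UNIV"
    proof (subst measurable_count_space_eq2_countable, intro conjI ballI)
      show "\<kappa> \<in> space N \<rightarrow> UNIV" by simp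
      fix l :: "(int \<times> int \<times> int) list"
      show "\<kappa> -` {l} \<inter> space N \<in> sets N"
      proof (cases "length l = 2 ^ m + 1")
        case True
        have "\<kappa> -` {l} \<inter> space N = {\<omega> \<in> space N. \<forall>k\<in>{..2 ^ m}. fl (a \<omega>) k = fst (l ! k) \<and>
            fl (b \<omega>) k = fst (snd (l ! k)) \<and> fl (c \<omega>) k = snd (snd (l ! k))}"
          using True by (auto simp: \<kappa>_def list_eq_iff_nth_eq prod_eq_iff less_Suc_eq_le nth_append)
        also have "\<dots> \<in> sets N"
        proof (intro sets.sets_Collect_finite_All' sets.sets_Collect_conj)
          have pre: "{\<omega> \<in> space N. fl (f \<omega>) k = z} \<in> sets N"
            if "\<And>t. t \<in> {0..1} \<Longrightarrow> (\<lambda>\<omega>. f \<omega> t) \<in> borel_measurable N" "k \<in> {..2 ^ m}" for f :: "'b \<Rightarrow> real \<Rightarrow> real" and k z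
          proof -
            have [measurable]: "(\<lambda>\<omega>. fl (f \<omega>) k) \<in> N \<rightarrow>\<^sub>M count_space UNIV" using that by (intro fl) auto
            show ?thesis by measurable
          qed
          fix k :: nat assume k: "k \<in> {..2 ^ m}"
          show "{\<omega> \<in> space N. fl (a \<omega>) k = fst (l ! k)} \<in> sets N" by (rule pre[OF meas(1) k])
          show "{\<omega> \<in> space N. fl (b \<omega>) k = fst (snd (l ! k))} \<in> sets N" by (rule pre[OF meas(2) k])
          show "{\<omega> \<in> space N. fl (c \<omega>) k = snd (snd (l ! k))} \<in> sets N" by (rule pre[OF meas(3) k])
        qed auto
        finally show ?thesis .
      next
        case False
        then have "\<kappa> -` {l} \<inter> space N = {}" by (auto simp: \<kappa>_def)
        then show ?thesis by simp
      qed
    qed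
    moreover have FK: "F m \<omega> = \<Psi> (\<kappa> \<omega>)" for \<omega>
    proof
      fix t
      show "F m \<omega> t = \<Psi> (\<kappa> \<omega>) t"
      proof (cases "t \<in> {0..1}")
        case True
        have k: "real (nat \<lfloor>2 ^ m * t\<rfloor>) = of_int \<lfloor>2 ^ m * t\<rfloor>" using True by simp
        have "2 ^ m * t \<le> 2 ^ m" using True by simp
        then have "real (nat \<lfloor>2 ^ m * t\<rfloor>) \<le> 2 ^ m" unfolding k by linarith
        then have k': "nat \<lfloor>2 ^ m * t\<rfloor> \<le> 2 ^ m" by (metis of_nat_le_iff of_nat_numeral of_nat_power)
        have d: "real (nat \<lfloor>2 ^ m * t\<rfloor>) / 2 ^ m = dyadic_floor m t" using k by (simp add: dyadic_floor_def)
        have n: "\<kappa> \<omega> ! nat \<lfloor>2 ^ m * t\<rfloor> = (fl (a \<omega>) (nat \<lfloor>2 ^ m * t\<rfloor>), fl (b \<omega>) (nat \<lfloor>2 ^ m * t\<rfloor>), fl (c \<omega>) (nat \<lfloor>2 ^ m * t\<rfloor>))"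
          unfolding \<kappa>_def using k' by (subst nth_map) (auto simp: less_Suc_eq_le nth_append simp del: upt_Suc)
        show ?thesis
          using True dyadic_floor_unit[OF True, of m]
          by (simp add: F_def \<Psi>_def n R_def path3_def fl_def d Let_def del: atLeastAtMost_iff)
            (simp add: dyadic_floor_def)
      next
        case False
        then show ?thesis unfolding F_def \<Psi>_def by (simp only: restrict_def if_False)
      qed
    qed
    \<comment> \<open>Factoring through a countable discrete space makes the preimage of an
      arbitrary set of paths measurable.\<close>
    ultimately have "F m -` U \<inter> space N \<in> sets N" for U
      using measurable_sets[of \<kappa> N "count_space UNIV" "\<Psi> -` U"] by (simp add: vimage_def)
    then show ?thesis
      by (intro measurable_borel_of_iff) (simp_all add: J1_topology_topspace cad)
  qed
  show ?thesis
    unfolding J1_topology_def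
  proof (rule Metric_space.measurable_borel_of_limit[OF Metric_space_J1])
    show "F m \<in> N \<rightarrow>\<^sub>M borel_of (Metric_space.mtopology cadlag_paths J1_dist)" for m
      using F[of m] by (simp add: J1_topology_def)
    fix \<omega> assume "\<omega> \<in> space N"
    then obtain B where B: "step_path B (path3 (a \<omega>) (b \<omega>) (c \<omega>))" using step by blast
    have e: "path3 (a \<omega>) (b \<omega>) (c \<omega>) \<in> extensional {0..1}" by (simp add: path3_def)
    show "path3 (a \<omega>) (b \<omega>) (c \<omega>) \<in> cadlag_paths" using B e by (rule step_path_cadlag)
    show "(\<lambda>m. J1_dist (F m \<omega>) (path3 (a \<omega>) (b \<omega>) (c \<omega>))) \<longlonglongrightarrow> 0"
      unfolding F_def using B e R by (rule step_path_discretize)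
  qed
qed

section \<open>Convergence to a deterministic continuous path\<close>

lemma path3_continuous_cadlag:
  assumes "continuous_on UNIV a" "continuous_on UNIV b" "continuous_on UNIV c"
  shows "path3 a b c \<in> cadlag_paths"
proof -
  define g :: "real \<Rightarrow> real^3" where "g t = vector [a t, b t, c t]" for t
  have "isCont g t" for t
    unfolding isCont_def
  proof (rule vec_tendstoI)
    fix i :: 3
    have "isCont a t" "isCont b t" "isCont c t" using assms by (auto simp: continuous_on_eq_continuous_at)
    then show "((\<lambda>x. g x $ i) \<longlongrightarrow> g t $ i) (at t)"
      using exhaust_3[of i] by (auto simp: g_def isCont_def)
  qed
  then have lim: "(g \<longlongrightarrow> g t) (at t within S)" for t S
    by (meson isCont_def tendsto_within_subset subset_UNIV)
  have p: "path3 a b c t = g t" if "t \<in> {0..1}" for t using that by (simp add: path3_def g_def)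
  show ?thesis
    unfolding cadlag_paths_def
  proof (intro CollectI conjI allI impI)
    show "path3 a b c \<in> extensional {0..1}" by (simp add: path3_def)
    fix t :: real
    {
      assume t: "0 \<le> t \<and> t < 1"
      have "\<forall>\<^sub>F x in at_right t. g x = path3 a b c x"
        using t by (auto simp: eventually_at_right_field p intro!: exI[of _ 1])
      then show "(path3 a b c \<longlongrightarrow> path3 a b c t) (at_right t)"
        using Lim_transform_eventually[OF lim] t by (simp add: p)
    }
    {
      assume t: "0 < t \<and> t \<le> 1"
      have "\<forall>\<^sub>F x in at_left t. g x = path3 a b c x"
        using t by (auto simp: eventually_at_left_field p intro!: exI[of _ 0])
      then show "\<exists>l. (path3 a b c \<longlongrightarrow> l) (at_left t)"
        using Lim_transform_eventually[OF lim] by blast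
    }
  qed
qed

text \<open>Convergence in probability to a constant implies convergence in distribution. A bounded
  continuous \<open>f\<close> varies by less than e / 3 on a J1 ball around \<open>x0\<close>, and
  the complementary event has small probability and changes \<open>f\<close> by at most twice its
  bound.\<close>

lemma converges_in_distribution_to_point:
  fixes X :: "nat \<Rightarrow> 'b \<Rightarrow> real \<Rightarrow> 'a::metric_space"
  assumes x0: "x0 \<in> cadlag_paths"
    and pr: "\<forall>\<^sub>F n in sequentially. prob_space (M n) \<and> X n \<in> M n \<rightarrow>\<^sub>M borel_of J1_topology"
    and conv: "\<And>\<epsilon>. \<epsilon> > 0 \<Longrightarrow>
      (\<lambda>n. measure (M n) {\<omega> \<in> space (M n). J1_dist x0 (X n \<omega>) \<ge> \<epsilon>}) \<longlonglongrightarrow> 0"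
  shows "converges_in_distribution J1_topology M X (return (borel_of J1_topology) x0)"
  unfolding converges_in_distribution_def
proof (intro conjI allI impI)
  have x0': "x0 \<in> space (borel_of J1_topology)" using x0 by (simp add: space_borel_of J1_topology_topspace)
  show "prob_space (return (borel_of J1_topology) x0)" by (rule prob_space_return[OF x0'])
  fix f :: "(real \<Rightarrow> 'a) \<Rightarrow> real"
  assume f: "continuous_map J1_topology euclideanreal f \<and> bounded (f ` topspace J1_topology)"
  have fm: "f \<in> borel_of J1_topology \<rightarrow>\<^sub>M borel" using f by (intro continuous_map_borel_of_measurable) auto
  obtain K where K: "\<And>x. x \<in> cadlag_paths \<Longrightarrow> \<bar>f x\<bar> \<le> K"
    using f unfolding bounded_iff J1_topology_topspace by auto
  have K0: "0 \<le> K" using K[OF x0] by simp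
  have [simp]: "(\<integral>x. f x \<partial>return (borel_of J1_topology) x0) = f x0"
    using fm x0' by (intro integral_return) auto
  have "(\<lambda>n. \<integral>\<omega>. f (X n \<omega>) \<partial>M n) \<longlonglongrightarrow> f x0"
    unfolding tendsto_iff
  proof (intro allI impI)
    fix e :: real assume e: "e > 0"
    have "openin J1_topology {x \<in> topspace J1_topology. f x \<in> ball (f x0) (e / 3)}"
      by (rule openin_continuous_map_preimage[OF conjunct1[OF f]]) simp
    moreover have "x0 \<in> {x \<in> topspace J1_topology. f x \<in> ball (f x0) (e / 3)}"
      using x0 e by (auto simp: J1_topology_topspace)
    ultimately obtain d where d: "d > 0" and
      sub: "Metric_space.mball cadlag_paths J1_dist x0 d \<subseteq> {x \<in> topspace J1_topology. f x \<in> ball (f x0) (e / 3)}"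
      unfolding J1_topology_def Metric_space.openin_mtopology[OF Metric_space_J1] by blast
    have near: "\<bar>f x - f x0\<bar> < e / 3" if "x \<in> cadlag_paths" "J1_dist x0 x < d" for x
    proof -
      have "x \<in> Metric_space.mball cadlag_paths J1_dist x0 d"
        using that x0 by (simp add: Metric_space.in_mball[OF Metric_space_J1])
      then have "f x \<in> ball (f x0) (e / 3)" using sub by blast
      then show ?thesis by (simp add: dist_real_def abs_minus_commute)
    qed
    have "\<forall>\<^sub>F n in sequentially. measure (M n) {\<omega> \<in> space (M n). J1_dist x0 (X n \<omega>) \<ge> d} < e / (6 * (K + 1))"
      using conv[OF d] e K0 by (intro order_tendstoD) auto
    then show "\<forall>\<^sub>F n in sequentially. dist (\<integral>\<omega>. f (X n \<omega>) \<partial>M n) (f x0) < e"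
      using pr
    proof eventually_elim
      case (elim n)
      interpret prob_space "M n" using elim by simp
      have Xm [measurable]: "X n \<in> M n \<rightarrow>\<^sub>M borel_of J1_topology" using elim by simp
      have Xc: "X n \<omega> \<in> cadlag_paths" if "\<omega> \<in> space (M n)" for \<omega>
        using measurable_space[OF Xm that] by (simp add: space_borel_of J1_topology_topspace)
      have [measurable]: "(\<lambda>\<omega>. f (X n \<omega>)) \<in> borel_measurable (M n)" using Xm fm by (rule measurable_compose)
      define A where "A = {\<omega> \<in> space (M n). \<not> J1_dist x0 (X n \<omega>) < d}"
      have "openin J1_topology (Metric_space.mball cadlag_paths J1_dist x0 d)"
        unfolding J1_topology_def by (rule Metric_space.openin_mball[OF Metric_space_J1])
      then have "X n -` Metric_space.mball cadlag_paths J1_dist x0 d \<inter> space (M n) \<in> sets (M n)"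
        by (intro measurable_sets[OF Xm] borel_of_openin)
      then have "space (M n) - (X n -` Metric_space.mball cadlag_paths J1_dist x0 d \<inter> space (M n)) \<in> sets (M n)"
        by blast
      also have "space (M n) - (X n -` Metric_space.mball cadlag_paths J1_dist x0 d \<inter> space (M n)) = A"
        using Xc x0 by (auto simp: A_def Metric_space.in_mball[OF Metric_space_J1])
      finally have A [measurable]: "A \<in> sets (M n)" .
      \<comment> \<open>The threshold makes the exceptional event contribute at most e / 3; using
        \<open>K + 1\<close> avoids division by 0 when \<open>K = 0\<close>.\<close>
      have pA: "prob A < e / (6 * (K + 1))" using elim by (simp add: A_def not_less)
      have int: "integrable (M n) (\<lambda>\<omega>. f (X n \<omega>))"
        by (rule integrable_const_bound[of _ K]) (use K Xc in auto)
      have "\<bar>(\<integral>\<omega>. f (X n \<omega>) \<partial>M n) - f x0\<bar> = \<bar>\<integral>\<omega>. f (X n \<omega>) - f x0 \<partial>M n\<bar>"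
        using int by (simp add: prob_space)
      also have "\<dots> \<le> (\<integral>\<omega>. \<bar>f (X n \<omega>) - f x0\<bar> \<partial>M n)" by (rule integral_abs_bound)
      also have "\<dots> \<le> (\<integral>\<omega>. e / 3 + 2 * K * indicator A \<omega> \<partial>M n)"
      proof (rule integral_mono)
        show "integrable (M n) (\<lambda>\<omega>. \<bar>f (X n \<omega>) - f x0\<bar>)" using int by auto
        show "integrable (M n) (\<lambda>\<omega>. e / 3 + 2 * K * indicator A \<omega>)"
          by (intro Bochner_Integration.integrable_add integrable_mult_right integrable_real_indicator)
            (auto simp: emeasure_eq_measure)
        fix \<omega> assume w: "\<omega> \<in> space (M n)"
        have "\<bar>f (X n \<omega>) - f x0\<bar> \<le> 2 * K" using K[OF Xc[OF w]] K[OF x0] by linarith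
        then show "\<bar>f (X n \<omega>) - f x0\<bar> \<le> e / 3 + 2 * K * indicator A \<omega>"
          using near[OF Xc[OF w]] w e K0 by (cases "\<omega> \<in> A") (auto simp: A_def)
      qed
      also have "\<dots> = e / 3 + 2 * K * prob A"
      proof -
        have "integrable (M n) (indicator A :: 'b \<Rightarrow> real)"
          by (intro integrable_real_indicator) (auto simp: emeasure_eq_measure)
        then show ?thesis by (simp add: prob_space)
      qed
      also have "\<dots> \<le> e / 3 + 2 * (K + 1) * prob A" by (simp add: mult_right_mono)
      also have "\<dots> < e"
        using pA K0 e by (simp add: field_simps)
      finally show ?case by (simp add: dist_real_def)
    qed
  qed
  then show "(\<lambda>n. \<integral>\<omega>. f (X n \<omega>) \<partial>M n) \<longlonglongrightarrow> (\<integral>x. f x \<partial>return (borel_of J1_topology) x0)" by simp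
qed (use pr in auto)

text \<open>For nondecreasing paths and a continuous limit, convergence in probability at each fixed time
  is already uniform in time.\<close>

lemma monotone_close_uniform:
  fixes f :: "real \<Rightarrow> real"
  assumes mono: "\<And>s t. 0 \<le> s \<Longrightarrow> s \<le> t \<Longrightarrow> t \<le> 1 \<Longrightarrow> f s \<le> f t"
    and m: "m > 0" and \<alpha>: "\<alpha> \<ge> 0"
    and grid: "\<And>j. j \<le> m \<Longrightarrow> \<bar>f (real j / real m) - \<alpha> * (real j / real m)\<bar> \<le> \<epsilon>"
    and t: "t \<in> {0..1}"
  shows "\<bar>f t - \<alpha> * t\<bar> \<le> \<epsilon> + \<alpha> / real m"
\<comment> \<open>The time 1 is itself a grid point and has no grid point to its right.\<close>
proof (cases "t = 1")
  case True
  then show ?thesis using grid[of m] m \<alpha> by (simp add: add_increasing2)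
next
  case False
  define j where "j = nat \<lfloor>real m * t\<rfloor>"
  have j: "real j \<le> real m * t" "real m * t < real j + 1"
    using t by (auto simp: j_def)
  have "real m * t < real m" using False t m by simp
  then have jm: "Suc j \<le> m" using j(1) by linarith
  have jt: "real j / real m \<le> t" "t \<le> real (Suc j) / real m"
    using j m by (auto simp: field_simps)
  have "f (real j / real m) \<le> f t" using jt t by (intro mono) auto
  moreover have "f t \<le> f (real (Suc j) / real m)" using jt jm t m by (intro mono) (auto simp: field_simps)
  moreover have "\<alpha> * (real j / real m) \<le> \<alpha> * t" "\<alpha> * t \<le> \<alpha> * (real (Suc j) / real m)"
    using mult_left_mono[OF jt(1) \<alpha>] mult_left_mono[OF jt(2) \<alpha>] by blast+
  moreover have "\<alpha> * (real (Suc j) / real m) = \<alpha> * (real j / real m) + \<alpha> / real m"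
    using m by (simp add: field_simps)
  ultimately show ?thesis using grid[of j] grid[of "Suc j"] jm by linarith
qed

text \<open>A union bound over finitely many grid times and three coordinates controls all grid
  errors at once; monotonicity fills in the times between, and uniform closeness bounds the J1
  distance through the identity time change.\<close>

lemma path3_converges:
  fixes a :: "nat \<Rightarrow> 'b \<Rightarrow> nat \<Rightarrow> real \<Rightarrow> real" and \<alpha> :: "nat \<Rightarrow> real"
  assumes prob: "\<And>n. n \<ge> 3 \<Longrightarrow> prob_space (M n)"
    and step: "\<And>n \<omega>. n \<ge> 3 \<Longrightarrow> \<omega> \<in> space (M n) \<Longrightarrow>
      \<exists>B. step_path B (path3 (a n \<omega> 0) (a n \<omega> 1) (a n \<omega> 2))"
    and meas: "\<And>n k t. n \<ge> 3 \<Longrightarrow> t \<in> {0..1} \<Longrightarrow> (\<lambda>\<omega>. a n \<omega> k t) \<in> borel_measurable (M n)"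
    and mono: "\<And>n \<omega> k s t. n \<ge> 3 \<Longrightarrow> \<omega> \<in> space (M n) \<Longrightarrow> 0 \<le> s \<Longrightarrow> s \<le> t \<Longrightarrow> t \<le> 1 \<Longrightarrow> a n \<omega> k s \<le> a n \<omega> k t"
    and \<alpha>: "\<And>k. \<alpha> k \<ge> 0"
    and lim: "\<And>k t \<epsilon>. k \<le> 2 \<Longrightarrow> t \<in> {0..1} \<Longrightarrow> \<epsilon> > 0 \<Longrightarrow>
      (\<lambda>n. measure (M n) {\<omega> \<in> space (M n). \<bar>a n \<omega> k t - \<alpha> k * t\<bar> > \<epsilon>}) \<longlonglongrightarrow> 0"
  shows "converges_in_distribution J1_topology M (\<lambda>n \<omega>. path3 (a n \<omega> 0) (a n \<omega> 1) (a n \<omega> 2))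
    (return (borel_of J1_topology) (path3 (\<lambda>t. \<alpha> 0 * t) (\<lambda>t. \<alpha> 1 * t) (\<lambda>t. \<alpha> 2 * t)))"
proof (rule converges_in_distribution_to_point)
  define x0 where "x0 = path3 (\<lambda>t. \<alpha> 0 * t) (\<lambda>t. \<alpha> 1 * t) (\<lambda>t. \<alpha> 2 * t)"
  have x0: "x0 \<in> cadlag_paths"
    unfolding x0_def by (intro path3_continuous_cadlag continuous_intros)
  show "path3 (\<lambda>t. \<alpha> 0 * t) (\<lambda>t. \<alpha> 1 * t) (\<lambda>t. \<alpha> 2 * t) \<in> cadlag_paths" using x0 by (simp add: x0_def)
  have m: "(\<lambda>\<omega>. path3 (a n \<omega> 0) (a n \<omega> 1) (a n \<omega> 2)) \<in> M n \<rightarrow>\<^sub>M borel_of J1_topology" if "n \<ge> 3" for n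
    by (rule path3_measurable) (use step meas that in auto)
  then show "\<forall>\<^sub>F n in sequentially. prob_space (M n) \<and>
      (\<lambda>\<omega>. path3 (a n \<omega> 0) (a n \<omega> 1) (a n \<omega> 2)) \<in> M n \<rightarrow>\<^sub>M borel_of J1_topology"
    using prob by (intro eventually_sequentiallyI[of 3]) auto
  fix \<epsilon> :: real assume e: "\<epsilon> > 0"
  define K where "K = \<alpha> 0 + \<alpha> 1 + \<alpha> 2"
  \<comment> \<open>The grid is fine enough that the limits together grow by at most \<epsilon> / 8
    between neighbouring grid points. With three grid errors of \<epsilon> / 8 the total is
    \<epsilon> / 2, strictly below \<epsilon>.\<close>
  define m where "m = nat \<lceil>8 * K / \<epsilon>\<rceil> + 1"
  have m0: "m > 0" by (simp add: m_def)
  have "8 * K / \<epsilon> \<le> real m" unfolding m_def by linarith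
  then have Km: "8 * (K / real m) \<le> \<epsilon>" using e m0 by (simp add: field_simps)
  define \<eta> where "\<eta> = \<epsilon> / 8"
  have eta: "\<eta> > 0" using e by (simp add: \<eta>_def)
  define E where "E n k j = {\<omega> \<in> space (M n). \<bar>a n \<omega> k (real j / real m) - \<alpha> k * (real j / real m)\<bar> > \<eta>}" for n k j
  have jm: "real j / real m \<in> {0..1}" if "j \<le> m" for j using that m0 by (auto simp: divide_le_eq)
  have "(\<lambda>n. \<Sum>k\<le>2. \<Sum>j\<le>m. measure (M n) (E n k j)) \<longlonglongrightarrow> (\<Sum>k\<le>(2::nat). \<Sum>j\<le>m. 0 :: real)"
    unfolding E_def by (intro tendsto_sum lim eta jm) simp_all
  then have L: "(\<lambda>n. \<Sum>k\<le>2. \<Sum>j\<le>m. measure (M n) (E n k j)) \<longlonglongrightarrow> 0" by simp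
  have "measure (M n) {\<omega> \<in> space (M n). \<epsilon> \<le> J1_dist x0 (path3 (a n \<omega> 0) (a n \<omega> 1) (a n \<omega> 2))}
      \<le> (\<Sum>k\<le>(2::nat). \<Sum>j\<le>m. measure (M n) (E n k j))" if n: "n \<ge> 3" for n
  proof -
    interpret prob_space "M n" using prob n by simp
    have E: "E n k j \<in> sets (M n)" if "j \<le> m" for k j
    proof -
      have [measurable]: "(\<lambda>\<omega>. a n \<omega> k (real j / real m)) \<in> borel_measurable (M n)"
        by (rule meas[OF n jm[OF that]])
      show ?thesis unfolding E_def by measurable
    qed
    have "{\<omega> \<in> space (M n). \<epsilon> \<le> J1_dist x0 (path3 (a n \<omega> 0) (a n \<omega> 1) (a n \<omega> 2))} \<subseteq> (\<Union>k\<le>2. \<Union>j\<le>m. E n k j)"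
    proof (rule subsetI, rule ccontr)
      fix \<omega> assume w: "\<omega> \<in> {\<omega> \<in> space (M n). \<epsilon> \<le> J1_dist x0 (path3 (a n \<omega> 0) (a n \<omega> 1) (a n \<omega> 2))}"
        and no: "\<omega> \<notin> (\<Union>k\<le>2. \<Union>j\<le>m. E n k j)"
      have cl: "\<bar>a n \<omega> k t - \<alpha> k * t\<bar> \<le> \<eta> + \<alpha> k / real m" if "k \<le> 2" "t \<in> {0..1}" for k t
        by (rule monotone_close_uniform[OF mono[OF n] m0 \<alpha> _ that(2)])
          (use no w that in \<open>auto simp: E_def not_less\<close>)
      have "J1_dist x0 (path3 (a n \<omega> 0) (a n \<omega> 1) (a n \<omega> 2)) \<le> \<epsilon> / 2"
      proof (rule J1_dist_le_uniform[OF x0])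
        show "path3 (a n \<omega> 0) (a n \<omega> 1) (a n \<omega> 2) \<in> cadlag_paths"
          using measurable_space[OF m[OF n], of \<omega>] w by (simp add: space_borel_of J1_topology_topspace)
        fix t :: real assume t: "t \<in> {0..1}"
        have "dist (x0 t) (path3 (a n \<omega> 0) (a n \<omega> 1) (a n \<omega> 2) t) \<le>
            \<bar>\<alpha> 0 * t - a n \<omega> 0 t\<bar> + \<bar>\<alpha> 1 * t - a n \<omega> 1 t\<bar> + \<bar>\<alpha> 2 * t - a n \<omega> 2 t\<bar>"
          using t unfolding x0_def path3_def by (simp add: dist_vector3_le)
        also have "\<dots> \<le> 3 * \<eta> + K / real m"
          using cl[OF _ t, of 0] cl[OF _ t, of 1] cl[OF _ t, of 2]
          by (simp add: K_def add_divide_distrib abs_minus_commute)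
        also have "\<dots> \<le> \<epsilon> / 2" using Km by (simp add: \<eta>_def)
        finally show "dist (x0 t) (path3 (a n \<omega> 0) (a n \<omega> 1) (a n \<omega> 2) t) \<le> \<epsilon> / 2" .
      qed (use e in simp)
      then show False using w e by simp
    qed
    then have "prob {\<omega> \<in> space (M n). \<epsilon> \<le> J1_dist x0 (path3 (a n \<omega> 0) (a n \<omega> 1) (a n \<omega> 2))} \<le> prob (\<Union>k\<le>2. \<Union>j\<le>m. E n k j)"
      using E by (intro finite_measure_mono) auto
    also have "\<dots> \<le> (\<Sum>k\<le>2. prob (\<Union>j\<le>m. E n k j))"
      using E by (intro finite_measure_subadditive_finite) auto
    also have "\<dots> \<le> (\<Sum>k\<le>2. \<Sum>j\<le>m. prob (E n k j))"
      using E by (intro sum_mono finite_measure_subadditive_finite) auto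
    finally show ?thesis .
  qed
  then show "(\<lambda>n. measure (M n) {\<omega> \<in> space (M n). \<epsilon> \<le> J1_dist (path3 (\<lambda>t. \<alpha> 0 * t) (\<lambda>t. \<alpha> 1 * t) (\<lambda>t. \<alpha> 2 * t))
      (path3 (a n \<omega> 0) (a n \<omega> 1) (a n \<omega> 2))}) \<longlonglongrightarrow> 0"
    unfolding x0_def[symmetric]
    by (intro tendsto_sandwich[OF _ _ tendsto_const L]) (auto intro: eventually_sequentiallyI[of 3])
qed

section \<open>Measurability of the marginals\<close>

definition order_stat :: "nat \<Rightarrow> (nat \<Rightarrow> real) \<Rightarrow> nat \<Rightarrow> real" where
  "order_stat n x i = sort (map x [0..<n]) ! i"

definition angle :: "complex \<Rightarrow> real" where
  "angle w = Arg2pi w / (2 * pi)"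

lemma angle_bounds: "0 \<le> angle w" "angle w < 1"
  using Arg2pi[of w] by (auto simp: angle_def)

lemma turn_angle: "norm w = 1 \<Longrightarrow> turn (angle w) = w"
  using Arg2pi_eq[of w] by (simp add: turn_def angle_def cis_conv_exp)

lemma order_stat_sorted: "i \<le> j \<Longrightarrow> j < n \<Longrightarrow> order_stat n x i \<le> order_stat n x j"
  unfolding order_stat_def by (intro sorted_nth_mono) auto

lemma order_stat_strict:
  assumes "inj_on x {..<n}" "i < j" "j < n"
  shows "order_stat n x i < order_stat n x j"
proof -
  have "distinct (sort (map x [0..<n]))" using assms(1) by (simp add: distinct_map lessThan_atLeast0)
  then have "order_stat n x i \<noteq> order_stat n x j"
    unfolding order_stat_def using assms(2,3) by (simp add: nth_eq_iff_index_eq)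
  then show ?thesis using order_stat_sorted[of i j n x] assms by simp
qed

lemma order_stat_image: "order_stat n x ` {..<n} = x ` {..<n}"
proof -
  have "order_stat n x ` {..<n} = set (sort (map x [0..<n]))"
    by (auto simp: order_stat_def set_conv_nth simp del: set_sort)
  then show ?thesis by (simp add: lessThan_atLeast0)
qed

text \<open>Sorting by a key and then taking keys is the same as sorting the keys, and on the unit
  circle a point is recovered from its angle. So the labelling is determined by the sorted list of
  angles.\<close>

lemma labelled_eq_order_stat:
  assumes "\<And>i. i < n \<Longrightarrow> norm (z i) = 1" "n > 0"
  shows "labelled n z i = turn (order_stat n (\<lambda>i. angle (z i)) (i mod n))"
proof -
  have "map Arg2pi (sort_key Arg2pi (map z [0..<n])) = sort (map Arg2pi (map z [0..<n]))"
  proof (rule sym, rule properties_for_sort)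
    have "mset (map Arg2pi (sort_key Arg2pi (map z [0..<n]))) = image_mset Arg2pi (mset (sort_key Arg2pi (map z [0..<n])))"
      by (rule mset_map)
    also have "\<dots> = mset (map Arg2pi (map z [0..<n]))" unfolding mset_sort mset_map ..
    finally show "mset (map Arg2pi (sort_key Arg2pi (map z [0..<n]))) = mset (map Arg2pi (map z [0..<n]))" .
  qed simp
  then have "map (\<lambda>w. w / (2 * pi)) (map Arg2pi (sort_key Arg2pi (map z [0..<n]))) =
      map (\<lambda>w. w / (2 * pi)) (sort (map Arg2pi (map z [0..<n])))" by (rule arg_cong)
  also have "\<dots> = sort (map (\<lambda>w. w / (2 * pi)) (map Arg2pi (map z [0..<n])))"
  proof (rule sym, rule properties_for_sort)
    show "mset (map (\<lambda>w. w / (2 * pi)) (sort (map Arg2pi (map z [0..<n])))) =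
        mset (map (\<lambda>w. w / (2 * pi)) (map Arg2pi (map z [0..<n])))"
      by (simp only: mset_map mset_sort)
    have "sorted_wrt (\<lambda>x y. x / (2 * pi) \<le> y / (2 * pi)) (sort (map Arg2pi (map z [0..<n])))"
      by (rule sorted_wrt_mono_rel[OF _ sorted_sort]) (simp add: divide_right_mono)
    then show "sorted (map (\<lambda>w. w / (2 * pi)) (sort (map Arg2pi (map z [0..<n]))))"
      by (simp only: sorted_wrt_map)
  qed
  finally have e: "map angle (sort_key Arg2pi (map z [0..<n])) = sort (map (\<lambda>i. angle (z i)) [0..<n])"
    by (simp add: angle_def[abs_def] comp_def)
  have i: "i mod n < n" using assms(2) by simp
  have "sort_key Arg2pi (map z [0..<n]) ! (i mod n) \<in> set (sort_key Arg2pi (map z [0..<n]))"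
    using i by (intro nth_mem) simp
  then have "norm (labelled n z i) = 1" using assms(1) by (auto simp: labelled_def)
  then have "labelled n z i = turn (angle (labelled n z i))" by (simp add: turn_angle)
  also have "angle (labelled n z i) = map angle (sort_key Arg2pi (map z [0..<n])) ! (i mod n)"
    unfolding labelled_def using i by simp
  finally show ?thesis unfolding e order_stat_def .
qed

text \<open>In a sorted list the entries at most \<open>t\<close> form an initial segment whose
  length is insensitive to the order. This reduces measurability of order statistics to
  measurability of counts.\<close>

lemma order_stat_le_iff:
  assumes "i < n"
  shows "order_stat n x i \<le> t \<longleftrightarrow> i < card {j \<in> {..<n}. x j \<le> t}"
proof -
  define xs where "xs = sort (map x [0..<n])"
  have len: "length xs = n" by (simp add: xs_def)
  have "card {j \<in> {..<n}. x j \<le> t} = length (filter (\<lambda>y. y \<le> t) (map x [0..<n]))"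
    by (subst length_filter_conv_card) (auto intro!: arg_cong[where f = card])
  also have "\<dots> = size (filter_mset (\<lambda>y. y \<le> t) (mset (map x [0..<n])))"
    by (metis mset_filter size_mset)
  also have "\<dots> = length (filter (\<lambda>y. y \<le> t) xs)"
    unfolding xs_def by (metis mset_filter size_mset mset_sort)
  also have "\<dots> = card {j. j < n \<and> xs ! j \<le> t}" by (simp add: length_filter_conv_card len)
  finally have c: "card {j \<in> {..<n}. x j \<le> t} = card {j. j < n \<and> xs ! j \<le> t}" .
  have mono: "xs ! j \<le> xs ! k" if "j \<le> k" "k < n" for j k
    using that len by (intro sorted_nth_mono) (auto simp: xs_def)
  show ?thesis
  proof
    assume "order_stat n x i \<le> t"
    then have "{..i} \<subseteq> {j. j < n \<and> xs ! j \<le> t}"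
      using assms mono[of _ i] by (auto simp: order_stat_def xs_def[symmetric] intro: order_trans)
    then have "card {..i} \<le> card {j. j < n \<and> xs ! j \<le> t}" by (intro card_mono) auto
    then show "i < card {j \<in> {..<n}. x j \<le> t}" using c by simp
  next
    assume a: "i < card {j \<in> {..<n}. x j \<le> t}"
    show "order_stat n x i \<le> t"
    proof (rule ccontr)
      assume no: "\<not> order_stat n x i \<le> t"
      have "{j. j < n \<and> xs ! j \<le> t} \<subseteq> {..<i}"
      proof
        fix j assume j: "j \<in> {j. j < n \<and> xs ! j \<le> t}"
        show "j \<in> {..<i}"
        proof (rule ccontr)
          assume "j \<notin> {..<i}"
          then have "xs ! i \<le> xs ! j" using j by (intro mono) auto
          then show False using no j by (simp add: order_stat_def xs_def)
        qed
      qed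
      then have "card {j. j < n \<and> xs ! j \<le> t} \<le> card {..<i}" by (intro card_mono) auto
      then show False using a c by simp
    qed
  qed
qed

section \<open>Measurability of counts and of sums over gaps\<close>

lemma measurable_card_Collect:
  assumes "finite I" "\<And>i. i \<in> I \<Longrightarrow> Measurable.pred M (\<lambda>\<omega>. P i \<omega>)"
  shows "(\<lambda>\<omega>. card {i \<in> I. P i \<omega>}) \<in> M \<rightarrow>\<^sub>M count_space UNIV"
proof -
  have [measurable]: "(\<lambda>\<omega>. \<Sum>i\<in>I. (if P i \<omega> then 1 else 0 :: nat)) \<in> M \<rightarrow>\<^sub>M count_space UNIV"
    using assms by (intro measurable_sum_nat) measurable
  have "card {i \<in> I. P i \<omega>} = (\<Sum>i\<in>I. (if P i \<omega> then 1 else 0))" for \<omega>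
    using assms(1) by (simp add: sum.If_cases Int_def)
  then show ?thesis by simp
qed

lemma measurable_order_stat:
  assumes "\<And>i. i < n \<Longrightarrow> (\<lambda>\<omega>. X \<omega> i) \<in> borel_measurable M" "i < n"
  shows "(\<lambda>\<omega>. order_stat n (X \<omega>) i) \<in> borel_measurable M"
proof (rule borel_measurableI_le)
  fix t
  have [measurable]: "(\<lambda>\<omega>. card {j \<in> {..<n}. X \<omega> j \<le> t}) \<in> M \<rightarrow>\<^sub>M count_space UNIV"
  proof (rule measurable_card_Collect)
    fix i assume "i \<in> {..<n}"
    then have [measurable]: "(\<lambda>\<omega>. X \<omega> i) \<in> borel_measurable M" using assms(1) by simp
    show "Measurable.pred M (\<lambda>\<omega>. X \<omega> i \<le> t)" by measurable
  qed simp
  show "{\<omega> \<in> space M. order_stat n (X \<omega>) i \<le> t} \<in> sets M"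
    unfolding order_stat_le_iff[OF assms(2)] by measurable
qed

lemma measurable_sum_image:
  fixes f :: "'i \<Rightarrow> 'a \<Rightarrow> real \<times> real" and h :: "real \<times> real \<Rightarrow> real"
  assumes "finite I" and f: "\<And>i. i \<in> I \<Longrightarrow> f i \<in> borel_measurable M"
    and Q: "\<And>i. i \<in> I \<Longrightarrow> Measurable.pred M (Q i)" and h: "h \<in> borel_measurable borel"
  shows "(\<lambda>\<omega>. \<Sum>g\<in>{f i \<omega> |i. i \<in> I \<and> Q i \<omega>}. h g) \<in> borel_measurable M"
  using assms(1) f Q
proof (induction I rule: finite_induct)
  case empty
  then show ?case by simp
next
  case (insert i I)
  have fin: "finite {f i \<omega> |i. i \<in> I \<and> Q i \<omega>}" for \<omega> using insert.hyps(1) by simp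
  have "(\<Sum>g\<in>{f j \<omega> |j. j \<in> insert i I \<and> Q j \<omega>}. h g) =
      (\<Sum>g\<in>{f j \<omega> |j. j \<in> I \<and> Q j \<omega>}. h g) +
      (if Q i \<omega> \<and> (\<forall>j\<in>I. \<not> (Q j \<omega> \<and> f j \<omega> = f i \<omega>)) then h (f i \<omega>) else 0)" for \<omega>
  proof (cases "Q i \<omega>")
    case True
    then have e: "{f j \<omega> |j. j \<in> insert i I \<and> Q j \<omega>} = insert (f i \<omega>) {f j \<omega> |j. j \<in> I \<and> Q j \<omega>}" by blast
    show ?thesis unfolding e sum.insert_if[OF fin] using True by auto
  next
    case False
    then have e: "{f j \<omega> |j. j \<in> insert i I \<and> Q j \<omega>} = {f j \<omega> |j. j \<in> I \<and> Q j \<omega>}" by blast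
    show ?thesis unfolding e using False by simp
  qed
  moreover have "(\<lambda>\<omega>. (\<Sum>g\<in>{f j \<omega> |j. j \<in> I \<and> Q j \<omega>}. h g) +
      (if Q i \<omega> \<and> (\<forall>j\<in>I. \<not> (Q j \<omega> \<and> f j \<omega> = f i \<omega>)) then h (f i \<omega>) else 0)) \<in> borel_measurable M"
  proof -
    have [measurable]: "(\<lambda>\<omega>. \<Sum>g\<in>{f j \<omega> |j. j \<in> I \<and> Q j \<omega>}. h g) \<in> borel_measurable M"
      using insert by auto
    have [measurable]: "f i \<in> borel_measurable M" "Measurable.pred M (Q i)" "h \<in> borel_measurable borel"
      using insert.prems h by auto
    have "Measurable.pred M (\<lambda>\<omega>. \<not> (Q j \<omega> \<and> f j \<omega> = f i \<omega>))" if "j \<in> I" for j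
    proof -
      have [measurable]: "f j \<in> borel_measurable M" "Measurable.pred M (Q j)" using insert.prems that by auto
      show ?thesis by measurable
    qed
    then have [measurable]: "Measurable.pred M (\<lambda>\<omega>. \<forall>j\<in>I. \<not> (Q j \<omega> \<and> f j \<omega> = f i \<omega>))"
      using insert.hyps(1) by (intro pred_intros_finite) auto
    show ?thesis by measurable
  qed
  ultimately show ?case by simp
qed

text \<open>The random set of gaps is contained in a fixed finite list of candidates, each a
  measurable function of the sample: both ends are means of neighbouring angles plus a half-integer
  from a bounded range.\<close>

lemma measurable_sum_gaps_upto:
  assumes Y: "\<And>i. i < n \<Longrightarrow> (\<lambda>\<omega>. Y \<omega> i) \<in> borel_measurable M"
    and bounds: "\<And>\<omega> i. i < n \<Longrightarrow> 0 \<le> Y \<omega> i \<and> Y \<omega> i < 1" and n: "n > 0"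
    and h: "h \<in> borel_measurable borel"
  shows "(\<lambda>\<omega>. \<Sum>g\<in>gaps_upto k n (Y \<omega>) t. h g :: real) \<in> borel_measurable M"
proof -
  define m where "m \<omega> i = (Y \<omega> i + Y \<omega> ((i + 1) mod n)) / 2" for \<omega> i
  \<comment> \<open>Means lie in [0,1), left ends in [0,1) and right ends in (0, 3/2); this confines
    the half-integer shifts to these ranges.\<close>
  define I where "I = ({..<n} \<times> {-1..1::int}) \<times> ({..<n} \<times> {-1..3::int})"
  define f where "f p \<omega> = (m \<omega> (fst (fst p)) + of_int (snd (fst p)) / 2,
    m \<omega> (fst (snd p)) + of_int (snd (snd p)) / 2)" for p :: "(nat \<times> int) \<times> (nat \<times> int)" and \<omega>
  define Q where "Q p \<omega> \<longleftrightarrow> 0 \<le> fst (f p \<omega>) \<and> fst (f p \<omega>) < 1 \<and> fst (f p \<omega>) < snd (f p \<omega>) \<and>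
    (\<forall>i\<in>{..<n}. \<forall>l::int. \<not> (fst (f p \<omega>) < m \<omega> i + of_int l / 2 \<and> m \<omega> i + of_int l / 2 < snd (f p \<omega>))) \<and>
    gap_type n (Y \<omega>) (f p \<omega>) = k \<and> (snd (f p \<omega>) \<le> t \<or> t = 1)" for p \<omega>
  have mb: "0 \<le> m \<omega> i" "m \<omega> i < 1" if "i < n" for \<omega> i
    using bounds[of i \<omega>] bounds[of "(i + 1) mod n" \<omega>] n that by (auto simp: m_def)
  have e: "gaps_upto k n (Y \<omega>) t = {f p \<omega> |p. p \<in> I \<and> Q p \<omega>}" for \<omega>
  proof -
    interpret line_angles "cuts n (Y \<omega>)" using n by (rule line_angles_cuts)
    have cin: "c \<in> cuts n (Y \<omega>) \<longleftrightarrow> (\<exists>i\<in>{..<n}. \<exists>l::int. c = m \<omega> i + of_int l / 2)" for c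
      by (auto simp: cuts_def m_def)
    show ?thesis
    proof (intro equalityI subsetI)
      fix g assume g: "g \<in> gaps_upto k n (Y \<omega>) t"
      obtain a b where ab: "g = (a, b)" by (cases g)
      have gg: "(a, b) \<in> gaps" using g by (simp add: gaps_upto_def ab)
      then have "a \<in> cuts n (Y \<omega>)" "b \<in> cuts n (Y \<omega>)" by (auto simp: gaps_def)
      then obtain i k1 j l where i: "a = m \<omega> i + of_int k1 / 2" "i < n" and j: "b = m \<omega> j + of_int l / 2" "j < n"
        unfolding cuts_def m_def by blast
      have ab': "0 \<le> a" "a < 1" "a < b" "b \<le> a + 1 / 2" using gg gap_length[OF gg] by (auto simp: gaps_def)
      have "of_int k1 > (- 2 :: real)" "of_int k1 < (2 :: real)" "of_int l > (- 2 :: real)" "of_int l < (4 :: real)"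
        using i j ab' mb[OF i(2), of \<omega>] mb[OF j(2), of \<omega>] by linarith+
      then have "((i, k1), (j, l)) \<in> I" using i j by (auto simp: I_def)
      moreover have "f ((i, k1), (j, l)) \<omega> = g" using i j by (simp add: f_def ab)
      moreover have "\<not> (a < m \<omega> i' + of_int l' / 2 \<and> m \<omega> i' + of_int l' / 2 < b)" if "i' < n" for i' and l' :: int
      proof -
        have "m \<omega> i' + of_int l' / 2 \<in> cuts n (Y \<omega>)" using cin that by blast
        then have "m \<omega> i' + of_int l' / 2 \<notin> {a<..<b}" using gg unfolding gaps_def by blast
        then show ?thesis by simp
      qed
      then have "Q ((i, k1), (j, l)) \<omega>"
        using g gg unfolding Q_def \<open>f ((i, k1), (j, l)) \<omega> = g\<close> ab
        by (auto simp: gaps_def gaps_upto_def)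
      ultimately show "g \<in> {f p \<omega> |p. p \<in> I \<and> Q p \<omega>}" by blast
    next
      fix g assume "g \<in> {f p \<omega> |p. p \<in> I \<and> Q p \<omega>}"
      then obtain p where p: "g = f p \<omega>" "p \<in> I" "Q p \<omega>" by blast
      have "fst g \<in> cuts n (Y \<omega>)" "snd g \<in> cuts n (Y \<omega>)"
        using p(2) unfolding p(1) f_def I_def cin by auto
      then show "g \<in> gaps_upto k n (Y \<omega>) t"
        using p(3) unfolding Q_def p(1)[symmetric]
        by (cases g) (auto simp: gaps_upto_def gaps_def cin)
    qed
  qed
  have mm: "(\<lambda>\<omega>. m \<omega> i) \<in> borel_measurable M" if "i < n" for i
    unfolding m_def using Y that n by (intro borel_measurable_divide borel_measurable_add) auto
  have fm: "f p \<in> borel_measurable M" if "p \<in> I" for p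
  proof -
    have [measurable]: "(\<lambda>\<omega>. m \<omega> (fst (fst p))) \<in> borel_measurable M" "(\<lambda>\<omega>. m \<omega> (fst (snd p))) \<in> borel_measurable M"
      using that by (auto simp: I_def intro!: mm)
    show ?thesis unfolding f_def by measurable
  qed
  show ?thesis
    unfolding e
  proof (rule measurable_sum_image)
    show "finite I" by (simp add: I_def)
    fix p assume p: "p \<in> I"
    show "f p \<in> borel_measurable M" by (rule fm[OF p])
    have [measurable]: "f p \<in> M \<rightarrow>\<^sub>M borel \<Otimes>\<^sub>M borel" using fm[OF p] by (simp add: borel_prod)
    have gt [measurable]: "(\<lambda>\<omega>. gap_type n (Y \<omega>) (f p \<omega>)) \<in> M \<rightarrow>\<^sub>M count_space UNIV"
      unfolding gap_type_def
    proof (rule measurable_card_Collect)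
      fix i assume "i \<in> {..<n}"
      then have [measurable]: "(\<lambda>\<omega>. Y \<omega> i) \<in> borel_measurable M" using Y by simp
      show "Measurable.pred M (\<lambda>\<omega>. \<exists>k::int. fst (f p \<omega>) < Y \<omega> i + of_int k / 2 \<and> Y \<omega> i + of_int k / 2 < snd (f p \<omega>))"
        by measurable
    qed simp
    have [measurable]: "Measurable.pred M (\<lambda>\<omega>. \<forall>i\<in>{..<n}. \<forall>l::int. \<not> (fst (f p \<omega>) < m \<omega> i + of_int l / 2 \<and> m \<omega> i + of_int l / 2 < snd (f p \<omega>)))"
    proof (rule pred_intros_finite)
      fix i assume "i \<in> {..<n}"
      then have [measurable]: "(\<lambda>\<omega>. m \<omega> i) \<in> borel_measurable M" using mm by simp
      show "Measurable.pred M (\<lambda>\<omega>. \<forall>l::int. \<not> (fst (f p \<omega>) < m \<omega> i + of_int l / 2 \<and> m \<omega> i + of_int l / 2 < snd (f p \<omega>)))"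
        by measurable
    qed simp
    show "Measurable.pred M (Q p)" unfolding Q_def by measurable
  qed (rule h)
qed

text \<open>If two points coincide, some bisector is the whole plane and every statistic vanishes.\<close>

lemma region_stats_eq:
  assumes "\<And>i. i < n \<Longrightarrow> norm (z i) = 1" "n \<ge> 2" "t \<in> {0..1}"
  defines "x \<equiv> \<lambda>i. angle (z i)"
  shows "real (region_count k n z t) =
      (if inj_on x {..<n} then \<Sum>g\<in>gaps_upto k n (order_stat n x) t. 1 else 0)" (is ?count)
    "region_length k n z t =
      (if inj_on x {..<n} then \<Sum>g\<in>gaps_upto k n (order_stat n x) t. snd g - fst g else 0)" (is ?length)
proof -
  have lab: "labelled n z i = turn (order_stat n x (i mod n))" for i
    unfolding x_def using assms by (intro labelled_eq_order_stat) auto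
  have ob: "0 \<le> order_stat n x i \<and> order_stat n x i < 1" if "i < n" for i
  proof -
    have "order_stat n x i \<in> x ` {..<n}" using that order_stat_image[of n x] by blast
    then show ?thesis using angle_bounds by (auto simp: x_def)
  qed
  have "?count \<and> ?length"
  proof (cases "inj_on x {..<n}")
    case True
    have "order_stat n x ((i + 1) mod n) \<noteq> order_stat n x i + of_int k" if i: "i < n" for i k
    proof
      assume e: "order_stat n x ((i + 1) mod n) = order_stat n x i + of_int k"
      have j: "(i + 1) mod n < n" using assms(2) by simp
      have "\<bar>of_int k :: real\<bar> < 1" using e ob[OF i] ob[OF j] by linarith
      then have "k = 0" by linarith
      have "(i + 1) mod n \<noteq> i" using i assms(2) by (cases "i + 1 = n") auto
      then show False
        using order_stat_strict[OF True, of i "(i + 1) mod n"] order_stat_strict[OF True, of "(i + 1) mod n" i] i j e \<open>k = 0\<close>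
        by (cases "i < (i + 1) mod n") auto
    qed
    then show ?thesis
      using region_count_eq[OF _ lab, of t k] region_length_eq[OF _ lab, of t k] assms True by simp
  next
    case False
    \<comment> \<open>If no two neighbouring order statistics agreed, they would increase strictly
      and take n different values, which makes \<open>x\<close> injective.\<close>
    have "\<exists>i. i < n \<and> order_stat n x (i mod n) = order_stat n x ((i + 1) mod n)"
    proof (rule ccontr)
      assume no: "\<nexists>i. i < n \<and> order_stat n x (i mod n) = order_stat n x ((i + 1) mod n)"
      have step: "order_stat n x i < order_stat n x (Suc i)" if "Suc i < n" for i
      proof -
        have "order_stat n x i \<noteq> order_stat n x (Suc i)" using no that by (metis Suc_eq_plus1 Suc_lessD mod_less)
        then show ?thesis using order_stat_sorted[of i "Suc i" n x] that by simp
      qed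
      have "order_stat n x i < order_stat n x j" if "i < j" "j < n" for i j
        using that
      proof (induction j)
        case (Suc j)
        then show ?case using step[of j] by (cases "i = j") (auto intro: less_trans)
      qed simp
      then have "inj_on (order_stat n x) {..<n}"
        by (metis inj_onI lessThan_iff linorder_neqE_nat order_less_irrefl)
      then have "card (x ` {..<n}) = n" using order_stat_image[of n x] by (metis card_image card_lessThan)
      then show False using False by (simp add: eq_card_imp_inj_on)
    qed
    then obtain i where "i < n" "labelled n z i = labelled n z (i + 1)" unfolding lab by auto
    then have "regions n z = {}" by (rule regions_empty)
    then show ?thesis using False
      by (simp add: region_count_def region_length_def regions_upto_def)
  qed
  then show ?count ?length by auto
qed

lemma finite_gaps_upto: "n > 0 \<Longrightarrow> finite (gaps_upto k n x t)"
  unfolding gaps_upto_def by (rule finite_subset[OF _ line_angles.finite_gaps[OF line_angles_cuts]]) auto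

lemma gaps_upto_mono: "s \<le> t \<Longrightarrow> t \<le> 1 \<Longrightarrow> gaps_upto k n x s \<subseteq> gaps_upto k n x t"
  by (auto simp: gaps_upto_def)

lemma sum_gaps_upto_mono:
  assumes "n > 0" "s \<le> t" "t \<le> 1" "\<And>a b. a < b \<Longrightarrow> h (a, b) \<ge> (0 :: real)"
  shows "(\<Sum>g\<in>gaps_upto k n x s. h g) \<le> (\<Sum>g\<in>gaps_upto k n x t. h g)"
proof (rule sum_mono2[OF finite_gaps_upto[OF assms(1)] gaps_upto_mono[OF assms(2,3)]])
  fix g assume "g \<in> gaps_upto k n x t - gaps_upto k n x s"
  then have "fst g < snd g"
    by (auto simp: gaps_upto_def line_angles.gaps_def[OF line_angles_cuts[OF assms(1)]])
  then show "0 \<le> h g" using assms(4)[of "fst g" "snd g"] by simp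
qed

lemma step_path_gaps:
  assumes "n > 0"
    and F: "\<And>s t. s \<in> {0..1} \<Longrightarrow> t \<in> {0..1} \<Longrightarrow> (\<And>k. gaps_upto k n x s = gaps_upto k n x t) \<Longrightarrow> F s = F t"
  shows "\<exists>B. step_path B F"
proof -
  interpret line_angles "cuts n x" using assms(1) by (rule line_angles_cuts)
  define B where "B = insert 1 (snd ` {g \<in> gaps. snd g \<le> 1})"
  have "step_path B F"
    unfolding step_path_def
  proof (intro conjI ballI impI)
    show "finite B" using finite_gaps by (simp add: B_def)
    show "B \<subseteq> {0<..1}" by (auto simp: B_def gaps_def)
    fix s t :: real assume st: "s \<in> {0..1}" "t \<in> {0..1}" and *: "\<forall>b\<in>B. b \<le> s \<longleftrightarrow> b \<le> t"
    show "F s = F t"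
    proof (rule F[OF st])
      fix k
      have "1 \<le> s \<longleftrightarrow> 1 \<le> t" using * by (simp add: B_def)
      then have "s = 1 \<longleftrightarrow> t = 1" using st by auto
      moreover have "snd g \<le> s \<longleftrightarrow> snd g \<le> t" if "g \<in> gaps" for g
      proof (cases "snd g \<le> 1")
        case True
        then have "snd g \<in> B" using that by (auto simp: B_def)
        then show ?thesis using * by blast
      qed (use st in auto)
      ultimately show "gaps_upto k n x s = gaps_upto k n x t"
        by (auto simp: gaps_upto_def)
    qed
  qed
  then show ?thesis ..
qed

text \<open>\<open>Arg2pi\<close> jumps across the positive real axis, but its sublevel sets are
  closed.\<close>

lemma measurable_angle: "angle \<in> borel_measurable borel"
proof -
  have "Arg2pi \<in> borel_measurable borel"
  proof (rule borel_measurableI_le)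
    fix t :: real
    show "{w \<in> space borel. Arg2pi w \<le> t} \<in> sets borel" using closed_Arg2pi2pi_le[of t] by simp
  qed
  then show ?thesis unfolding angle_def by measurable
qed

section \<open>Void probabilities for independent uniform points\<close>

definition U01 :: "real measure" where
  "U01 = uniform_measure lborel {0..<1}"

definition PU :: "nat \<Rightarrow> (nat \<Rightarrow> real) measure" where
  "PU n = PiM {..<n} (\<lambda>_. U01)"

lemma sets_U01 [measurable_cong]: "sets U01 = sets borel"
  by (simp add: U01_def)

lemma space_U01 [simp]: "space U01 = UNIV"
  by (simp add: U01_def)

lemma prob_space_U01: "prob_space U01"
  unfolding U01_def by (rule prob_space_uniform_measure) auto

lemma prob_space_PU: "prob_space (PU n)"
  unfolding PU_def by (intro prob_space_PiM prob_space_U01)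

lemma sets_PU [measurable_cong]: "sets (PU n) = sets (PiM {..<n} (\<lambda>_. borel))"
  unfolding PU_def by (intro sets_PiM_cong) (auto simp: sets_U01)

lemma measurable_PU_component:
  assumes "k < n"
  shows "(\<lambda>\<omega>. \<omega> k) \<in> borel_measurable (PU n)"
proof -
  have "(\<lambda>\<omega>. \<omega> k) \<in> PU n \<rightarrow>\<^sub>M U01"
    unfolding PU_def using assms by (intro measurable_component_singleton) simp
  then show ?thesis by (simp cong: measurable_cong_sets add: sets_U01)
qed

lemma nn_integral_U01:
  "f \<in> borel_measurable borel \<Longrightarrow> (\<integral>\<^sup>+x. f x \<partial>U01) = (\<integral>\<^sup>+x. f x * indicator {0..<1} x \<partial>lborel)"
  unfolding U01_def by (subst nn_integral_uniform_measure) (auto simp: divide_ennreal_def)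

lemma emeasure_U01: "A \<in> sets borel \<Longrightarrow> emeasure U01 A = emeasure lborel ({0..<1} \<inter> A)"
  unfolding U01_def by (subst emeasure_uniform_measure) (auto simp: divide_ennreal_def)

lemma product_sigma_finite_U01: "product_sigma_finite (\<lambda>_::nat. U01)"
  by (simp add: product_sigma_finite_def prob_space_U01 prob_space_imp_sigma_finite)

text \<open>Given the coordinates in \<open>J\<close>, the remaining ones are independent, so the
  probability that all of them satisfy the condition \<open>A\<close> is a power. This exact formula
  is the source of every moment computed below.\<close>

lemma nn_integral_PU_void:
  assumes J: "J \<subseteq> {..<n}" and G [measurable]: "G \<in> borel_measurable (PiM J (\<lambda>_. U01))"
    and A [measurable]: "Measurable.pred (PiM J (\<lambda>_. U01) \<Otimes>\<^sub>M U01) (\<lambda>(x, s). A x s)"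
  shows "(\<integral>\<^sup>+\<omega>. G (restrict \<omega> J) * of_bool (\<forall>k\<in>{..<n} - J. A (restrict \<omega> J) (\<omega> k)) \<partial>PU n) =
    (\<integral>\<^sup>+x. G x * emeasure U01 {s. A x s} ^ (n - card J) \<partial>PiM J (\<lambda>_. U01))"
proof -
  interpret product_sigma_finite "\<lambda>_::nat. U01" by (rule product_sigma_finite_U01)
  have fin: "finite J" using J finite_subset by blast
  define K where "K = {..<n} - J"
  have K: "J \<inter> K = {}" "finite K" "J \<union> K = {..<n}" using J by (auto simp: K_def)
  have [measurable]: "Measurable.pred (PiM {..<n} (\<lambda>_. U01)) (\<lambda>\<omega>. \<forall>k\<in>K. A (restrict \<omega> J) (\<omega> k))"
  proof (rule pred_intros_finite)
    fix k assume "k \<in> K"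
    then have "k \<in> {..<n}" using K by auto
    then have "(\<lambda>\<omega>. (restrict \<omega> J, \<omega> k)) \<in> PiM {..<n} (\<lambda>_. U01) \<rightarrow>\<^sub>M PiM J (\<lambda>_. U01) \<Otimes>\<^sub>M U01"
      using J by (intro measurable_Pair measurable_restrict_subset measurable_component_singleton)
    from measurable_compose[OF this A] show "Measurable.pred (PiM {..<n} (\<lambda>_. U01)) (\<lambda>\<omega>. A (restrict \<omega> J) (\<omega> k))"
      by simp
  qed (rule K(2))
  have [measurable]: "(\<lambda>\<omega>. G (restrict \<omega> J)) \<in> borel_measurable (PiM {..<n} (\<lambda>_. U01))"
    by (rule measurable_compose[OF measurable_restrict_subset[OF J] G])
  have "(\<integral>\<^sup>+\<omega>. G (restrict \<omega> J) * of_bool (\<forall>k\<in>K. A (restrict \<omega> J) (\<omega> k)) \<partial>PiM (J \<union> K) (\<lambda>_. U01)) =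
    (\<integral>\<^sup>+x. (\<integral>\<^sup>+y. G (restrict (merge J K (x, y)) J) * of_bool (\<forall>k\<in>K. A (restrict (merge J K (x, y)) J) (merge J K (x, y) k))
       \<partial>PiM K (\<lambda>_. U01)) \<partial>PiM J (\<lambda>_. U01))"
    by (rule product_nn_integral_fold[OF K(1) fin K(2)]) (unfold K(3), measurable)
  also have "\<dots> = (\<integral>\<^sup>+x. G x * emeasure U01 {s. A x s} ^ card K \<partial>PiM J (\<lambda>_. U01))"
  proof (rule nn_integral_cong)
    fix x assume x: "x \<in> space (PiM J (\<lambda>_. U01))"
    then have r: "restrict x J = x" by (auto simp: space_PiM PiE_def extensional_restrict)
    have Ax [measurable]: "Measurable.pred U01 (A x)"
      using measurable_compose[OF measurable_Pair1'[OF x] A] by simp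
    have set: "{s. A x s} \<in> sets U01" using Ax by (simp add: pred_def)
    have "(\<integral>\<^sup>+y. G (restrict (merge J K (x, y)) J) * of_bool (\<forall>k\<in>K. A (restrict (merge J K (x, y)) J) (merge J K (x, y) k)) \<partial>PiM K (\<lambda>_. U01)) =
        (\<integral>\<^sup>+y. G x * (\<Prod>k\<in>K. of_bool (A x (y k))) \<partial>PiM K (\<lambda>_. U01))"
    proof (rule nn_integral_cong)
      fix y
      have "merge J K (x, y) k = y k" if "k \<in> K" for k using that K(1) by (auto simp: merge_def)
      moreover have "(\<Prod>k\<in>K. of_bool (A x (y k))) = (of_bool (\<forall>k\<in>K. A x (y k)) :: ennreal)"
        using K(2) by (auto simp: prod_zero_iff)
      ultimately show "G (restrict (merge J K (x, y)) J) * of_bool (\<forall>k\<in>K. A (restrict (merge J K (x, y)) J) (merge J K (x, y) k)) =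
          G x * (\<Prod>k\<in>K. of_bool (A x (y k)))"
        using K(1) r by (simp add: restrict_merge)
    qed
    also have "\<dots> = G x * (\<integral>\<^sup>+y. (\<Prod>k\<in>K. of_bool (A x (y k))) \<partial>PiM K (\<lambda>_. U01))"
      by (rule nn_integral_cmult) measurable
    also have "(\<integral>\<^sup>+y. (\<Prod>k\<in>K. of_bool (A x (y k))) \<partial>PiM K (\<lambda>_. U01)) = (\<Prod>k\<in>K. \<integral>\<^sup>+s. of_bool (A x s) \<partial>U01)"
      by (rule product_nn_integral_prod[OF K(2)]) measurable
    also have "(\<integral>\<^sup>+s. of_bool (A x s) \<partial>U01) = emeasure U01 {s. A x s}"
      using nn_integral_indicator[OF set] by (simp add: indicator_def[abs_def] of_bool_def)
    finally show "(\<integral>\<^sup>+y. G (restrict (merge J K (x, y)) J) * of_bool (\<forall>k\<in>K. A (restrict (merge J K (x, y)) J) (merge J K (x, y) k)) \<partial>PiM K (\<lambda>_. U01)) =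
        G x * emeasure U01 {s. A x s} ^ card K" unfolding prod_constant .
  qed
  also have "card K = n - card J" unfolding K_def using fin J by (simp add: card_Diff_subset)
  finally show ?thesis unfolding K(3) unfolding PU_def K_def .
qed

lemma nn_integral_PiM_pair:
  assumes ij: "i \<noteq> (j::nat)" and F [measurable]: "(\<lambda>(p, q). F p q) \<in> borel_measurable (borel \<Otimes>\<^sub>M borel)"
  shows "(\<integral>\<^sup>+x. F (x i) (x j) \<partial>PiM {i, j} (\<lambda>_. U01)) = (\<integral>\<^sup>+p. \<integral>\<^sup>+q. F p q \<partial>U01 \<partial>U01)"
proof -
  interpret product_sigma_finite "\<lambda>_::nat. U01" by (rule product_sigma_finite_U01)
  interpret prob_space U01 by (rule prob_space_U01)
  have "(\<integral>\<^sup>+x. F (x i) (x j) \<partial>PiM (insert j {i}) (\<lambda>_. U01)) =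
      (\<integral>\<^sup>+x. (\<integral>\<^sup>+q. F ((x(j := q)) i) ((x(j := q)) j) \<partial>U01) \<partial>PiM {i} (\<lambda>_. U01))"
    using ij by (intro product_nn_integral_insert) auto
  also have "\<dots> = (\<integral>\<^sup>+x. (\<integral>\<^sup>+q. F (x i) q \<partial>U01) \<partial>PiM {i} (\<lambda>_. U01))" using ij by simp
  also have "\<dots> = (\<integral>\<^sup>+p. \<integral>\<^sup>+q. F p q \<partial>U01 \<partial>U01)"
    by (rule product_nn_integral_singleton) measurable
  finally show ?thesis by (simp add: insert_commute)
qed

lemma nn_integral_PiM_quad:
  assumes d: "distinct [i, j, k, l :: nat]"
    and F [measurable]: "(\<lambda>(p, q, p', q'). F p q p' q') \<in> borel_measurable (borel \<Otimes>\<^sub>M borel \<Otimes>\<^sub>M borel \<Otimes>\<^sub>M borel)"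
  shows "(\<integral>\<^sup>+x. F (x i) (x j) (x k) (x l) \<partial>PiM {i, j, k, l} (\<lambda>_. U01)) =
    (\<integral>\<^sup>+p. \<integral>\<^sup>+q. \<integral>\<^sup>+p'. \<integral>\<^sup>+q'. F p q p' q' \<partial>U01 \<partial>U01 \<partial>U01 \<partial>U01)"
proof -
  interpret product_sigma_finite "\<lambda>_::nat. U01" by (rule product_sigma_finite_U01)
  interpret prob_space U01 by (rule prob_space_U01)
  have [measurable (raw)]: "(\<lambda>x. F (a x) (b x) (c x) (d x)) \<in> borel_measurable N"
    if [measurable]: "a \<in> borel_measurable N" "b \<in> borel_measurable N" "c \<in> borel_measurable N" "d \<in> borel_measurable N"
    for a b c d and N :: "'z measure"
  proof -
    have "(\<lambda>x. (\<lambda>(p, q, p', q'). F p q p' q') (a x, b x, c x, d x)) \<in> borel_measurable N" by (rule measurable_compose[OF _ F]) measurable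
    then show ?thesis by simp
  qed
  have "(\<integral>\<^sup>+x. F (x i) (x j) (x k) (x l) \<partial>PiM (insert l {i, j, k}) (\<lambda>_. U01)) =
      (\<integral>\<^sup>+x. (\<integral>\<^sup>+q'. F ((x(l := q')) i) ((x(l := q')) j) ((x(l := q')) k) ((x(l := q')) l) \<partial>U01) \<partial>PiM {i, j, k} (\<lambda>_. U01))"
    using d by (intro product_nn_integral_insert) auto
  also have "\<dots> = (\<integral>\<^sup>+x. (\<integral>\<^sup>+q'. F (x i) (x j) (x k) q' \<partial>U01) \<partial>PiM (insert k {i, j}) (\<lambda>_. U01))"
    using d by (simp add: insert_commute)
  also have "\<dots> = (\<integral>\<^sup>+x. (\<integral>\<^sup>+p'. \<integral>\<^sup>+q'. F ((x(k := p')) i) ((x(k := p')) j) ((x(k := p')) k) q' \<partial>U01 \<partial>U01) \<partial>PiM {i, j} (\<lambda>_. U01))"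
    using d by (intro product_nn_integral_insert) auto
  also have "\<dots> = (\<integral>\<^sup>+x. (\<integral>\<^sup>+p'. \<integral>\<^sup>+q'. F (x i) (x j) p' q' \<partial>U01 \<partial>U01) \<partial>PiM {i, j} (\<lambda>_. U01))"
    using d by simp
  also have "\<dots> = (\<integral>\<^sup>+p. \<integral>\<^sup>+q. \<integral>\<^sup>+p'. \<integral>\<^sup>+q'. F p q p' q' \<partial>U01 \<partial>U01 \<partial>U01 \<partial>U01)"
    using d by (intro nn_integral_PiM_pair) auto
  finally show ?thesis by (simp add: insert_commute)
qed

text \<open>Statistics counting pairs of sample points in a position \<open>Q\<close> whose zone \<open>V\<close> is free of
  other points; \<open>y\<close> is an additional location that is integrated out.\<close>

locale void_pairs = sigma_finite_measure \<nu> for \<nu> :: "real measure" +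
  fixes Q :: "real \<Rightarrow> real \<Rightarrow> real \<Rightarrow> bool" and V :: "real \<Rightarrow> real \<Rightarrow> real \<Rightarrow> real \<Rightarrow> bool"
  assumes sets_nu [measurable_cong]: "sets \<nu> = sets borel"
    and Q_measurable [measurable]: "Measurable.pred (borel \<Otimes>\<^sub>M borel \<Otimes>\<^sub>M borel) (\<lambda>(y, p, q). Q y p q)"
    and V_measurable [measurable]: "Measurable.pred (borel \<Otimes>\<^sub>M borel \<Otimes>\<^sub>M borel \<Otimes>\<^sub>M borel) (\<lambda>(y, p, q, s). V y p q s)"
begin

lemma Q_measurable_compose [measurable (raw)]:
  assumes [measurable]: "a \<in> borel_measurable N" "b \<in> borel_measurable N" "c \<in> borel_measurable N"
  shows "Measurable.pred N (\<lambda>x. Q (a x) (b x) (c x))"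
proof -
  have "Measurable.pred N (\<lambda>x. (\<lambda>(y, p, q). Q y p q) (a x, b x, c x))"
    by (rule measurable_compose[OF _ Q_measurable]) measurable
  then show ?thesis by simp
qed

lemma V_measurable_compose [measurable (raw)]:
  assumes [measurable]: "a \<in> borel_measurable N" "b \<in> borel_measurable N" "c \<in> borel_measurable N"
    "d \<in> borel_measurable N"
  shows "Measurable.pred N (\<lambda>x. V (a x) (b x) (c x) (d x))"
proof -
  have "Measurable.pred N (\<lambda>x. (\<lambda>(y, p, q, s). V y p q s) (a x, b x, c x, d x))"
    by (rule measurable_compose[OF _ V_measurable]) measurable
  then show ?thesis by simp
qed

definition surv :: "real \<Rightarrow> real \<Rightarrow> real \<Rightarrow> ennreal" where
  "surv y p q = emeasure U01 {s. \<not> V y p q s}"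

text \<open>The expected mass of hits for one ordered pair of indices when \<open>m\<close> other
  points have to avoid the zone: \<open>m = n - 2\<close> gives first moments,
  \<open>m = n - 4\<close> enters the bound on second moments.\<close>

definition mean :: "nat \<Rightarrow> ennreal" where
  "mean m = (\<integral>\<^sup>+y. \<integral>\<^sup>+p. \<integral>\<^sup>+q. of_bool (Q y p q) * surv y p q ^ m \<partial>U01 \<partial>U01 \<partial>\<nu>)"

text \<open>The pair is ordered: in the applications \<open>i\<close> is the point near the location
  and \<open>j\<close> the point near its antipode. Sums over hits range over pairs of different
  indices.\<close>

definition hit :: "nat \<Rightarrow> (nat \<Rightarrow> real) \<Rightarrow> real \<Rightarrow> nat \<Rightarrow> nat \<Rightarrow> bool" where
  "hit n \<omega> y i j \<longleftrightarrow> Q y (\<omega> i) (\<omega> j) \<and> (\<forall>k\<in>{..<n} - {i, j}. \<not> V y (\<omega> i) (\<omega> j) (\<omega> k))"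

lemma surv_measurable [measurable (raw)]:
  assumes [measurable]: "a \<in> borel_measurable N" "b \<in> borel_measurable N" "c \<in> borel_measurable N"
  shows "(\<lambda>x. surv (a x) (b x) (c x)) \<in> borel_measurable N"
proof -
  interpret U: prob_space U01 by (rule prob_space_U01)
  have "surv y p q = (\<integral>\<^sup>+s. of_bool (\<not> V y p q s) \<partial>U01)" for y p q
  proof -
    have [measurable]: "{s. \<not> V y p q s} \<in> sets U01" by measurable
    show ?thesis unfolding surv_def
      using nn_integral_indicator[of "{s. \<not> V y p q s}" U01] by (simp add: indicator_def[abs_def] of_bool_def)
  qed
  then show ?thesis by simp
qed

lemma hit_measurable:
  assumes "w \<in> N \<rightarrow>\<^sub>M PU n" and y: "y \<in> borel_measurable N" and ij: "i < n" "j < n"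
  shows "Measurable.pred N (\<lambda>x. hit n (w x) (y x) i j)"
proof -
  have c: "(\<lambda>x. w x k) \<in> borel_measurable N" if "k < n" for k
    by (rule measurable_compose[OF assms(1) measurable_PU_component[OF that]])
  have "Measurable.pred N (\<lambda>x. \<forall>k\<in>{..<n} - {i, j}. \<not> V (y x) (w x i) (w x j) (w x k))"
    by (rule pred_intros_finite) (auto intro!: pred_intros_logic V_measurable_compose y c ij)
  then show ?thesis
    unfolding hit_def by (intro pred_intros_logic Q_measurable_compose y c ij)
qed

lemma hit_expectation:
  assumes "i < n" "j < n" "i \<noteq> j"
  shows "(\<integral>\<^sup>+\<omega>. of_bool (hit n \<omega> y i j) \<partial>PU n) = (\<integral>\<^sup>+p. \<integral>\<^sup>+q. of_bool (Q y p q) * surv y p q ^ (n - 2) \<partial>U01 \<partial>U01)"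
proof -
  have "(\<integral>\<^sup>+\<omega>. of_bool (hit n \<omega> y i j) \<partial>PU n) =
      (\<integral>\<^sup>+\<omega>. of_bool (Q y (restrict \<omega> {i, j} i) (restrict \<omega> {i, j} j)) *
        of_bool (\<forall>k\<in>{..<n} - {i, j}. \<not> V y (restrict \<omega> {i, j} i) (restrict \<omega> {i, j} j) (\<omega> k)) \<partial>PU n)"
    by (simp add: hit_def of_bool_conj)
  also have "\<dots> = (\<integral>\<^sup>+x. of_bool (Q y (x i) (x j)) * emeasure U01 {s. \<not> V y (x i) (x j) s} ^ (n - card {i, j}) \<partial>PiM {i, j} (\<lambda>_. U01))"
    by (rule nn_integral_PU_void[where G = "\<lambda>x. of_bool (Q y (x i) (x j))" and A = "\<lambda>x s. \<not> V y (x i) (x j) s"])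
      (use assms in auto)
  also have "\<dots> = (\<integral>\<^sup>+x. of_bool (Q y (x i) (x j)) * surv y (x i) (x j) ^ (n - 2) \<partial>PiM {i, j} (\<lambda>_. U01))"
    using assms by (simp add: surv_def numeral_2_eq_2)
  also have "\<dots> = (\<integral>\<^sup>+p. \<integral>\<^sup>+q. of_bool (Q y p q) * surv y p q ^ (n - 2) \<partial>U01 \<partial>U01)"
    by (rule nn_integral_PiM_pair[OF assms(3)]) measurable
  finally show ?thesis .
qed

text \<open>By exchangeability each of the n (n - 1) ordered pairs of indices contributes the same
  integral.\<close>

lemma expectation_sum_hits:
  "(\<integral>\<^sup>+\<omega>. (\<integral>\<^sup>+y. (\<Sum>i<n. \<Sum>j\<in>{..<n} - {i}. of_bool (hit n \<omega> y i j)) \<partial>\<nu>) \<partial>PU n) =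
    of_nat (n * (n - 1)) * mean (n - 2)"
proof -
  interpret P: prob_space "PU n" by (rule prob_space_PU)
  interpret pair_sigma_finite \<nu> "PU n" ..
  have [measurable]: "(\<lambda>(y, \<omega>). of_bool (hit n \<omega> y i j) :: ennreal) \<in> borel_measurable (\<nu> \<Otimes>\<^sub>M PU n)"
    if "i < n" "j < n" for i j
  proof -
    have [measurable]: "Measurable.pred (\<nu> \<Otimes>\<^sub>M PU n) (\<lambda>x. hit n (snd x) (fst x) i j)"
      by (rule hit_measurable[OF measurable_snd _ that]) measurable
    show ?thesis unfolding split_def by measurable
  qed
  have "(\<lambda>(y, \<omega>). \<Sum>i<n. \<Sum>j\<in>{..<n} - {i}. of_bool (hit n \<omega> y i j) :: ennreal) \<in> borel_measurable (\<nu> \<Otimes>\<^sub>M PU n)"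
    unfolding split_def by (intro borel_measurable_sum) (auto simp: split_def[symmetric])
  then have "(\<integral>\<^sup>+\<omega>. (\<integral>\<^sup>+y. (\<Sum>i<n. \<Sum>j\<in>{..<n} - {i}. of_bool (hit n \<omega> y i j)) \<partial>\<nu>) \<partial>PU n) =
      (\<integral>\<^sup>+y. (\<integral>\<^sup>+\<omega>. (\<Sum>i<n. \<Sum>j\<in>{..<n} - {i}. of_bool (hit n \<omega> y i j)) \<partial>PU n) \<partial>\<nu>)"
    by (rule Fubini')
  also have "\<dots> = (\<integral>\<^sup>+y. (\<Sum>i<n. \<Sum>j\<in>{..<n} - {i}. \<integral>\<^sup>+\<omega>. of_bool (hit n \<omega> y i j) \<partial>PU n) \<partial>\<nu>)"
  proof (rule nn_integral_cong)
    fix y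
    have m: "(\<lambda>\<omega>. of_bool (hit n \<omega> y i j) :: ennreal) \<in> borel_measurable (PU n)" if "i < n" "j < n" for i j
    proof -
      have [measurable]: "Measurable.pred (PU n) (\<lambda>\<omega>. hit n \<omega> y i j)"
        by (rule hit_measurable[OF measurable_ident_sets[OF refl] _ that]) simp
      show ?thesis by measurable
    qed
    show "(\<integral>\<^sup>+\<omega>. (\<Sum>i<n. \<Sum>j\<in>{..<n} - {i}. of_bool (hit n \<omega> y i j)) \<partial>PU n) =
        (\<Sum>i<n. \<Sum>j\<in>{..<n} - {i}. \<integral>\<^sup>+\<omega>. of_bool (hit n \<omega> y i j) \<partial>PU n)"
      by (subst nn_integral_sum; (intro borel_measurable_sum m sum.cong refl nn_integral_sum)?) (auto intro: m)
  qed
  also have "\<dots> = (\<integral>\<^sup>+y. (\<Sum>i<n. \<Sum>j\<in>{..<n} - {i}. \<integral>\<^sup>+p. \<integral>\<^sup>+q. of_bool (Q y p q) * surv y p q ^ (n - 2) \<partial>U01 \<partial>U01) \<partial>\<nu>)"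
    by (intro nn_integral_cong sum.cong refl hit_expectation) auto
  also have "\<dots> = (\<integral>\<^sup>+y. of_nat (n * (n - 1)) * (\<integral>\<^sup>+p. \<integral>\<^sup>+q. of_bool (Q y p q) * surv y p q ^ (n - 2) \<partial>U01 \<partial>U01) \<partial>\<nu>)"
    by (simp add: mult.assoc)
  also have "\<dots> = of_nat (n * (n - 1)) * mean (n - 2)"
  proof -
    interpret U: prob_space U01 by (rule prob_space_U01)
    show ?thesis unfolding mean_def by (rule nn_integral_cmult) measurable
  qed
  finally show ?thesis .
qed

text \<open>If two indices were shared, \<open>sep\<close> would be violated, so only four distinct
  indices contribute. The other n - 4 points must avoid two disjoint zones, and 1 - a - b \<le> (1 -
  a) (1 - b) bounds this by the product of the separate void probabilities. An upper bound suffices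
  for second moments.\<close>

lemma two_hits_expectation:
  fixes far :: "real \<Rightarrow> real \<Rightarrow> real \<Rightarrow> real \<Rightarrow> bool"
  assumes far [measurable]: "Measurable.pred (borel \<Otimes>\<^sub>M borel \<Otimes>\<^sub>M borel \<Otimes>\<^sub>M borel) (\<lambda>(y, p, y', p'). far y p y' p')"
    and sep: "\<And>y p q y' p' q'. far y p y' p' \<Longrightarrow> Q y p q \<Longrightarrow> Q y' p' q' \<Longrightarrow>
      p \<noteq> p' \<and> p \<noteq> q' \<and> q \<noteq> p' \<and> q \<noteq> q' \<and> (\<forall>s. \<not> (V y p q s \<and> V y' p' q' s))"
    and ij: "i < n" "j < n" "i \<noteq> j" and kl: "k < n" "l < n" "k \<noteq> l"
  shows "(\<integral>\<^sup>+\<omega>. of_bool (hit n \<omega> y i j \<and> hit n \<omega> y' k l \<and> far y (\<omega> i) y' (\<omega> k)) \<partial>PU n) \<le>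
    (\<integral>\<^sup>+p. \<integral>\<^sup>+q. of_bool (Q y p q) * surv y p q ^ (n - 4) \<partial>U01 \<partial>U01) *
    (\<integral>\<^sup>+p. \<integral>\<^sup>+q. of_bool (Q y' p q) * surv y' p q ^ (n - 4) \<partial>U01 \<partial>U01)"
proof (cases "distinct [i, j, k, l]")
  case False
  have "\<not> (hit n \<omega> y i j \<and> hit n \<omega> y' k l \<and> far y (\<omega> i) y' (\<omega> k))" for \<omega>
  proof
    assume "hit n \<omega> y i j \<and> hit n \<omega> y' k l \<and> far y (\<omega> i) y' (\<omega> k)"
    then have "\<omega> i \<noteq> \<omega> k \<and> \<omega> i \<noteq> \<omega> l \<and> \<omega> j \<noteq> \<omega> k \<and> \<omega> j \<noteq> \<omega> l"
      using sep[of y "\<omega> i" y' "\<omega> k" "\<omega> j" "\<omega> l"] by (simp add: hit_def)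
    then show False using False ij kl by auto
  qed
  then have "of_bool (hit n \<omega> y i j \<and> hit n \<omega> y' k l \<and> far y (\<omega> i) y' (\<omega> k)) = (0 :: ennreal)" for \<omega> by simp
  then show ?thesis by (simp only: nn_integral_const) simp
next
  case True
  interpret U: prob_space U01 by (rule prob_space_U01)
  have far_comp [measurable (raw)]: "Measurable.pred N (\<lambda>x. far (a x) (b x) (c x) (d x))"
    if [measurable]: "a \<in> borel_measurable N" "b \<in> borel_measurable N" "c \<in> borel_measurable N" "d \<in> borel_measurable N"
    for a b c d and N :: "'z measure"
  proof -
    have "Measurable.pred N (\<lambda>x. (\<lambda>(y, p, y', p'). far y p y' p') (a x, b x, c x, d x))"
      by (rule measurable_compose[OF _ far]) measurable
    then show ?thesis by simp
  qed
  define J where "J = {i, j, k, l}"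
  have cJ: "card J = 4" using True by (simp add: J_def)
  have mem: "i \<in> J" "j \<in> J" "k \<in> J" "l \<in> J" by (auto simp: J_def)
  define S where "S p q p' q' = emeasure U01 {s. \<not> V y p q s \<and> \<not> V y' p' q' s}" for p q p' q'
  define D where "D p q p' \<longleftrightarrow> Q y p q \<and> far y p y' p'" for p q p'
  have S_eq: "S p q p' q' = (\<integral>\<^sup>+s. of_bool (\<not> V y p q s \<and> \<not> V y' p' q' s) \<partial>U01)" for p q p' q'
  proof -
    have [measurable]: "{s. \<not> V y p q s \<and> \<not> V y' p' q' s} \<in> sets U01" by measurable
    show ?thesis unfolding S_def
      using nn_integral_indicator[of "{s. \<not> V y p q s \<and> \<not> V y' p' q' s}" U01]
      by (simp add: indicator_def[abs_def] of_bool_def)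
  qed
  have le: "of_bool (Q y p q \<and> Q y' p' q' \<and> far y p y' p') * S p q p' q' ^ (n - 4) \<le>
      (of_bool (Q y p q) * surv y p q ^ (n - 4)) * (of_bool (Q y' p' q') * surv y' p' q' ^ (n - 4))" for p q p' q'
  proof (cases "Q y p q \<and> Q y' p' q' \<and> far y p y' p'")
    case True
    define A where "A = {s. V y p q s}"
    define B where "B = {s. V y' p' q' s}"
    have AB [measurable]: "A \<in> sets U01" "B \<in> sets U01" unfolding A_def B_def by measurable
    have dis: "A \<inter> B = {}" using sep True unfolding A_def B_def by blast
    have m: "measure U01 (A \<union> B) = measure U01 A + measure U01 B"
      using dis AB by (intro U.finite_measure_Union) auto
    \<comment> \<open>With disjoint zones of masses a and b, the left side is 1 - a - b; the right
      side exceeds it by a b.\<close>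
    have "measure U01 (UNIV - (A \<union> B)) \<le> measure U01 (UNIV - A) * measure U01 (UNIV - B)"
    proof -
      have c: "measure U01 (UNIV - X) = 1 - measure U01 X" if "X \<in> sets U01" for X
        using U.prob_compl[OF that] by simp
      have AB': "A \<union> B \<in> sets U01" by measurable
      show ?thesis
        unfolding c[OF AB'] c[OF AB(1)] c[OF AB(2)] m by (simp add: algebra_simps)
    qed
    then have "S p q p' q' \<le> surv y p q * surv y' p' q'"
      unfolding S_def surv_def U.emeasure_eq_measure
      by (simp add: A_def B_def Compl_eq_Diff_UNIV[symmetric] Collect_neg_eq[symmetric] Collect_disj_eq[symmetric]
          ennreal_mult[symmetric] ennreal_leI)
    then have "S p q p' q' ^ (n - 4) \<le> (surv y p q * surv y' p' q') ^ (n - 4)" by (intro power_mono) auto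
    then show ?thesis using True by (simp add: power_mult_distrib)
  qed auto
  have "(\<integral>\<^sup>+\<omega>. of_bool (hit n \<omega> y i j \<and> hit n \<omega> y' k l \<and> far y (\<omega> i) y' (\<omega> k)) \<partial>PU n) \<le>
      (\<integral>\<^sup>+\<omega>. of_bool (Q y (restrict \<omega> J i) (restrict \<omega> J j) \<and> Q y' (restrict \<omega> J k) (restrict \<omega> J l) \<and> far y (restrict \<omega> J i) y' (restrict \<omega> J k)) *
        of_bool (\<forall>m\<in>{..<n} - J. \<not> V y (restrict \<omega> J i) (restrict \<omega> J j) (\<omega> m) \<and> \<not> V y' (restrict \<omega> J k) (restrict \<omega> J l) (\<omega> m)) \<partial>PU n)"
    by (intro nn_integral_mono) (auto simp: hit_def mem J_def)
  also have "\<dots> = (\<integral>\<^sup>+x. of_bool (Q y (x i) (x j) \<and> Q y' (x k) (x l) \<and> far y (x i) y' (x k)) *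
      emeasure U01 {s. \<not> V y (x i) (x j) s \<and> \<not> V y' (x k) (x l) s} ^ (n - card J) \<partial>PiM J (\<lambda>_. U01))"
    by (rule nn_integral_PU_void[where G = "\<lambda>x. of_bool (Q y (x i) (x j) \<and> Q y' (x k) (x l) \<and> far y (x i) y' (x k))"
          and A = "\<lambda>x s. \<not> V y (x i) (x j) s \<and> \<not> V y' (x k) (x l) s"])
      (use ij kl mem in \<open>auto simp: J_def\<close>)
  also have "\<dots> = (\<integral>\<^sup>+x. of_bool (Q y (x i) (x j) \<and> Q y' (x k) (x l) \<and> far y (x i) y' (x k)) *
      S (x i) (x j) (x k) (x l) ^ (n - 4) \<partial>PiM {i, j, k, l} (\<lambda>_. U01))"
    unfolding S_def cJ unfolding J_def ..
  also have "\<dots> = (\<integral>\<^sup>+p. \<integral>\<^sup>+q. \<integral>\<^sup>+p'. \<integral>\<^sup>+q'. of_bool (Q y p q \<and> Q y' p' q' \<and> far y p y' p') * S p q p' q' ^ (n - 4) \<partial>U01 \<partial>U01 \<partial>U01 \<partial>U01)"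
    by (rule nn_integral_PiM_quad[OF True, where F = "\<lambda>p q p' q'. of_bool (Q y p q \<and> Q y' p' q' \<and> far y p y' p') * S p q p' q' ^ (n - 4)"])
      (unfold S_eq, measurable)
  also have "\<dots> \<le> (\<integral>\<^sup>+p. \<integral>\<^sup>+q. \<integral>\<^sup>+p'. \<integral>\<^sup>+q'. (of_bool (Q y p q) * surv y p q ^ (n - 4)) *
      (of_bool (Q y' p' q') * surv y' p' q' ^ (n - 4)) \<partial>U01 \<partial>U01 \<partial>U01 \<partial>U01)"
    by (intro nn_integral_mono le)
  also have "\<dots> = (\<integral>\<^sup>+p. \<integral>\<^sup>+q. (of_bool (Q y p q) * surv y p q ^ (n - 4)) *
      (\<integral>\<^sup>+p'. \<integral>\<^sup>+q'. of_bool (Q y' p' q') * surv y' p' q' ^ (n - 4) \<partial>U01 \<partial>U01) \<partial>U01 \<partial>U01)"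
    by (simp add: nn_integral_cmult)
  also have "\<dots> = (\<integral>\<^sup>+p. \<integral>\<^sup>+q. of_bool (Q y p q) * surv y p q ^ (n - 4) \<partial>U01 \<partial>U01) *
    (\<integral>\<^sup>+p. \<integral>\<^sup>+q. of_bool (Q y' p q) * surv y' p q ^ (n - 4) \<partial>U01 \<partial>U01)"
    by (simp add: nn_integral_multc)
  finally show ?thesis .
qed

text \<open>Each of the at most n^4 index quadruples is bounded by a product in which the two
  locations are separated, so integrating over both locations yields the square of
  \<open>mean\<close>.\<close>

lemma expectation_sum_far_hits:
  fixes far :: "real \<Rightarrow> real \<Rightarrow> real \<Rightarrow> real \<Rightarrow> bool"
  assumes far [measurable]: "Measurable.pred (borel \<Otimes>\<^sub>M borel \<Otimes>\<^sub>M borel \<Otimes>\<^sub>M borel) (\<lambda>(y, p, y', p'). far y p y' p')"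
    and sep: "\<And>y p q y' p' q'. far y p y' p' \<Longrightarrow> Q y p q \<Longrightarrow> Q y' p' q' \<Longrightarrow>
      p \<noteq> p' \<and> p \<noteq> q' \<and> q \<noteq> p' \<and> q \<noteq> q' \<and> (\<forall>s. \<not> (V y p q s \<and> V y' p' q' s))"
  shows "(\<integral>\<^sup>+\<omega>. (\<integral>\<^sup>+y. (\<integral>\<^sup>+y'. (\<Sum>i<n. \<Sum>j\<in>{..<n} - {i}. \<Sum>k<n. \<Sum>l\<in>{..<n} - {k}.
      of_bool (hit n \<omega> y i j \<and> hit n \<omega> y' k l \<and> far y (\<omega> i) y' (\<omega> k))) \<partial>\<nu>) \<partial>\<nu>) \<partial>PU n) \<le>
    of_nat (n ^ 4) * (mean (n - 4))\<^sup>2"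
proof -
  interpret P: prob_space "PU n" by (rule prob_space_PU)
  interpret U: prob_space U01 by (rule prob_space_U01)
  interpret pair: pair_sigma_finite \<nu> \<nu> ..
  interpret pair2: pair_sigma_finite \<nu> "PU n" ..
  have far_comp [measurable (raw)]: "Measurable.pred N (\<lambda>x. far (a x) (b x) (c x) (d x))"
    if [measurable]: "a \<in> borel_measurable N" "b \<in> borel_measurable N" "c \<in> borel_measurable N" "d \<in> borel_measurable N"
    for a b c d and N :: "'z measure"
  proof -
    have "Measurable.pred N (\<lambda>x. (\<lambda>(y, p, y', p'). far y p y' p') (a x, b x, c x, d x))"
      by (rule measurable_compose[OF _ far]) measurable
    then show ?thesis by simp
  qed
  define A where "A y = (\<integral>\<^sup>+p. \<integral>\<^sup>+q. of_bool (Q y p q) * surv y p q ^ (n - 4) \<partial>U01 \<partial>U01)" for y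
  have A_m [measurable]: "A \<in> borel_measurable borel" unfolding A_def by measurable
  define f where "f i j k l \<omega> y y' = (of_bool (hit n \<omega> y i j \<and> hit n \<omega> y' k l \<and> far y (\<omega> i) y' (\<omega> k)) :: ennreal)"
    for i j k l \<omega> y y'
  have comp: "(\<lambda>x. w x m) \<in> borel_measurable N" if "w \<in> N \<rightarrow>\<^sub>M PU n" "m < n" for w m and N :: "'z measure"
    by (rule measurable_compose[OF that(1) measurable_PU_component[OF that(2)]])
  have f_m: "(\<lambda>x. f i j k l (w x) (a x) (b x)) \<in> borel_measurable N"
    if [measurable]: "w \<in> N \<rightarrow>\<^sub>M PU n" "a \<in> borel_measurable N" "b \<in> borel_measurable N"
      and lt: "i < n" "j < n" "k < n" "l < n" for w a b i j k l and N :: "'z measure"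
  proof -
    note [measurable] = hit_measurable[OF that(1,2) lt(1,2)] hit_measurable[OF that(1,3) lt(3,4)]
      comp[OF that(1) lt(1)] comp[OF that(1) lt(3)]
    show ?thesis unfolding f_def by measurable
  qed
  have one: "(\<integral>\<^sup>+\<omega>. (\<integral>\<^sup>+y. (\<integral>\<^sup>+y'. f i j k l \<omega> y y' \<partial>\<nu>) \<partial>\<nu>) \<partial>PU n) \<le> (mean (n - 4))\<^sup>2"
    if lt: "i < n" "j < n" "i \<noteq> j" "k < n" "l < n" "k \<noteq> l" for i j k l
  proof -
    have [measurable (raw)]: "(\<lambda>x. f i j k l (w x) (a x) (b x)) \<in> borel_measurable N"
      if "w \<in> N \<rightarrow>\<^sub>M PU n" "a \<in> borel_measurable N" "b \<in> borel_measurable N" for w a b and N :: "'z measure"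
      using that lt by (intro f_m) auto
    have "(\<integral>\<^sup>+\<omega>. (\<integral>\<^sup>+y. (\<integral>\<^sup>+y'. f i j k l \<omega> y y' \<partial>\<nu>) \<partial>\<nu>) \<partial>PU n) =
        (\<integral>\<^sup>+y. (\<integral>\<^sup>+\<omega>. (\<integral>\<^sup>+y'. f i j k l \<omega> y y' \<partial>\<nu>) \<partial>PU n) \<partial>\<nu>)"
      by (rule pair2.Fubini') measurable
    also have "\<dots> = (\<integral>\<^sup>+y. (\<integral>\<^sup>+y'. (\<integral>\<^sup>+\<omega>. f i j k l \<omega> y y' \<partial>PU n) \<partial>\<nu>) \<partial>\<nu>)"
      by (intro nn_integral_cong pair2.Fubini') measurable
    also have "\<dots> \<le> (\<integral>\<^sup>+y. (\<integral>\<^sup>+y'. A y * A y' \<partial>\<nu>) \<partial>\<nu>)"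
      unfolding f_def A_def by (intro nn_integral_mono two_hits_expectation[OF far sep] lt)
    also have "\<dots> = (\<integral>\<^sup>+y. A y \<partial>\<nu>) * (\<integral>\<^sup>+y. A y \<partial>\<nu>)"
      by (simp add: nn_integral_cmult nn_integral_multc)
    finally show ?thesis by (simp add: A_def mean_def power2_eq_square)
  qed
  have "(\<integral>\<^sup>+\<omega>. (\<integral>\<^sup>+y. (\<integral>\<^sup>+y'. (\<Sum>i<n. \<Sum>j\<in>{..<n} - {i}. \<Sum>k<n. \<Sum>l\<in>{..<n} - {k}. f i j k l \<omega> y y') \<partial>\<nu>) \<partial>\<nu>) \<partial>PU n) =
      (\<Sum>i<n. \<Sum>j\<in>{..<n} - {i}. \<Sum>k<n. \<Sum>l\<in>{..<n} - {k}. (\<integral>\<^sup>+\<omega>. (\<integral>\<^sup>+y. (\<integral>\<^sup>+y'. f i j k l \<omega> y y' \<partial>\<nu>) \<partial>\<nu>) \<partial>PU n))"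
  proof -
    have m1: "(\<lambda>y'. f i j k l \<omega> y y') \<in> borel_measurable \<nu>" if "i < n" "j < n" "k < n" "l < n" "\<omega> \<in> space (PU n)" for i j k l \<omega> y
      using f_m[of "\<lambda>_. \<omega>" \<nu> "\<lambda>_. y" "\<lambda>y'. y'"] that by auto
    have m2: "(\<lambda>y. \<integral>\<^sup>+y'. f i j k l \<omega> y y' \<partial>\<nu>) \<in> borel_measurable \<nu>" if "i < n" "j < n" "k < n" "l < n" "\<omega> \<in> space (PU n)" for i j k l \<omega>
    proof -
      have "(\<lambda>x. f i j k l \<omega> (fst x) (snd x)) \<in> borel_measurable (\<nu> \<Otimes>\<^sub>M \<nu>)"
        using that by (intro f_m) auto
      then have "(\<lambda>(y, y'). f i j k l \<omega> y y') \<in> borel_measurable (\<nu> \<Otimes>\<^sub>M \<nu>)" by (simp add: split_def)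
      then show ?thesis by (rule borel_measurable_nn_integral)
    qed
    have m3: "(\<lambda>\<omega>. \<integral>\<^sup>+y. \<integral>\<^sup>+y'. f i j k l \<omega> y y' \<partial>\<nu> \<partial>\<nu>) \<in> borel_measurable (PU n)" if "i < n" "j < n" "k < n" "l < n" for i j k l
    proof -
      have [measurable (raw)]: "(\<lambda>x. f i j k l (w x) (a x) (b x)) \<in> borel_measurable N"
        if "w \<in> N \<rightarrow>\<^sub>M PU n" "a \<in> borel_measurable N" "b \<in> borel_measurable N" for w a b and N :: "'z measure"
        using that \<open>i < n\<close> \<open>j < n\<close> \<open>k < n\<close> \<open>l < n\<close> by (intro f_m) auto
      show ?thesis by measurable
    qed
    have s: "(\<integral>\<^sup>+x. (\<Sum>i<n. \<Sum>j\<in>{..<n} - {i}. \<Sum>k<n. \<Sum>l\<in>{..<n} - {k}. g i j k l x) \<partial>N) =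
      (\<Sum>i<n. \<Sum>j\<in>{..<n} - {i}. \<Sum>k<n. \<Sum>l\<in>{..<n} - {k}. \<integral>\<^sup>+x. g i j k l x \<partial>N)"
      if "\<And>i j k l. i < n \<Longrightarrow> j < n \<Longrightarrow> k < n \<Longrightarrow> l < n \<Longrightarrow> g i j k l \<in> borel_measurable N"
      for g :: "nat \<Rightarrow> nat \<Rightarrow> nat \<Rightarrow> nat \<Rightarrow> 'z \<Rightarrow> ennreal" and N :: "'z measure"
    proof -
      have m: "g i j k l \<in> borel_measurable N" if "i \<in> {..<n}" "j \<in> {..<n} - {i}" "k \<in> {..<n}" "l \<in> {..<n} - {k}" for i j k l
        using that \<open>\<And>i j k l. i < n \<Longrightarrow> j < n \<Longrightarrow> k < n \<Longrightarrow> l < n \<Longrightarrow> g i j k l \<in> borel_measurable N\<close> by auto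
      show ?thesis
        by (subst nn_integral_sum, (intro borel_measurable_sum m; assumption)?, intro sum.cong refl,
            subst nn_integral_sum, (intro borel_measurable_sum m; assumption)?, intro sum.cong refl,
            subst nn_integral_sum, (intro borel_measurable_sum m; assumption)?, intro sum.cong refl,
            subst nn_integral_sum, (intro m; assumption)?, rule refl)
    qed
    have "(\<integral>\<^sup>+\<omega>. (\<integral>\<^sup>+y. (\<integral>\<^sup>+y'. (\<Sum>i<n. \<Sum>j\<in>{..<n} - {i}. \<Sum>k<n. \<Sum>l\<in>{..<n} - {k}. f i j k l \<omega> y y') \<partial>\<nu>) \<partial>\<nu>) \<partial>PU n) =
        (\<integral>\<^sup>+\<omega>. (\<integral>\<^sup>+y. (\<Sum>i<n. \<Sum>j\<in>{..<n} - {i}. \<Sum>k<n. \<Sum>l\<in>{..<n} - {k}. \<integral>\<^sup>+y'. f i j k l \<omega> y y' \<partial>\<nu>) \<partial>\<nu>) \<partial>PU n)"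
      by (intro nn_integral_cong s m1)
    also have "\<dots> = (\<integral>\<^sup>+\<omega>. (\<Sum>i<n. \<Sum>j\<in>{..<n} - {i}. \<Sum>k<n. \<Sum>l\<in>{..<n} - {k}. \<integral>\<^sup>+y. \<integral>\<^sup>+y'. f i j k l \<omega> y y' \<partial>\<nu> \<partial>\<nu>) \<partial>PU n)"
      by (intro nn_integral_cong s m2)
    also have "\<dots> = (\<Sum>i<n. \<Sum>j\<in>{..<n} - {i}. \<Sum>k<n. \<Sum>l\<in>{..<n} - {k}. (\<integral>\<^sup>+\<omega>. (\<integral>\<^sup>+y. (\<integral>\<^sup>+y'. f i j k l \<omega> y y' \<partial>\<nu>) \<partial>\<nu>) \<partial>PU n))"
      by (intro s m3)
    finally show ?thesis .
  qed
  also have "\<dots> \<le> (\<Sum>i<n. \<Sum>j\<in>{..<n} - {i}. \<Sum>k<n. \<Sum>l\<in>{..<n} - {k}. (mean (n - 4))\<^sup>2)"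
    by (intro sum_mono one) auto
  also have "\<dots> = of_nat (n * (n - 1) * (n * (n - 1))) * (mean (n - 4))\<^sup>2"
    by (simp add: mult.assoc)
  also have "\<dots> \<le> of_nat (n ^ 4) * (mean (n - 4))\<^sup>2"
  proof (intro mult_right_mono of_nat_mono)
    have "n * (n - 1) * (n * (n - 1)) \<le> n * n * (n * n)" by (intro mult_mono) auto
    then show "n * (n - 1) * (n * (n - 1)) \<le> n ^ 4" by (simp add: power4_eq_xxxx mult.assoc)
  qed auto
  finally show ?thesis by (simp only: f_def)
qed

end

section \<open>Nearest pairs of a point and an antipode\<close>

definition anti :: "real \<Rightarrow> real" where
  "anti u = (if u < 1 / 2 then u + 1 / 2 else u - 1 / 2)"

text \<open>Let \<open>p\<close> lie near \<open>u\<close> and \<open>q\<close> near \<open>anti u\<close>. No sample point in \<open>zone 1 u p q\<close> means that \<open>p\<close>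
  is the sample point nearest to \<open>u\<close> and the antipode of \<open>q\<close> is the antipodal point nearest both
  to \<open>u\<close> and to \<open>p\<close>; for \<open>zone 2\<close> also \<open>p\<close> is the sample point nearest to the antipode of \<open>q\<close>.\<close>

definition zone :: "nat \<Rightarrow> real \<Rightarrow> real \<Rightarrow> real \<Rightarrow> real \<Rightarrow> bool" where
  "zone k u p q s \<longleftrightarrow> \<bar>s - u\<bar> \<le> \<bar>p - u\<bar> \<or> \<bar>s - anti u\<bar> \<le> \<bar>q - anti u\<bar> \<or>
     \<bar>s - anti u - (p - u)\<bar> \<le> \<bar>(p - u) - (q - anti u)\<bar> \<or>
     (k = 2 \<and> \<bar>s - u - (q - anti u)\<bar> \<le> \<bar>(p - u) - (q - anti u)\<bar>)"

text \<open>The length of the union of the interval of radius |b| around 0 and the interval of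
  radius |a - b| around \<open>a\<close>. Both contain \<open>b\<close>, so the union is an
  interval, and the two maxima are its extents to the left and to the right of 0.\<close>

definition reach :: "real \<Rightarrow> real \<Rightarrow> real" where
  "reach a b = max \<bar>b\<bar> (\<bar>a - b\<bar> - a) + max \<bar>b\<bar> (a + \<bar>a - b\<bar>)"

text \<open>The volume of the zone when \<open>p\<close> and \<open>q\<close> have offsets
  \<open>a\<close> and \<open>b\<close> from the location and its antipode: the part near the
  location plus the part near the antipode. The condition added for \<open>k = 2\<close> enlarges
  only the first part.\<close>

definition vol :: "nat \<Rightarrow> real \<Rightarrow> real \<Rightarrow> real" where
  "vol k a b = (if k = 2 then reach b a else 2 * \<bar>a\<bar>) + reach a b"

text \<open>Distance more than 3 r from 0, 1/2 and 1. By \<open>zone_near\<close> a zone with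
  offsets below r stays within 3 r of the location and its antipode, so its two parts lie in [0,1),
  disjoint and without wrapping around.\<close>

definition safe :: "real \<Rightarrow> real set" where
  "safe r = {3 * r<..<1 / 2 - 3 * r} \<union> {1 / 2 + 3 * r<..<1 - 3 * r}"

lemma anti_measurable [measurable]: "anti \<in> borel_measurable borel"
  unfolding anti_def by measurable

lemma reach_measurable [measurable (raw)]:
  "f \<in> borel_measurable M \<Longrightarrow> g \<in> borel_measurable M \<Longrightarrow> (\<lambda>x. reach (f x) (g x)) \<in> borel_measurable M"
  unfolding reach_def
  by (intro borel_measurable_add borel_measurable_max borel_measurable_diff borel_measurable_abs)

lemma vol_measurable [measurable (raw)]:
  "f \<in> borel_measurable M \<Longrightarrow> g \<in> borel_measurable M \<Longrightarrow> (\<lambda>x. vol k (f x) (g x)) \<in> borel_measurable M"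
  unfolding vol_def
  by (cases "k = 2") (auto intro!: borel_measurable_add reach_measurable borel_measurable_times borel_measurable_abs)

lemma reach_uminus: "reach (- a) (- b) = reach a b"
proof -
  have e: "\<bar>- a - - b\<bar> = \<bar>a - b\<bar>" "\<bar>a - b\<bar> - - a = a + \<bar>a - b\<bar>" "- a + \<bar>a - b\<bar> = \<bar>a - b\<bar> - a"
    by linarith+
  show ?thesis unfolding reach_def e abs_minus_cancel by (rule add.commute)
qed

lemma reach_scale: "c \<ge> 0 \<Longrightarrow> reach (c * a) (c * b) = c * reach a b"
proof -
  assume c: "c \<ge> 0"
  have m: "c * max x y = max (c * x) (c * y)" for x y using c by (simp add: max_mult_distrib_left)
  have d: "c * \<bar>a - b\<bar> = \<bar>c * a - c * b\<bar>" using c by (simp only: right_diff_distrib[symmetric] abs_mult abs_of_nonneg)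
  have b: "c * \<bar>b\<bar> = \<bar>c * b\<bar>" using c by (simp only: abs_mult abs_of_nonneg)
  show ?thesis unfolding reach_def distrib_left m right_diff_distrib d b ..
qed

lemma vol_uminus: "vol k (- a) (- b) = vol k a b"
  by (simp add: vol_def reach_uminus)

lemma vol_scale: "c \<ge> 0 \<Longrightarrow> vol k (c * a) (c * b) = c * vol k a b"
  by (simp add: vol_def reach_scale abs_mult distrib_left)

text \<open>The two parts contain intervals of radius |a| and |b|. This gives the integrable bound
  exp (- |a| - |b|) for exp (- vol / 2).\<close>

lemma vol_ge: "2 * (\<bar>a\<bar> + \<bar>b\<bar>) \<le> vol k a b"
  by (auto simp: vol_def reach_def max_def abs_if)

text \<open>When the location is the point itself, each of the two parts is an interval of radius
  |b|. Integrating exp (- 4 |b|) over the line gives the 1/2 for mutually nearest pairs.\<close>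

lemma vol_zero: "vol 2 0 b = 4 * \<bar>b\<bar>"
  by (auto simp: vol_def reach_def max_def abs_if)

lemma zone_measurable: "Measurable.pred (borel \<Otimes>\<^sub>M borel \<Otimes>\<^sub>M borel \<Otimes>\<^sub>M borel) (\<lambda>(u, p, q, s). zone k u p q s)"
  unfolding zone_def by measurable

lemma zone_measurable' [measurable]: "Measurable.pred borel (\<lambda>s. zone k u p q s)"
  unfolding zone_def by measurable

lemma zone_near:
  assumes "zone k u p q s" "\<bar>p - u\<bar> < r" "\<bar>q - anti u\<bar> < r"
  shows "\<bar>s - u\<bar> < 3 * r \<or> \<bar>s - anti u\<bar> < 3 * r"
  using assms unfolding zone_def by linarith

text \<open>The two intervals overlap, as both contain \<open>b\<close>, so their union is the
  interval between the extreme ends.\<close>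

lemma reach_interval:
  "\<bar>x\<bar> \<le> \<bar>b\<bar> \<or> \<bar>x - a\<bar> \<le> \<bar>a - b\<bar> \<longleftrightarrow> x \<in> {- max \<bar>b\<bar> (\<bar>a - b\<bar> - a)..max \<bar>b\<bar> (a + \<bar>a - b\<bar>)}" for x a b :: real
  by (auto simp: max_def abs_if split: if_splits)

text \<open>At a safe location the zone is a disjoint union of two intervals inside [0,1), with
  radii governed by \<open>reach\<close>; hence its uniform probability is exactly its total
  length.\<close>

lemma emeasure_not_zone:
  assumes u: "u \<in> safe r" and a: "\<bar>a\<bar> < r" and b: "\<bar>b\<bar> < r"
  shows "emeasure U01 {s. \<not> zone k u (u + a) (anti u + b) s} = ennreal (1 - vol k a b)"
proof -
  interpret U: prob_space U01 by (rule prob_space_U01)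
  define h where "h = anti u"
  define \<alpha>1 where "\<alpha>1 = (if k = 2 then max \<bar>a\<bar> (\<bar>b - a\<bar> - b) else \<bar>a\<bar>)"
  define \<alpha>2 where "\<alpha>2 = (if k = 2 then max \<bar>a\<bar> (b + \<bar>b - a\<bar>) else \<bar>a\<bar>)"
  define \<beta>1 where "\<beta>1 = max \<bar>b\<bar> (\<bar>a - b\<bar> - a)"
  define \<beta>2 where "\<beta>2 = max \<bar>b\<bar> (a + \<bar>a - b\<bar>)"
  have vol: "vol k a b = \<alpha>1 + \<alpha>2 + (\<beta>1 + \<beta>2)"
    by (simp add: vol_def reach_def \<alpha>1_def \<alpha>2_def \<beta>1_def \<beta>2_def)
  have bd: "0 \<le> \<alpha>1" "0 \<le> \<alpha>2" "0 \<le> \<beta>1" "0 \<le> \<beta>2" "\<alpha>1 < 3 * r" "\<alpha>2 < 3 * r" "\<beta>1 < 3 * r" "\<beta>2 < 3 * r"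
  proof -
    have m: "0 \<le> max \<bar>y\<bar> z" "max \<bar>y\<bar> z < 3 * r" if "\<bar>y\<bar> < r" "z < 3 * r" for y z
      using that by (auto simp: le_max_iff_disj)
    have z: "\<bar>a - b\<bar> - a < 3 * r" "a + \<bar>a - b\<bar> < 3 * r" "\<bar>b - a\<bar> - b < 3 * r" "b + \<bar>b - a\<bar> < 3 * r" "\<bar>a\<bar> < 3 * r"
      using a b by linarith+
    show "0 \<le> \<beta>1" "0 \<le> \<beta>2" "\<beta>1 < 3 * r" "\<beta>2 < 3 * r"
      unfolding \<beta>1_def \<beta>2_def by (rule m[OF b z(1)] m[OF b z(2)])+
    have "0 \<le> \<alpha>1 \<and> 0 \<le> \<alpha>2 \<and> \<alpha>1 < 3 * r \<and> \<alpha>2 < 3 * r"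
    proof (cases "k = 2")
      case True
      show ?thesis unfolding \<alpha>1_def \<alpha>2_def if_P[OF True] by (intro conjI m[OF a z(3)] m[OF a z(4)])
    next
      case False
      show ?thesis unfolding \<alpha>1_def \<alpha>2_def if_not_P[OF False] by (intro conjI abs_ge_zero z(5))
    qed
    then show "0 \<le> \<alpha>1" "0 \<le> \<alpha>2" "\<alpha>1 < 3 * r" "\<alpha>2 < 3 * r" by simp_all
  qed
  have uh: "(u < 1 / 2 \<and> h = u + 1 / 2 \<or> u > 1 / 2 \<and> h = u - 1 / 2) \<and> h \<in> safe r"
    using u a by (auto simp: safe_def h_def anti_def)
  have "zone k u (u + a) (anti u + b) s \<longleftrightarrow> s \<in> {u - \<alpha>1..u + \<alpha>2} \<union> {h - \<beta>1..h + \<beta>2}" for s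
  proof -
    have H: "(\<bar>s - h\<bar> \<le> \<bar>b\<bar> \<or> \<bar>s - h - a\<bar> \<le> \<bar>a - b\<bar>) = (s \<in> {h - \<beta>1..h + \<beta>2})"
      unfolding reach_interval[of "s - h" b a] by (auto simp: \<beta>1_def \<beta>2_def)
    have U: "(\<bar>s - u\<bar> \<le> \<bar>a\<bar> \<or> (k = 2 \<and> \<bar>s - u - b\<bar> \<le> \<bar>a - b\<bar>)) = (s \<in> {u - \<alpha>1..u + \<alpha>2})"
    proof (cases "k = 2")
      case True
      then show ?thesis using reach_interval[of "s - u" a b] abs_minus_commute[of a b] by (auto simp: \<alpha>1_def \<alpha>2_def)
    next
      case False
      then show ?thesis by (auto simp: \<alpha>1_def \<alpha>2_def)
    qed
    have "zone k u (u + a) (anti u + b) s = ((\<bar>s - u\<bar> \<le> \<bar>a\<bar> \<or> (k = 2 \<and> \<bar>s - u - b\<bar> \<le> \<bar>a - b\<bar>)) \<or>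
        (\<bar>s - h\<bar> \<le> \<bar>b\<bar> \<or> \<bar>s - h - a\<bar> \<le> \<bar>a - b\<bar>))"
      unfolding zone_def add_diff_cancel_left' h_def by argo
    then show ?thesis unfolding H U Un_iff .
  qed
  then have Z: "{s. zone k u (u + a) (anti u + b) s} = {u - \<alpha>1..u + \<alpha>2} \<union> {h - \<beta>1..h + \<beta>2}"
    by (intro set_eqI) (simp only: mem_Collect_eq)
  have sep: "u + \<alpha>2 < h - \<beta>1 \<or> h + \<beta>2 < u - \<alpha>1" and in01: "0 \<le> u - \<alpha>1" "u + \<alpha>2 < 1" "0 \<le> h - \<beta>1" "h + \<beta>2 < 1"
  proof -
    have r: "(u < 1 / 2 \<and> h = u + 1 / 2 \<and> 3 * r < u \<and> u < 1 / 2 - 3 * r) \<or>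
        (u > 1 / 2 \<and> h = u - 1 / 2 \<and> 1 / 2 + 3 * r < u \<and> u < 1 - 3 * r)"
      using uh u a by (auto simp: safe_def)
    from r show "u + \<alpha>2 < h - \<beta>1 \<or> h + \<beta>2 < u - \<alpha>1"
    proof
      assume "u < 1 / 2 \<and> h = u + 1 / 2 \<and> 3 * r < u \<and> u < 1 / 2 - 3 * r"
      then have "u + \<alpha>2 < h - \<beta>1" using bd by linarith
      then show ?thesis ..
    next
      assume "u > 1 / 2 \<and> h = u - 1 / 2 \<and> 1 / 2 + 3 * r < u \<and> u < 1 - 3 * r"
      then have "h + \<beta>2 < u - \<alpha>1" using bd by linarith
      then show ?thesis ..
    qed
    from r show "0 \<le> u - \<alpha>1" "u + \<alpha>2 < 1" "0 \<le> h - \<beta>1" "h + \<beta>2 < 1" using bd by (elim disjE; linarith)+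
  qed
  have dis: "{u - \<alpha>1..u + \<alpha>2} \<inter> {h - \<beta>1..h + \<beta>2} = {}"
    using sep by auto
  have sub: "{0..<1} \<inter> {s. zone k u (u + a) (anti u + b) s} = {u - \<alpha>1..u + \<alpha>2} \<union> {h - \<beta>1..h + \<beta>2}"
    unfolding Z using in01 by auto
  have "emeasure U01 {s. zone k u (u + a) (anti u + b) s} = emeasure lborel ({u - \<alpha>1..u + \<alpha>2} \<union> {h - \<beta>1..h + \<beta>2})"
    using sub by (subst emeasure_U01) (auto simp: Z)
  also have "\<dots> = emeasure lborel {u - \<alpha>1..u + \<alpha>2} + emeasure lborel {h - \<beta>1..h + \<beta>2}"
    using dis by (intro plus_emeasure[symmetric]) auto
  also have "\<dots> = ennreal (vol k a b)"
    using bd by (simp add: vol flip: ennreal_plus)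
  finally have m: "measure U01 {s. zone k u (u + a) (anti u + b) s} = vol k a b"
    unfolding U.emeasure_eq_measure using bd by (subst (asm) ennreal_inj) (auto simp: vol)
  have "measure U01 (space U01 - {s. zone k u (u + a) (anti u + b) s}) = 1 - vol k a b"
    unfolding m[symmetric] by (rule U.prob_compl) measurable
  moreover have "space U01 - {s. zone k u (u + a) (anti u + b) s} = {s. \<not> zone k u (u + a) (anti u + b) s}" by auto
  ultimately show ?thesis by (simp add: U.emeasure_eq_measure)
qed

text \<open>The mean contribution of one pair at one location, integrated over the offsets of
  \<open>p\<close> and \<open>q\<close>. It does not depend on the safe location, which is why only
  offsets appear.\<close>

definition kappa :: "nat \<Rightarrow> real \<Rightarrow> nat \<Rightarrow> ennreal" where
  "kappa k r m = (\<integral>\<^sup>+a. \<integral>\<^sup>+b. of_bool (\<bar>a\<bar> < r \<and> \<bar>b\<bar> < r) * ennreal (1 - vol k a b) ^ m \<partial>lborel \<partial>lborel)"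

definition kappa0 :: "real \<Rightarrow> nat \<Rightarrow> ennreal" where
  "kappa0 r m = (\<integral>\<^sup>+b. of_bool (\<bar>b\<bar> < r) * ennreal (1 - vol 2 0 b) ^ m \<partial>lborel)"

lemma tendsto_one_minus_power:
  fixes v :: real
  shows "(\<lambda>n. ennreal (1 - v / real n) ^ (n - c)) \<longlonglongrightarrow> ennreal (exp (- v))"
proof -
  have "(\<lambda>n. (1 + (- v) / real n) ^ n / (1 - v / real n) ^ c) \<longlonglongrightarrow> exp (- v) / (1 - 0) ^ c"
    by (intro tendsto_intros tendsto_exp_limit_sequentially lim_const_over_n) simp
  then have "(\<lambda>n. ennreal ((1 + (- v) / real n) ^ n / (1 - v / real n) ^ c)) \<longlonglongrightarrow> ennreal (exp (- v))"
    by (intro tendsto_ennrealI) simp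
  moreover have "\<forall>\<^sub>F n in sequentially. ennreal ((1 + (- v) / real n) ^ n / (1 - v / real n) ^ c) = ennreal (1 - v / real n) ^ (n - c)"
  proof -
    have "\<forall>\<^sub>F n in sequentially. v / real n < 1"
      using lim_const_over_n[of v] by (intro order_tendstoD) auto
    then show ?thesis using eventually_ge_at_top[of c]
    proof eventually_elim
      case (elim n)
      have "(1 - v / real n) ^ (n - c) = (1 - v / real n) ^ n / (1 - v / real n) ^ c"
        using elim by (intro power_diff) auto
      then show ?case using elim by (simp add: ennreal_power)
    qed
  qed
  ultimately show ?thesis by (rule Lim_transform_eventually)
qed

text \<open>Dropping \<open>c\<close> of at least \<open>2 * c\<close> factors at most halves the
  exponent; the bound is uniform in \<open>n\<close> and serves as the dominating function.\<close>

lemma one_minus_power_le: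
  assumes "v \<ge> 0" "n \<ge> 2 * c" "n > 0"
  shows "ennreal (1 - v / real n) ^ (n - c) \<le> ennreal (exp (- v / 2))"
proof -
  have "ennreal (1 - v / real n) \<le> ennreal (exp (- (v / real n)))"
    using exp_ge_add_one_self[of "- (v / real n)"] by (intro ennreal_leI) simp
  then have "ennreal (1 - v / real n) ^ (n - c) \<le> ennreal (exp (- (v / real n))) ^ (n - c)"
    by (rule power_mono) simp
  also have "\<dots> = ennreal (exp (- (v / real n) * real (n - c)))"
    by (simp add: ennreal_power mult.commute flip: exp_of_nat_mult)
  also have "\<dots> \<le> ennreal (exp (- v / 2))"
  proof -
    have "real n / 2 \<le> real (n - c)" using assms by (simp add: of_nat_diff)
    then have "(v / real n) * (real n / 2) \<le> (v / real n) * real (n - c)" using assms by (intro mult_left_mono) auto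
    then show ?thesis using assms by (intro ennreal_leI) simp
  qed
  finally show ?thesis .
qed

section \<open>The integrals behind the limiting constants\<close>

lemma nn_integral_exp_tail:
  assumes "c > 0"
  shows "(\<integral>\<^sup>+x. ennreal (exp (- c * x)) * indicator {t..} x \<partial>lborel) = ennreal (exp (- c * t) / c)"
proof -
  have "((\<lambda>x. - exp (- c * x) / c) \<longlongrightarrow> 0) at_top"
    using assms by real_asymp
  then have "(\<integral>\<^sup>+x. ennreal (exp (- c * x)) * indicator {t..} x \<partial>lborel) = ennreal (0 - (- exp (- c * t) / c))"
    by (intro nn_integral_FTC_atLeast) (use assms in \<open>auto intro!: derivative_eq_intros\<close>)
  then show ?thesis by simp
qed

lemma nn_integral_exp_linear_tail:
  assumes "\<alpha> \<ge> 0"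
  shows "(\<integral>\<^sup>+x. ennreal (exp (- 4 * x) * (\<alpha> + x)) * indicator {0..} x \<partial>lborel) = ennreal (\<alpha> / 4 + 1 / 16)"
proof -
  have "((\<lambda>x. - exp (- 4 * x) * (\<alpha> / 4 + x / 4 + 1 / 16)) \<longlongrightarrow> 0) at_top"
    by real_asymp
  then have "(\<integral>\<^sup>+x. ennreal (exp (- 4 * x) * (\<alpha> + x)) * indicator {0..} x \<partial>lborel) =
      ennreal (0 - (- exp (- 4 * 0) * (\<alpha> / 4 + 0 / 4 + 1 / 16)))"
    by (intro nn_integral_FTC_atLeast) (use assms in \<open>auto intro!: derivative_eq_intros simp: field_simps\<close>)
  also have "0 - (- exp (- 4 * 0) * (\<alpha> / 4 + 0 / 4 + 1 / 16)) = \<alpha> / 4 + 1 / 16" by simp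
  finally show ?thesis .
qed

lemma nn_integral_even:
  assumes [measurable]: "f \<in> borel_measurable borel" and "\<And>x. f (- x :: real) = f x"
  shows "(\<integral>\<^sup>+x. f x \<partial>lborel) = 2 * (\<integral>\<^sup>+x. f x * indicator {0..} x \<partial>lborel)"
proof -
  have "(\<integral>\<^sup>+x. f x * indicator {..0} x \<partial>lborel) = (\<integral>\<^sup>+x. f x * indicator {0..} x \<partial>lborel)"
    by (subst nn_integral_real_affine[of _ "- 1" 0]) (auto simp: assms(2) indicator_def intro!: nn_integral_cong)
  moreover have "(\<integral>\<^sup>+x. f x \<partial>lborel) = (\<integral>\<^sup>+x. f x * indicator {..0} x + f x * indicator {0..} x \<partial>lborel)"
    by (rule nn_integral_cong_AE, rule AE_mp[OF AE_lborel_singleton[of 0]]) (auto simp: indicator_def intro!: AE_I2)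
  ultimately show ?thesis by (simp add: nn_integral_add mult_2)
qed

text \<open>For fixed \<open>a \<ge> 0\<close> the volume is constantly 4 a for \<open>b\<close> in
  [0,a] and grows linearly outside, with slope 4 for \<open>k = 2\<close> and slope 2 otherwise. The
  three pieces contribute exp (- 4 a) / c, a exp (- 4 a) and again exp (- 4 a) / c.\<close>

lemma nn_integral_exp_vol_inner:
  assumes a: "a \<ge> 0"
  shows "(\<integral>\<^sup>+b. ennreal (exp (- vol k a b)) \<partial>lborel) = ennreal (exp (- 4 * a) * ((if k = 2 then 1 / 2 else 1) + a))"
proof -
  define c where "c = (if k = 2 then 4 else 2 :: real)"
  have c: "c > 0" by (simp add: c_def)
  have v: "vol k a b = (if b < 0 then 4 * a - c * b else if b \<le> a then 4 * a else (4 - c) * a + c * b)" for b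
    using a by (auto simp: vol_def reach_def max_def abs_if c_def)
  have ne: "AE b in lborel. b \<noteq> 0 \<and> b \<noteq> a"
    using AE_lborel_singleton[of 0] AE_lborel_singleton[of a] by eventually_elim auto
  have "(\<integral>\<^sup>+b. ennreal (exp (- vol k a b)) \<partial>lborel) =
      (\<integral>\<^sup>+b. ennreal (exp (- 4 * a)) * (ennreal (exp (c * b)) * indicator {..0} b) +
        (ennreal (exp (- 4 * a)) * indicator {0..a} b +
         ennreal (exp (- (4 - c) * a)) * (ennreal (exp (- c * b)) * indicator {a..} b)) \<partial>lborel)"
  proof (rule nn_integral_cong_AE, use ne in eventually_elim)
    case (elim b)
    show ?case
      using elim a by (auto simp: v indicator_def ennreal_mult[symmetric] exp_add[symmetric] algebra_simps)
  qed
  also have "\<dots> = ennreal (exp (- 4 * a)) * (\<integral>\<^sup>+b. ennreal (exp (c * b)) * indicator {..0} b \<partial>lborel) +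
      (ennreal (exp (- 4 * a)) * emeasure lborel {0..a} +
       ennreal (exp (- (4 - c) * a)) * (\<integral>\<^sup>+b. ennreal (exp (- c * b)) * indicator {a..} b \<partial>lborel))"
    by (simp add: nn_integral_add nn_integral_cmult nn_integral_cmult_indicator)
  also have "(\<integral>\<^sup>+b. ennreal (exp (c * b)) * indicator {..0} b \<partial>lborel) = (\<integral>\<^sup>+b. ennreal (exp (- c * b)) * indicator {0..} b \<partial>lborel)"
    by (subst nn_integral_real_affine[of _ "- 1" 0]) (auto simp: indicator_def intro!: nn_integral_cong)
  also have "ennreal (exp (- 4 * a)) * (\<integral>\<^sup>+b. ennreal (exp (- c * b)) * indicator {0..} b \<partial>lborel) +
      (ennreal (exp (- 4 * a)) * emeasure lborel {0..a} +
       ennreal (exp (- (4 - c) * a)) * (\<integral>\<^sup>+b. ennreal (exp (- c * b)) * indicator {a..} b \<partial>lborel)) =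
      ennreal (exp (- 4 * a) * (1 / c) + (exp (- 4 * a) * a + exp (- (4 - c) * a) * (exp (- c * a) / c)))"
    unfolding nn_integral_exp_tail[OF c] using a c by (simp add: ennreal_mult[symmetric] del: ennreal_plus flip: ennreal_plus)
  also have "exp (- 4 * a) * (1 / c) + (exp (- 4 * a) * a + exp (- (4 - c) * a) * (exp (- c * a) / c)) =
      exp (- 4 * a) * ((if k = 2 then 1 / 2 else 1) + a)"
  proof -
    have "exp (- (4 - c) * a) * exp (- c * a) = exp (- 4 * a)" by (simp add: exp_add[symmetric] algebra_simps)
    then have "exp (- (4 - c) * a) * (exp (- c * a) / c) = exp (- 4 * a) / c" by simp
    then have "exp (- 4 * a) * (1 / c) + (exp (- 4 * a) * a + exp (- (4 - c) * a) * (exp (- c * a) / c)) =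
        exp (- 4 * a) * (2 / c + a)" by (simp only:) (simp add: algebra_simps)
    also have "2 / c = (if k = 2 then 1 / 2 else 1)" by (simp add: c_def)
    finally show ?thesis .
  qed
  finally show ?thesis .
qed

text \<open>By the reflection symmetry of \<open>vol\<close> the inner integral is even in
  \<open>a\<close>. The result is 2 (\<alpha> / 4 + 1 / 16) with \<alpha> = 1/2 for
  \<open>k = 2\<close>, giving 3/8, and \<alpha> = 1 otherwise, giving 5/8.\<close>

lemma nn_integral_exp_vol:
  "(\<integral>\<^sup>+a. \<integral>\<^sup>+b. ennreal (exp (- vol k a b)) \<partial>lborel \<partial>lborel) = ennreal (if k = 2 then 3 / 8 else 5 / 8)"
proof -
  define g where "g a = (\<integral>\<^sup>+b. ennreal (exp (- vol k a b)) \<partial>lborel)" for a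
  define \<alpha> where "\<alpha> = (if k = 2 then 1 / 2 else 1 :: real)"
  have [measurable]: "g \<in> borel_measurable borel" unfolding g_def by measurable
  have "g (- a) = g a" for a
  proof -
    have "g (- a) = (\<integral>\<^sup>+b. ennreal (exp (- vol k (- a) (0 + (- 1) * b))) \<partial>lborel)"
      unfolding g_def by (subst nn_integral_real_affine[of _ "- 1" 0]) auto
    then show ?thesis by (simp add: vol_uminus g_def)
  qed
  then have "(\<integral>\<^sup>+a. g a \<partial>lborel) = 2 * (\<integral>\<^sup>+a. g a * indicator {0..} a \<partial>lborel)" by (intro nn_integral_even) auto
  also have "(\<integral>\<^sup>+a. g a * indicator {0..} a \<partial>lborel) = (\<integral>\<^sup>+a. ennreal (exp (- 4 * a) * (\<alpha> + a)) * indicator {0..} a \<partial>lborel)"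
    by (intro nn_integral_cong) (auto simp: indicator_def g_def nn_integral_exp_vol_inner \<alpha>_def)
  also have "\<dots> = ennreal (\<alpha> / 4 + 1 / 16)"
    by (rule nn_integral_exp_linear_tail) (simp add: \<alpha>_def)
  also have "2 * ennreal (\<alpha> / 4 + 1 / 16) = ennreal (2 * (\<alpha> / 4 + 1 / 16))"
    using ennreal_mult'[of 2 "\<alpha> / 4 + 1 / 16"] by (simp del: ennreal_plus)
  finally have "(\<integral>\<^sup>+a. g a \<partial>lborel) = ennreal (2 * (\<alpha> / 4 + 1 / 16))" .
  moreover have "2 * (\<alpha> / 4 + 1 / 16) = (if k = 2 then 3 / 8 else 5 / 8)" by (simp add: \<alpha>_def)
  ultimately show ?thesis by (simp only: g_def)
qed

lemma nn_integral_exp_abs: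
  assumes "c > 0"
  shows "(\<integral>\<^sup>+b. ennreal (exp (- (c * \<bar>b\<bar>))) \<partial>lborel) = ennreal (2 / c)"
proof -
  have "(\<integral>\<^sup>+b. ennreal (exp (- (c * \<bar>b\<bar>))) \<partial>lborel) = 2 * (\<integral>\<^sup>+b. ennreal (exp (- (c * \<bar>b\<bar>))) * indicator {0..} b \<partial>lborel)"
    by (intro nn_integral_even) auto
  also have "(\<integral>\<^sup>+b. ennreal (exp (- (c * \<bar>b\<bar>))) * indicator {0..} b \<partial>lborel) = (\<integral>\<^sup>+b. ennreal (exp (- c * b)) * indicator {0..} b \<partial>lborel)"
    by (intro nn_integral_cong) (auto simp: indicator_def)
  also have "2 * \<dots> = ennreal (2 / c)"
    unfolding nn_integral_exp_tail[OF assms] using assms ennreal_mult'[of 2 "exp (- c * 0) / c"] by simp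
  finally show ?thesis .
qed

text \<open>Scaling both offsets by n and using homogeneity of \<open>vol\<close> turns the
  integrand into (1 - vol / n)^(n - c). It tends to exp (- vol), and half the exponent dominates it,
  so dominated convergence applies.\<close>

lemma kappa_limit:
  "(\<lambda>n. ennreal (real n ^ 2) * kappa k (1 / sqrt (real n)) (n - c)) \<longlonglongrightarrow> ennreal (if k = 2 then 3 / 8 else 5 / 8)"
proof -
  \<comment> \<open>In scaled offsets the radius 1 / sqrt n becomes sqrt n, so the cutoff disappears
    in the limit. Setting small \<open>n\<close> to 0 lets the dominating function work for the
    whole sequence.\<close>
  define u where "u n = (\<lambda>(a, b). of_bool (n \<ge> 2 * c + 1 \<and> \<bar>a\<bar> < sqrt (real n) \<and> \<bar>b\<bar> < sqrt (real n)) *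
    ennreal (1 - vol k a b / real n) ^ (n - c))" for n :: nat
  have "(\<lambda>n. \<integral>\<^sup>+x. u n x \<partial>(lborel \<Otimes>\<^sub>M lborel)) \<longlonglongrightarrow> (\<integral>\<^sup>+(a, b). ennreal (exp (- vol k a b)) \<partial>(lborel \<Otimes>\<^sub>M lborel))"
  proof (rule nn_integral_dominated_convergence[where w = "\<lambda>(a, b). ennreal (exp (- \<bar>a\<bar>)) * ennreal (exp (- \<bar>b\<bar>))"])
    show "u n \<in> borel_measurable (lborel \<Otimes>\<^sub>M lborel)" for n unfolding u_def by measurable
    show "(\<lambda>(a, b). ennreal (exp (- vol k a b))) \<in> borel_measurable (lborel \<Otimes>\<^sub>M lborel)" by measurable
    show "(\<lambda>(a, b). ennreal (exp (- \<bar>a\<bar>)) * ennreal (exp (- \<bar>b\<bar>))) \<in> borel_measurable (lborel \<Otimes>\<^sub>M lborel)" by measurable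
    show "AE x in lborel \<Otimes>\<^sub>M lborel. u n x \<le> (case x of (a, b) \<Rightarrow> ennreal (exp (- \<bar>a\<bar>)) * ennreal (exp (- \<bar>b\<bar>)))" for n
    proof (rule AE_I2, clarify)
      fix a b :: real
      show "u n (a, b) \<le> ennreal (exp (- \<bar>a\<bar>)) * ennreal (exp (- \<bar>b\<bar>))"
      proof (cases "n \<ge> 2 * c + 1 \<and> \<bar>a\<bar> < sqrt (real n) \<and> \<bar>b\<bar> < sqrt (real n)")
        case True
        have v: "2 * (\<bar>a\<bar> + \<bar>b\<bar>) \<le> vol k a b" by (rule vol_ge)
        have "0 \<le> 2 * (\<bar>a\<bar> + \<bar>b\<bar>)" by simp
        then have "0 \<le> vol k a b" using v by (rule order_trans)
        then have "ennreal (1 - vol k a b / real n) ^ (n - c) \<le> ennreal (exp (- vol k a b / 2))"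
          using True by (intro one_minus_power_le) auto
        also have "\<dots> \<le> ennreal (exp (- \<bar>a\<bar> + - \<bar>b\<bar>))" using v by (intro ennreal_leI) simp
        also have "\<dots> = ennreal (exp (- \<bar>a\<bar>)) * ennreal (exp (- \<bar>b\<bar>))" unfolding exp_add by (rule ennreal_mult) auto
        finally show ?thesis using True by (simp add: u_def)
      next
        case False
        then have "u n (a, b) = 0" unfolding u_def by (simp only: prod.case of_bool_eq mult_zero_left)
        then show ?thesis by simp
      qed
    qed
    have "(\<integral>\<^sup>+x. (case x of (a, b) \<Rightarrow> ennreal (exp (- \<bar>a\<bar>)) * ennreal (exp (- \<bar>b\<bar>))) \<partial>(lborel \<Otimes>\<^sub>M lborel)) =
        (\<integral>\<^sup>+a. \<integral>\<^sup>+b. ennreal (exp (- \<bar>a\<bar>)) * ennreal (exp (- \<bar>b\<bar>)) \<partial>lborel \<partial>lborel)"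
      by (subst lborel.nn_integral_fst[symmetric]) auto
    also have "\<dots> = ennreal 2 * ennreal 2"
      using nn_integral_exp_abs[of 1] by (simp add: nn_integral_cmult nn_integral_multc)
    finally show "(\<integral>\<^sup>+x. (case x of (a, b) \<Rightarrow> ennreal (exp (- \<bar>a\<bar>)) * ennreal (exp (- \<bar>b\<bar>))) \<partial>(lborel \<Otimes>\<^sub>M lborel)) < \<infinity>"
      by (simp add: ennreal_mult_less_top)
    show "AE x in lborel \<Otimes>\<^sub>M lborel. (\<lambda>n. u n x) \<longlonglongrightarrow> (case x of (a, b) \<Rightarrow> ennreal (exp (- vol k a b)))"
    proof (rule AE_I2, clarify)
      fix a b :: real
      have "filterlim (\<lambda>n. sqrt (real n)) at_top sequentially"
        by (rule filterlim_compose[OF sqrt_at_top filterlim_real_sequentially])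
      then have "\<forall>\<^sub>F n in sequentially. \<bar>a\<bar> < sqrt (real n)" "\<forall>\<^sub>F n in sequentially. \<bar>b\<bar> < sqrt (real n)"
        by (simp_all add: filterlim_at_top_dense)
      then have "\<forall>\<^sub>F n in sequentially. ennreal (1 - vol k a b / real n) ^ (n - c) = u n (a, b)"
        using eventually_ge_at_top[of "2 * c + 1"] by eventually_elim (simp add: u_def)
      then show "(\<lambda>n. u n (a, b)) \<longlonglongrightarrow> ennreal (exp (- vol k a b))"
        by (rule Lim_transform_eventually[OF tendsto_one_minus_power])
    qed
  qed
  also have "(\<integral>\<^sup>+(a, b). ennreal (exp (- vol k a b)) \<partial>(lborel \<Otimes>\<^sub>M lborel)) = ennreal (if k = 2 then 3 / 8 else 5 / 8)"
    by (subst lborel.nn_integral_fst[symmetric]) (auto simp: nn_integral_exp_vol)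
  finally have lim: "(\<lambda>n. \<integral>\<^sup>+x. u n x \<partial>(lborel \<Otimes>\<^sub>M lborel)) \<longlonglongrightarrow> ennreal (if k = 2 then 3 / 8 else 5 / 8)" .
  have "(\<integral>\<^sup>+x. u n x \<partial>(lborel \<Otimes>\<^sub>M lborel)) = ennreal (real n ^ 2) * kappa k (1 / sqrt (real n)) (n - c)"
    if n: "n \<ge> 2 * c + 1" for n
  proof -
    define r where "r = 1 / sqrt (real n)"
    have n0: "real n > 0" using n by simp
    have sq: "sqrt (real n) / real n = r" using n0 by (simp add: r_def field_simps)
    have lt: "\<bar>x / real n\<bar> < r \<longleftrightarrow> \<bar>x\<bar> < sqrt (real n)" for x
      unfolding sq[symmetric] using n0 by (simp add: abs_divide divide_less_cancel)
    have scale: "(\<integral>\<^sup>+x. f x \<partial>lborel) = ennreal (1 / real n) * (\<integral>\<^sup>+x. f (x / real n) \<partial>lborel)"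
      if "f \<in> borel_measurable borel" for f
      using nn_integral_real_affine[OF that, of "1 / real n" 0] n0 by simp
    have vs: "vol k (a / real n) (b / real n) = vol k a b / real n" for a b
      using vol_scale[of "1 / real n" k a b] by simp
    have "kappa k r (n - c) = ennreal (1 / real n) * (\<integral>\<^sup>+a. \<integral>\<^sup>+b.
        of_bool (\<bar>a / real n\<bar> < r \<and> \<bar>b\<bar> < r) * ennreal (1 - vol k (a / real n) b) ^ (n - c) \<partial>lborel \<partial>lborel)"
      unfolding kappa_def by (rule scale) measurable
    also have "\<dots> = ennreal (1 / real n) * (\<integral>\<^sup>+a. ennreal (1 / real n) * (\<integral>\<^sup>+b.
        of_bool (\<bar>a / real n\<bar> < r \<and> \<bar>b / real n\<bar> < r) * ennreal (1 - vol k (a / real n) (b / real n)) ^ (n - c) \<partial>lborel) \<partial>lborel)"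
      by (intro arg_cong2[where f = times] refl nn_integral_cong scale) measurable
    also have "\<dots> = ennreal (1 / real n) * (\<integral>\<^sup>+a. ennreal (1 / real n) * (\<integral>\<^sup>+b. u n (a, b) \<partial>lborel) \<partial>lborel)"
      using n by (simp only: lt vs u_def prod.case simp_thms)
    also have "\<dots> = ennreal (1 / real n) * (ennreal (1 / real n) * (\<integral>\<^sup>+a. (\<integral>\<^sup>+b. u n (a, b) \<partial>lborel) \<partial>lborel))"
      by (subst nn_integral_cmult) (auto simp: u_def)
    also have "(\<integral>\<^sup>+a. (\<integral>\<^sup>+b. u n (a, b) \<partial>lborel) \<partial>lborel) = (\<integral>\<^sup>+x. u n x \<partial>(lborel \<Otimes>\<^sub>M lborel))"
      by (rule lborel.nn_integral_fst) (simp add: u_def)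
    finally have "ennreal (real n ^ 2) * kappa k r (n - c) =
        ennreal (real n ^ 2) * (ennreal (1 / real n) * (ennreal (1 / real n) * (\<integral>\<^sup>+x. u n x \<partial>(lborel \<Otimes>\<^sub>M lborel))))" by simp
    also have "\<dots> = ennreal (real n ^ 2 * (1 / real n) * (1 / real n)) * (\<integral>\<^sup>+x. u n x \<partial>(lborel \<Otimes>\<^sub>M lborel))"
      by (subst ennreal_mult, simp, simp, subst ennreal_mult, simp, simp, simp only: mult.assoc)
    also have "real n ^ 2 * (1 / real n) * (1 / real n) = 1" using n0 by (simp add: power2_eq_square)
    finally show ?thesis by (simp add: r_def)
  qed
  then have "\<forall>\<^sub>F n in sequentially. (\<integral>\<^sup>+x. u n x \<partial>(lborel \<Otimes>\<^sub>M lborel)) = ennreal (real n ^ 2) * kappa k (1 / sqrt (real n)) (n - c)"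
    by (intro eventually_sequentiallyI[of "2 * c + 1"])
  then show ?thesis by (rule Lim_transform_eventually[OF lim])
qed

text \<open>The same argument with a single free offset, hence only one factor n from the
  scaling.\<close>

lemma kappa0_limit:
  "(\<lambda>n. ennreal (real n) * kappa0 (1 / sqrt (real n)) (n - c)) \<longlonglongrightarrow> ennreal (1 / 2)"
proof -
  define u where "u n b = of_bool (n \<ge> 2 * c + 1 \<and> \<bar>b\<bar> < sqrt (real n)) *
    ennreal (1 - vol 2 0 b / real n) ^ (n - c)" for n :: nat and b
  have "(\<lambda>n. \<integral>\<^sup>+b. u n b \<partial>lborel) \<longlonglongrightarrow> (\<integral>\<^sup>+b. ennreal (exp (- vol 2 0 b)) \<partial>lborel)"
  proof (rule nn_integral_dominated_convergence[where w = "\<lambda>b. ennreal (exp (- \<bar>b\<bar>))"])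
    show "u n \<in> borel_measurable lborel" for n unfolding u_def by measurable
    show "(\<lambda>b. ennreal (exp (- vol 2 0 b))) \<in> borel_measurable lborel" by measurable
    show "AE b in lborel. u n b \<le> ennreal (exp (- \<bar>b\<bar>))" for n
    proof (rule AE_I2)
      fix b :: real
      show "u n b \<le> ennreal (exp (- \<bar>b\<bar>))"
      proof (cases "n \<ge> 2 * c + 1")
        case True
        have v: "0 \<le> vol 2 0 b" "\<bar>b\<bar> \<le> vol 2 0 b / 2" by (simp_all add: vol_zero)
        have "ennreal (1 - vol 2 0 b / real n) ^ (n - c) \<le> ennreal (exp (- vol 2 0 b / 2))"
          using True v by (intro one_minus_power_le) auto
        also have "\<dots> \<le> ennreal (exp (- \<bar>b\<bar>))" using v by (intro ennreal_leI) simp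
        finally show ?thesis by (auto simp: u_def)
      qed (simp add: u_def)
    qed
    show "(\<lambda>b. ennreal (exp (- \<bar>b\<bar>))) \<in> borel_measurable lborel" by measurable
    show "(\<integral>\<^sup>+b. ennreal (exp (- \<bar>b\<bar>)) \<partial>lborel) < \<infinity>" using nn_integral_exp_abs[of 1] by simp
    show "AE b in lborel. (\<lambda>n. u n b) \<longlonglongrightarrow> ennreal (exp (- vol 2 0 b))"
    proof (rule AE_I2)
      fix b :: real
      have "filterlim (\<lambda>n. sqrt (real n)) at_top sequentially"
        by (rule filterlim_compose[OF sqrt_at_top filterlim_real_sequentially])
      then have "\<forall>\<^sub>F n in sequentially. \<bar>b\<bar> < sqrt (real n)"
        by (simp add: filterlim_at_top_dense)
      then have "\<forall>\<^sub>F n in sequentially. ennreal (1 - vol 2 0 b / real n) ^ (n - c) = u n b"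
        using eventually_ge_at_top[of "2 * c + 1"] by eventually_elim (simp add: u_def)
      then show "(\<lambda>n. u n b) \<longlonglongrightarrow> ennreal (exp (- vol 2 0 b))"
        by (rule Lim_transform_eventually[OF tendsto_one_minus_power])
    qed
  qed
  also have "(\<integral>\<^sup>+b. ennreal (exp (- vol 2 0 b)) \<partial>lborel) = ennreal (1 / 2)"
    using nn_integral_exp_abs[of 4] by (simp add: vol_zero)
  finally have lim: "(\<lambda>n. \<integral>\<^sup>+b. u n b \<partial>lborel) \<longlonglongrightarrow> ennreal (1 / 2)" .
  have "(\<integral>\<^sup>+b. u n b \<partial>lborel) = ennreal (real n) * kappa0 (1 / sqrt (real n)) (n - c)"
    if n: "n \<ge> 2 * c + 1" for n
  proof -
    define r where "r = 1 / sqrt (real n)"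
    have n0: "real n > 0" using n by simp
    have sq: "sqrt (real n) / real n = r" using n0 by (simp add: r_def field_simps)
    have lt: "\<bar>x / real n\<bar> < r \<longleftrightarrow> \<bar>x\<bar> < sqrt (real n)" for x
      unfolding sq[symmetric] using n0 by (simp add: abs_divide divide_less_cancel)
    have vs: "vol 2 0 (b / real n) = vol 2 0 b / real n" for b
      by (simp add: vol_zero)
    have "kappa0 r (n - c) = ennreal (1 / real n) * (\<integral>\<^sup>+b. u n b \<partial>lborel)"
      unfolding kappa0_def
    proof -
      have "(\<integral>\<^sup>+b. of_bool (\<bar>b\<bar> < r) * ennreal (1 - vol 2 0 b) ^ (n - c) \<partial>lborel) =
          ennreal (1 / real n) * (\<integral>\<^sup>+b. of_bool (\<bar>b / real n\<bar> < r) * ennreal (1 - vol 2 0 (b / real n)) ^ (n - c) \<partial>lborel)"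
        using n0 by (subst nn_integral_real_affine[of _ "1 / real n" 0]) simp_all
      also have "\<dots> = ennreal (1 / real n) * (\<integral>\<^sup>+b. u n b \<partial>lborel)"
        using n by (simp only: lt vs u_def simp_thms)
      finally show "(\<integral>\<^sup>+b. of_bool (\<bar>b\<bar> < r) * ennreal (1 - vol 2 0 b) ^ (n - c) \<partial>lborel) =
          ennreal (1 / real n) * (\<integral>\<^sup>+b. u n b \<partial>lborel)" .
    qed
    then have "ennreal (real n) * kappa0 r (n - c) = ennreal (real n * (1 / real n)) * (\<integral>\<^sup>+b. u n b \<partial>lborel)"
      by (subst ennreal_mult, simp, simp, simp only: mult.assoc)
    then show ?thesis using n0 by (simp add: r_def)
  qed
  then have "\<forall>\<^sub>F n in sequentially. (\<integral>\<^sup>+b. u n b \<partial>lborel) = ennreal (real n) * kappa0 (1 / sqrt (real n)) (n - c)"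
    by (intro eventually_sequentiallyI[of "2 * c + 1"])
  then show ?thesis by (rule Lim_transform_eventually[OF lim])
qed

section \<open>Laws of large numbers\<close>

text \<open>Chebyshev's inequality, arranged without subtraction so that it can be integrated in
  \<open>ennreal\<close>: \<epsilon>^2 times the indicator of the deviation, plus 2 c Y, is at most
  Y^2 + c^2. It asks for the limit of the means and only an asymptotic upper bound for the second
  moments.\<close>

lemma tendsto_in_probability:
  assumes P: "\<And>n. prob_space (P n)" and Y: "\<And>n. Y n \<in> borel_measurable (P n)"
    and nonneg: "\<And>n \<omega>. 0 \<le> Y n \<omega>" and c: "0 \<le> c"
    and mean: "(\<lambda>n. \<integral>\<^sup>+\<omega>. ennreal (Y n \<omega>) \<partial>P n) \<longlonglongrightarrow> ennreal c"
    and square: "\<forall>\<^sub>F n in sequentially. (\<integral>\<^sup>+\<omega>. ennreal ((Y n \<omega>)\<^sup>2) \<partial>P n) \<le> f n"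
    and f: "f \<longlonglongrightarrow> ennreal (c\<^sup>2)" and \<epsilon>: "\<epsilon> > 0"
  shows "(\<lambda>n. measure (P n) {\<omega> \<in> space (P n). \<bar>Y n \<omega> - c\<bar> > \<epsilon>}) \<longlonglongrightarrow> 0"
proof -
  define e where "e n = (\<integral>\<^sup>+\<omega>. ennreal (Y n \<omega>) \<partial>P n)" for n
  define p where "p n = measure (P n) {\<omega> \<in> space (P n). \<bar>Y n \<omega> - c\<bar> > \<epsilon>}" for n
  have key: "ennreal (\<epsilon>\<^sup>2 * p n) + ennreal (2 * c) * e n \<le> (\<integral>\<^sup>+\<omega>. ennreal ((Y n \<omega>)\<^sup>2) \<partial>P n) + ennreal (c\<^sup>2)" for n
  proof -
    interpret prob_space "P n" by (rule P)
    note Y[measurable]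
    have "ennreal (\<epsilon>\<^sup>2 * p n) + ennreal (2 * c) * e n =
        (\<integral>\<^sup>+\<omega>. ennreal (\<epsilon>\<^sup>2) * indicator {\<omega> \<in> space (P n). \<bar>Y n \<omega> - c\<bar> > \<epsilon>} \<omega> + ennreal (2 * c) * ennreal (Y n \<omega>) \<partial>P n)"
      by (subst nn_integral_add)
        (auto simp: e_def p_def nn_integral_cmult nn_integral_cmult_indicator ennreal_mult emeasure_eq_measure)
    also have "\<dots> \<le> (\<integral>\<^sup>+\<omega>. ennreal ((Y n \<omega>)\<^sup>2) + ennreal (c\<^sup>2) \<partial>P n)"
    proof (rule nn_integral_mono)
      fix \<omega> assume w: "\<omega> \<in> space (P n)"
      have "\<epsilon>\<^sup>2 * (if \<bar>Y n \<omega> - c\<bar> > \<epsilon> then 1 else 0) \<le> (Y n \<omega> - c)\<^sup>2"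
        using \<epsilon> by (auto simp: abs_le_square_iff[symmetric])
      then have "\<epsilon>\<^sup>2 * (if \<bar>Y n \<omega> - c\<bar> > \<epsilon> then 1 else 0) + 2 * c * Y n \<omega> \<le> (Y n \<omega>)\<^sup>2 + c\<^sup>2"
        by (simp add: power2_diff mult.commute mult.left_commute)
      then have "ennreal (\<epsilon>\<^sup>2 * (if \<bar>Y n \<omega> - c\<bar> > \<epsilon> then 1 else 0) + 2 * c * Y n \<omega>) \<le> ennreal ((Y n \<omega>)\<^sup>2 + c\<^sup>2)"
        by (rule ennreal_leI)
      then show "ennreal (\<epsilon>\<^sup>2) * indicator {\<omega> \<in> space (P n). \<bar>Y n \<omega> - c\<bar> > \<epsilon>} \<omega> + ennreal (2 * c) * ennreal (Y n \<omega>)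
          \<le> ennreal ((Y n \<omega>)\<^sup>2) + ennreal (c\<^sup>2)"
        using c w nonneg[of n \<omega>] by (auto simp: indicator_def ennreal_mult' split: if_splits)
    qed
    also have "\<dots> = (\<integral>\<^sup>+\<omega>. ennreal ((Y n \<omega>)\<^sup>2) \<partial>P n) + ennreal (c\<^sup>2)"
      by (subst nn_integral_add) (auto simp: emeasure_space_1)
    finally show ?thesis .
  qed
  have e: "\<forall>\<^sub>F n in sequentially. e n < \<top>" using mean by (intro order_tendstoD) (auto simp: e_def)
  have f': "\<forall>\<^sub>F n in sequentially. f n < \<top>" using f by (intro order_tendstoD) auto
  have le: "\<forall>\<^sub>F n in sequentially. p n \<le> (enn2real (f n) + c\<^sup>2 - 2 * c * enn2real (e n)) / \<epsilon>\<^sup>2"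
    using e f' square
  proof eventually_elim
    case (elim n)
    have "ennreal (\<epsilon>\<^sup>2 * p n) + ennreal (2 * c) * e n \<le> f n + ennreal (c\<^sup>2)"
      using key[of n] elim(3) by (meson add_right_mono order_trans)
    also have "f n = ennreal (enn2real (f n))" using elim by simp
    also have "e n = ennreal (enn2real (e n))" using elim by simp
    finally have "ennreal (\<epsilon>\<^sup>2 * p n + 2 * c * enn2real (e n)) \<le> ennreal (enn2real (f n) + c\<^sup>2)"
      using c by (simp add: p_def ennreal_mult ennreal_plus del: ennreal_enn2real)
    then have "\<epsilon>\<^sup>2 * p n + 2 * c * enn2real (e n) \<le> enn2real (f n) + c\<^sup>2"
      by (subst (asm) ennreal_le_iff) auto
    then show ?case using \<epsilon> by (simp add: field_simps)
  qed
  have AB: "(\<lambda>n. enn2real (e n)) \<longlonglongrightarrow> c" "(\<lambda>n. enn2real (f n)) \<longlonglongrightarrow> c\<^sup>2"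
    using tendsto_enn2real[OF mean] tendsto_enn2real[OF f] c by (auto simp: e_def)
  have "(\<lambda>n. (enn2real (f n) + c\<^sup>2 - 2 * c * enn2real (e n)) / \<epsilon>\<^sup>2) \<longlonglongrightarrow> (c\<^sup>2 + c\<^sup>2 - 2 * c * c) / \<epsilon>\<^sup>2"
    by (rule tendsto_divide[OF tendsto_diff[OF tendsto_add[OF AB(2) tendsto_const] tendsto_mult[OF tendsto_const AB(1)]] tendsto_const])
      (use \<epsilon> in simp)
  then have L: "(\<lambda>n. (enn2real (f n) + c\<^sup>2 - 2 * c * enn2real (e n)) / \<epsilon>\<^sup>2) \<longlonglongrightarrow> 0"
    by (simp add: power2_eq_square)
  have "p \<longlonglongrightarrow> 0"
    by (rule tendsto_sandwich[OF _ le tendsto_const L]) (simp add: p_def)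
  then show ?thesis by (simp add: p_def[abs_def])
qed

section \<open>The two instances: free locations and locations at sample points\<close>

lemma void_pairs_location:
  assumes [measurable]: "U \<in> sets borel"
  shows "void_pairs lborel (\<lambda>u p q. u \<in> U \<and> \<bar>p - u\<bar> < r \<and> \<bar>q - anti u\<bar> < r) (zone k)"
proof
  show "sets lborel = (sets borel :: real set set)" by simp
  show "Measurable.pred (borel \<Otimes>\<^sub>M borel \<Otimes>\<^sub>M borel) (\<lambda>(u, p, q). u \<in> U \<and> \<bar>p - u\<bar> < r \<and> \<bar>q - anti u\<bar> < r)"
    by measurable
  show "Measurable.pred (borel \<Otimes>\<^sub>M borel \<Otimes>\<^sub>M borel \<Otimes>\<^sub>M borel) (\<lambda>(y, p, q, s). zone k y p q s)"
    by (rule zone_measurable)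
qed

text \<open>For counts the location is the point \<open>p\<close> itself. The extra location is then
  a dummy, and a point mass in place of Lebesgue measure makes integrating over it trivial.\<close>

lemma void_pairs_points:
  assumes [measurable]: "U \<in> sets borel"
  shows "void_pairs (return borel (0::real)) (\<lambda>_ p q. p \<in> U \<and> \<bar>q - anti p\<bar> < r) (\<lambda>_ p q. zone 2 p p q)"
proof -
  interpret prob_space "return borel (0::real)" by (intro prob_space_return) simp
  show ?thesis
  proof
    show "sets (return borel (0::real)) = sets borel" by simp
    show "Measurable.pred (borel \<Otimes>\<^sub>M borel \<Otimes>\<^sub>M borel) (\<lambda>(u::real, p, q). p \<in> U \<and> \<bar>q - anti p\<bar> < r)"
      by measurable
    show "Measurable.pred (borel \<Otimes>\<^sub>M borel \<Otimes>\<^sub>M borel \<Otimes>\<^sub>M borel) (\<lambda>(y::real, p, q, s). zone 2 p p q s)"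
      unfolding zone_def by measurable
  qed
qed

lemma nn_integral_U01_shift:
  assumes [measurable]: "f \<in> borel_measurable borel" and "\<And>x. f x \<noteq> 0 \<Longrightarrow> 0 \<le> x \<and> x < 1"
  shows "(\<integral>\<^sup>+x. f x \<partial>U01) = (\<integral>\<^sup>+a. f (c + a) \<partial>lborel)"
proof -
  have "(\<integral>\<^sup>+x. f x \<partial>U01) = (\<integral>\<^sup>+x. f x \<partial>lborel)"
    unfolding nn_integral_U01[OF assms(1)] using assms(2) by (intro nn_integral_cong) (force simp: indicator_def)
  also have "\<dots> = (\<integral>\<^sup>+a. f (c + a) \<partial>lborel)"
    using nn_integral_real_affine[OF assms(1), of 1 c] by simp
  finally show ?thesis .
qed

lemma safe_in_unit:
  assumes "u \<in> safe r" "\<bar>x - u\<bar> < r \<or> \<bar>x - anti u\<bar> < r"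
  shows "0 \<le> x" "x < 1"
proof -
  have "(u < 1 / 2 \<and> anti u = u + 1 / 2 \<and> 3 * r < u \<and> u < 1 / 2 - 3 * r) \<or>
      (u > 1 / 2 \<and> anti u = u - 1 / 2 \<and> 1 / 2 + 3 * r < u \<and> u < 1 - 3 * r)"
    using assms unfolding safe_def anti_def by auto
  then show "0 \<le> x" "x < 1" using assms(2) by (elim disjE; linarith)+
qed

text \<open>At a safe location the survival probability depends only on the offsets of
  \<open>p\<close> and \<open>q\<close>, so the inner integral is \<open>kappa\<close> for every
  location in \<open>U\<close>.\<close>

lemma mean_location:
  assumes U: "U \<in> sets borel" "U \<subseteq> safe r"
  shows "void_pairs.mean lborel (\<lambda>u p q. u \<in> U \<and> \<bar>p - u\<bar> < r \<and> \<bar>q - anti u\<bar> < r) (zone k) m =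
    emeasure lborel U * kappa k r m"
proof -
  interpret void_pairs lborel "\<lambda>u p q. u \<in> U \<and> \<bar>p - u\<bar> < r \<and> \<bar>q - anti u\<bar> < r" "zone k"
    using U(1) by (rule void_pairs_location)
  interpret U01: prob_space U01 by (rule prob_space_U01)
  note U(1)[measurable]
  have "(\<integral>\<^sup>+p. \<integral>\<^sup>+q. of_bool (u \<in> U \<and> \<bar>p - u\<bar> < r \<and> \<bar>q - anti u\<bar> < r) * surv u p q ^ m \<partial>U01 \<partial>U01) =
      kappa k r m * indicator U u" for u
  proof (cases "u \<in> U")
    case True
    then have us: "u \<in> safe r" using U by blast
    have "(\<integral>\<^sup>+p. \<integral>\<^sup>+q. of_bool (u \<in> U \<and> \<bar>p - u\<bar> < r \<and> \<bar>q - anti u\<bar> < r) * surv u p q ^ m \<partial>U01 \<partial>U01) =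
        (\<integral>\<^sup>+p. \<integral>\<^sup>+b. of_bool (\<bar>p - u\<bar> < r \<and> \<bar>b\<bar> < r) * surv u p (anti u + b) ^ m \<partial>lborel \<partial>U01)"
    proof (rule nn_integral_cong)
      fix p
      show "(\<integral>\<^sup>+q. of_bool (u \<in> U \<and> \<bar>p - u\<bar> < r \<and> \<bar>q - anti u\<bar> < r) * surv u p q ^ m \<partial>U01) =
        (\<integral>\<^sup>+b. of_bool (\<bar>p - u\<bar> < r \<and> \<bar>b\<bar> < r) * surv u p (anti u + b) ^ m \<partial>lborel)"
        using True safe_in_unit[OF us] by (subst nn_integral_U01_shift[where c = "anti u"]) auto
    qed
    also have "\<dots> = (\<integral>\<^sup>+a. \<integral>\<^sup>+b. of_bool (\<bar>a\<bar> < r \<and> \<bar>b\<bar> < r) * surv u (u + a) (anti u + b) ^ m \<partial>lborel \<partial>lborel)"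
    proof -
      have "(\<integral>\<^sup>+p. \<integral>\<^sup>+b. of_bool (\<bar>p - u\<bar> < r \<and> \<bar>b\<bar> < r) * surv u p (anti u + b) ^ m \<partial>lborel \<partial>U01) =
          (\<integral>\<^sup>+a. \<integral>\<^sup>+b. of_bool (\<bar>u + a - u\<bar> < r \<and> \<bar>b\<bar> < r) * surv u (u + a) (anti u + b) ^ m \<partial>lborel \<partial>lborel)"
      proof (rule nn_integral_U01_shift)
        show "0 \<le> x \<and> x < 1" if "(\<integral>\<^sup>+b. of_bool (\<bar>x - u\<bar> < r \<and> \<bar>b\<bar> < r) * surv u x (anti u + b) ^ m \<partial>lborel) \<noteq> 0" for x
        proof -
          have "\<bar>x - u\<bar> < r" using that by (cases "\<bar>x - u\<bar> < r") auto
          then show ?thesis using safe_in_unit[OF us] by blast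
        qed
      qed measurable
      then show ?thesis by simp
    qed
    also have "\<dots> = kappa k r m"
      unfolding kappa_def
      by (intro nn_integral_cong) (auto simp: surv_def emeasure_not_zone[OF us] of_bool_def)
    finally show ?thesis using True by simp
  qed simp
  then have "mean m = (\<integral>\<^sup>+u. kappa k r m * indicator U u \<partial>lborel)" by (simp add: mean_def)
  also have "\<dots> = kappa k r m * emeasure lborel U" by (rule nn_integral_cmult_indicator) simp
  finally show ?thesis by (simp add: mult.commute)
qed

text \<open>The location is \<open>p\<close>, so its own offset is 0 and only the offset of
  \<open>q\<close> is integrated; integrating over \<open>p\<close> yields the measure of
  \<open>U\<close>.\<close>

lemma mean_points:
  assumes U: "U \<in> sets borel" "U \<subseteq> safe r" and r: "r > 0"
  shows "void_pairs.mean (return borel (0::real)) (\<lambda>_ p q. p \<in> U \<and> \<bar>q - anti p\<bar> < r) (\<lambda>_ p q. zone 2 p p q) m =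
    emeasure lborel U * kappa0 r m"
proof -
  interpret void_pairs "return borel (0::real)" "\<lambda>_ p q. p \<in> U \<and> \<bar>q - anti p\<bar> < r" "\<lambda>_ p q. zone 2 p p q"
    using U(1) by (rule void_pairs_points)
  interpret U01: prob_space U01 by (rule prob_space_U01)
  note U(1)[measurable]
  have "(\<integral>\<^sup>+q. of_bool (p \<in> U \<and> \<bar>q - anti p\<bar> < r) * surv y p q ^ m \<partial>U01) = kappa0 r m * indicator U p" for y p
  proof (cases "p \<in> U")
    case True
    then have us: "p \<in> safe r" using U by blast
    have "(\<integral>\<^sup>+q. of_bool (p \<in> U \<and> \<bar>q - anti p\<bar> < r) * surv y p q ^ m \<partial>U01) =
        (\<integral>\<^sup>+b. of_bool (\<bar>b\<bar> < r) * surv y p (anti p + b) ^ m \<partial>lborel)"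
      using True safe_in_unit[OF us] by (subst nn_integral_U01_shift[where c = "anti p"]) auto
    also have "\<dots> = kappa0 r m"
      unfolding kappa0_def
      using emeasure_not_zone[OF us, of 0 _ 2] r
      by (intro nn_integral_cong) (auto simp: surv_def of_bool_def)
    finally show ?thesis using True by simp
  qed simp
  then have "mean m = (\<integral>\<^sup>+y. \<integral>\<^sup>+p. kappa0 r m * indicator U p \<partial>U01 \<partial>return borel (0::real))" by (simp add: mean_def)
  also have "\<dots> = (\<integral>\<^sup>+p. kappa0 r m * indicator U p \<partial>U01)" by (subst nn_integral_return) auto
  also have "\<dots> = kappa0 r m * emeasure U01 U" by (simp add: nn_integral_cmult_indicator)
  also have "emeasure U01 U = emeasure lborel U"
  proof -
    have "{0..<1} \<inter> U = U" using U(2) r unfolding safe_def by auto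
    then show ?thesis using U(1) by (simp add: emeasure_U01)
  qed
  finally show ?thesis by (simp add: mult.commute)
qed

section \<open>Moments of the length covered by paired locations\<close>

definition pair_at :: "nat \<Rightarrow> nat \<Rightarrow> real \<Rightarrow> (nat \<Rightarrow> real) \<Rightarrow> real \<Rightarrow> nat \<Rightarrow> nat \<Rightarrow> bool" where
  "pair_at k n r x u i j \<longleftrightarrow> i < n \<and> j < n \<and> i \<noteq> j \<and> \<bar>x i - u\<bar> < r \<and> \<bar>x j - anti u\<bar> < r \<and>
     (\<forall>m\<in>{..<n} - {i, j}. \<not> zone k u (x i) (x j) (x m))"

definition paired :: "nat \<Rightarrow> nat \<Rightarrow> real \<Rightarrow> (nat \<Rightarrow> real) \<Rightarrow> real \<Rightarrow> bool" where
  "paired k n r x u \<longleftrightarrow> (\<exists>i j. pair_at k n r x u i j)"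

text \<open>Of two candidates near the location, the nearer one lies in the zone of the other, which
  was assumed empty; the same holds near the antipode. Safety keeps the two neighbourhoods apart, so
  a candidate on one side is never the exempted index of the other side.\<close>

lemma pair_at_unique:
  assumes u: "u \<in> safe r" and "pair_at k n r x u i j" "pair_at k n r x u i' j'"
  shows "i = i' \<and> j = j'"
proof -
  have sep: "\<bar>u - anti u\<bar> = 1 / 2" by (simp add: anti_def)
  have p: "\<bar>x i - u\<bar> < r" "\<bar>x j - anti u\<bar> < r" "\<bar>x i' - u\<bar> < r" "\<bar>x j' - anti u\<bar> < r"
    and lt: "i < n" "j < n" "i' < n" "j' < n"
    and z: "\<And>m. m < n \<Longrightarrow> m \<noteq> i \<Longrightarrow> m \<noteq> j \<Longrightarrow> \<not> zone k u (x i) (x j) (x m)"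
      "\<And>m. m < n \<Longrightarrow> m \<noteq> i' \<Longrightarrow> m \<noteq> j' \<Longrightarrow> \<not> zone k u (x i') (x j') (x m)"
    using assms(2,3) by (auto simp: pair_at_def)
  have "r < 1 / 4" using u by (auto simp: safe_def)
  then have ne: "x i \<noteq> x j'" "x i' \<noteq> x j" using p sep by linarith+
  have "i = i'"
  proof (rule ccontr)
    assume ii: "i \<noteq> i'"
    have "\<not> zone k u (x i) (x j) (x i')" using z(1)[of i'] lt ii ne by metis
    moreover have "\<not> zone k u (x i') (x j') (x i)" using z(2)[of i] lt ii ne by metis
    ultimately show False unfolding zone_def using linear by blast
  qed
  moreover have "j = j'"
  proof (rule ccontr)
    assume jj: "j \<noteq> j'"
    have "\<not> zone k u (x i) (x j) (x j')" using z(1)[of j'] lt jj ne by metis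
    moreover have "\<not> zone k u (x i') (x j') (x j)" using z(2)[of j] lt jj ne by metis
    ultimately show False unfolding zone_def using linear by blast
  qed
  ultimately show ?thesis ..
qed

text \<open>The distance 6 r is twice the extent 3 r of a zone, so zones and points belonging to two
  such locations cannot meet.\<close>

definition far_apart :: "real \<Rightarrow> real \<Rightarrow> real \<Rightarrow> bool" where
  "far_apart r u v \<longleftrightarrow> 6 * r \<le> \<bar>u - v\<bar> \<and> 6 * r \<le> \<bar>u - anti v\<bar> \<and> 6 * r \<le> \<bar>anti u - v\<bar> \<and> 6 * r \<le> \<bar>anti u - anti v\<bar>"

lemma far_apart_separates:
  assumes f: "far_apart r u v" and s: "\<bar>s - u\<bar> < 3 * r \<or> \<bar>s - anti u\<bar> < 3 * r"
    and s': "\<bar>s' - v\<bar> < 3 * r \<or> \<bar>s' - anti v\<bar> < 3 * r"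
  shows "s \<noteq> s'"
proof
  assume e: "s = s'"
  have f': "6 * r \<le> \<bar>u - v\<bar>" "6 * r \<le> \<bar>u - anti v\<bar>" "6 * r \<le> \<bar>anti u - v\<bar>" "6 * r \<le> \<bar>anti u - anti v\<bar>"
    using f by (simp_all add: far_apart_def)
  from s s' show False unfolding e by (elim disjE) (use f' in linarith)+
qed

lemma far_apart_measurable [measurable (raw)]:
  "f \<in> borel_measurable M \<Longrightarrow> g \<in> borel_measurable M \<Longrightarrow> Measurable.pred M (\<lambda>x. far_apart r (f x) (g x))"
proof -
  assume [measurable]: "f \<in> borel_measurable M" "g \<in> borel_measurable M"
  have [measurable]: "(\<lambda>x. anti (f x)) \<in> borel_measurable M" "(\<lambda>x. anti (g x)) \<in> borel_measurable M" by measurable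
  show ?thesis unfolding far_apart_def by measurable
qed

text \<open>Six intervals of length 12 r: around \<open>u\<close> and \<open>anti u\<close>, and,
  because \<open>anti v\<close> is \<open>v\<close> shifted by 1/2 in either direction, around
  \<open>u\<close> and \<open>anti u\<close> shifted by 1/2 both ways.\<close>

lemma emeasure_not_far_apart:
  assumes "r > 0"
  shows "emeasure lborel {v. \<not> far_apart r u v} \<le> ennreal (72 * r)"
proof -
  define I where "I c = {c - 6 * r..c + 6 * r}" for c
  have I: "emeasure lborel (I c) = ennreal (12 * r)" for c using assms by (simp add: I_def)
  have [measurable]: "I c \<in> sets borel" for c by (simp add: I_def)
  have "{v. \<not> far_apart r u v} \<subseteq> (I u \<union> I (anti u)) \<union> ((I (u + 1 / 2) \<union> I (u - 1 / 2)) \<union> (I (anti u + 1 / 2) \<union> I (anti u - 1 / 2)))"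
  proof
    fix v assume "v \<in> {v. \<not> far_apart r u v}"
    then have "\<bar>u - v\<bar> < 6 * r \<or> \<bar>anti u - v\<bar> < 6 * r \<or> \<bar>u - anti v\<bar> < 6 * r \<or> \<bar>anti u - anti v\<bar> < 6 * r"
      by (auto simp: far_apart_def not_le)
    moreover have "w \<in> I c" if "\<bar>c - w\<bar> < 6 * r" for w c
      using that unfolding I_def atLeastAtMost_iff by linarith
    moreover have "v \<in> I (c + 1 / 2) \<or> v \<in> I (c - 1 / 2)" if "\<bar>c - anti v\<bar> < 6 * r" for c
      using that unfolding I_def atLeastAtMost_iff anti_def by (cases "v < 1 / 2") (simp_all, linarith+)
    ultimately show "v \<in> (I u \<union> I (anti u)) \<union> ((I (u + 1 / 2) \<union> I (u - 1 / 2)) \<union> (I (anti u + 1 / 2) \<union> I (anti u - 1 / 2)))"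
      by blast
  qed
  then have "emeasure lborel {v. \<not> far_apart r u v} \<le> emeasure lborel ((I u \<union> I (anti u)) \<union> ((I (u + 1 / 2) \<union> I (u - 1 / 2)) \<union> (I (anti u + 1 / 2) \<union> I (anti u - 1 / 2))))"
    by (rule emeasure_mono) measurable
  also have "\<dots> \<le> (emeasure lborel (I u) + emeasure lborel (I (anti u))) +
      ((emeasure lborel (I (u + 1 / 2)) + emeasure lborel (I (u - 1 / 2))) +
       (emeasure lborel (I (anti u + 1 / 2)) + emeasure lborel (I (anti u - 1 / 2))))"
    by (intro order_trans[OF emeasure_subadditive] add_mono emeasure_subadditive) auto
  also have "\<dots> = ennreal (72 * r)"
    unfolding I using assms by (simp flip: ennreal_plus)
  finally show ?thesis .
qed

lemma sum_of_bool_unique: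
  assumes "finite I" "\<And>i. finite (J i)"
    and "\<And>i j i' j'. P i j \<Longrightarrow> P i' j' \<Longrightarrow> i = i' \<and> j = j'"
  shows "(\<Sum>i\<in>I. \<Sum>j\<in>J i. of_bool (P i j)) = (of_bool (\<exists>i\<in>I. \<exists>j\<in>J i. P i j) :: ennreal)"
proof (cases "\<exists>i\<in>I. \<exists>j\<in>J i. P i j")
  case True
  then obtain a b where ab: "a \<in> I" "b \<in> J a" "P a b" by blast
  have "(\<Sum>i\<in>I. \<Sum>j\<in>J i. of_bool (P i j)) = (\<Sum>i\<in>I. if i = a then (\<Sum>j\<in>J a. if j = b then 1 else 0) else (0 :: ennreal))"
  proof (intro sum.cong refl)
    fix i assume "i \<in> I"
    show "(\<Sum>j\<in>J i. of_bool (P i j)) = (if i = a then (\<Sum>j\<in>J a. if j = b then 1 else 0) else (0 :: ennreal))"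
    proof -
      have "P i j \<longleftrightarrow> i = a \<and> j = b" for i j using assms(3)[OF ab(3), of i j] ab(3) by metis
      then show ?thesis by (cases "i = a") (simp_all add: of_bool_def)
    qed
  qed
  also have "\<dots> = 1" using ab assms(1,2) by simp
  finally show ?thesis using True by simp
qed (auto intro!: sum.neutral)

lemma paired_measurable:
  assumes "w \<in> N \<rightarrow>\<^sub>M PU n" "y \<in> borel_measurable N"
  shows "Measurable.pred N (\<lambda>x. paired k n r (w x) (y x))"
proof -
  interpret void_pairs lborel "\<lambda>u p q. u \<in> UNIV \<and> \<bar>p - u\<bar> < r \<and> \<bar>q - anti u\<bar> < r" "zone k"
    by (rule void_pairs_location) simp
  have "paired k n r x u \<longleftrightarrow> (\<exists>i\<in>{..<n}. \<exists>j\<in>{..<n} - {i}. hit n x u i j)" for x u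
    unfolding paired_def pair_at_def hit_def by blast
  moreover have "Measurable.pred N (\<lambda>x. \<exists>i\<in>{..<n}. \<exists>j\<in>{..<n} - {i}. hit n (w x) (y x) i j)"
    by (intro pred_intros_finite hit_measurable[OF assms]) simp_all
  ultimately show ?thesis by simp
qed

definition paired_length :: "nat \<Rightarrow> nat \<Rightarrow> real \<Rightarrow> real set \<Rightarrow> (nat \<Rightarrow> real) \<Rightarrow> real" where
  "paired_length k n r U x = measure lborel {u \<in> U. paired k n r x u}"

lemma safe_subset_unit: "r > 0 \<Longrightarrow> safe r \<subseteq> {0..1}"
  by (auto simp: safe_def)

lemma emeasure_subset_safe_le_1:
  assumes "U \<subseteq> safe r" "r > 0"
  shows "emeasure lborel U \<le> 1"
proof -
  have "emeasure lborel U \<le> emeasure lborel {0..1::real}"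
    using assms safe_subset_unit[of r] by (intro emeasure_mono) auto
  then show ?thesis by simp
qed

text \<open>A safe location has at most one pair, so the sum of all hits at a location is an
  indicator and the length is its integral. In the square, pairs of far locations are bounded by the
  two-hit estimate, and near pairs have total measure at most 72 r.\<close>

lemma paired_length_moments:
  assumes U: "U \<in> sets borel" "U \<subseteq> safe r" and r: "r > 0"
  shows "paired_length k n r U \<in> borel_measurable (PU n)"
    "(\<integral>\<^sup>+x. ennreal (paired_length k n r U x) \<partial>PU n) = of_nat (n * (n - 1)) * (emeasure lborel U * kappa k r (n - 2))"
    "(\<integral>\<^sup>+x. ennreal ((paired_length k n r U x)\<^sup>2) \<partial>PU n) \<le>
      of_nat (n ^ 4) * (emeasure lborel U * kappa k r (n - 4))\<^sup>2 + ennreal (72 * r)"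
proof -
  interpret P: prob_space "PU n" by (rule prob_space_PU)
  interpret void_pairs lborel "\<lambda>u p q. u \<in> U \<and> \<bar>p - u\<bar> < r \<and> \<bar>q - anti u\<bar> < r" "zone k"
    using U(1) by (rule void_pairs_location)
  note U(1)[measurable]
  have hit: "hit n x u i j \<longleftrightarrow> u \<in> U \<and> pair_at k n r x u i j" if "i < n" "j \<in> {..<n} - {i}" for x u i j
    using that by (auto simp: hit_def pair_at_def)
  define e where "e x u = (of_bool (u \<in> U \<and> paired k n r x u) :: ennreal)" for x u
  have e_sum: "(\<Sum>i<n. \<Sum>j\<in>{..<n} - {i}. of_bool (hit n x u i j)) = e x u" for x u
  proof -
    have "(\<Sum>i<n. \<Sum>j\<in>{..<n} - {i}. of_bool (hit n x u i j)) =
        (\<Sum>i<n. \<Sum>j\<in>{..<n} - {i}. of_bool (u \<in> U \<and> pair_at k n r x u i j) :: ennreal)"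
      by (intro sum.cong refl) (simp add: hit)
    also have "\<dots> = of_bool (\<exists>i\<in>{..<n}. \<exists>j\<in>{..<n} - {i}. u \<in> U \<and> pair_at k n r x u i j)"
    proof (rule sum_of_bool_unique)
      fix i j i' j' assume "u \<in> U \<and> pair_at k n r x u i j" "u \<in> U \<and> pair_at k n r x u i' j'"
      then show "i = i' \<and> j = j'" using pair_at_unique[of u r k n x i j i' j'] U(2) by blast
    qed simp_all
    also have "(\<exists>i\<in>{..<n}. \<exists>j\<in>{..<n} - {i}. u \<in> U \<and> pair_at k n r x u i j) \<longleftrightarrow> u \<in> U \<and> paired k n r x u"
      by (auto simp: paired_def pair_at_def)
    finally show ?thesis by (simp add: e_def)
  qed
  have paired_m: "Measurable.pred N (\<lambda>z. paired k n r (w z) (y z))"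
    if "w \<in> N \<rightarrow>\<^sub>M PU n" "y \<in> borel_measurable N" for w y and N :: "'z measure"
    using that by (rule paired_measurable)
  note paired_m[measurable (raw)]
  have e_m [measurable]: "(\<lambda>(x, u). e x u) \<in> borel_measurable (PU n \<Otimes>\<^sub>M borel)"
    unfolding e_def by measurable
  have e_x [measurable]: "e x \<in> borel_measurable borel" if "x \<in> space (PU n)" for x
    using measurable_compose[OF measurable_Pair1'[OF that] e_m] by simp
  have len: "ennreal (paired_length k n r U x) = (\<integral>\<^sup>+u. e x u \<partial>lborel)" if x: "x \<in> space (PU n)" for x
  proof -
    have set: "{u \<in> U. paired k n r x u} \<in> sets lborel"
    proof -
      have "Measurable.pred borel (\<lambda>u. e x u = 1)" using e_x[OF x] by measurable
      then have "{u. e x u = 1} \<in> sets borel" by (simp add: pred_def)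
      then show ?thesis by (simp add: e_def Collect_conj_eq)
    qed
    have "emeasure lborel {u \<in> U. paired k n r x u} \<le> emeasure lborel U" by (intro emeasure_mono) auto
    also have "\<dots> \<le> 1" by (rule emeasure_subset_safe_le_1[OF U(2) r])
    finally have "emeasure lborel {u \<in> U. paired k n r x u} \<noteq> \<infinity>" by (auto simp: top_unique)
    then have "ennreal (paired_length k n r U x) = emeasure lborel {u \<in> U. paired k n r x u}"
      unfolding paired_length_def by (rule emeasure_eq_ennreal_measure[symmetric, unfolded infinity_ennreal_def[symmetric]])
    also have "\<dots> = (\<integral>\<^sup>+u. indicator {u \<in> U. paired k n r x u} u \<partial>lborel)" using set by simp
    also have "\<dots> = (\<integral>\<^sup>+u. e x u \<partial>lborel)" by (simp add: e_def indicator_def of_bool_def)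
    finally show ?thesis .
  qed
  have int_m [measurable]: "(\<lambda>x. \<integral>\<^sup>+u. e x u \<partial>lborel) \<in> borel_measurable (PU n)" by measurable
  have "(\<lambda>x. enn2real (\<integral>\<^sup>+u. e x u \<partial>lborel)) \<in> borel_measurable (PU n)" by measurable
  moreover have "paired_length k n r U x = enn2real (\<integral>\<^sup>+u. e x u \<partial>lborel)" if "x \<in> space (PU n)" for x
    unfolding len[OF that, symmetric] by (simp add: paired_length_def)
  ultimately show Ym: "paired_length k n r U \<in> borel_measurable (PU n)"
    by (subst measurable_cong)
  have "(\<integral>\<^sup>+x. ennreal (paired_length k n r U x) \<partial>PU n) = (\<integral>\<^sup>+x. (\<integral>\<^sup>+u. e x u \<partial>lborel) \<partial>PU n)"
    by (intro nn_integral_cong len)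
  also have "\<dots> = of_nat (n * (n - 1)) * mean (n - 2)"
    unfolding e_sum[symmetric] by (rule expectation_sum_hits)
  finally show "(\<integral>\<^sup>+x. ennreal (paired_length k n r U x) \<partial>PU n) = of_nat (n * (n - 1)) * (emeasure lborel U * kappa k r (n - 2))"
    by (simp add: mean_location[OF U])
  define A where "A x u v = e x u * e x v * of_bool (far_apart r u v)" for x u v
  have A_sum: "(\<Sum>i<n. \<Sum>j\<in>{..<n} - {i}. \<Sum>i'<n. \<Sum>j'\<in>{..<n} - {i'}.
      of_bool (hit n x u i j \<and> hit n x v i' j' \<and> far_apart r u v)) = A x u v" for x u v
    unfolding A_def e_sum[symmetric] of_bool_conj mult.assoc sum_distrib_right
    unfolding sum_distrib_left ..
  define B where "B u v = (of_bool (u \<in> U) * of_bool (\<not> far_apart r u v) :: ennreal)" for u v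
  have [measurable]: "(\<lambda>(u, v). B u v) \<in> borel_measurable (borel \<Otimes>\<^sub>M borel)" unfolding B_def by measurable
  have Bu [measurable]: "B u \<in> borel_measurable borel" for u unfolding B_def by measurable
  \<comment> \<open>At far locations this is an identity; elsewhere the second indicator is simply
    bounded by 1.\<close>
  have AB: "e x u * e x v \<le> A x u v + B u v" for x u v
    by (auto simp: A_def B_def e_def)
  have B_le: "(\<integral>\<^sup>+u. \<integral>\<^sup>+v. B u v \<partial>lborel \<partial>lborel) \<le> ennreal (72 * r)"
  proof -
    have "(\<integral>\<^sup>+v. of_bool (\<not> far_apart r u v) \<partial>lborel) = emeasure lborel {v. \<not> far_apart r u v}" for u
    proof -
      have [measurable]: "{v. \<not> far_apart r u v} \<in> sets lborel" by measurable
      show ?thesis using nn_integral_indicator[of "{v. \<not> far_apart r u v}" lborel]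
        by (simp add: indicator_def[abs_def] of_bool_def)
    qed
    then have Bi: "(\<integral>\<^sup>+v. B u v \<partial>lborel) \<le> of_bool (u \<in> U) * ennreal (72 * r)" for u
      unfolding B_def by (subst nn_integral_cmult) (auto intro!: mult_left_mono emeasure_not_far_apart r)
    have "(\<integral>\<^sup>+v. B u v \<partial>lborel) \<le> ennreal (72 * r) * indicator U u" for u
      using Bi[of u] by (cases "u \<in> U") simp_all
    then have "(\<integral>\<^sup>+u. \<integral>\<^sup>+v. B u v \<partial>lborel \<partial>lborel) \<le> (\<integral>\<^sup>+u. ennreal (72 * r) * indicator U u \<partial>lborel)"
      by (intro nn_integral_mono)
    also have "\<dots> = ennreal (72 * r) * emeasure lborel U" by (rule nn_integral_cmult_indicator) simp
    also have "\<dots> \<le> ennreal (72 * r) * 1"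
      by (intro mult_left_mono emeasure_subset_safe_le_1[OF U(2) r]) simp
    finally show ?thesis by simp
  qed
  have "(\<integral>\<^sup>+x. ennreal ((paired_length k n r U x)\<^sup>2) \<partial>PU n) \<le>
      (\<integral>\<^sup>+x. (\<integral>\<^sup>+u. \<integral>\<^sup>+v. A x u v \<partial>lborel \<partial>lborel) + ennreal (72 * r) \<partial>PU n)"
  proof (rule nn_integral_mono)
    fix x assume x: "x \<in> space (PU n)"
    note e_x[OF x, measurable]
    have Am [measurable]: "(\<lambda>(u, v). A x u v) \<in> borel_measurable (borel \<Otimes>\<^sub>M borel)"
      unfolding A_def by measurable
    have Axu [measurable]: "A x u \<in> borel_measurable borel" for u
      unfolding A_def by measurable
    have "ennreal ((paired_length k n r U x)\<^sup>2) = ennreal (paired_length k n r U x) * ennreal (paired_length k n r U x)"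
      by (simp add: power2_eq_square ennreal_mult paired_length_def)
    also have "\<dots> = (\<integral>\<^sup>+u. \<integral>\<^sup>+v. e x u * e x v \<partial>lborel \<partial>lborel)"
      unfolding len[OF x] by (simp add: nn_integral_cmult nn_integral_multc)
    also have "\<dots> \<le> (\<integral>\<^sup>+u. \<integral>\<^sup>+v. A x u v + B u v \<partial>lborel \<partial>lborel)"
      by (intro nn_integral_mono AB)
    also have "\<dots> = (\<integral>\<^sup>+u. (\<integral>\<^sup>+v. A x u v \<partial>lborel) + (\<integral>\<^sup>+v. B u v \<partial>lborel) \<partial>lborel)"
      by (intro nn_integral_cong nn_integral_add) auto
    also have "\<dots> = (\<integral>\<^sup>+u. \<integral>\<^sup>+v. A x u v \<partial>lborel \<partial>lborel) + (\<integral>\<^sup>+u. \<integral>\<^sup>+v. B u v \<partial>lborel \<partial>lborel)"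
      by (rule nn_integral_add) measurable
    also have "\<dots> \<le> (\<integral>\<^sup>+u. \<integral>\<^sup>+v. A x u v \<partial>lborel \<partial>lborel) + ennreal (72 * r)"
      using B_le by (rule add_left_mono)
    finally show "ennreal ((paired_length k n r U x)\<^sup>2) \<le> (\<integral>\<^sup>+u. \<integral>\<^sup>+v. A x u v \<partial>lborel \<partial>lborel) + ennreal (72 * r)" .
  qed
  also have "\<dots> = (\<integral>\<^sup>+x. (\<integral>\<^sup>+u. \<integral>\<^sup>+v. A x u v \<partial>lborel \<partial>lborel) \<partial>PU n) + ennreal (72 * r)"
  proof -
    have [measurable]: "(\<lambda>z. e (w z) (y z)) \<in> borel_measurable N"
      if [measurable]: "w \<in> N \<rightarrow>\<^sub>M PU n" "y \<in> borel_measurable N" for w y and N :: "'z measure"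
    proof -
      have "(\<lambda>z. (\<lambda>(x, u). e x u) (w z, y z)) \<in> borel_measurable N" by (rule measurable_compose[OF _ e_m]) measurable
      then show ?thesis by simp
    qed
    have "(\<lambda>x. \<integral>\<^sup>+u. \<integral>\<^sup>+v. A x u v \<partial>lborel \<partial>lborel) \<in> borel_measurable (PU n)"
      unfolding A_def e_def by measurable
    then show ?thesis by (subst nn_integral_add) (auto simp: P.emeasure_space_1)
  qed
  also have "\<dots> \<le> of_nat (n ^ 4) * (mean (n - 4))\<^sup>2 + ennreal (72 * r)"
  proof (rule add_right_mono)
    have "(\<integral>\<^sup>+\<omega>. (\<integral>\<^sup>+y. (\<integral>\<^sup>+y'. (\<Sum>i<n. \<Sum>j\<in>{..<n} - {i}. \<Sum>k<n. \<Sum>l\<in>{..<n} - {k}.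
      of_bool (hit n \<omega> y i j \<and> hit n \<omega> y' k l \<and> far_apart r y y')) \<partial>lborel) \<partial>lborel) \<partial>PU n) \<le>
      of_nat (n ^ 4) * (mean (n - 4))\<^sup>2"
    proof (rule expectation_sum_far_hits[where far = "\<lambda>y p y' p'. far_apart r y y'"])
      show "Measurable.pred (borel \<Otimes>\<^sub>M borel \<Otimes>\<^sub>M borel \<Otimes>\<^sub>M borel) (\<lambda>(y, p::real, y', p'::real). far_apart r y y')"
        by measurable
      fix y p q y' p' q' assume f: "far_apart r y y'"
        and Q: "y \<in> U \<and> \<bar>p - y\<bar> < r \<and> \<bar>q - anti y\<bar> < r" and Q': "y' \<in> U \<and> \<bar>p' - y'\<bar> < r \<and> \<bar>q' - anti y'\<bar> < r"
      have n1: "\<bar>p - y\<bar> < 3 * r" "\<bar>q - anti y\<bar> < 3 * r" "\<bar>p' - y'\<bar> < 3 * r" "\<bar>q' - anti y'\<bar> < 3 * r"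
        using Q Q' r by auto
      have "\<not> (zone k y p q s \<and> zone k y' p' q' s)" for s
      proof
        assume z: "zone k y p q s \<and> zone k y' p' q' s"
        have "\<bar>s - y\<bar> < 3 * r \<or> \<bar>s - anti y\<bar> < 3 * r" using zone_near z Q by blast
        moreover have "\<bar>s - y'\<bar> < 3 * r \<or> \<bar>s - anti y'\<bar> < 3 * r" using zone_near z Q' by blast
        ultimately have "s \<noteq> s" by (rule far_apart_separates[OF f])
        then show False by simp
      qed
      moreover have "p \<noteq> p'" "p \<noteq> q'" "q \<noteq> p'" "q \<noteq> q'"
        by (rule far_apart_separates[OF f]; simp add: n1)+
      ultimately show "p \<noteq> p' \<and> p \<noteq> q' \<and> q \<noteq> p' \<and> q \<noteq> q' \<and> (\<forall>s. \<not> (zone k y p q s \<and> zone k y' p' q' s))" by blast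
    qed
    then show "(\<integral>\<^sup>+x. (\<integral>\<^sup>+u. \<integral>\<^sup>+v. A x u v \<partial>lborel \<partial>lborel) \<partial>PU n) \<le> of_nat (n ^ 4) * (mean (n - 4))\<^sup>2"
      by (simp only: A_sum)
  qed
  finally show "(\<integral>\<^sup>+x. ennreal ((paired_length k n r U x)\<^sup>2) \<partial>PU n) \<le>
      of_nat (n ^ 4) * (emeasure lborel U * kappa k r (n - 4))\<^sup>2 + ennreal (72 * r)"
    by (simp add: mean_location[OF U])
qed

lemma inverse_sqrt_tendsto_0: "(\<lambda>n. 1 / sqrt (real n)) \<longlonglongrightarrow> 0"
  by real_asymp

lemma paired_length_in_probability:
  assumes U: "\<And>n. U n \<in> sets borel" "\<And>n. U n \<subseteq> safe (1 / sqrt (real n))"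
    and lim: "(\<lambda>n. emeasure lborel (U n)) \<longlonglongrightarrow> ennreal L" and L: "L \<ge> 0" and \<epsilon>: "\<epsilon> > 0"
  shows "(\<lambda>n. measure (PU n) {x \<in> space (PU n).
      \<bar>paired_length k n (1 / sqrt (real n)) (U n) x - L * (if k = 2 then 3 / 8 else 5 / 8)\<bar> > \<epsilon>}) \<longlonglongrightarrow> 0"
proof -
  define c where "c = (if k = 2 then 3 / 8 else 5 / 8 :: real)"
  have c: "c \<ge> 0" by (simp add: c_def)
  define r where "r n = 1 / sqrt (real n)" for n
  \<comment> \<open>At \<open>n = 0\<close> the radius 1 / sqrt 0 is 0, outside the range of the
    moment bounds, so the statistic is replaced there.\<close>
  define Y where "Y n x = (if n = 0 then 0 else paired_length k n (r n) (U n) x)" for n x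
  have r: "r n > 0" if "n > 0" for n using that by (simp add: r_def)
  have Us: "U n \<subseteq> safe (r n)" for n using U(2) by (simp add: r_def)
  have K: "(\<lambda>n. ennreal (real n ^ 2) * kappa k (r n) (n - d)) \<longlonglongrightarrow> ennreal c" for d
    using kappa_limit[of k d] by (simp add: r_def c_def)
  have LK: "(\<lambda>n. emeasure lborel (U n) * (ennreal (real n ^ 2) * kappa k (r n) (n - d))) \<longlonglongrightarrow> ennreal (L * c)" for d
    using tendsto_mult_ennreal[OF lim K[of d]] L c by (simp add: ennreal_mult)
  have "(\<lambda>n. measure (PU n) {x \<in> space (PU n). \<bar>Y n x - L * c\<bar> > \<epsilon>}) \<longlonglongrightarrow> 0"
  proof (rule tendsto_in_probability[where f = "\<lambda>n. (emeasure lborel (U n) * (ennreal (real n ^ 2) * kappa k (r n) (n - 4)))\<^sup>2 + ennreal (72 * r n)"])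
    show "Y n \<in> borel_measurable (PU n)" for n
      using paired_length_moments(1)[OF U(1) Us r] by (cases "n = 0") (auto simp: Y_def[abs_def])
    show "0 \<le> Y n x" for n x by (simp add: Y_def paired_length_def)
    have "(\<lambda>n. ennreal (1 - 1 / real n) * (emeasure lborel (U n) * (ennreal (real n ^ 2) * kappa k (r n) (n - 2)))) \<longlonglongrightarrow> ennreal (1 - 0) * ennreal (L * c)"
      by (intro tendsto_mult_ennreal LK tendsto_ennrealI tendsto_intros lim_const_over_n) (use L c in auto)
    moreover have "\<forall>\<^sub>F n in sequentially. ennreal (1 - 1 / real n) * (emeasure lborel (U n) * (ennreal (real n ^ 2) * kappa k (r n) (n - 2))) = (\<integral>\<^sup>+x. ennreal (Y n x) \<partial>PU n)"
    proof (rule eventually_sequentiallyI[of 1])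
      fix n :: nat assume n: "n \<ge> 1"
      have "(of_nat (n * (n - 1)) :: ennreal) = ennreal (real (n * (n - 1)))" by (simp add: ennreal_of_nat_eq_real_of_nat)
      also have "real (n * (n - 1)) = (1 - 1 / real n) * real n ^ 2" using n by (simp add: of_nat_diff field_simps power2_eq_square)
      also have "ennreal ((1 - 1 / real n) * real n ^ 2) = ennreal (1 - 1 / real n) * ennreal (real n ^ 2)"
        using n by (intro ennreal_mult) auto
      finally show "ennreal (1 - 1 / real n) * (emeasure lborel (U n) * (ennreal (real n ^ 2) * kappa k (r n) (n - 2))) = (\<integral>\<^sup>+x. ennreal (Y n x) \<partial>PU n)"
        using n paired_length_moments(2)[OF U(1)[of n] Us[of n] r[of n], where n = n and k = k] by (simp add: Y_def mult_ac)
    qed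
    ultimately show "(\<lambda>n. \<integral>\<^sup>+x. ennreal (Y n x) \<partial>PU n) \<longlonglongrightarrow> ennreal (L * c)"
      by (simp add: Lim_transform_eventually)
    show "\<forall>\<^sub>F n in sequentially. (\<integral>\<^sup>+x. ennreal ((Y n x)\<^sup>2) \<partial>PU n) \<le>
        (emeasure lborel (U n) * (ennreal (real n ^ 2) * kappa k (r n) (n - 4)))\<^sup>2 + ennreal (72 * r n)"
    proof (rule eventually_sequentiallyI[of 1])
      fix n :: nat assume n: "n \<ge> 1"
      have "(of_nat (n ^ 4) :: ennreal) = (ennreal (real n ^ 2))\<^sup>2"
        by (simp add: ennreal_of_nat_eq_real_of_nat ennreal_power flip: power_mult)
      then show "(\<integral>\<^sup>+x. ennreal ((Y n x)\<^sup>2) \<partial>PU n) \<le>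
          (emeasure lborel (U n) * (ennreal (real n ^ 2) * kappa k (r n) (n - 4)))\<^sup>2 + ennreal (72 * r n)"
        using n paired_length_moments(3)[OF U(1)[of n] Us[of n] r[of n], where n = n and k = k] by (simp add: Y_def power_mult_distrib mult_ac)
    qed
    have "(\<lambda>n. (emeasure lborel (U n) * (ennreal (real n ^ 2) * kappa k (r n) (n - 4)))\<^sup>2 + ennreal (72 * r n)) \<longlonglongrightarrow> ennreal (L * c) ^ 2 + ennreal (72 * 0)"
    proof (intro tendsto_add tendsto_ennrealI tendsto_mult tendsto_const)
      show "(\<lambda>n. (emeasure lborel (U n) * (ennreal (real n ^ 2) * kappa k (r n) (n - 4)))\<^sup>2) \<longlonglongrightarrow> (ennreal (L * c))\<^sup>2"
        unfolding power2_eq_square[of "_ * (_ * kappa _ _ _)"] power2_eq_square[of "ennreal _"]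
        by (intro tendsto_mult_ennreal LK) auto
      show "r \<longlonglongrightarrow> 0" unfolding r_def by (rule inverse_sqrt_tendsto_0)
    qed
    then show "(\<lambda>n. (emeasure lborel (U n) * (ennreal (real n ^ 2) * kappa k (r n) (n - 4)))\<^sup>2 + ennreal (72 * r n)) \<longlonglongrightarrow> ennreal ((L * c)\<^sup>2)"
      using L c by (simp add: ennreal_power)
  qed (use \<epsilon> L c prob_space_PU in auto)
  then show ?thesis
    by (rule Lim_transform_eventually)
      (auto simp: Y_def c_def r_def intro!: eventually_sequentiallyI[of 1])
qed

section \<open>Empirical fractions of sample points\<close>

lemma nn_integral_PU_marginal:
  assumes "J \<subseteq> {..<n}" "G \<in> borel_measurable (PiM J (\<lambda>_. U01))"
  shows "(\<integral>\<^sup>+x. G (restrict x J) \<partial>PU n) = (\<integral>\<^sup>+x. G x \<partial>PiM J (\<lambda>_. U01))"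
proof -
  interpret U01: prob_space U01 by (rule prob_space_U01)
  have "emeasure U01 {s. True} = 1" using U01.emeasure_space_1 by simp
  then show ?thesis using nn_integral_PU_void[OF assms, of "\<lambda>_ _. True"] by simp
qed

lemma nn_integral_PU_one:
  assumes "i < n" and [measurable]: "f \<in> borel_measurable borel"
  shows "(\<integral>\<^sup>+x. f (x i) \<partial>PU n) = (\<integral>\<^sup>+p. f p \<partial>U01)"
proof -
  interpret product_sigma_finite "\<lambda>_::nat. U01" by (rule product_sigma_finite_U01)
  have "(\<integral>\<^sup>+x. f (restrict x {i} i) \<partial>PU n) = (\<integral>\<^sup>+x. f (x i) \<partial>PiM {i} (\<lambda>_. U01))"
    using assms(1) by (intro nn_integral_PU_marginal) auto
  also have "\<dots> = (\<integral>\<^sup>+p. f p \<partial>U01)" by (rule product_nn_integral_singleton) measurable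
  finally show ?thesis by simp
qed

lemma nn_integral_PU_two:
  assumes "i < n" "j < n" "i \<noteq> j" and [measurable]: "(\<lambda>(p, q). F p q) \<in> borel_measurable (borel \<Otimes>\<^sub>M borel)"
  shows "(\<integral>\<^sup>+x. F (x i) (x j) \<partial>PU n) = (\<integral>\<^sup>+p. \<integral>\<^sup>+q. F p q \<partial>U01 \<partial>U01)"
proof -
  have "(\<integral>\<^sup>+x. F (restrict x {i, j} i) (restrict x {i, j} j) \<partial>PU n) = (\<integral>\<^sup>+x. F (x i) (x j) \<partial>PiM {i, j} (\<lambda>_. U01))"
  proof (rule nn_integral_PU_marginal)
    have "(\<lambda>x. (\<lambda>(p, q). F p q) (x i, x j)) \<in> borel_measurable (PiM {i, j} (\<lambda>_. U01))"
      by (rule measurable_compose[OF _ assms(4)]) measurable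
    then show "(\<lambda>x. F (x i) (x j)) \<in> borel_measurable (PiM {i, j} (\<lambda>_. U01))" by simp
  qed (use assms in auto)
  also have "\<dots> = (\<integral>\<^sup>+p. \<integral>\<^sup>+q. F p q \<partial>U01 \<partial>U01)" by (rule nn_integral_PiM_pair[OF assms(3,4)])
  finally show ?thesis by simp
qed

definition fraction :: "nat \<Rightarrow> real set \<Rightarrow> (nat \<Rightarrow> real) \<Rightarrow> real" where
  "fraction n A x = real (card {i \<in> {..<n}. x i \<in> A}) / real n"

lemma fraction_eq_sum: "ennreal (fraction n A x) = ennreal (1 / real n) * (\<Sum>i<n. of_bool (x i \<in> A))"
proof -
  have "(\<Sum>i<n. of_bool (x i \<in> A)) = (ennreal (real (card {i \<in> {..<n}. x i \<in> A})))"
    by (simp add: ennreal_of_nat_eq_real_of_nat[symmetric] of_bool_def sum.If_cases Int_def)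
  then show ?thesis
    by (simp add: fraction_def ennreal_mult[symmetric])
qed

lemma fraction_measurable:
  assumes [measurable]: "A \<in> sets borel"
  shows "fraction n A \<in> borel_measurable (PU n)"
proof -
  have "fraction n A x = (\<Sum>i<n. (if x i \<in> A then 1 else 0)) / real n" for x
    by (simp add: fraction_def sum.If_cases Int_def)
  moreover have "(\<lambda>x. (\<Sum>i<n. (if x i \<in> A then 1 else 0)) / real n) \<in> borel_measurable (PU n)"
  proof (intro borel_measurable_divide borel_measurable_sum)
    fix i assume "i \<in> {..<n}"
    then have [measurable]: "(\<lambda>x. x i) \<in> borel_measurable (PU n)" by (auto intro: measurable_PU_component)
    show "(\<lambda>x. if x i \<in> A then 1 else (0::real)) \<in> borel_measurable (PU n)" by measurable
  qed simp
  ultimately show ?thesis by (simp add: cong: measurable_cong)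
qed

text \<open>In the second moment, different indices are independent and give the square of the
  probability; the n diagonal terms are bounded by 1 each and contribute 1 / n.\<close>

lemma fraction_moments:
  assumes A [measurable]: "A \<in> sets borel" and n: "n > 0"
  shows "(\<integral>\<^sup>+x. ennreal (fraction n A x) \<partial>PU n) = emeasure U01 A"
    "(\<integral>\<^sup>+x. ennreal ((fraction n A x)\<^sup>2) \<partial>PU n) \<le> (emeasure U01 A)\<^sup>2 + ennreal (1 / real n)"
proof -
  interpret P: prob_space "PU n" by (rule prob_space_PU)
  interpret U01: prob_space U01 by (rule prob_space_U01)
  have m: "(\<lambda>x. of_bool (x i \<in> A) :: ennreal) \<in> borel_measurable (PU n)" if "i \<in> {..<n}" for i
  proof -
    have [measurable]: "(\<lambda>x. x i) \<in> borel_measurable (PU n)" using that by (auto intro: measurable_PU_component)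
    show ?thesis by measurable
  qed
  have p: "(\<integral>\<^sup>+p. of_bool (p \<in> A) \<partial>U01) = emeasure U01 A"
  proof -
    have "A \<in> sets U01" by (simp add: sets_U01)
    then show ?thesis using nn_integral_indicator[of A U01] by (simp add: indicator_def[abs_def] of_bool_def)
  qed
  have one: "(\<integral>\<^sup>+x. of_bool (x i \<in> A) \<partial>PU n) = emeasure U01 A" if "i < n" for i
    using nn_integral_PU_one[OF that, of "\<lambda>p. of_bool (p \<in> A)"] p by simp
  have cn: "ennreal (1 / real n) * of_nat n = 1"
    using n by (simp add: ennreal_of_nat_eq_real_of_nat ennreal_mult[symmetric])
  have "(\<integral>\<^sup>+x. ennreal (fraction n A x) \<partial>PU n) = ennreal (1 / real n) * (\<Sum>i<n. \<integral>\<^sup>+x. of_bool (x i \<in> A) \<partial>PU n)"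
    unfolding fraction_eq_sum
    by (subst nn_integral_cmult, intro borel_measurable_sum m, assumption, subst nn_integral_sum[OF m], assumption, rule refl)
  also have "\<dots> = (ennreal (1 / real n) * of_nat n) * emeasure U01 A" by (simp add: one mult.assoc)
  finally show "(\<integral>\<^sup>+x. ennreal (fraction n A x) \<partial>PU n) = emeasure U01 A" by (simp add: cn)
  have two: "(\<integral>\<^sup>+x. of_bool (x i \<in> A) * of_bool (x j \<in> A) \<partial>PU n) \<le> (emeasure U01 A)\<^sup>2 + of_bool (i = j)"
    if "i < n" "j < n" for i j
  proof (cases "i = j")
    case True
    have "(\<integral>\<^sup>+x. of_bool (x i \<in> A) * of_bool (x j \<in> A) \<partial>PU n) \<le> (\<integral>\<^sup>+x. 1 \<partial>PU n)"
      by (intro nn_integral_mono) auto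
    then show ?thesis using True by (simp add: P.emeasure_space_1 add_increasing)
  next
    case False
    have "(\<integral>\<^sup>+x. of_bool (x i \<in> A) * of_bool (x j \<in> A) \<partial>PU n) = (\<integral>\<^sup>+p. \<integral>\<^sup>+q. of_bool (p \<in> A) * of_bool (q \<in> A) \<partial>U01 \<partial>U01)"
      by (rule nn_integral_PU_two[OF that False, where F = "\<lambda>p q. of_bool (p \<in> A) * of_bool (q \<in> A)"]) measurable
    also have "\<dots> = (emeasure U01 A)\<^sup>2"
      by (simp add: nn_integral_cmult nn_integral_multc p power2_eq_square)
    finally show ?thesis using False by simp
  qed
  have sq: "ennreal ((fraction n A x)\<^sup>2) = ennreal ((1 / real n)\<^sup>2) * (\<Sum>i<n. \<Sum>j<n. of_bool (x i \<in> A) * of_bool (x j \<in> A))" for x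
  proof -
    have "ennreal ((fraction n A x)\<^sup>2) = (ennreal (fraction n A x))\<^sup>2"
      by (simp add: fraction_def ennreal_power)
    then show ?thesis
      unfolding fraction_eq_sum power_mult_distrib power2_eq_square[of "sum _ _"] sum_product
      by (subst (asm) ennreal_power) auto
  qed
  have "(\<integral>\<^sup>+x. ennreal ((fraction n A x)\<^sup>2) \<partial>PU n) =
      ennreal ((1 / real n)\<^sup>2) * (\<Sum>i<n. \<Sum>j<n. \<integral>\<^sup>+x. of_bool (x i \<in> A) * of_bool (x j \<in> A) \<partial>PU n)"
  proof -
    have mm: "(\<lambda>x. of_bool (x i \<in> A) * of_bool (x j \<in> A) :: ennreal) \<in> borel_measurable (PU n)"
      if "i \<in> {..<n}" "j \<in> {..<n}" for i j
      using m that by (intro borel_measurable_times_ennreal) auto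
    have "(\<integral>\<^sup>+x. ennreal ((fraction n A x)\<^sup>2) \<partial>PU n) =
        ennreal ((1 / real n)\<^sup>2) * (\<integral>\<^sup>+x. (\<Sum>i<n. \<Sum>j<n. of_bool (x i \<in> A) * of_bool (x j \<in> A)) \<partial>PU n)"
      unfolding sq by (intro nn_integral_cmult borel_measurable_sum mm)
    also have "(\<integral>\<^sup>+x. (\<Sum>i<n. \<Sum>j<n. of_bool (x i \<in> A) * of_bool (x j \<in> A)) \<partial>PU n) =
        (\<Sum>i<n. \<integral>\<^sup>+x. (\<Sum>j<n. of_bool (x i \<in> A) * of_bool (x j \<in> A)) \<partial>PU n)"
      by (intro nn_integral_sum borel_measurable_sum mm)
    also have "\<dots> = (\<Sum>i<n. \<Sum>j<n. \<integral>\<^sup>+x. of_bool (x i \<in> A) * of_bool (x j \<in> A) \<partial>PU n)"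
      by (intro sum.cong refl nn_integral_sum mm)
    finally show ?thesis .
  qed
  also have "\<dots> \<le> ennreal ((1 / real n)\<^sup>2) * (\<Sum>i<n. \<Sum>j<n. (emeasure U01 A)\<^sup>2 + of_bool (i = j))"
    by (intro mult_left_mono sum_mono two) auto
  also have "(\<Sum>i<n. \<Sum>j<n. (emeasure U01 A)\<^sup>2 + of_bool (i = j)) = of_nat n * (of_nat n * (emeasure U01 A)\<^sup>2) + of_nat n"
    by (simp add: sum.distrib of_bool_def distrib_left)
  also have "ennreal ((1 / real n)\<^sup>2) = ennreal (1 / real n) * ennreal (1 / real n)"
    by (simp add: power2_eq_square ennreal_mult[symmetric])
  also have "ennreal (1 / real n) * ennreal (1 / real n) * (of_nat n * (of_nat n * (emeasure U01 A)\<^sup>2) + of_nat n) =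
      (ennreal (1 / real n) * of_nat n) * ((ennreal (1 / real n) * of_nat n) * (emeasure U01 A)\<^sup>2) + ennreal (1 / real n) * (ennreal (1 / real n) * of_nat n)"
    by (simp only: distrib_left mult_ac)
  finally show "(\<integral>\<^sup>+x. ennreal ((fraction n A x)\<^sup>2) \<partial>PU n) \<le> (emeasure U01 A)\<^sup>2 + ennreal (1 / real n)"
    by (simp add: cn)
qed

lemma fraction_in_probability:
  assumes A: "\<And>n. A n \<in> sets borel" and lim: "(\<lambda>n. emeasure U01 (A n)) \<longlonglongrightarrow> ennreal p" and p: "p \<ge> 0" and \<epsilon>: "\<epsilon> > 0"
  shows "(\<lambda>n. measure (PU n) {x \<in> space (PU n). \<bar>fraction n (A n) x - p\<bar> > \<epsilon>}) \<longlonglongrightarrow> 0"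
proof (rule tendsto_in_probability[where f = "\<lambda>n. (emeasure U01 (A n))\<^sup>2 + ennreal (1 / real n)"])
  show "(\<lambda>n. \<integral>\<^sup>+x. ennreal (fraction n (A n) x) \<partial>PU n) \<longlonglongrightarrow> ennreal p"
    by (rule Lim_transform_eventually[OF lim]) (use fraction_moments(1)[OF A] in \<open>auto intro!: eventually_sequentiallyI[of 1]\<close>)
  show "\<forall>\<^sub>F n in sequentially. (\<integral>\<^sup>+x. ennreal ((fraction n (A n) x)\<^sup>2) \<partial>PU n) \<le> (emeasure U01 (A n))\<^sup>2 + ennreal (1 / real n)"
    using fraction_moments(2)[OF A] by (intro eventually_sequentiallyI[of 1]) auto
  have "(\<lambda>n. (emeasure U01 (A n))\<^sup>2 + ennreal (1 / real n)) \<longlonglongrightarrow> ennreal p * ennreal p + ennreal 0"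
    unfolding power2_eq_square by (intro tendsto_add tendsto_mult_ennreal lim tendsto_ennrealI lim_const_over_n) auto
  then show "(\<lambda>n. (emeasure U01 (A n))\<^sup>2 + ennreal (1 / real n)) \<longlonglongrightarrow> ennreal (p\<^sup>2)"
    using p by (simp add: power2_eq_square ennreal_mult)
qed (use assms prob_space_PU fraction_measurable in \<open>auto simp: fraction_def\<close>)

text \<open>Points in mutually nearest position with some antipode, found by placing the location at
  the point itself: with offset 0 the zone for \<open>k = 2\<close> expresses exactly the mutual
  condition.\<close>

definition linked :: "nat \<Rightarrow> real \<Rightarrow> real set \<Rightarrow> (nat \<Rightarrow> real) \<Rightarrow> nat set" where
  "linked n r U x = {i \<in> {..<n}. x i \<in> U \<and> (\<exists>j. pair_at 2 n r x (x i) i j)}"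

text \<open>The partner of a point is unique, so a sum of hits counts linked points. In the square,
  index pairs with nearby points are bounded crudely, with probability 72 r for different indices
  and 1 for equal ones, which after division by n^2 adds at most 72 r + 1 / n.\<close>

lemma linked_fraction_moments:
  assumes U: "U \<in> sets borel" "U \<subseteq> safe r" and r: "r > 0" and n: "n > 0"
  shows "(\<lambda>x. real (card (linked n r U x)) / real n) \<in> borel_measurable (PU n)"
    "(\<integral>\<^sup>+x. ennreal (real (card (linked n r U x)) / real n) \<partial>PU n) =
      ennreal (1 - 1 / real n) * (emeasure lborel U * (ennreal (real n) * kappa0 r (n - 2)))"
    "(\<integral>\<^sup>+x. ennreal ((real (card (linked n r U x)) / real n)\<^sup>2) \<partial>PU n) \<le>
      (emeasure lborel U * (ennreal (real n) * kappa0 r (n - 4)))\<^sup>2 + ennreal (72 * r + 1 / real n)"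
proof -
  interpret P: prob_space "PU n" by (rule prob_space_PU)
  interpret U01: prob_space U01 by (rule prob_space_U01)
  interpret void_pairs "return borel (0::real)" "\<lambda>_ p q. p \<in> U \<and> \<bar>q - anti p\<bar> < r" "\<lambda>_ p q. zone 2 p p q"
    using U(1) by (rule void_pairs_points)
  note U(1)[measurable]
  have nu1: "emeasure (return borel (0::real)) (space (return borel (0::real))) = 1" by simp
  have const: "(\<integral>\<^sup>+y. c \<partial>return borel (0::real)) = c" for c :: ennreal
    by (simp only: nn_integral_const nu1 mult_1_right)
  define H where "H x i j \<longleftrightarrow> x i \<in> U \<and> pair_at 2 n r x (x i) i j" for x i j
  have hit: "hit n x y i j \<longleftrightarrow> H x i j" if "i < n" "j \<in> {..<n} - {i}" for x y i j
    using that r by (auto simp: H_def hit_def pair_at_def)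
  have Hm: "(\<lambda>x. of_bool (H x i j) :: ennreal) \<in> borel_measurable (PU n)" if "i < n" "j \<in> {..<n} - {i}" for i j
  proof -
    have [measurable]: "Measurable.pred (PU n) (\<lambda>x. hit n x (0::real) i j)"
      using that by (intro hit_measurable[OF measurable_ident_sets[OF refl]]) auto
    have "(\<lambda>x. of_bool (hit n x (0::real) i j) :: ennreal) \<in> borel_measurable (PU n)" by measurable
    then show ?thesis using hit[OF that] by simp
  qed
  have uniq: "j = j'" if "H x i j" "H x i j'" for x i j j'
    using that pair_at_unique[of "x i" r 2 n x i j i j'] U(2) by (auto simp: H_def)
  define L where "L x i = (\<Sum>j\<in>{..<n} - {i}. of_bool (H x i j) :: ennreal)" for x i
  have L_eq: "L x i = of_bool (i \<in> linked n r U x)" if "i < n" for x i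
  proof -
    have "L x i = (\<Sum>a\<in>{i}. \<Sum>j\<in>{..<n} - {i}. of_bool (a = i \<and> H x i j))" by (simp add: L_def)
    also have "\<dots> = of_bool (\<exists>a\<in>{i}. \<exists>j\<in>{..<n} - {i}. a = i \<and> H x i j)"
      by (rule sum_of_bool_unique) (auto dest: uniq)
    also have "(\<exists>a\<in>{i}. \<exists>j\<in>{..<n} - {i}. a = i \<and> H x i j) \<longleftrightarrow> i \<in> linked n r U x"
      using that by (auto simp: linked_def H_def pair_at_def)
    finally show ?thesis .
  qed
  have card_L: "of_nat (card (linked n r U x)) = (\<Sum>i<n. L x i)" for x
  proof -
    have "(\<Sum>i<n. L x i) = (\<Sum>i<n. of_bool (i \<in> linked n r U x))" by (intro sum.cong refl L_eq) simp
    also have "\<dots> = of_nat (card ({..<n} \<inter> linked n r U x))" by (simp add: of_bool_def sum.If_cases)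
    also have "{..<n} \<inter> linked n r U x = linked n r U x" by (auto simp: linked_def)
    finally show ?thesis by simp
  qed
  have Lm: "(\<lambda>x. L x i) \<in> borel_measurable (PU n)" if "i < n" for i
    unfolding L_def using Hm that by (intro borel_measurable_sum) auto
  have div: "ennreal (real c / real n) = ennreal (1 / real n) * of_nat c" for c
    by (simp add: ennreal_of_nat_eq_real_of_nat ennreal_mult[symmetric])
  have sum_m: "(\<lambda>x. \<Sum>i<n. L x i) \<in> borel_measurable (PU n)" by (intro borel_measurable_sum Lm) simp
  have "(\<lambda>x. enn2real (\<Sum>i<n. L x i) / real n) \<in> borel_measurable (PU n)"
    using sum_m by (intro borel_measurable_divide measurable_compose[OF sum_m borel_measurable_enn2real]) auto
  then show "(\<lambda>x. real (card (linked n r U x)) / real n) \<in> borel_measurable (PU n)"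
    unfolding card_L[symmetric] by simp
  have cn: "ennreal (1 / real n) * of_nat n = 1"
    using n by (simp add: ennreal_of_nat_eq_real_of_nat ennreal_mult[symmetric])
  have "(\<integral>\<^sup>+x. ennreal (real (card (linked n r U x)) / real n) \<partial>PU n) = ennreal (1 / real n) * (\<integral>\<^sup>+x. (\<Sum>i<n. L x i) \<partial>PU n)"
    unfolding div card_L using sum_m by (rule nn_integral_cmult)
  also have "(\<integral>\<^sup>+x. (\<Sum>i<n. L x i) \<partial>PU n) =
      (\<integral>\<^sup>+x. (\<integral>\<^sup>+y. (\<Sum>i<n. \<Sum>j\<in>{..<n} - {i}. of_bool (hit n x y i j)) \<partial>return borel (0::real)) \<partial>PU n)"
  proof (intro nn_integral_cong)
    fix x
    have "(\<Sum>i<n. \<Sum>j\<in>{..<n} - {i}. of_bool (hit n x y i j)) = (\<Sum>i<n. L x i)" for y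
      unfolding L_def by (intro sum.cong refl) (simp add: hit)
    then show "(\<Sum>i<n. L x i) = (\<integral>\<^sup>+y. (\<Sum>i<n. \<Sum>j\<in>{..<n} - {i}. of_bool (hit n x y i j)) \<partial>return borel (0::real))"
      by (simp only: const)
  qed
  also have "\<dots> = of_nat (n * (n - 1)) * (emeasure lborel U * kappa0 r (n - 2))"
    unfolding expectation_sum_hits mean_points[OF U r] ..
  also have "ennreal (1 / real n) * (of_nat (n * (n - 1)) * (emeasure lborel U * kappa0 r (n - 2))) =
      ennreal (1 - 1 / real n) * (emeasure lborel U * (ennreal (real n) * kappa0 r (n - 2)))"
  proof -
    have "ennreal (1 / real n) * of_nat (n * (n - 1)) = ennreal (1 / real n * real (n * (n - 1)))"
      by (simp only: ennreal_of_nat_eq_real_of_nat) (simp add: ennreal_mult[symmetric])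
    also have "1 / real n * real (n * (n - 1)) = (1 - 1 / real n) * real n"
      using n by (simp add: of_nat_diff field_simps)
    also have "ennreal \<dots> = ennreal (1 - 1 / real n) * ennreal (real n)" using n by (intro ennreal_mult) auto
    finally show ?thesis by (simp only: mult.assoc[symmetric]) (simp only: mult_ac)
  qed
  finally show "(\<integral>\<^sup>+x. ennreal (real (card (linked n r U x)) / real n) \<partial>PU n) =
      ennreal (1 - 1 / real n) * (emeasure lborel U * (ennreal (real n) * kappa0 r (n - 2)))" .
  define A where "A x = (\<Sum>i<n. \<Sum>j\<in>{..<n} - {i}. \<Sum>k<n. \<Sum>l\<in>{..<n} - {k}.
      of_bool (H x i j \<and> H x k l \<and> far_apart r (x i) (x k)) :: ennreal)" for x
  define B where "B x = (\<Sum>i<n. \<Sum>k<n. of_bool (\<not> far_apart r (x i) (x k)) :: ennreal)" for x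
  have comp: "(\<lambda>x. x i) \<in> borel_measurable (PU n)" if "i < n" for i using that by (rule measurable_PU_component)
  have far_m: "(\<lambda>x. of_bool (\<not> far_apart r (x i) (x k)) :: ennreal) \<in> borel_measurable (PU n)" if "i < n" "k < n" for i k
  proof -
    note comp[OF that(1), measurable] comp[OF that(2), measurable]
    show ?thesis by measurable
  qed
  have B_m: "B \<in> borel_measurable (PU n)"
    unfolding B_def by (intro borel_measurable_sum far_m) auto
  have LL: "(\<Sum>i<n. L x i) * (\<Sum>k<n. L x k) \<le> A x + B x" for x
  proof -
    have "(\<Sum>i<n. L x i) * (\<Sum>k<n. L x k) = (\<Sum>i<n. \<Sum>k<n. L x i * L x k)" by (rule sum_product)
    also have "\<dots> \<le> (\<Sum>i<n. \<Sum>k<n. L x i * L x k * of_bool (far_apart r (x i) (x k)) + of_bool (\<not> far_apart r (x i) (x k)))"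
      by (intro sum_mono) (simp add: L_eq)
    also have "\<dots> = (\<Sum>i<n. \<Sum>k<n. L x i * L x k * of_bool (far_apart r (x i) (x k))) + B x"
      by (simp add: sum.distrib B_def)
    also have "(\<Sum>i<n. \<Sum>k<n. L x i * L x k * of_bool (far_apart r (x i) (x k))) = A x"
    proof -
      have "L x i * L x k * of_bool (far_apart r (x i) (x k)) =
        (\<Sum>j\<in>{..<n} - {i}. \<Sum>l\<in>{..<n} - {k}. of_bool (H x i j \<and> H x k l \<and> far_apart r (x i) (x k)))" for i k
        unfolding L_def sum_distrib_right of_bool_conj mult.assoc unfolding sum_distrib_left ..
      moreover have "A x = (\<Sum>i<n. \<Sum>k<n. \<Sum>j\<in>{..<n} - {i}. \<Sum>l\<in>{..<n} - {k}.
          of_bool (H x i j \<and> H x k l \<and> far_apart r (x i) (x k)))"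
        unfolding A_def by (intro sum.cong refl sum.swap)
      ultimately show ?thesis by (simp only:)
    qed
    finally show ?thesis .
  qed
  have EA: "(\<integral>\<^sup>+x. A x \<partial>PU n) \<le> of_nat (n ^ 4) * (mean (n - 4))\<^sup>2"
  proof -
    have "(\<integral>\<^sup>+x. A x \<partial>PU n) = (\<integral>\<^sup>+\<omega>. (\<integral>\<^sup>+y. (\<integral>\<^sup>+y'. (\<Sum>i<n. \<Sum>j\<in>{..<n} - {i}. \<Sum>k<n. \<Sum>l\<in>{..<n} - {k}.
        of_bool (hit n \<omega> y i j \<and> hit n \<omega> y' k l \<and> far_apart r (\<omega> i) (\<omega> k))) \<partial>return borel (0::real)) \<partial>return borel (0::real)) \<partial>PU n)"
    proof (rule nn_integral_cong)
      fix x
      have "(\<Sum>i<n. \<Sum>j\<in>{..<n} - {i}. \<Sum>k<n. \<Sum>l\<in>{..<n} - {k}.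
        of_bool (hit n x y i j \<and> hit n x y' k l \<and> far_apart r (x i) (x k))) = A x" for y y'
        unfolding A_def by (intro sum.cong refl) (simp add: hit)
      then show "A x = (\<integral>\<^sup>+y. (\<integral>\<^sup>+y'. (\<Sum>i<n. \<Sum>j\<in>{..<n} - {i}. \<Sum>k<n. \<Sum>l\<in>{..<n} - {k}.
        of_bool (hit n x y i j \<and> hit n x y' k l \<and> far_apart r (x i) (x k))) \<partial>return borel (0::real)) \<partial>return borel (0::real))"
        by (simp only: const)
    qed
    also have "\<dots> \<le> of_nat (n ^ 4) * (mean (n - 4))\<^sup>2"
    proof (rule expectation_sum_far_hits[where far = "\<lambda>y p y' p'. far_apart r p p'"])
      show "Measurable.pred (borel \<Otimes>\<^sub>M borel \<Otimes>\<^sub>M borel \<Otimes>\<^sub>M borel) (\<lambda>(y::real, p, y'::real, p'). far_apart r p p')"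
        by measurable
      fix p q p' q' assume f: "far_apart r p p'"
        and Q: "p \<in> U \<and> \<bar>q - anti p\<bar> < r" and Q': "p' \<in> U \<and> \<bar>q' - anti p'\<bar> < r"
      have n1: "\<bar>p - p\<bar> < r" "\<bar>p' - p'\<bar> < r" "\<bar>q - anti p\<bar> < 3 * r" "\<bar>q' - anti p'\<bar> < 3 * r"
        using Q Q' r by auto
      have "\<not> (zone 2 p p q s \<and> zone 2 p' p' q' s)" for s
      proof
        assume z: "zone 2 p p q s \<and> zone 2 p' p' q' s"
        have "\<bar>s - p\<bar> < 3 * r \<or> \<bar>s - anti p\<bar> < 3 * r" using zone_near z Q n1 by blast
        moreover have "\<bar>s - p'\<bar> < 3 * r \<or> \<bar>s - anti p'\<bar> < 3 * r" using zone_near z Q' n1 by blast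
        ultimately have "s \<noteq> s" by (rule far_apart_separates[OF f])
        then show False by simp
      qed
      moreover have "p \<noteq> p'" "p \<noteq> q'" "q \<noteq> p'" "q \<noteq> q'"
        by (rule far_apart_separates[OF f]; simp add: n1 r)+
      ultimately show "p \<noteq> p' \<and> p \<noteq> q' \<and> q \<noteq> p' \<and> q \<noteq> q' \<and> (\<forall>s. \<not> (zone 2 p p q s \<and> zone 2 p' p' q' s))" by blast
    qed
    finally show ?thesis .
  qed
  have far_int: "(\<integral>\<^sup>+x. of_bool (\<not> far_apart r (x i) (x k)) \<partial>PU n) \<le> ennreal (72 * r) + of_bool (i = k)"
    if "i < n" "k < n" for i k
  proof (cases "i = k")
    case True
    have "(\<integral>\<^sup>+x. of_bool (\<not> far_apart r (x i) (x k)) \<partial>PU n) \<le> (\<integral>\<^sup>+x. 1 \<partial>PU n)"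
      by (intro nn_integral_mono) auto
    then show ?thesis using True by (simp add: P.emeasure_space_1 add_increasing)
  next
    case False
    have inner: "(\<integral>\<^sup>+q. of_bool (\<not> far_apart r p q) \<partial>U01) \<le> ennreal (72 * r)" for p
    proof -
      have [measurable]: "{v. \<not> far_apart r p v} \<in> sets lborel" by measurable
      have "(\<integral>\<^sup>+q. of_bool (\<not> far_apart r p q) \<partial>U01) = (\<integral>\<^sup>+q. of_bool (\<not> far_apart r p q) * indicator {0..<1} q \<partial>lborel)"
        by (rule nn_integral_U01) measurable
      also have "\<dots> \<le> (\<integral>\<^sup>+q. indicator {v. \<not> far_apart r p v} q \<partial>lborel)"
        by (intro nn_integral_mono) (auto simp: indicator_def)
      also have "\<dots> = emeasure lborel {v. \<not> far_apart r p v}" by simp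
      finally show ?thesis using emeasure_not_far_apart[OF r, of p] by simp
    qed
    have "(\<integral>\<^sup>+x. of_bool (\<not> far_apart r (x i) (x k)) \<partial>PU n) = (\<integral>\<^sup>+p. \<integral>\<^sup>+q. of_bool (\<not> far_apart r p q) \<partial>U01 \<partial>U01)"
      by (rule nn_integral_PU_two[OF that False, where F = "\<lambda>p q. of_bool (\<not> far_apart r p q)"]) measurable
    also have "\<dots> \<le> (\<integral>\<^sup>+p. ennreal (72 * r) \<partial>U01)" by (intro nn_integral_mono inner)
    also have "\<dots> = ennreal (72 * r)" using U01.emeasure_space_1 by simp
    finally show ?thesis using False by simp
  qed
  have EB: "(\<integral>\<^sup>+x. B x \<partial>PU n) \<le> of_nat n * (of_nat n * ennreal (72 * r)) + of_nat n"
  proof -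
    have "(\<integral>\<^sup>+x. B x \<partial>PU n) = (\<Sum>i<n. \<Sum>k<n. \<integral>\<^sup>+x. of_bool (\<not> far_apart r (x i) (x k)) \<partial>PU n)"
    proof -
      have "(\<integral>\<^sup>+x. B x \<partial>PU n) = (\<Sum>i<n. \<integral>\<^sup>+x. (\<Sum>k<n. of_bool (\<not> far_apart r (x i) (x k))) \<partial>PU n)"
        unfolding B_def by (intro nn_integral_sum borel_measurable_sum far_m) auto
      also have "\<dots> = (\<Sum>i<n. \<Sum>k<n. \<integral>\<^sup>+x. of_bool (\<not> far_apart r (x i) (x k)) \<partial>PU n)"
        by (intro sum.cong refl nn_integral_sum far_m) auto
      finally show ?thesis .
    qed
    also have "\<dots> \<le> (\<Sum>i<n. \<Sum>k<n. ennreal (72 * r) + of_bool (i = k))"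
      by (intro sum_mono far_int) auto
    also have "\<dots> = of_nat n * (of_nat n * ennreal (72 * r)) + of_nat n"
      by (simp add: sum.distrib of_bool_def distrib_left)
    finally show ?thesis .
  qed
  have "(\<integral>\<^sup>+x. ennreal ((real (card (linked n r U x)) / real n)\<^sup>2) \<partial>PU n) =
      (\<integral>\<^sup>+x. (ennreal (1 / real n))\<^sup>2 * ((\<Sum>i<n. L x i) * (\<Sum>k<n. L x k)) \<partial>PU n)"
  proof (rule nn_integral_cong)
    fix x
    have "ennreal ((real (card (linked n r U x)) / real n)\<^sup>2) = (ennreal (real (card (linked n r U x)) / real n))\<^sup>2"
      by (simp add: ennreal_power)
    then show "ennreal ((real (card (linked n r U x)) / real n)\<^sup>2) = (ennreal (1 / real n))\<^sup>2 * ((\<Sum>i<n. L x i) * (\<Sum>k<n. L x k))"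
      unfolding div card_L power_mult_distrib by (simp only: power2_eq_square[of "sum _ _"])
  qed
  also have "\<dots> \<le> (\<integral>\<^sup>+x. (ennreal (1 / real n))\<^sup>2 * (A x + B x) \<partial>PU n)"
    by (intro nn_integral_mono mult_left_mono LL) simp
  also have "\<dots> = (ennreal (1 / real n))\<^sup>2 * ((\<integral>\<^sup>+x. A x \<partial>PU n) + (\<integral>\<^sup>+x. B x \<partial>PU n))"
  proof -
    have A_m: "A \<in> borel_measurable (PU n)"
    proof -
      have "(\<lambda>x. of_bool (H x i j) * (of_bool (H x k l) * of_bool (far_apart r (x i) (x k))) :: ennreal) \<in> borel_measurable (PU n)"
        if "i < n" "j \<in> {..<n} - {i}" "k < n" "l \<in> {..<n} - {k}" for i j k l
      proof -
        note comp[OF that(1), measurable] comp[OF that(3), measurable] Hm[OF that(1,2), measurable] Hm[OF that(3,4), measurable]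
        show ?thesis by measurable
      qed
      then show ?thesis unfolding A_def of_bool_conj by (intro borel_measurable_sum) auto
    qed
    show ?thesis using A_m B_m by (simp add: nn_integral_cmult nn_integral_add)
  qed
  also have "\<dots> \<le> (ennreal (1 / real n))\<^sup>2 * (of_nat (n ^ 4) * (mean (n - 4))\<^sup>2 + (of_nat n * (of_nat n * ennreal (72 * r)) + of_nat n))"
    by (intro mult_left_mono add_mono EA EB) simp
  also have "\<dots> = (ennreal (1 / real n) * of_nat n)\<^sup>2 * (of_nat n * mean (n - 4))\<^sup>2 +
      ((ennreal (1 / real n) * of_nat n)\<^sup>2 * ennreal (72 * r) + (ennreal (1 / real n) * of_nat n) * ennreal (1 / real n))"
    by (simp add: power2_eq_square power4_eq_xxxx distrib_left mult_ac)
  also have "\<dots> = (emeasure lborel U * (ennreal (real n) * kappa0 r (n - 4)))\<^sup>2 + ennreal (72 * r + 1 / real n)"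
    unfolding cn mean_points[OF U r] using r by (simp add: ennreal_of_nat_eq_real_of_nat mult_ac)
  finally show "(\<integral>\<^sup>+x. ennreal ((real (card (linked n r U x)) / real n)\<^sup>2) \<partial>PU n) \<le>
      (emeasure lborel U * (ennreal (real n) * kappa0 r (n - 4)))\<^sup>2 + ennreal (72 * r + 1 / real n)" .
qed

lemma linked_in_probability:
  assumes U: "\<And>n. U n \<in> sets borel" "\<And>n. U n \<subseteq> safe (1 / sqrt (real n))"
    and lim: "(\<lambda>n. emeasure lborel (U n)) \<longlonglongrightarrow> ennreal L" and L: "L \<ge> 0" and \<epsilon>: "\<epsilon> > 0"
  shows "(\<lambda>n. measure (PU n) {x \<in> space (PU n).
      \<bar>real (card (linked n (1 / sqrt (real n)) (U n) x)) / real n - L / 2\<bar> > \<epsilon>}) \<longlonglongrightarrow> 0"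
proof -
  define r where "r n = 1 / sqrt (real n)" for n
  have r: "r n > 0" if "n > 0" for n using that by (simp add: r_def)
  have Us: "U n \<subseteq> safe (r n)" for n using U(2) by (simp add: r_def)
  have K: "(\<lambda>n. ennreal (real n) * kappa0 (r n) (n - d)) \<longlonglongrightarrow> ennreal (1 / 2)" for d
    using kappa0_limit[of d] by (simp only: r_def)
  have LK: "(\<lambda>n. emeasure lborel (U n) * (ennreal (real n) * kappa0 (r n) (n - d))) \<longlonglongrightarrow> ennreal (L / 2)" for d
  proof -
    have "ennreal L * ennreal (1 / 2) = ennreal (L / 2)" using L by (subst ennreal_mult[symmetric]) auto
    moreover have "(\<lambda>n. emeasure lborel (U n) * (ennreal (real n) * kappa0 (r n) (n - d))) \<longlonglongrightarrow> ennreal L * ennreal (1 / 2)"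
      by (rule tendsto_mult_ennreal[OF lim K]) simp
    ultimately show ?thesis by (simp only:)
  qed
  have "(\<lambda>n. measure (PU n) {x \<in> space (PU n). \<bar>real (card (linked n (r n) (U n) x)) / real n - L / 2\<bar> > \<epsilon>}) \<longlonglongrightarrow> 0"
  proof (rule tendsto_in_probability[where f = "\<lambda>n. (emeasure lborel (U n) * (ennreal (real n) * kappa0 (r n) (n - 4)))\<^sup>2 + ennreal (72 * r n + 1 / real n)"])
    show "(\<lambda>x. real (card (linked n (r n) (U n) x)) / real n) \<in> borel_measurable (PU n)" for n
      using linked_fraction_moments(1)[OF U(1)[of n] Us[of n] r[of n], of n] by (cases "n = 0") auto
    have "(\<lambda>n. ennreal (1 - 1 / real n) * (emeasure lborel (U n) * (ennreal (real n) * kappa0 (r n) (n - 2)))) \<longlonglongrightarrow> ennreal (1 - 0) * ennreal (L / 2)"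
      by (intro tendsto_mult_ennreal LK tendsto_ennrealI tendsto_intros lim_const_over_n) (use L in auto)
    moreover have "\<forall>\<^sub>F n in sequentially. ennreal (1 - 1 / real n) * (emeasure lborel (U n) * (ennreal (real n) * kappa0 (r n) (n - 2))) =
        (\<integral>\<^sup>+x. ennreal (real (card (linked n (r n) (U n) x)) / real n) \<partial>PU n)"
      using linked_fraction_moments(2)[OF U(1) Us r] by (intro eventually_sequentiallyI[of 1]) auto
    ultimately show "(\<lambda>n. \<integral>\<^sup>+x. ennreal (real (card (linked n (r n) (U n) x)) / real n) \<partial>PU n) \<longlonglongrightarrow> ennreal (L / 2)"
      by (simp add: Lim_transform_eventually)
    show "\<forall>\<^sub>F n in sequentially. (\<integral>\<^sup>+x. ennreal ((real (card (linked n (r n) (U n) x)) / real n)\<^sup>2) \<partial>PU n) \<le>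
        (emeasure lborel (U n) * (ennreal (real n) * kappa0 (r n) (n - 4)))\<^sup>2 + ennreal (72 * r n + 1 / real n)"
      using linked_fraction_moments(3)[OF U(1) Us r] by (intro eventually_sequentiallyI[of 1]) auto
    have "(\<lambda>n. (emeasure lborel (U n) * (ennreal (real n) * kappa0 (r n) (n - 4)))\<^sup>2 + ennreal (72 * r n + 1 / real n)) \<longlonglongrightarrow> ennreal (L / 2) ^ 2 + ennreal (72 * 0 + 0)"
    proof (intro tendsto_add tendsto_ennrealI tendsto_mult tendsto_const)
      show "(\<lambda>n. (emeasure lborel (U n) * (ennreal (real n) * kappa0 (r n) (n - 4)))\<^sup>2) \<longlonglongrightarrow> (ennreal (L / 2))\<^sup>2"
        unfolding power2_eq_square[of "_ * (_ * kappa0 _ _)"] power2_eq_square[of "ennreal _"]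
        by (intro tendsto_mult_ennreal LK) auto
      show "r \<longlonglongrightarrow> 0" unfolding r_def by (rule inverse_sqrt_tendsto_0)
    qed (rule lim_const_over_n)
    then show "(\<lambda>n. (emeasure lborel (U n) * (ennreal (real n) * kappa0 (r n) (n - 4)))\<^sup>2 + ennreal (72 * r n + 1 / real n)) \<longlonglongrightarrow> ennreal ((L / 2)\<^sup>2)"
      using L by (simp add: ennreal_power)
  qed (use \<epsilon> L prob_space_PU in auto)
  then show ?thesis by (simp only: r_def)
qed

section \<open>No long stretch without sample points\<close>

lemma prob_no_point:
  assumes A: "A \<in> sets borel"
  shows "emeasure (PU n) {x \<in> space (PU n). \<forall>i<n. x i \<notin> A} = emeasure U01 (- A) ^ n"
proof -
  interpret product_sigma_finite "\<lambda>_::nat. U01" by (rule product_sigma_finite_U01)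
  note A[measurable]
  have "{x \<in> space (PU n). \<forall>i\<in>{..<n}. x i \<notin> A} \<in> sets (PU n)"
  proof (rule sets.sets_Collect_finite_All)
    fix i assume "i \<in> {..<n}"
    then have [measurable]: "(\<lambda>x. x i) \<in> borel_measurable (PU n)" by (auto intro: measurable_PU_component)
    show "{x \<in> space (PU n). x i \<notin> A} \<in> sets (PU n)" by measurable
  qed simp
  then have S: "{x \<in> space (PU n). \<forall>i<n. x i \<notin> A} \<in> sets (PU n)" by (simp only: Ball_def lessThan_iff)
  have "emeasure (PU n) {x \<in> space (PU n). \<forall>i<n. x i \<notin> A} = (\<integral>\<^sup>+x. 1 * of_bool (\<forall>k\<in>{..<n} - {}. x k \<notin> A) \<partial>PU n)"
    unfolding nn_integral_indicator[OF S, symmetric]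
    by (intro nn_integral_cong) (auto simp: indicator_def)
  also have "\<dots> = (\<integral>\<^sup>+x. 1 * emeasure U01 {s. s \<notin> A} ^ (n - card ({} :: nat set)) \<partial>PiM ({} :: nat set) (\<lambda>_. U01))"
    by (rule nn_integral_PU_void[where G = "\<lambda>_. 1" and A = "\<lambda>_ s. s \<notin> A"]) auto
  also have "\<dots> = emeasure U01 (- A) ^ n"
    using prob_space.emeasure_space_1[OF prob_space_PiM[of "{} :: nat set" "\<lambda>_. U01"]] prob_space_U01
    by (simp add: Compl_eq)
  finally show ?thesis .
qed

definition cells_hit :: "nat \<Rightarrow> nat \<Rightarrow> (nat \<Rightarrow> real) \<Rightarrow> bool" where
  "cells_hit n N x \<longleftrightarrow> (\<forall>j<N. \<exists>i<n. real j / real N \<le> x i \<and> x i < real (Suc j) / real N)"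

text \<open>With at least 16 sqrt n cells, two cell widths are at most 1 / (8 sqrt n), safely below
  the radius 1 / sqrt n, while a cell still expects on the order of sqrt n points.\<close>

definition cells :: "nat \<Rightarrow> nat" where
  "cells n = nat \<lceil>16 * sqrt (real n)\<rceil>"

lemma cells_measurable: "{x \<in> space (PU n). \<not> cells_hit n N x} \<in> sets (PU n)"
proof -
  have "{x \<in> space (PU n). \<exists>j\<in>{..<N}. \<forall>i\<in>{..<n}. \<not> (real j / real N \<le> x i \<and> x i < real (Suc j) / real N)} \<in> sets (PU n)"
  proof (intro sets.sets_Collect_finite_Ex)
    fix j
    show "{x \<in> space (PU n). \<forall>i\<in>{..<n}. \<not> (real j / real N \<le> x i \<and> x i < real (Suc j) / real N)} \<in> sets (PU n)"
    proof (rule sets.sets_Collect_finite_All)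
      fix i assume "i \<in> {..<n}"
      then have [measurable]: "(\<lambda>x. x i) \<in> borel_measurable (PU n)" by (auto intro: measurable_PU_component)
      show "{x \<in> space (PU n). \<not> (real j / real N \<le> x i \<and> x i < real (Suc j) / real N)} \<in> sets (PU n)" by measurable
    qed simp
  qed auto
  also have "{x \<in> space (PU n). \<exists>j\<in>{..<N}. \<forall>i\<in>{..<n}. \<not> (real j / real N \<le> x i \<and> x i < real (Suc j) / real N)} =
      {x \<in> space (PU n). \<not> cells_hit n N x}"
    unfolding cells_hit_def by blast
  finally show ?thesis .
qed

text \<open>Union bound: a given cell is empty with probability (1 - 1 / N)^n \<le> exp (- n / N).
  For n \<ge> 1 the rounding in \<open>cells\<close> costs at most one further sqrt n, which turns
  16 into 17.\<close>

lemma cells_hit_in_probability: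
  "(\<lambda>n. measure (PU n) {x \<in> space (PU n). \<not> cells_hit n (cells n) x}) \<longlonglongrightarrow> 0"
proof -
  interpret U01: prob_space U01 by (rule prob_space_U01)
  have bound: "measure (PU n) {x \<in> space (PU n). \<not> cells_hit n N x} \<le> real N * exp (- real n / real N)" if N: "N > 0" for n N
  proof -
    interpret prob_space "PU n" by (rule prob_space_PU)
    define A where "A j = {real j / real N..<real (Suc j) / real N}" for j
    have one: "measure (PU n) {x \<in> space (PU n). \<forall>i<n. x i \<notin> A j} \<le> exp (- real n / real N)" if j: "j < N" for j
    proof -
      have sub: "A j \<subseteq> {0..<1}"
      proof
        fix y assume "y \<in> A j"
        then have y: "real j / real N \<le> y" "y < real (Suc j) / real N" by (auto simp: A_def)
        have "real (Suc j) / real N \<le> 1" using j N by (simp add: divide_le_eq)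
        then have "y < 1" using y(2) by linarith
        moreover have "0 \<le> real j / real N" by simp
        then have "0 \<le> y" using y(1) by linarith
        ultimately show "y \<in> {0..<1}" by simp
      qed
      have "emeasure U01 (A j) = emeasure lborel (A j)"
        using sub by (subst emeasure_U01) (auto simp: A_def Int_absorb1)
      also have "\<dots> = ennreal (1 / real N)"
        using N by (simp add: A_def divide_right_mono diff_divide_distrib[symmetric])
      finally have mA: "measure U01 (A j) = 1 / real N" by (simp add: measure_def)
      have "measure U01 (space U01 - A j) = 1 - measure U01 (A j)"
        by (rule U01.prob_compl) (simp add: A_def sets_U01)
      then have m: "measure U01 (- A j) = 1 - 1 / real N" by (simp add: mA Compl_eq_Diff_UNIV)
      have Ab: "A j \<in> sets borel" by (simp add: A_def)
      have "measure (PU n) {x \<in> space (PU n). \<forall>i<n. x i \<notin> A j} = (1 - 1 / real N) ^ n"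
        using prob_no_point[OF Ab, of n] N unfolding U01.emeasure_eq_measure emeasure_eq_measure m
        by (simp add: ennreal_power)
      also have "\<dots> \<le> exp (- (1 / real N)) ^ n"
        using N exp_ge_add_one_self[of "- (1 / real N)"] by (intro power_mono) auto
      also have "\<dots> = exp (- real n / real N)" by (simp flip: exp_of_nat_mult)
      finally show ?thesis .
    qed
    have S: "{x \<in> space (PU n). \<forall>i<n. x i \<notin> A j} \<in> sets (PU n)" for j
    proof -
      have "{x \<in> space (PU n). \<forall>i\<in>{..<n}. x i \<notin> A j} \<in> sets (PU n)"
      proof (rule sets.sets_Collect_finite_All)
        fix i assume "i \<in> {..<n}"
        then have [measurable]: "(\<lambda>x. x i) \<in> borel_measurable (PU n)" by (auto intro: measurable_PU_component)
        show "{x \<in> space (PU n). x i \<notin> A j} \<in> sets (PU n)" unfolding A_def by measurable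
      qed simp
      then show ?thesis by (simp only: Ball_def lessThan_iff)
    qed
    have "measure (PU n) {x \<in> space (PU n). \<not> cells_hit n N x} \<le> measure (PU n) (\<Union>j<N. {x \<in> space (PU n). \<forall>i<n. x i \<notin> A j})"
    proof (rule finite_measure_mono)
      show "{x \<in> space (PU n). \<not> cells_hit n N x} \<subseteq> (\<Union>j<N. {x \<in> space (PU n). \<forall>i<n. x i \<notin> A j})"
      proof
        fix x assume x: "x \<in> {x \<in> space (PU n). \<not> cells_hit n N x}"
        then obtain j where j: "j < N" "\<not> (\<exists>i<n. real j / real N \<le> x i \<and> x i < real (Suc j) / real N)"
          unfolding cells_hit_def by blast
        have "x i \<notin> A j" if "i < n" for i
          using j(2) that unfolding A_def atLeastLessThan_iff by metis
        then show "x \<in> (\<Union>j<N. {x \<in> space (PU n). \<forall>i<n. x i \<notin> A j})" using j(1) x by blast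
      qed
      show "(\<Union>j<N. {x \<in> space (PU n). \<forall>i<n. x i \<notin> A j}) \<in> sets (PU n)" by (rule sets.finite_UN[OF finite_lessThan S])
    qed
    also have "\<dots> \<le> (\<Sum>j<N. measure (PU n) {x \<in> space (PU n). \<forall>i<n. x i \<notin> A j})"
      by (rule finite_measure_subadditive_finite[OF finite_lessThan]) (use S in blast)
    also have "\<dots> \<le> (\<Sum>j<N. exp (- real n / real N))" by (intro sum_mono one) simp
    finally show ?thesis by simp
  qed
  have cb: "real (cells n) \<le> 17 * sqrt (real n)" "cells n > 0" if n: "n > 0" for n
  proof -
    have "1 \<le> sqrt (real n)" using n by simp
    then show "real (cells n) \<le> 17 * sqrt (real n)" unfolding cells_def by linarith
    show "cells n > 0" using n by (simp add: cells_def)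
  qed
  have le: "measure (PU n) {x \<in> space (PU n). \<not> cells_hit n (cells n) x} \<le> 17 * sqrt (real n) * exp (- sqrt (real n) / 17)" if n: "n > 0" for n
  proof -
    have "sqrt (real n) / 17 * real (cells n) \<le> sqrt (real n) / 17 * (17 * sqrt (real n))"
      using cb[OF n] by (intro mult_left_mono) auto
    then have "sqrt (real n) / 17 \<le> real n / real (cells n)" using cb[OF n] by (simp add: pos_le_divide_eq)
    then have "exp (- real n / real (cells n)) \<le> exp (- sqrt (real n) / 17)" by simp
    then have "real (cells n) * exp (- real n / real (cells n)) \<le> 17 * sqrt (real n) * exp (- sqrt (real n) / 17)"
      using cb[OF n] by (intro mult_mono) auto
    then show ?thesis using bound[OF cb(2)[OF n], of n] by linarith
  qed
  have L: "(\<lambda>n. 17 * sqrt (real n) * exp (- sqrt (real n) / 17)) \<longlonglongrightarrow> 0" by real_asymp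
  show ?thesis
    by (rule tendsto_sandwich[OF _ _ tendsto_const L]) (use le in \<open>auto intro: eventually_sequentiallyI[of 1]\<close>)
qed

text \<open>Almost sure absence of coincidences among the points and the lines.\<close>

definition generic :: "nat \<Rightarrow> (nat \<Rightarrow> real) \<Rightarrow> bool" where
  "generic n x \<longleftrightarrow> (\<forall>a<n. \<forall>c<n. \<forall>d<n. a \<noteq> c \<longrightarrow> a \<noteq> d \<longrightarrow>
     (\<forall>z::int. 2 * x a \<noteq> x c + x d + of_int z) \<and>
     (\<forall>b<n. a \<noteq> b \<longrightarrow> (\<forall>z::int. x a \<noteq> x c + x d - x b + of_int z)))"

text \<open>Conditioned on the other coordinates, the function value is a constant, and a uniform
  variable hits a constant with probability 0.\<close>

lemma AE_PU_ne:
  assumes i: "i < n" and F: "F \<in> borel_measurable (PiM ({..<n} - {i}) (\<lambda>_. U01))"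
  shows "AE x in PU n. x i \<noteq> F (restrict x ({..<n} - {i}))"
proof -
  interpret P: prob_space "PU n" by (rule prob_space_PU)
  interpret U01: prob_space U01 by (rule prob_space_U01)
  define J where "J = {..<n} - {i}"
  have J: "J \<subseteq> {..<n}" "{..<n} - J = {i}" "n - card J = 1" using i by (auto simp: J_def)
  have [measurable]: "F \<in> borel_measurable (PiM J (\<lambda>_. U01))" using F by (simp add: J_def)
  interpret Q: prob_space "PiM J (\<lambda>_. U01)" by (intro prob_space_PiM prob_space_U01)
  have ne: "emeasure U01 {s. s \<noteq> c} = 1" for c
  proof -
    have "emeasure U01 {s. s \<noteq> c} = emeasure lborel ({0..<1} - {c})"
      by (subst emeasure_U01) (auto intro!: arg_cong[where f = "emeasure lborel"])
    also have "\<dots> = emeasure lborel {0..<1::real}" by (intro emeasure_Diff_null_set) auto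
    finally show ?thesis by simp
  qed
  have "(\<integral>\<^sup>+x. 1 * of_bool (\<forall>k\<in>{..<n} - J. x k \<noteq> F (restrict x J)) \<partial>PU n) =
      (\<integral>\<^sup>+x. 1 * emeasure U01 {s. s \<noteq> F x} ^ (n - card J) \<partial>PiM J (\<lambda>_. U01))"
    by (rule nn_integral_PU_void[where G = "\<lambda>_. 1" and A = "\<lambda>x s. s \<noteq> F x"]) (use J in auto)
  also have "\<dots> = 1" using ne J(3) Q.emeasure_space_1 by simp
  finally have int: "(\<integral>\<^sup>+x. of_bool (x i \<noteq> F (restrict x J)) \<partial>PU n) = 1" using J(2) by simp
  have comp: "(\<lambda>x. x i) \<in> borel_measurable (PU n)" by (rule measurable_PU_component[OF i])
  have "(\<lambda>x. restrict x J) \<in> PU n \<rightarrow>\<^sub>M PiM J (\<lambda>_. U01)"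
    unfolding PU_def by (rule measurable_restrict_subset[OF J(1)])
  then have Fm: "(\<lambda>x. F (restrict x J)) \<in> borel_measurable (PU n)" by (rule measurable_compose) measurable
  note comp[measurable] Fm[measurable]
  have S: "{x \<in> space (PU n). x i \<noteq> F (restrict x J)} \<in> sets (PU n)"
    by (rule borel_measurable_neq[OF comp Fm])
  have "emeasure (PU n) {x \<in> space (PU n). x i \<noteq> F (restrict x J)} = (\<integral>\<^sup>+x. of_bool (x i \<noteq> F (restrict x J)) \<partial>PU n)"
    unfolding nn_integral_indicator[OF S, symmetric] by (intro nn_integral_cong) (auto simp: indicator_def)
  then have "P.prob {x \<in> space (PU n). x i \<noteq> F (restrict x J)} = 1" using int by (simp add: measure_def)
  then show ?thesis using P.prob_Collect_eq_1[OF S] by (simp add: J_def)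
qed

text \<open>Each excluded relation expresses \<open>x a\<close> through the other coordinates; there
  are finitely many index choices and countably many integers.\<close>

lemma AE_generic: "AE x in PU n. generic n x"
proof -
  have "AE x in PU n. \<forall>a\<in>{..<n}. \<forall>c\<in>{..<n}. \<forall>d\<in>{..<n}. a \<noteq> c \<longrightarrow> a \<noteq> d \<longrightarrow>
     (\<forall>z::int. 2 * x a \<noteq> x c + x d + of_int z) \<and>
     (\<forall>b\<in>{..<n}. a \<noteq> b \<longrightarrow> (\<forall>z::int. x a \<noteq> x c + x d - x b + of_int z))"
  proof (intro AE_finite_allI AE_impI AE_conjI)
    fix a c d assume lt: "a \<in> {..<n}" "c \<in> {..<n}" "d \<in> {..<n}" and ne: "a \<noteq> c" "a \<noteq> d"
    have comp: "(\<lambda>x. x k) \<in> borel_measurable (PiM ({..<n} - {a}) (\<lambda>_. U01))" if "k < n" "a \<noteq> k" for k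
    proof -
      have "(\<lambda>x. x k) \<in> PiM ({..<n} - {a}) (\<lambda>_. U01) \<rightarrow>\<^sub>M U01" using that by (intro measurable_component_singleton) auto
      then show ?thesis by (simp cong: measurable_cong_sets add: sets_U01)
    qed
    have lt': "c < n" "d < n" using lt by auto
    note [measurable] = comp[OF lt'(1) ne(1)] comp[OF lt'(2) ne(2)]
    show "AE x in PU n. \<forall>z::int. 2 * x a \<noteq> x c + x d + of_int z"
    proof (subst AE_all_countable, intro allI)
      fix z :: int
      have "(\<lambda>x. (x c + x d + of_int z) / 2) \<in> borel_measurable (PiM ({..<n} - {a}) (\<lambda>_. U01))"
        by measurable
      then have "AE x in PU n. x a \<noteq> (restrict x ({..<n} - {a}) c + restrict x ({..<n} - {a}) d + of_int z) / 2"
        using AE_PU_ne[of a n "\<lambda>x. (x c + x d + of_int z) / 2"] lt by auto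
      then show "AE x in PU n. 2 * x a \<noteq> x c + x d + of_int z" using lt ne by (elim AE_mp) (auto intro!: AE_I2)
    qed
    fix b assume b: "b \<in> {..<n}" "a \<noteq> b"
    have b': "b < n" using b by auto
    note [measurable] = comp[OF b' b(2)]
    show "AE x in PU n. \<forall>z::int. x a \<noteq> x c + x d - x b + of_int z"
    proof (subst AE_all_countable, intro allI)
      fix z :: int
      have "(\<lambda>x. x c + x d - x b + of_int z) \<in> borel_measurable (PiM ({..<n} - {a}) (\<lambda>_. U01))"
        by measurable
      then have "AE x in PU n. x a \<noteq> restrict x ({..<n} - {a}) c + restrict x ({..<n} - {a}) d - restrict x ({..<n} - {a}) b + of_int z"
        using AE_PU_ne[of a n "\<lambda>x. x c + x d - x b + of_int z"] lt by auto
      then show "AE x in PU n. x a \<noteq> x c + x d - x b + of_int z" using lt ne b by (elim AE_mp) (auto intro!: AE_I2)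
    qed
  qed auto
  then show ?thesis by (elim AE_mp) (auto simp: generic_def intro!: AE_I2)
qed

section \<open>Nearest points and regions\<close>

text \<open>The function grows by 1 over each period, so some period brackets \<open>u\<close>;
  within that finite range the largest index with value at most \<open>u\<close> is taken.\<close>

lemma strict_mono_int_bracket:
  fixes f :: "int \<Rightarrow> real"
  assumes mono: "strict_mono f" and period: "\<And>i. f (i + int n) = f i + 1" and n: "n > 0"
  obtains i where "f i \<le> u" "u < f (i + 1)"
proof -
  have shift: "f (i + int n * k) = f i + of_int k" for i k
  proof (induction k rule: int_induct[of _ 0])
    case (step1 k)
    have "i + int n * (k + 1) = (i + int n * k) + int n" by (simp add: algebra_simps)
    then show ?case using step1 period[of "i + int n * k"] by (simp add: algebra_simps)
  next
    case (step2 k)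
    have "i + int n * k = (i + int n * (k - 1)) + int n" by (simp add: algebra_simps)
    then show ?case using step2 period[of "i + int n * (k - 1)"] by (simp add: algebra_simps)
  qed simp
  define k where "k = \<lfloor>u - f 0\<rfloor>"
  define S where "S = {i \<in> {int n * k..int n * (k + 1)}. f i \<le> u}"
  have lo: "f (int n * k) \<le> u" and hi: "u < f (int n * (k + 1))"
    using shift[of 0 k] shift[of 0 "k + 1"] unfolding k_def by (simp_all; linarith)+
  have "finite S" by (rule finite_subset[of _ "{int n * k..int n * (k + 1)}"]) (auto simp: S_def)
  moreover have "int n * k \<in> S" using lo n by (auto simp: S_def distrib_left)
  ultimately have S: "finite S" "int n * k \<in> S" by blast+
  define i where "i = Max S"
  have i: "i \<in> S" using Max_in[OF S(1)] S(2) by (auto simp: i_def)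
  have ne: "i \<noteq> int n * (k + 1)" using i hi by (auto simp: S_def)
  have "u < f (i + 1)"
  proof (rule ccontr)
    assume "\<not> u < f (i + 1)"
    then have "i + 1 \<in> S" using i ne by (auto simp: S_def)
    then have "i + 1 \<le> i" unfolding i_def by (intro Max_ge S)
    then show False by simp
  qed
  then show ?thesis using that i by (auto simp: S_def)
qed

text \<open>A fixed configuration without randomness. \<delta> bounds the spacing on the whole
  lifted line, so nearest points are always closer than \<delta>; the probabilistic part later
  supplies \<delta> below the search radius.\<close>

locale circle_config =
  fixes n :: nat and x :: "nat \<Rightarrow> real" and \<delta> :: real
  assumes n: "n \<ge> 3" and unit: "\<And>i. i < n \<Longrightarrow> 0 \<le> x i \<and> x i < 1"
    and generic: "generic n x"
    and spacing: "\<And>s. \<exists>k<n. \<exists>z::int. s \<le> x k + of_int z \<and> x k + of_int z < s + \<delta>"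
begin

text \<open>A coincidence of \<open>x a\<close> and \<open>x c\<close> is the excluded relation x a
  = x c + x d - x b with \<open>d = b\<close>, for any third index choice \<open>b\<close> different
  from \<open>a\<close>.\<close>

lemma inj: "inj_on x {..<n}"
proof (rule inj_onI, rule ccontr)
  fix a c assume ac: "a \<in> {..<n}" "c \<in> {..<n}" "x a = x c" "a \<noteq> c"
  obtain b where b: "b < n" "b \<noteq> a"
    using n by (metis (no_types) One_nat_def Suc_1 Suc_le_lessD less_trans_Suc numeral_3_eq_3 zero_less_Suc less_numeral_extra(1) le_less_trans nat_neq_iff zero_less_numeral)
  have "x a \<noteq> x c + x b - x b + of_int 0"
    using generic ac b unfolding generic_def by (metis lessThan_iff)
  then show False using ac by simp
qed

abbreviation y :: "nat \<Rightarrow> real" where "y \<equiv> order_stat n x"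

text \<open>The sample points, lifted to the line with period 1, are \<open>\<dots> < \<xi> 0 < \<xi> 1 < \<dots>\<close>; the boundaries
  of their Voronoi cells are the \<open>\<mu> i\<close>.\<close>

definition \<xi> :: "int \<Rightarrow> real" where
  "\<xi> i = y (nat (i mod int n)) + of_int (i div int n)"

definition \<mu> :: "int \<Rightarrow> real" where
  "\<mu> i = (\<xi> i + \<xi> (i + 1)) / 2"

definition cell :: "int \<Rightarrow> real set" where
  "cell i = {\<mu> (i - 1)<..<\<mu> i}"

lemma n0: "n > 0" "int n > 0" using n by auto

lemma idx: "nat (i mod int n) < n"
  using n0 by (simp add: nat_less_iff)

lemma y_unit: "k < n \<Longrightarrow> 0 \<le> y k \<and> y k < 1"
  using order_stat_image[of n x] unit by (metis imageE imageI lessThan_iff)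

lemma \<xi>_period: "\<xi> (i + int n) = \<xi> i + 1"
  using n0 by (simp add: \<xi>_def)

lemma \<xi>_period_int: "\<xi> (i + int n * k) = \<xi> i + of_int k"
  using n0 by (simp add: \<xi>_def div_mult_self2[of "int n" i k, simplified] add.commute)

lemma strict_mono_\<xi>: "strict_mono \<xi>"
proof (rule strict_monoI)
  fix i j :: int assume ij: "i < j"
  have le: "i div int n \<le> j div int n" using ij n0 by (intro zdiv_mono1) auto
  show "\<xi> i < \<xi> j"
  proof (cases "i div int n = j div int n")
    case True
    have "i mod int n < j mod int n" using ij True
      by (metis add_less_cancel_left mult_div_mod_eq)
    then have "nat (i mod int n) < nat (j mod int n)" using n0 nat_less_eq_zless[of "i mod int n" "j mod int n"] by simp
    then show ?thesis using order_stat_strict[OF inj _ idx[of j]] True by (simp add: \<xi>_def)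
  next
    case False
    then have "i div int n + 1 \<le> j div int n" using le by simp
    then have "of_int (i div int n) + 1 \<le> (of_int (j div int n) :: real)" by linarith
    then show ?thesis using y_unit[OF idx[of i]] y_unit[OF idx[of j]] by (simp add: \<xi>_def)
  qed
qed

lemma \<xi>_less_iff [simp]: "\<xi> i < \<xi> j \<longleftrightarrow> i < j"
  using strict_mono_less[OF strict_mono_\<xi>] .

lemma \<xi>_le_iff [simp]: "\<xi> i \<le> \<xi> j \<longleftrightarrow> i \<le> j"
  using strict_mono_less_eq[OF strict_mono_\<xi>] .

lemma \<xi>_eq_iff [simp]: "\<xi> i = \<xi> j \<longleftrightarrow> i = j"
  using strict_mono_eq[OF strict_mono_\<xi>] .

lemma \<xi>_idx: obtains k z where "k < n" "\<xi> i = x k + of_int z"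
proof -
  have "y (nat (i mod int n)) \<in> x ` {..<n}" using order_stat_image[of n x] idx by blast
  then show ?thesis using that by (auto simp: \<xi>_def)
qed

lemma x_is_\<xi>: "k < n \<Longrightarrow> \<exists>i. \<xi> i = x k + of_int z"
proof -
  assume "k < n"
  then have "x k \<in> y ` {..<n}" using order_stat_image[of n x] by blast
  then obtain m where m: "m < n" "x k = y m" by auto
  have "\<xi> (int m + int n * z) = x k + of_int z"
    unfolding \<xi>_period_int using m by (simp add: \<xi>_def)
  then show ?thesis by blast
qed

lemma \<xi>_unit: "0 \<le> \<xi> i \<Longrightarrow> \<xi> i < 1 \<Longrightarrow> \<exists>k<n. \<xi> i = x k"
proof -
  assume u: "0 \<le> \<xi> i" "\<xi> i < 1"
  obtain k z where k: "k < n" "\<xi> i = x k + of_int z" by (rule \<xi>_idx)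
  have "z = 0" using k u unit[OF k(1)] by linarith
  then show ?thesis using k by auto
qed

lemma \<xi>_gap: "\<xi> (i + 1) \<le> \<xi> i + \<delta>"
proof (rule ccontr)
  assume no: "\<not> \<xi> (i + 1) \<le> \<xi> i + \<delta>"
  define s where "s = \<xi> (i + 1) - \<delta>"
  obtain k z where k: "k < n" "s \<le> x k + of_int z" "x k + of_int z < s + \<delta>" using spacing by blast
  obtain j where j: "\<xi> j = x k + of_int z" using x_is_\<xi>[OF k(1)] by blast
  have "\<xi> i < \<xi> j" "\<xi> j < \<xi> (i + 1)" using k j no by (auto simp: s_def)
  then show False by simp
qed

lemma \<mu>_between: "\<xi> i < \<mu> i" "\<mu> i < \<xi> (i + 1)"
proof -
  have "\<xi> i < \<xi> (i + 1)" by simp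
  then show "\<xi> i < \<mu> i" "\<mu> i < \<xi> (i + 1)" by (auto simp: \<mu>_def simp del: \<xi>_less_iff)
qed

lemma \<mu>_period: "\<mu> (i + int n) = \<mu> i + 1"
proof -
  have "\<xi> (i + int n + 1) = \<xi> (i + 1) + 1" using \<xi>_period[of "i + 1"] by (simp add: ac_simps)
  then show ?thesis by (simp add: \<mu>_def \<xi>_period)
qed

lemma strict_mono_\<mu>: "strict_mono \<mu>"
proof (rule strict_monoI)
  fix i j :: int assume "i < j"
  then have "\<xi> i < \<xi> j" "\<xi> (i + 1) < \<xi> (j + 1)" by simp_all
  then show "\<mu> i < \<mu> j" unfolding \<mu>_def by (intro divide_strict_right_mono add_strict_mono) simp_all
qed

lemma \<mu>_less_iff [simp]: "\<mu> i < \<mu> j \<longleftrightarrow> i < j"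
  using strict_mono_less[OF strict_mono_\<mu>] .

lemma \<mu>_le_iff [simp]: "\<mu> i \<le> \<mu> j \<longleftrightarrow> i \<le> j"
  using strict_mono_less_eq[OF strict_mono_\<mu>] .

lemma \<mu>_eq_iff [simp]: "\<mu> i = \<mu> j \<longleftrightarrow> i = j"
  using strict_mono_eq[OF strict_mono_\<mu>] .

lemma \<xi>_in_cell: "\<xi> i \<in> cell i"
  using \<mu>_between[of i] \<mu>_between[of "i - 1"] by (simp add: cell_def)

lemma cell_unique: "u \<in> cell i \<Longrightarrow> u \<in> cell j \<Longrightarrow> i = j"
proof -
  assume "u \<in> cell i" "u \<in> cell j"
  then have "\<mu> (i - 1) < \<mu> j" "\<mu> (j - 1) < \<mu> i" unfolding cell_def by (auto simp del: \<mu>_less_iff)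
  then show "i = j" by simp
qed

lemma \<xi>_in_cell_iff: "\<xi> m \<in> cell i \<longleftrightarrow> m = i"
  using \<xi>_in_cell cell_unique by blast

lemma \<mu>_notin_cell: "\<mu> m \<notin> cell i"
  by (auto simp: cell_def)

lemma ex_cell: "u \<notin> range \<mu> \<Longrightarrow> \<exists>i. u \<in> cell i"
proof -
  assume u: "u \<notin> range \<mu>"
  obtain i where i: "\<mu> i \<le> u" "u < \<mu> (i + 1)"
    by (rule strict_mono_int_bracket[OF strict_mono_\<mu> \<mu>_period n0(1)])
  then have "\<mu> i < u" using u by (metis order_le_less rangeI)
  then show ?thesis using i by (auto simp: cell_def intro!: exI[of _ "i + 1"])
qed

lemma cell_period: "u + 1 \<in> cell (i + int n) \<longleftrightarrow> u \<in> cell i"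
  using \<mu>_period[of i] \<mu>_period[of "i - 1"] by (simp add: cell_def algebra_simps)

lemma cell_radius: "u \<in> cell i \<Longrightarrow> \<bar>\<xi> i - u\<bar> < \<delta>"
  using \<xi>_gap[of i] \<xi>_gap[of "i - 1"] \<mu>_between[of i] \<mu>_between[of "i - 1"] by (auto simp: cell_def)

lemma cell_nearest:
  assumes u: "u \<in> cell i" and m: "\<bar>\<xi> m - u\<bar> \<le> \<bar>\<xi> i - u\<bar>"
  shows "m = i"
proof (rule ccontr)
  assume "m \<noteq> i"
  then consider "m \<le> i - 1" | "i + 1 \<le> m" by linarith
  then show False
  proof cases
    case 1
    then have "\<xi> m \<le> \<xi> (i - 1)" by simp
    moreover have "2 * \<mu> (i - 1) = \<xi> (i - 1) + \<xi> i" by (simp add: \<mu>_def)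
    moreover have "\<xi> (i - 1) < \<xi> i" by simp
    moreover have "\<mu> (i - 1) < u" using u by (simp add: cell_def)
    ultimately show False using m by linarith
  next
    case 2
    then have "\<xi> (i + 1) \<le> \<xi> m" by simp
    moreover have "2 * \<mu> i = \<xi> i + \<xi> (i + 1)" by (simp add: \<mu>_def)
    moreover have "\<xi> i < \<xi> (i + 1)" by simp
    moreover have "u < \<mu> i" using u by (simp add: cell_def)
    ultimately show False using m by linarith
  qed
qed

lemma nearest_cell:
  assumes "\<And>m. \<bar>\<xi> m - u\<bar> \<le> \<bar>\<xi> i - u\<bar> \<Longrightarrow> m = i"
  shows "u \<in> cell i"
proof -
  have "\<bar>\<xi> (i - 1) - u\<bar> > \<bar>\<xi> i - u\<bar>" "\<bar>\<xi> (i + 1) - u\<bar> > \<bar>\<xi> i - u\<bar>"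
    using assms[of "i - 1"] assms[of "i + 1"] by linarith+
  moreover have "\<xi> (i - 1) < \<xi> i" "\<xi> i < \<xi> (i + 1)" by simp_all
  moreover have "2 * \<mu> (i - 1) = \<xi> (i - 1) + \<xi> i" "2 * \<mu> i = \<xi> i + \<xi> (i + 1)" by (simp_all add: \<mu>_def)
  ultimately have "\<mu> (i - 1) < u \<and> u < \<mu> i" by linarith
  then show ?thesis by (simp add: cell_def)
qed

lemma \<xi>_index_eq_iff:
  assumes "\<xi> i = x a + of_int z" "\<xi> j = x a + of_int w" "a < n"
  shows "\<exists>k. i = j + int n * k"
proof -
  have "\<xi> i = \<xi> (j + int n * (z - w))" unfolding \<xi>_period_int using assms by simp
  then show ?thesis by (auto simp del: )
qed

lemma consecutive_indices:
  assumes "\<xi> i = x a + of_int z" "\<xi> (i + 1) = x b + of_int w" "a < n"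
  shows "a \<noteq> b"
proof
  assume "a = b"
  then obtain k where "i + 1 = i + int n * k" using \<xi>_index_eq_iff[OF assms(2)] assms by metis
  then have "int n * k = 1" by simp
  then have "int n = 1" using n0(2) by (metis zmult_eq_1_iff less_le_not_le zero_le_one int_one_le_iff_zero_less linorder_not_less neg_0_less_iff_less)
  then show False using n by simp
qed

text \<open>By genericity the two pairs of neighbours must involve the same samples. In the same
  order the indices differ by a multiple of \<open>n\<close>, so the cuts differ by an integer; in
  crossed order \<open>n\<close> would divide 2. This is where n \<ge> 3 enters: for two points both
  bisectors coincide.\<close>

lemma \<mu>_ne_half: "\<mu> i \<noteq> \<mu> j + 1 / 2"
proof
  assume e: "\<mu> i = \<mu> j + 1 / 2"
  obtain a za where a: "a < n" "\<xi> i = x a + of_int za" by (rule \<xi>_idx)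
  obtain b zb where b: "b < n" "\<xi> (i + 1) = x b + of_int zb" by (rule \<xi>_idx)
  obtain c zc where c: "c < n" "\<xi> j = x c + of_int zc" by (rule \<xi>_idx)
  obtain d zd where d: "d < n" "\<xi> (j + 1) = x d + of_int zd" by (rule \<xi>_idx)
  have ab: "a \<noteq> b" using consecutive_indices a b by blast
  have cd: "c \<noteq> d" using consecutive_indices c d by blast
  have sum: "x a + x b = x c + x d + of_int (zc + zd - za - zb + 1)"
    using e a b c d by (simp add: \<mu>_def field_simps)
  have gen: "x a \<noteq> x c + x d - x b + of_int z" if "a < n" "b < n" "a \<noteq> b" "a \<noteq> c" "a \<noteq> d" for a b z
    using generic that c(1) d(1) unfolding generic_def by metis
  have "a = c \<or> a = d" using gen[of a b "zc + zd - za - zb + 1"] a b ab sum by force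
  moreover have "b = c \<or> b = d" using gen[of b a "zc + zd - za - zb + 1"] a b ab sum by force
  ultimately consider "a = c" "b = d" | "a = d" "b = c" using ab by blast
  then show False
  proof cases
    case 1
    then have "of_int (zc + zd - za - zb + 1) = (0 :: real)" using sum by simp
    moreover obtain k where k: "i = j + int n * k" using \<xi>_index_eq_iff a c 1 by blast
    have "\<mu> i = \<mu> j + of_int k"
    proof -
      have "\<xi> (j + int n * k + 1) = \<xi> (j + 1) + of_int k" using \<xi>_period_int[of "j + 1" k] by (simp add: ac_simps)
      then show ?thesis unfolding k \<mu>_def \<xi>_period_int by (simp add: field_simps)
    qed
    then have "of_int (2 * k) = (1 :: real)" using e by simp
    then have "2 * k = 1" by linarith
    then show False by presburger
  next
    case 2
    obtain k where k: "i = (j + 1) + int n * k" using \<xi>_index_eq_iff[of i a za "j + 1" zd] a d 2 by blast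
    obtain l where l: "i + 1 = j + int n * l" using \<xi>_index_eq_iff[of "i + 1" b zb j zc] b c 2 by blast
    have "int n * (l - k) = 2" using k l by (simp add: algebra_simps)
    then have "int n dvd 2" by (metis dvd_triv_left)
    then have "int n \<le> 2" by (rule zdvd_imp_le) simp
    then show False using n by simp
  qed
qed

text \<open>If twice a sample equals the sum of two samples modulo 1, genericity makes it one of the
  two, and the relation collapses to a coincidence of different samples modulo 1.\<close>

lemma \<xi>_ne_half: "\<xi> i \<noteq> \<mu> j + 1 / 2"
proof
  assume e: "\<xi> i = \<mu> j + 1 / 2"
  obtain a za where a: "a < n" "\<xi> i = x a + of_int za" by (rule \<xi>_idx)
  obtain c zc where c: "c < n" "\<xi> j = x c + of_int zc" by (rule \<xi>_idx)
  obtain d zd where d: "d < n" "\<xi> (j + 1) = x d + of_int zd" by (rule \<xi>_idx)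
  have cd: "c \<noteq> d" using consecutive_indices c d by blast
  have sum: "2 * x a = x c + x d + of_int (zc + zd + 1 - 2 * za)"
    using e a c d by (simp add: \<mu>_def field_simps)
  have "a = c \<or> a = d"
    using generic a(1) c(1) d(1) sum unfolding generic_def by metis
  then obtain b w where b: "b < n" "b \<noteq> a" "x a = x b + of_int w"
  proof
    assume "a = c"
    then have "x a = x d + of_int (zc + zd + 1 - 2 * za)" using sum by simp
    then show ?thesis using that d cd \<open>a = c\<close> by blast
  next
    assume "a = d"
    then have "x a = x c + of_int (zc + zd + 1 - 2 * za)" using sum by simp
    then show ?thesis using that c cd \<open>a = d\<close> by blast
  qed
  have "w = 0" using unit[OF a(1)] unit[OF b(1)] b(3) by linarith
  then show False using b a inj by (auto simp: inj_on_def)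
qed

lemma \<xi>_ne_half': "\<xi> i \<noteq> \<mu> j - 1 / 2"
  using \<xi>_ne_half[of i "j - int n"] \<mu>_period[of "j - int n"] by simp

text \<open>At the last index \<open>cuts\<close> averages with \<open>y 0\<close>, whereas
  \<open>\<mu>\<close> averages with its lift \<open>y 0 + 1\<close>; the discrepancy of 1/2 is
  absorbed by the half-integer shifts. Even shifts give the \<open>\<mu>\<close> themselves and odd
  ones their antipodes.\<close>

lemma cuts_eq: "cuts n y = range \<mu> \<union> (\<lambda>i. \<mu> i + 1 / 2) ` UNIV"
proof (intro equalityI subsetI)
  have mid: "\<exists>j k'. (y i + y ((i + 1) mod n)) / 2 + of_int k / 2 = \<mu> j + of_int k' / 2" if i: "i < n" for i k
  proof (cases "i + 1 < n")
    case True
    have "nat (int i + 1) = Suc i" by linarith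
    then have "\<mu> (int i) = (y i + y (i + 1)) / 2"
      using i True by (simp add: \<mu>_def \<xi>_def zmod_int[symmetric] zdiv_int[symmetric] nat_int_add flip: of_nat_Suc)
    then show ?thesis using True by (intro exI[of _ "int i"] exI[of _ k]) simp
  next
    case False
    then have ni: "n = i + 1" using i by simp
    have ii: "int i + 1 = 0 + int n" using ni by simp
    have "\<xi> (int i + 1) = y 0 + 1" unfolding ii \<xi>_period using n0 by (simp add: \<xi>_def)
    moreover have "\<xi> (int i) = y i" using i by (simp add: \<xi>_def)
    ultimately have "\<mu> (int i) = (y i + y 0 + 1) / 2" by (simp add: \<mu>_def)
    then show ?thesis using ni by (intro exI[of _ "int i"] exI[of _ "k - 1"]) (simp add: field_simps)
  qed
  have half: "\<mu> j + of_int k / 2 \<in> range \<mu> \<union> (\<lambda>i. \<mu> i + 1 / 2) ` UNIV" for j k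
  proof -
    have per: "\<mu> (j + int n * m) = \<mu> j + of_int m" for m
    proof -
      have "\<xi> (j + int n * m + 1) = \<xi> (j + 1) + of_int m" using \<xi>_period_int[of "j + 1" m] by (simp add: ac_simps)
      then show ?thesis unfolding \<mu>_def \<xi>_period_int by (simp add: field_simps)
    qed
    show ?thesis
    proof (cases "even k")
      case True
      then obtain m where "k = 2 * m" by blast
      then have "\<mu> j + of_int k / 2 = \<mu> (j + int n * m)" by (simp add: per)
      then show ?thesis by blast
    next
      case False
      then obtain m where "k = 2 * m + 1" by (elim oddE)
      then have "\<mu> j + of_int k / 2 = \<mu> (j + int n * m) + 1 / 2" by (simp add: per add_divide_distrib)
      then show ?thesis by blast
    qed
  qed
  fix c
  {
    assume "c \<in> cuts n y"
    then obtain i k where "c = (y i + y ((i + 1) mod n)) / 2 + of_int k / 2" "i < n" by (auto simp: cuts_def)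
    then show "c \<in> range \<mu> \<union> (\<lambda>i. \<mu> i + 1 / 2) ` UNIV" using mid[of i k] half by metis
  }
  {
    interpret line_angles "cuts n y" using n0 by (intro line_angles_cuts)
    have main: "\<mu> j \<in> cuts n y" for j
    proof -
      define i where "i = nat (j mod int n)"
      have i: "i < n" unfolding i_def by (rule idx)
      have j: "j = int i + int n * (j div int n)" using n0 by (simp add: i_def)
      have "\<mu> j = \<mu> (int i) + of_int (j div int n)"
      proof -
        have "\<xi> (int i + int n * (j div int n) + 1) = \<xi> (int i + 1) + of_int (j div int n)"
          using \<xi>_period_int[of "int i + 1" "j div int n"] by (simp add: ac_simps)
        then show ?thesis by (subst j, unfold \<mu>_def \<xi>_period_int) (simp add: field_simps)
      qed
      moreover have "\<mu> (int i) \<in> cuts n y"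
      proof (cases "i + 1 < n")
        case True
        have "nat (int i + 1) = Suc i" by linarith
        then have "\<mu> (int i) = (y i + y ((i + 1) mod n)) / 2 + of_int 0 / 2"
          using i True by (simp add: \<mu>_def \<xi>_def zmod_int[symmetric] zdiv_int[symmetric] nat_int_add flip: of_nat_Suc)
        then show ?thesis using i unfolding cuts_def by blast
      next
        case False
        then have ni: "n = i + 1" using i by simp
        have ii: "int i + 1 = 0 + int n" using ni by simp
        have "\<xi> (int i + 1) = y 0 + 1" unfolding ii \<xi>_period using n0 by (simp add: \<xi>_def)
        moreover have "\<xi> (int i) = y i" using i by (simp add: \<xi>_def)
        moreover have "(i + 1) mod n = 0" using ni by simp
        ultimately have "\<mu> (int i) = (y i + y ((i + 1) mod n)) / 2 + of_int 1 / 2"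
          by (simp add: \<mu>_def add_divide_distrib)
        then show ?thesis using i unfolding cuts_def by blast
      qed
      ultimately show ?thesis using int_shift_iff by simp
    qed
    assume "c \<in> range \<mu> \<union> (\<lambda>i. \<mu> i + 1 / 2) ` UNIV"
    then show "c \<in> cuts n y" using main add_half by auto
  }
qed

end

section \<open>From empty zones to Voronoi cells\<close>

lemma safe_in_unit3:
  assumes "u \<in> safe r" "\<bar>w - u\<bar> < 3 * r \<or> \<bar>w - anti u\<bar> < 3 * r"
  shows "0 \<le> w" "w < 1"
proof -
  have "(u < 1 / 2 \<and> anti u = u + 1 / 2 \<and> 3 * r < u \<and> u < 1 / 2 - 3 * r) \<or>
      (u > 1 / 2 \<and> anti u = u - 1 / 2 \<and> 1 / 2 + 3 * r < u \<and> u < 1 - 3 * r)"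
    using assms unfolding safe_def anti_def by auto
  then show "0 \<le> w" "w < 1" using assms(2) by (elim disjE; linarith)+
qed

context circle_config
begin

sublocale LA: line_angles "cuts n y"
  using n0 by (intro line_angles_cuts)

text \<open>On the lifted line the antipode of \<open>u\<close> is \<open>u - 1 / 2\<close>, while
  \<open>anti u\<close> lies in [0,1). The difference of the two is 1 for \<open>u < 1 / 2\<close>
  and 0 otherwise, so passing between them permutes the lifted points.\<close>

lemma anti_shift: obtains "\<And>m. \<exists>m'. \<xi> m' = \<xi> m + (1 / 2 - (u - anti u))" "\<And>m. \<exists>m'. \<xi> m' = \<xi> m - (1 / 2 - (u - anti u))"
proof (cases "u < 1 / 2")
  case True
  then have "1 / 2 - (u - anti u) = 1" by (simp add: anti_def)
  moreover have "\<exists>m'. \<xi> m' = \<xi> m + 1" for m using \<xi>_period[of m] by blast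
  moreover have "\<exists>m'. \<xi> m' = \<xi> m - 1" for m
    using \<xi>_period[of "m - int n"] by (intro exI[of _ "m - int n"]) simp
  ultimately show ?thesis using that by simp
next
  case False
  then have z: "1 / 2 - (u - anti u) = 0" by (simp add: anti_def)
  show ?thesis by (rule that; unfold z) auto
qed

text \<open>Each clause of \<open>zone\<close>, when free of other points, says that a generator is
  nearest to some location: to \<open>u\<close>, to its antipode, to the antipode of
  \<open>\<xi> i\<close>, and for \<open>kk = 2\<close> also to the antipode of
  \<open>\<xi> j\<close>. Safety guarantees that lifted points near these locations are actual
  samples, and \<open>\<delta> \<le> r\<close> that the nearest ones lie within the search
  radius.\<close>

lemma paired_iff:
  assumes u: "u \<in> safe r" and r: "r > 0" "\<delta> \<le> r"
  shows "paired kk n r x u \<longleftrightarrow> (\<exists>i j. u \<in> cell i \<and> u - 1 / 2 \<in> cell j \<and> \<xi> i - 1 / 2 \<in> cell j \<and>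
    (kk = 2 \<longrightarrow> \<xi> j + 1 / 2 \<in> cell i))"
proof
  define \<sigma> where "\<sigma> = u - anti u"
  have \<sigma>: "\<bar>\<sigma>\<bar> = 1 / 2" by (simp add: \<sigma>_def anti_def)
  have au: "anti u = u - \<sigma>" by (simp add: \<sigma>_def)
  have r12: "12 * r < 1" using u by (auto simp: safe_def)
  have up: "\<exists>m'. \<xi> m' = \<xi> m + (1 / 2 - \<sigma>)" and down: "\<exists>m'. \<xi> m' = \<xi> m - (1 / 2 - \<sigma>)" for m
    using anti_shift[of u] unfolding \<sigma>_def by metis+
  {
    assume "paired kk n r x u"
    then obtain k l where P: "pair_at kk n r x u k l" by (auto simp: paired_def)
    have kl: "k < n" "l < n" "\<bar>x k - u\<bar> < r" "\<bar>x l - (u - \<sigma>)\<bar> < r"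
      using P unfolding pair_at_def au by auto
    \<comment> \<open>A lifted point in the zone is within 3 r of \<open>u\<close> or
      \<open>anti u\<close>, hence in [0,1), hence a sample; the zone contains none besides the two
      generators.\<close>
    have free: "\<xi> m = x k \<or> \<xi> m = x l" if z: "zone kk u (x k) (x l) (\<xi> m)" for m
    proof -
      have "\<bar>\<xi> m - u\<bar> < 3 * r \<or> \<bar>\<xi> m - anti u\<bar> < 3 * r"
        by (rule zone_near[OF z]) (use kl au in auto)
      then have "0 \<le> \<xi> m" "\<xi> m < 1" using safe_in_unit3[OF u] by blast+
      then obtain k' where "k' < n" "\<xi> m = x k'" using \<xi>_unit by blast
      then show ?thesis using P z unfolding pair_at_def by (metis DiffI insertE lessThan_iff singletonD)
    qed
    have zones: "zone kk u (x k) (x l) s" if "\<bar>s - u\<bar> \<le> \<bar>x k - u\<bar> \<or> \<bar>s - (u - \<sigma>)\<bar> \<le> \<bar>x l - (u - \<sigma>)\<bar> \<or>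
        \<bar>s - (u - \<sigma>) - (x k - u)\<bar> \<le> \<bar>(x k - u) - (x l - (u - \<sigma>))\<bar> \<or>
        (kk = 2 \<and> \<bar>s - u - (x l - (u - \<sigma>))\<bar> \<le> \<bar>(x k - u) - (x l - (u - \<sigma>))\<bar>)" for s
      using that unfolding zone_def au by blast
    obtain i where i: "\<xi> i = x k" using x_is_\<xi>[OF kl(1), of 0] by auto
    obtain j0 where j0: "\<xi> j0 = x l" using x_is_\<xi>[OF kl(2), of 0] by auto
    obtain j where j: "\<xi> j = x l - (1 / 2 - \<sigma>)" using down[of j0] j0 by auto
    have "u \<in> cell i"
    proof (rule nearest_cell)
      fix m assume m: "\<bar>\<xi> m - u\<bar> \<le> \<bar>\<xi> i - u\<bar>"
      then have "\<xi> m = x k \<or> \<xi> m = x l" using i by (intro free zones) auto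
      moreover have "\<xi> m \<noteq> x l" using m i kl \<sigma> r12 by linarith
      ultimately have "\<xi> m = \<xi> i" using i by simp
      then show "m = i" by simp
    qed
    moreover have "u - 1 / 2 \<in> cell j"
    proof (rule nearest_cell)
      fix m assume m: "\<bar>\<xi> m - (u - 1 / 2)\<bar> \<le> \<bar>\<xi> j - (u - 1 / 2)\<bar>"
      obtain m' where m': "\<xi> m' = \<xi> m + (1 / 2 - \<sigma>)" using up by blast
      have le: "\<bar>\<xi> m' - (u - \<sigma>)\<bar> \<le> \<bar>x l - (u - \<sigma>)\<bar>" using m m' j by (simp add: algebra_simps)
      then have "\<xi> m' = x k \<or> \<xi> m' = x l" by (intro free zones) auto
      moreover have "\<xi> m' \<noteq> x k" using le kl \<sigma> r12 by linarith
      ultimately have "\<xi> m = \<xi> j" using m' j by simp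
      then show "m = j" by simp
    qed
    moreover have "\<xi> i - 1 / 2 \<in> cell j"
    proof (rule nearest_cell)
      fix m assume m: "\<bar>\<xi> m - (\<xi> i - 1 / 2)\<bar> \<le> \<bar>\<xi> j - (\<xi> i - 1 / 2)\<bar>"
      obtain m' where m': "\<xi> m' = \<xi> m + (1 / 2 - \<sigma>)" using up by blast
      have "\<xi> m' - (u - \<sigma>) - (x k - u) = \<xi> m - (\<xi> i - 1 / 2)" using m' i by simp
      moreover have "(x k - u) - (x l - (u - \<sigma>)) = - (\<xi> j - (\<xi> i - 1 / 2))" using j i by simp
      ultimately have le: "\<bar>\<xi> m' - (u - \<sigma>) - (x k - u)\<bar> \<le> \<bar>(x k - u) - (x l - (u - \<sigma>))\<bar>" using m by simp
      then have "\<xi> m' = x k \<or> \<xi> m' = x l" by (intro free zones) auto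
      moreover have "\<xi> m' \<noteq> x k" using le kl \<sigma> r12 by linarith
      ultimately have "\<xi> m = \<xi> j" using m' j by simp
      then show "m = j" by simp
    qed
    moreover have "\<xi> j + 1 / 2 \<in> cell i" if kk: "kk = 2"
    proof (rule nearest_cell)
      fix m assume m: "\<bar>\<xi> m - (\<xi> j + 1 / 2)\<bar> \<le> \<bar>\<xi> i - (\<xi> j + 1 / 2)\<bar>"
      have "\<xi> m - u - (x l - (u - \<sigma>)) = \<xi> m - (\<xi> j + 1 / 2)" using j by simp
      moreover have "(x k - u) - (x l - (u - \<sigma>)) = \<xi> i - (\<xi> j + 1 / 2)" using j i by simp
      ultimately have le: "\<bar>\<xi> m - u - (x l - (u - \<sigma>))\<bar> \<le> \<bar>(x k - u) - (x l - (u - \<sigma>))\<bar>" using m by simp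
      then have "\<xi> m = x k \<or> \<xi> m = x l" using kk by (intro free zones) auto
      moreover have "\<xi> m \<noteq> x l" using le kl \<sigma> r12 by linarith
      ultimately have "\<xi> m = \<xi> i" using i by simp
      then show "m = i" by simp
    qed
    ultimately show "\<exists>i j. u \<in> cell i \<and> u - 1 / 2 \<in> cell j \<and> \<xi> i - 1 / 2 \<in> cell j \<and> (kk = 2 \<longrightarrow> \<xi> j + 1 / 2 \<in> cell i)"
      by blast
  }
  assume "\<exists>i j. u \<in> cell i \<and> u - 1 / 2 \<in> cell j \<and> \<xi> i - 1 / 2 \<in> cell j \<and> (kk = 2 \<longrightarrow> \<xi> j + 1 / 2 \<in> cell i)"
  then obtain i j where ij: "u \<in> cell i" "u - 1 / 2 \<in> cell j" "\<xi> i - 1 / 2 \<in> cell j" "kk = 2 \<Longrightarrow> \<xi> j + 1 / 2 \<in> cell i"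
    by blast
  have di: "\<bar>\<xi> i - u\<bar> < r" "\<bar>\<xi> j - (u - 1 / 2)\<bar> < r" using cell_radius[OF ij(1)] cell_radius[OF ij(2)] r by auto
  \<comment> \<open>\<open>j'\<close> is the lift of the same sample that lies near
    \<open>anti u\<close>, inside [0,1), rather than near \<open>u - 1 / 2\<close>.\<close>
  obtain j' where j': "\<xi> j' = \<xi> j + (1 / 2 - \<sigma>)" using up by blast
  have dj: "\<bar>\<xi> j' - (u - \<sigma>)\<bar> < r" using di(2) j' by (simp add: algebra_simps)
  have "0 \<le> \<xi> i" "\<xi> i < 1" "0 \<le> \<xi> j'" "\<xi> j' < 1"
    using safe_in_unit[OF u, of "\<xi> i"] safe_in_unit[OF u, of "\<xi> j'"] di dj au by auto
  then obtain k l where k: "k < n" "\<xi> i = x k" and l: "l < n" "\<xi> j' = x l" using \<xi>_unit by metis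
  have "x k \<noteq> x l" using di dj k l \<sigma> r12 by linarith
  then have "k \<noteq> l" by blast
  have "\<not> zone kk u (x k) (x l) (x m)" if m: "m < n" "m \<noteq> k" "m \<noteq> l" for m
  proof
    assume z: "zone kk u (x k) (x l) (x m)"
    obtain m1 where m1: "\<xi> m1 = x m" using x_is_\<xi>[OF m(1), of 0] by auto
    obtain m2 where m2: "\<xi> m2 = x m - (1 / 2 - \<sigma>)" using down[of m1] m1 by auto
    have ne: "m1 \<noteq> i" "m2 \<noteq> j"
      using inj m k l m1 m2 j' unfolding inj_on_def by auto
    have "\<bar>\<xi> m1 - u\<bar> > \<bar>\<xi> i - u\<bar>" using cell_nearest[OF ij(1), of m1] ne(1) by (meson linorder_not_less)
    moreover have "\<bar>\<xi> m2 - (u - 1 / 2)\<bar> > \<bar>\<xi> j - (u - 1 / 2)\<bar>" using cell_nearest[OF ij(2), of m2] ne(2) by (meson linorder_not_less)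
    then have "\<bar>x m - (u - \<sigma>)\<bar> > \<bar>x l - (u - \<sigma>)\<bar>" using m2 l j' by (simp add: algebra_simps)
    moreover have "\<bar>x m - (u - \<sigma>) - (x k - u)\<bar> > \<bar>(x k - u) - (x l - (u - \<sigma>))\<bar>"
    proof -
      have "\<bar>\<xi> m2 - (\<xi> i - 1 / 2)\<bar> > \<bar>\<xi> j - (\<xi> i - 1 / 2)\<bar>" using cell_nearest[OF ij(3), of m2] ne(2) by (meson linorder_not_less)
      moreover have "x m - (u - \<sigma>) - (x k - u) = \<xi> m2 - (\<xi> i - 1 / 2)" using m2 k by simp
      moreover have "(x k - u) - (x l - (u - \<sigma>)) = - (\<xi> j - (\<xi> i - 1 / 2))" using l j' k by simp
      ultimately show ?thesis by simp
    qed
    moreover have "\<bar>x m - u - (x l - (u - \<sigma>))\<bar> > \<bar>(x k - u) - (x l - (u - \<sigma>))\<bar>" if "kk = 2"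
    proof -
      have "\<bar>\<xi> m1 - (\<xi> j + 1 / 2)\<bar> > \<bar>\<xi> i - (\<xi> j + 1 / 2)\<bar>" using cell_nearest[OF ij(4)[OF that], of m1] ne(1) by (meson linorder_not_less)
      moreover have "x m - u - (x l - (u - \<sigma>)) = \<xi> m1 - (\<xi> j + 1 / 2)" using m1 l j' by simp
      moreover have "(x k - u) - (x l - (u - \<sigma>)) = \<xi> i - (\<xi> j + 1 / 2)" using l j' k by simp
      ultimately show ?thesis by simp
    qed
    ultimately show False using z m1 k unfolding zone_def au by (auto simp: not_le[symmetric])
  qed
  then have "pair_at kk n r x u k l"
    using k l \<open>k \<noteq> l\<close> di dj au unfolding pair_at_def by auto
  then show "paired kk n r x u" by (auto simp: paired_def)
qed

text \<open>With the location at \<open>x k\<close>, that sample has distance 0 and lies in every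
  zone there; so it must be one of the two generators, and the antipodal one is half a turn
  away.\<close>

lemma linked_iff_paired:
  assumes k: "k < n" and r: "r < 1 / 2"
  shows "(\<exists>l. pair_at 2 n r x (x k) k l) \<longleftrightarrow> paired 2 n r x (x k)"
proof
  assume "paired 2 n r x (x k)"
  then obtain k' l where P: "pair_at 2 n r x (x k) k' l" by (auto simp: paired_def)
  have "\<bar>x k - anti (x k)\<bar> = 1 / 2" by (simp add: anti_def)
  then have "k \<noteq> l" using P r by (auto simp: pair_at_def)
  moreover have "zone 2 (x k) (x k') (x l) (x k)" by (simp add: zone_def)
  ultimately have "k = k'" using P k by (auto simp: pair_at_def)
  then show "\<exists>l. pair_at 2 n r x (x k) k l" using P by blast
qed (auto simp: paired_def)

text \<open>Seen from the antipodal location, points and antipodes exchange their roles, so this is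
  \<open>paired_iff\<close> with the two cell indices swapped. The case distinction only moves cells
  by a full period.\<close>

lemma paired_anti_iff:
  assumes u: "u \<in> safe r" "anti u \<in> safe r" and r: "r > 0" "\<delta> \<le> r"
  shows "paired 1 n r x (anti u) \<longleftrightarrow> (\<exists>i j. u \<in> cell i \<and> u - 1 / 2 \<in> cell j \<and> \<xi> j + 1 / 2 \<in> cell i)"
proof -
  have eq: "paired 1 n r x (anti u) \<longleftrightarrow> (\<exists>j i. anti u \<in> cell j \<and> anti u - 1 / 2 \<in> cell i \<and> \<xi> j - 1 / 2 \<in> cell i)"
    unfolding paired_iff[OF u(2) r] by simp
  have down: "w \<in> cell i \<longleftrightarrow> w - 1 \<in> cell (i - int n)" for w i
    using cell_period[of "w - 1" "i - int n"] by simp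
  have half_up: "v - 1 / 2 + 1 = v + 1 / 2" and half_dn: "v + 1 / 2 - 1 = v - 1 / 2"
    and half_dn': "v + 1 - 1 / 2 = v + 1 / 2" and half_both: "v + 1 / 2 - 1 / 2 = v"
    and half_dn2: "v - 1 / 2 - 1 / 2 = v - 1" and half_dn3: "v - 1 + 1 / 2 = v - 1 / 2" for v :: real by simp_all
  have \<xi>_down: "\<xi> (j - int n) + 1 / 2 = \<xi> j - 1 / 2" for j
    using \<xi>_period[of "j - int n"] by simp
  show ?thesis
  proof (cases "u < 1 / 2")
    case True
    then have au: "anti u = u + 1 / 2" by (simp add: anti_def)
    show ?thesis
    proof
      assume "paired 1 n r x (anti u)"
      then obtain j i where "u + 1 / 2 \<in> cell j" "u \<in> cell i" "\<xi> j - 1 / 2 \<in> cell i" unfolding eq unfolding au by auto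
      then show "\<exists>i j. u \<in> cell i \<and> u - 1 / 2 \<in> cell j \<and> \<xi> j + 1 / 2 \<in> cell i"
        using down[of "u + 1 / 2" j] \<xi>_down[of j] by (metis half_up half_dn)
    next
      assume "\<exists>i j. u \<in> cell i \<and> u - 1 / 2 \<in> cell j \<and> \<xi> j + 1 / 2 \<in> cell i"
      then obtain i j where "u \<in> cell i" "u - 1 / 2 \<in> cell j" "\<xi> j + 1 / 2 \<in> cell i" by blast
      then show "paired 1 n r x (anti u)"
        unfolding eq unfolding au using cell_period[of "u - 1 / 2" j] \<xi>_period[of j] by (metis half_up half_dn' half_both)
    qed
  next
    case False
    then have au: "anti u = u - 1 / 2" by (simp add: anti_def)
    show ?thesis
    proof
      assume "paired 1 n r x (anti u)"
      then obtain j i where "u - 1 / 2 \<in> cell j" "u - 1 \<in> cell i" "\<xi> j - 1 / 2 \<in> cell i" unfolding eq unfolding au by auto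
      then show "\<exists>i j. u \<in> cell i \<and> u - 1 / 2 \<in> cell j \<and> \<xi> j + 1 / 2 \<in> cell i"
        using cell_period[of "u - 1" i] cell_period[of "\<xi> j - 1 / 2" i] by (metis diff_add_cancel half_up)
    next
      assume "\<exists>i j. u \<in> cell i \<and> u - 1 / 2 \<in> cell j \<and> \<xi> j + 1 / 2 \<in> cell i"
      then obtain i j where "u \<in> cell i" "u - 1 / 2 \<in> cell j" "\<xi> j + 1 / 2 \<in> cell i" by blast
      then show "paired 1 n r x (anti u)"
        unfolding eq unfolding au using down[of u i] down[of "\<xi> j + 1 / 2" i] by (metis half_dn half_dn2)
    qed
  qed
qed

text \<open>A gap is the intersection of a cell with the half-turn shift of another: moving from
  \<open>u\<close> to \<open>w\<close> inside both crosses no cut, and inside the gap neither cell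
  can be left, since its ends are cuts.\<close>

lemma gap_eq_cells:
  assumes g: "(a, b) \<in> LA.gaps" and u: "a < u" "u < b" "u \<in> cell i" "u - 1 / 2 \<in> cell j"
  shows "a < w \<and> w < b \<longleftrightarrow> w \<in> cell i \<and> w - 1 / 2 \<in> cell j"
proof
  have gg: "a \<in> cuts n y" "b \<in> cuts n y" "cuts n y \<inter> {a<..<b} = {}" using g by (auto simp: LA.gaps_def)
  have c1: "\<mu> m \<notin> {a<..<b}" "\<mu> m + 1 / 2 \<notin> {a<..<b}" for m
    using gg(3) unfolding cuts_eq by blast+
  {
    assume w: "a < w \<and> w < b"
    have "w \<in> cell i"
      using c1(1)[of i] c1(1)[of "i - 1"] u w unfolding cell_def greaterThanLessThan_iff by linarith
    moreover have "w - 1 / 2 \<in> cell j"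
      using c1(2)[of j] c1(2)[of "j - 1"] u w unfolding cell_def greaterThanLessThan_iff by linarith
    ultimately show "w \<in> cell i \<and> w - 1 / 2 \<in> cell j" ..
  }
  assume w: "w \<in> cell i \<and> w - 1 / 2 \<in> cell j"
  \<comment> \<open>Both cells are intervals, so the whole segment between \<open>u\<close> and
    \<open>w\<close> stays inside them and is free of cuts.\<close>
  have no: "c \<notin> {min u w..max u w}" if "c \<in> cuts n y" for c
  proof
    assume c: "c \<in> {min u w..max u w}"
    have cb: "min u w \<le> c" "c \<le> max u w" using c by auto
    have wb: "\<mu> (i - 1) < w" "w < \<mu> i" "\<mu> (j - 1) < w - 1 / 2" "w - 1 / 2 < \<mu> j"
      and ub: "\<mu> (i - 1) < u" "u < \<mu> i" "\<mu> (j - 1) < u - 1 / 2" "u - 1 / 2 < \<mu> j"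
      using w u by (simp_all add: cell_def)
    have "c \<in> cell i" "c - 1 / 2 \<in> cell j"
      unfolding cell_def greaterThanLessThan_iff using cb wb ub unfolding min_def max_def by (cases "u \<le> w"; simp only: if_True if_False; linarith)+
    moreover have "c \<in> range \<mu> \<or> c - 1 / 2 \<in> range \<mu>" using that unfolding cuts_eq by auto
    ultimately show False using \<mu>_notin_cell by auto
  qed
  show "a < w \<and> w < b"
  proof (rule ccontr)
    assume "\<not> (a < w \<and> w < b)"
    then have "a \<in> {min u w..max u w} \<or> b \<in> {min u w..max u w}"
      using u by (cases "u \<le> w") (auto simp: min_def max_def)
    then show False using no[OF gg(1)] no[OF gg(2)] by blast
  qed
qed

lemma gap_has_cells:
  assumes g: "(a, b) \<in> LA.gaps" "a < u" "u < b"
  obtains i j where "u \<in> cell i" "u - 1 / 2 \<in> cell j"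
proof -
  have "u \<notin> cuts n y" using g by (auto simp: LA.gaps_def)
  then have "u \<notin> range \<mu>" "u - 1 / 2 \<notin> range \<mu>" unfolding cuts_eq by (auto simp: image_iff algebra_simps)
  then show ?thesis using ex_cell that by blast
qed

text \<open>\<open>h = 0\<close> for the points, \<open>h = 1 / 2\<close> for their antipodes.\<close>

definition has_pt :: "real \<Rightarrow> int \<Rightarrow> real \<times> real \<Rightarrow> bool" where
  "has_pt h m g \<longleftrightarrow> fst g < \<xi> m + h \<and> \<xi> m + h < snd g"

lemma gap_points:
  assumes g: "g \<in> LA.gaps" and u: "fst g < u" "u < snd g" "u \<in> cell i" "u - 1 / 2 \<in> cell j"
  shows "has_pt 0 m g \<longleftrightarrow> m = i \<and> \<xi> i - 1 / 2 \<in> cell j" "has_pt (1 / 2) m g \<longleftrightarrow> m = j \<and> \<xi> j + 1 / 2 \<in> cell i"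
proof -
  have g': "(fst g, snd g) \<in> LA.gaps" using g by simp
  show "has_pt 0 m g \<longleftrightarrow> m = i \<and> \<xi> i - 1 / 2 \<in> cell j"
    using gap_eq_cells[OF g' u, of "\<xi> m"] \<xi>_in_cell_iff[of m i] unfolding has_pt_def add_0_right by metis
  have "\<xi> m + 1 / 2 - 1 / 2 = \<xi> m" by simp
  then show "has_pt (1 / 2) m g \<longleftrightarrow> m = j \<and> \<xi> j + 1 / 2 \<in> cell i"
    using gap_eq_cells[OF g' u, of "\<xi> m + 1 / 2"] \<xi>_in_cell_iff[of m j] unfolding has_pt_def by metis
qed

text \<open>A gap contains at most one point and at most one antipode, so the number of samples
  involved is the sum of two indicators, once it is known that the two belong to different
  samples.\<close>

lemma gap_type_eq:
  assumes g: "g \<in> LA.gaps"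
  shows "gap_type n y g = of_bool (\<exists>m. has_pt 0 m g) + of_bool (\<exists>m. has_pt (1 / 2) m g)"
proof -
  define a b where ab: "a = fst g" "b = snd g"
  have g': "(a, b) \<in> LA.gaps" using g by (simp add: ab)
  have lt: "a < b" "b \<le> a + 1 / 2" using LA.gap_length[OF g'] g' by (auto simp: LA.gaps_def)
  define u where "u = (a + b) / 2"
  have u: "a < u" "u < b" using lt by (auto simp: u_def)
  obtain i j where ij: "u \<in> cell i" "u - 1 / 2 \<in> cell j" using gap_has_cells[OF g' u] .
  note P = gap_points[OF g u[unfolded ab] ij]
  define cA where "cA \<longleftrightarrow> (\<exists>m. has_pt 0 m g)"
  define cB where "cB \<longleftrightarrow> (\<exists>m. has_pt (1 / 2) m g)"
  have A: "has_pt 0 m g \<longleftrightarrow> m = i \<and> cA" and B: "has_pt (1 / 2) m g \<longleftrightarrow> m = j \<and> cB" for m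
    using P unfolding cA_def cB_def by blast+
  define K where "K i = nat (i mod int n)" for i
  have \<xi>K: "\<xi> i = y (K i) + of_int (i div int n)" for i by (simp add: \<xi>_def K_def)
  have K_inv: "K (int k + int n * w) = k" "(int k + int n * w) div int n = w" if "k < n" for k w
    using that n0 by (simp_all add: K_def)
  have "{k \<in> {..<n}. \<exists>z::int. fst g < y k + of_int z / 2 \<and> y k + of_int z / 2 < snd g} =
      (if cA then {K i} else {}) \<union> (if cB then {K j} else {})"
  proof (intro equalityI subsetI)
    fix k assume "k \<in> {k \<in> {..<n}. \<exists>z::int. fst g < y k + of_int z / 2 \<and> y k + of_int z / 2 < snd g}"
    then obtain z :: int where k: "k < n" and z: "fst g < y k + of_int z / 2" "y k + of_int z / 2 < snd g" by auto
    show "k \<in> (if cA then {K i} else {}) \<union> (if cB then {K j} else {})"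
    proof (cases "even z")
      case True
      then obtain w where w: "z = 2 * w" by blast
      have "has_pt 0 (int k + int n * w) g" using z K_inv[OF k, of w] \<xi>K[of "int k + int n * w"] by (simp add: has_pt_def w)
      then have "int k + int n * w = i \<and> cA" using A by blast
      then show ?thesis using K_inv(1)[OF k, of w] by auto
    next
      case False
      then obtain w where w: "z = 2 * w + 1" by (elim oddE)
      have "has_pt (1 / 2) (int k + int n * w) g" using z K_inv[OF k, of w] \<xi>K[of "int k + int n * w"]
        by (simp add: has_pt_def w add_divide_distrib)
      then have "int k + int n * w = j \<and> cB" using B by blast
      then show ?thesis using K_inv(1)[OF k, of w] by auto
    qed
  next
    fix k assume k: "k \<in> (if cA then {K i} else {}) \<union> (if cB then {K j} else {})"
    then consider "cA" "k = K i" | "cB" "k = K j" by (auto split: if_splits)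
    then show "k \<in> {k \<in> {..<n}. \<exists>z::int. fst g < y k + of_int z / 2 \<and> y k + of_int z / 2 < snd g}"
    proof cases
      case 1
      then have "has_pt 0 i g" using A by blast
      then have "fst g < y k + of_int (2 * (i div int n)) / 2 \<and> y k + of_int (2 * (i div int n)) / 2 < snd g"
        using \<xi>K[of i] 1 by (simp add: has_pt_def)
      then show ?thesis using 1 idx unfolding K_def by blast
    next
      case 2
      then have "has_pt (1 / 2) j g" using B by blast
      then have "fst g < y k + of_int (2 * (j div int n) + 1) / 2 \<and> y k + of_int (2 * (j div int n) + 1) / 2 < snd g"
        using \<xi>K[of j] 2 by (simp add: has_pt_def add_divide_distrib)
      then show ?thesis using 2 idx unfolding K_def by blast
    qed
  qed
  \<comment> \<open>A sample and its own antipode differ by an odd multiple of 1/2, too far for two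
    interior points of a gap of length at most 1/2.\<close>
  moreover have "K i \<noteq> K j" if "cA" "cB"
  proof
    assume e: "K i = K j"
    have "has_pt 0 i g" "has_pt (1 / 2) j g" using A B that by auto
    then have "a < \<xi> i" "\<xi> i < b" "a < \<xi> j + 1 / 2" "\<xi> j + 1 / 2 < b" by (simp_all add: has_pt_def ab)
    then have "\<bar>\<xi> i - (\<xi> j + 1 / 2)\<bar> < 1 / 2" using lt by linarith
    moreover have "\<xi> i - \<xi> j = of_int (i div int n - j div int n)" using \<xi>K[of i] \<xi>K[of j] e by simp
    ultimately have "0 < (of_int (i div int n - j div int n) :: real)" "(of_int (i div int n - j div int n) :: real) < 1" by linarith+
    then show False unfolding of_int_0_less_iff of_int_less_1_iff by linarith
  qed
  ultimately show ?thesis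
    unfolding gap_type_def cA_def[symmetric] cB_def[symmetric] by (cases cA; cases cB) auto
qed

end

section \<open>Counts and lengths up to small errors\<close>

lemma card_le_Suc_if_unique:
  assumes "finite B" "\<And>i j. i \<in> A - B \<Longrightarrow> j \<in> A - B \<Longrightarrow> i = j"
  shows "finite A" "card A \<le> card B + 1"
proof -
  obtain a where a: "A - B \<subseteq> {a}" using assms(2) by blast
  then have D: "finite (A - B)" by (rule finite_subset) simp
  have "card (A - B) \<le> card {a}" by (rule card_mono[OF _ a]) simp
  have sub: "A \<subseteq> B \<union> (A - B)" by blast
  show "finite A" by (rule finite_subset[OF sub]) (use assms(1) D in blast)
  have "card A \<le> card (B \<union> (A - B))" by (rule card_mono[OF _ sub]) (use assms(1) D in blast)
  also have "\<dots> \<le> card B + card (A - B)" by (rule card_Un_le)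
  finally show "card A \<le> card B + 1" using \<open>card (A - B) \<le> card {a}\<close> by simp
qed

lemma card_disagreement:
  assumes "finite A" "finite B" "A \<subseteq> B \<union> D" "B \<subseteq> A \<union> D" "finite D"
  shows "\<bar>real (card A) - real (card B)\<bar> \<le> card D"
proof -
  have "card A \<le> card (B \<union> D)" "card B \<le> card (A \<union> D)" by (intro card_mono; use assms in blast)+
  then show ?thesis using card_Un_le[of B D] card_Un_le[of A D] by linarith
qed

lemma measure_translated:
  assumes S: "S \<in> sets borel"
  shows "measure lborel {u :: real. u + c \<in> S} = measure lborel S"
proof -
  have "measure lborel S = measure (distr lborel borel ((+) c)) S" by (simp add: lborel_distr_plus)
  also have "\<dots> = measure lborel ((+) c -` S \<inter> space lborel)" using S by (intro measure_distr) auto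
  also have "(+) c -` S \<inter> space lborel = {u. u + c \<in> S}" by (auto simp: add.commute)
  finally show ?thesis ..
qed

lemma anti_anti: "u \<in> {0..<1} \<Longrightarrow> anti u \<in> {0..<1} \<and> anti (anti u) = u"
  by (auto simp: anti_def)

text \<open>\<open>anti\<close> exchanges the two halves of [0,1) by translations, each of which
  preserves Lebesgue measure.\<close>

lemma measure_anti:
  assumes S: "S \<in> sets borel" "S \<subseteq> {0..<1}"
  shows "measure lborel {u \<in> {0..<1}. anti u \<in> S} = measure lborel S"
proof -
  define S1 where "S1 = S \<inter> {0..<1 / 2}"
  define S2 where "S2 = S \<inter> {1 / 2..<1}"
  have m: "S1 \<in> sets borel" "S2 \<in> sets borel" using S by (auto simp: S1_def S2_def)
  have m': "{u. u + (- 1 / 2) \<in> S1} \<in> sets borel" "{u. u + 1 / 2 \<in> S2} \<in> sets borel"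
    using m by measurable
  have fin: "emeasure lborel A \<noteq> \<infinity>" if "A \<subseteq> {-2..2}" for A :: "real set"
    using emeasure_mono[of A "{-2..2}" lborel] that by (auto simp: top_unique)
  have "{u \<in> {0..<1}. anti u \<in> S} = {u. u + (- 1 / 2) \<in> S1} \<union> {u. u + 1 / 2 \<in> S2}"
    using S(2) by (auto simp: anti_def S1_def S2_def split: if_splits)
  also have "measure lborel \<dots> = measure lborel {u. u + (- 1 / 2) \<in> S1} + measure lborel {u. u + 1 / 2 \<in> S2}"
    using m' by (intro measure_Union fin) (auto simp: S1_def S2_def)
  also have "\<dots> = measure lborel S1 + measure lborel S2"
    using m by (simp only: measure_translated)
  also have "\<dots> = measure lborel (S1 \<union> S2)"
    using m by (intro measure_Union[symmetric] fin) (auto simp: S1_def S2_def)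
  also have "S1 \<union> S2 = S" using S(2) by (auto simp: S1_def S2_def)
  finally show ?thesis .
qed

lemma anti_safe_iff: "u \<in> {0..<1} \<Longrightarrow> anti u \<in> safe r \<longleftrightarrow> u \<in> safe r"
  if "r > 0" using that by (auto simp: anti_def safe_def)

text \<open>The excluded neighbourhoods of 0, 1/2 and 1 have lengths 3 r, 6 r and 3 r.\<close>

lemma measure_unsafe_le:
  assumes r: "r > 0" and A: "A \<in> sets borel" "A \<subseteq> {0..1} - safe r"
  shows "measure lborel A \<le> 12 * r"
proof -
  define B where "B = {0..3 * r} \<union> {1 / 2 - 3 * r..1 / 2 + 3 * r} \<union> {1 - 3 * r..1}"
  have "A \<subseteq> B" using A(2) by (auto simp: B_def safe_def)
  then have "measure lborel A \<le> measure lborel B"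
  proof (rule measure_mono_fmeasurable)
    have "bounded B" "closed B" by (auto simp: B_def)
    then show "B \<in> fmeasurable lborel" by (intro fmeasurable_compact) (simp add: compact_eq_bounded_closed)
  qed (use A in simp_all)
  also have "\<dots> \<le> measure lborel ({0..3 * r} \<union> {1 / 2 - 3 * r..1 / 2 + 3 * r}) + measure lborel {1 - 3 * r..1}"
    unfolding B_def by (intro measure_Un_le) auto
  also have "\<dots> \<le> (measure lborel {0..3 * r} + measure lborel {1 / 2 - 3 * r..1 / 2 + 3 * r}) + measure lborel {1 - 3 * r..1}"
    by (intro add_right_mono measure_Un_le) auto
  also have "\<dots> = 12 * r" using r by simp
  finally show ?thesis .
qed

context circle_config
begin

lemma \<mu>_finite: "finite {i. p \<le> \<mu> i \<and> \<mu> i \<le> q}"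
proof -
  have "\<mu> ` {i. p \<le> \<mu> i \<and> \<mu> i \<le> q} \<subseteq> cuts n y \<inter> {p..q}" unfolding cuts_eq by auto
  then have "finite (\<mu> ` {i. p \<le> \<mu> i \<and> \<mu> i \<le> q})" using LA.fin finite_subset by blast
  then show ?thesis by (rule finite_imageD) (simp add: inj_on_def)
qed

text \<open>Since \<open>\<mu> i\<close> lies between consecutive points, an index counted for one
  sequence only must straddle an end of the interval: the right end if the point alone is counted,
  the left end if the cut alone is. Each end is straddled by one index.\<close>

lemma \<xi>_\<mu>_interlacing:
  "finite {i. p \<le> \<xi> i \<and> \<xi> i \<le> q}"
  "\<bar>real (card {i. p \<le> \<xi> i \<and> \<xi> i \<le> q}) - real (card {i. p \<le> \<mu> i \<and> \<mu> i \<le> q})\<bar> \<le> 1"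
proof -
  define S where "S = {i. p \<le> \<xi> i \<and> \<xi> i \<le> q}"
  define T where "T = {i. p \<le> \<mu> i \<and> \<mu> i \<le> q}"
  have T: "finite T" unfolding T_def by (rule \<mu>_finite)
  have uS: "i = j" if "i \<in> S - T" "j \<in> S - T" for i j
  proof -
    have "\<xi> i \<le> q \<and> q < \<xi> (i + 1)" if "i \<in> S - T" for i
      using that \<mu>_between[of i] unfolding S_def T_def by auto
    then have "\<xi> i < \<xi> (j + 1)" "\<xi> j < \<xi> (i + 1)" using that by (meson le_less_trans)+
    then show ?thesis by simp
  qed
  note S = card_le_Suc_if_unique[of T S, OF T uS]
  have uT: "i = j" if "i \<in> T - S" "j \<in> T - S" for i j
  proof -
    have "\<xi> i < p \<and> p \<le> \<xi> (i + 1)" if "i \<in> T - S" for i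
      using that \<mu>_between[of i] unfolding S_def T_def by auto
    then have "\<xi> i < \<xi> (j + 1)" "\<xi> j < \<xi> (i + 1)" using that by (meson less_le_trans)+
    then show ?thesis by simp
  qed
  note T' = card_le_Suc_if_unique[of S T, OF S(1) uT]
  show "finite {i. p \<le> \<xi> i \<and> \<xi> i \<le> q}" using S(1) by (simp add: S_def)
  show "\<bar>real (card {i. p \<le> \<xi> i \<and> \<xi> i \<le> q}) - real (card {i. p \<le> \<mu> i \<and> \<mu> i \<le> q})\<bar> \<le> 1"
    using S(2) T'(2) unfolding S_def[symmetric] T_def[symmetric] by linarith
qed

text \<open>The distance of consecutive \<open>\<mu>\<close> is the mean of two neighbouring
  spacings, hence at most \<delta>.\<close>

lemma cut_after: obtains i where "s < \<mu> i" "\<mu> i \<le> s + \<delta>"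
proof -
  obtain i where i: "\<mu> i \<le> s" "s < \<mu> (i + 1)"
    by (rule strict_mono_int_bracket[OF strict_mono_\<mu> \<mu>_period n0(1)])
  have avg: "b \<le> a + \<delta> \<Longrightarrow> c \<le> b + \<delta> \<Longrightarrow> (b + c) / 2 \<le> (a + b) / 2 + \<delta>" for a b c by argo
  have "\<mu> (i + 1) \<le> \<mu> i + \<delta>" unfolding \<mu>_def by (rule avg) (rule \<xi>_gap)+
  then show ?thesis using that i by force
qed

lemma \<xi>_\<mu>_not_cut:
  assumes h: "h = 0 \<or> h = 1 / 2"
  shows "\<mu> i + h \<in> cuts n y" "\<xi> i + h \<notin> cuts n y"
proof -
  have a: "\<xi> i \<noteq> \<mu> j" for i j using \<xi>_in_cell \<mu>_notin_cell by metis
  have b: "\<xi> i + 1 / 2 \<noteq> \<mu> j" for i j using \<xi>_ne_half'[of i j] by auto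
  show "\<mu> i + h \<in> cuts n y" using h unfolding cuts_eq by (elim disjE; hypsubst; auto)
  show "\<xi> i + h \<notin> cuts n y" using h a b \<xi>_ne_half unfolding cuts_eq by (elim disjE; hypsubst; auto)
qed

text \<open>Unlike \<open>gaps_upto\<close> this has no exception at \<open>t = 1\<close>; the
  single gap across the direction 0 is treated as an error term, so that all gaps counted here lie
  in [0,t].\<close>

definition gaps_to :: "real \<Rightarrow> (real \<times> real) set" where
  "gaps_to t = {g \<in> LA.gaps. snd g \<le> t}"

lemma finite_gaps_to: "finite (gaps_to t)"
  using LA.finite_gaps by (simp add: gaps_to_def)

lemma gap_unique: "g \<in> LA.gaps \<Longrightarrow> g' \<in> LA.gaps \<Longrightarrow> fst g < s \<Longrightarrow> s < snd g \<Longrightarrow> fst g' < s \<Longrightarrow> s < snd g' \<Longrightarrow> g = g'"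
  using LA.gaps_disjoint[of "fst g" "snd g" "fst g'" "snd g'" s 0] by (simp add: prod_eq_iff)

text \<open>Between two lifted points there is a cut of the same family, which cannot lie inside a
  gap.\<close>

lemma has_pt_unique:
  assumes h: "h = 0 \<or> h = 1 / 2" and g: "g \<in> LA.gaps" and m: "has_pt h m g" "has_pt h m' g"
  shows "m = m'"
proof -
  have "\<not> m < m'" if "has_pt h m g" "has_pt h m' g" for m m'
  proof
    assume "m < m'"
    then have "\<xi> (m + 1) \<le> \<xi> m'" by simp
    then have "\<mu> m + h \<in> {fst g<..<snd g}" using that \<mu>_between[of m] by (auto simp: has_pt_def simp del: \<xi>_le_iff)
    moreover have "cuts n y \<inter> {fst g<..<snd g} = {}" using g by (auto simp: LA.gaps_def)
    ultimately show False using \<xi>_\<mu>_not_cut(1)[OF h] by blast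
  qed
  then show ?thesis using m by (meson linorder_neqE)
qed

text \<open>The maximal cut-free interval around \<open>w\<close> cannot extend beyond the cuts
  \<open>c\<close> and \<open>c'\<close>, so it is a gap within [0,t].\<close>

lemma covered:
  assumes w: "w \<notin> cuts n y" and c: "c \<in> cuts n y" "0 \<le> c" "c < w" "c' \<in> cuts n y" "w < c'" "c' \<le> t" and t: "t \<le> 1"
  obtains g where "g \<in> gaps_to t" "fst g < w" "w < snd g"
proof -
  obtain a b where ab: "a \<in> cuts n y" "b \<in> cuts n y" "a < w" "w < b" "cuts n y \<inter> {a<..<b} = {}"
    using LA.ex_surrounding[OF w] .
  have "c \<notin> {a<..<b}" "c' \<notin> {a<..<b}" using ab c by blast+
  then have "0 \<le> a" "b \<le> t" using ab c by auto
  then have "(a, b) \<in> gaps_to t" using ab t by (auto simp: gaps_to_def LA.gaps_def)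
  then show ?thesis using that ab by force
qed

lemma card_has_pt:
  assumes h: "h = 0 \<or> h = 1 / 2"
  shows "card {m. \<exists>g\<in>gaps_to t. has_pt h m g \<and> P g} = card {g \<in> gaps_to t. (\<exists>m. has_pt h m g) \<and> P g}"
    "finite {m. \<exists>g\<in>gaps_to t. has_pt h m g \<and> P g}"
proof -
  define f where "f g = (THE m. has_pt h m g)" for g
  have f: "f g = m" if "g \<in> gaps_to t" "has_pt h m g" for g m
  proof -
    have "g \<in> LA.gaps" using that by (simp add: gaps_to_def)
    then show ?thesis unfolding f_def using that(2) has_pt_unique[OF h _ _ that(2)] by (intro the_equality) blast+
  qed
  have im: "{m. \<exists>g\<in>gaps_to t. has_pt h m g \<and> P g} = f ` {g \<in> gaps_to t. (\<exists>m. has_pt h m g) \<and> P g}"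
    using f by (auto simp: image_iff; metis)
  have "inj_on f {g \<in> gaps_to t. (\<exists>m. has_pt h m g) \<and> P g}"
  proof (rule inj_onI)
    fix g g' assume g: "g \<in> {g \<in> gaps_to t. (\<exists>m. has_pt h m g) \<and> P g}" "g' \<in> {g \<in> gaps_to t. (\<exists>m. has_pt h m g) \<and> P g}" "f g = f g'"
    then obtain m m' where "has_pt h m g" "has_pt h m' g'" by blast
    then have "has_pt h m g" "has_pt h m g'" using f g by auto
    then show "g = g'" using g gap_unique[of g g' "\<xi> m + h"] by (auto simp: gaps_to_def has_pt_def)
  qed
  then show "card {m. \<exists>g\<in>gaps_to t. has_pt h m g \<and> P g} = card {g \<in> gaps_to t. (\<exists>m. has_pt h m g) \<and> P g}"
    unfolding im by (rule card_image)
  show "finite {m. \<exists>g\<in>gaps_to t. has_pt h m g \<and> P g}" unfolding im using finite_gaps_to by simp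
qed

text \<open>A point whose two neighbouring cuts of the same family lie in [0,t] is inside a counted
  gap. The only exceptions are the least point at or after 0 and the greatest at or before
  t.\<close>

lemma uncovered:
  assumes h: "h = 0 \<or> h = 1 / 2" and t: "t \<le> 1"
  defines "N \<equiv> {m. 0 \<le> \<xi> m + h \<and> \<xi> m + h \<le> t \<and> (\<forall>g\<in>gaps_to t. \<not> has_pt h m g)}"
  shows "finite N" "card N \<le> 2"
proof -
  define L where "L = {m. \<xi> (m - 1) < - h \<and> - h \<le> \<xi> m}"
  define R where "R = {m. \<xi> m \<le> t - h \<and> t - h < \<xi> (m + 1)}"
  have "i = j" if "i \<in> L - {}" "j \<in> L - {}" for i j
  proof -
    have "\<xi> (i - 1) < \<xi> j" "\<xi> (j - 1) < \<xi> i" using that unfolding L_def by (auto simp del: \<xi>_less_iff)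
    then show ?thesis by simp
  qed
  then have L: "finite L" "card L \<le> 1" using card_le_Suc_if_unique[of "{}" L] by auto
  have "i = j" if "i \<in> R - {}" "j \<in> R - {}" for i j
  proof -
    have "\<xi> i < \<xi> (j + 1)" "\<xi> j < \<xi> (i + 1)" using that unfolding R_def by (auto simp del: \<xi>_less_iff)
    then show ?thesis by simp
  qed
  then have R: "finite R" "card R \<le> 1" using card_le_Suc_if_unique[of "{}" R] by auto
  have sub: "N \<subseteq> L \<union> R"
  proof
    fix m assume m: "m \<in> N"
    show "m \<in> L \<union> R"
    proof (rule ccontr)
      assume no: "m \<notin> L \<union> R"
      have "0 \<le> \<mu> (m - 1) + h" "\<mu> m + h \<le> t"
        using no m \<mu>_between[of m] \<mu>_between[of "m - 1"] by (auto simp: N_def L_def R_def)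
      then obtain g where "g \<in> gaps_to t" "fst g < \<xi> m + h" "\<xi> m + h < snd g"
        using covered[OF \<xi>_\<mu>_not_cut(2)[OF h, of m] \<xi>_\<mu>_not_cut(1)[OF h, of "m - 1"] _ _ \<xi>_\<mu>_not_cut(1)[OF h, of m] _ _ t]
          \<mu>_between[of m] \<mu>_between[of "m - 1"] by auto
      then show False using m by (auto simp: N_def has_pt_def)
    qed
  qed
  show "finite N" using sub L R finite_subset by blast
  have "card N \<le> card (L \<union> R)" using sub L R by (intro card_mono) auto
  then show "card N \<le> 2" using card_Un_le[of L R] L R by linarith
qed

lemma card_points_near:
  assumes h: "h = 0 \<or> h = 1 / 2" and t: "0 \<le> t" "t \<le> 1"
  shows "\<bar>real (card {g \<in> gaps_to t. \<exists>m. has_pt h m g}) - real (card {m. 0 \<le> \<xi> m + h \<and> \<xi> m + h \<le> t})\<bar> \<le> 2"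
proof -
  define N where "N = {m. 0 \<le> \<xi> m + h \<and> \<xi> m + h \<le> t \<and> (\<forall>g\<in>gaps_to t. \<not> has_pt h m g)}"
  define C where "C = {m. \<exists>g\<in>gaps_to t. has_pt h m g \<and> True}"
  define S where "S = {m. 0 \<le> \<xi> m + h \<and> \<xi> m + h \<le> t}"
  have N: "finite N" "card N \<le> 2" using uncovered[OF h t(2)] by (simp_all add: N_def)
  have "S = {m. - h \<le> \<xi> m \<and> \<xi> m \<le> t - h}" by (auto simp: S_def)
  then have S: "finite S" using \<xi>_\<mu>_interlacing(1) by simp
  have "C \<subseteq> S"
    by (auto simp: C_def S_def has_pt_def gaps_to_def LA.gaps_def)
  moreover have "S \<subseteq> C \<union> N" by (auto simp: S_def C_def N_def)
  ultimately have "\<bar>real (card C) - real (card S)\<bar> \<le> card N"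
    using S N finite_subset by (intro card_disagreement) blast+
  then show ?thesis using N card_has_pt(1)[OF h, where P = "\<lambda>_. True"] by (simp add: C_def S_def)
qed

text \<open>Gaps are counted by their right ends, which are all cuts in [0,t] except possibly the
  smallest. The cuts form two disjoint families, interlacing with the points and with the antipodes;
  each of the three comparisons costs at most 1.\<close>

lemma card_gaps_to:
  assumes t: "0 \<le> t" "t \<le> 1"
  shows "\<bar>real (card (gaps_to t)) - (real (card {m. 0 \<le> \<xi> m \<and> \<xi> m \<le> t}) + real (card {m. 0 \<le> \<xi> m + 1 / 2 \<and> \<xi> m + 1 / 2 \<le> t}))\<bar> \<le> 3"
proof -
  define T where "T = cuts n y \<inter> {0..t}"
  define T1 where "T1 = {m. 0 \<le> \<mu> m \<and> \<mu> m \<le> t}"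
  define T2 where "T2 = {m. - 1 / 2 \<le> \<mu> m \<and> \<mu> m \<le> t - 1 / 2}"
  have T: "finite T" unfolding T_def by (rule LA.fin)
  have Teq: "T = \<mu> ` T1 \<union> (\<lambda>m. \<mu> m + 1 / 2) ` T2"
    unfolding T_def T1_def T2_def cuts_eq by auto
  have "card T = card (\<mu> ` T1) + card ((\<lambda>m. \<mu> m + 1 / 2) ` T2)"
    unfolding Teq using \<mu>_ne_half \<mu>_finite unfolding T1_def T2_def by (intro card_Un_disjoint) auto
  also have "\<dots> = card T1 + card T2"
    by (intro arg_cong2[of _ _ _ _ "(+)"] card_image) (auto simp: inj_on_def)
  finally have cT: "card T = card T1 + card T2" .
  have inj: "inj_on snd (gaps_to t)"
  proof (rule inj_onI)
    fix g g' assume g: "g \<in> gaps_to t" "g' \<in> gaps_to t" "snd g = snd g'"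
    then have lt: "fst g < snd g" "fst g' < snd g'" "fst g \<in> cuts n y" "fst g' \<in> cuts n y"
      "cuts n y \<inter> {fst g<..<snd g} = {}" "cuts n y \<inter> {fst g'<..<snd g'} = {}" by (auto simp: gaps_to_def LA.gaps_def)
    then have "fst g \<notin> {fst g'<..<snd g'}" "fst g' \<notin> {fst g<..<snd g}" by blast+
    then show "g = g'" using lt g by (auto simp: prod_eq_iff)
  qed
  have sub: "snd ` gaps_to t \<subseteq> T" by (auto simp: gaps_to_def LA.gaps_def T_def)
  \<comment> \<open>Every cut in [0,t] with a predecessor in [0,t] is the right end of the gap that
    starts at this predecessor.\<close>
  have left: "c = Min T" if c: "c \<in> T - snd ` gaps_to t" for c
  proof (rule ccontr)
    assume "c \<noteq> Min T"
    moreover have ne: "T \<noteq> {}" using c by blast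
    ultimately have Mlt: "Min T < c" using c T by (metis DiffD1 Min_le order_le_less)
    define a where "a = Max (T \<inter> {..<c})"
    have fin: "finite (T \<inter> {..<c})" and ne': "T \<inter> {..<c} \<noteq> {}" using T Min_in[OF T ne] Mlt by auto
    have a: "a \<in> T \<inter> {..<c}" unfolding a_def by (rule Max_in[OF fin ne'])
    have "cuts n y \<inter> {a<..<c} = {}"
    proof (rule ccontr)
      assume "cuts n y \<inter> {a<..<c} \<noteq> {}"
      then obtain b where b: "b \<in> cuts n y" "a < b" "b < c" by auto
      then have "b \<in> T \<inter> {..<c}" using a c by (auto simp: T_def)
      then have "b \<le> a" unfolding a_def by (rule Max_ge[OF fin])
      then show False using b by simp
    qed
    then have "(a, c) \<in> gaps_to t" using a c t by (auto simp: T_def gaps_to_def LA.gaps_def)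
    then show False using c by force
  qed
  have u: "i = j" if "i \<in> T - snd ` gaps_to t" "j \<in> T - snd ` gaps_to t" for i j
    using left that by metis
  have "finite (snd ` gaps_to t)" using finite_gaps_to by simp
  then have "card T \<le> card (snd ` gaps_to t) + 1" using u by (rule card_le_Suc_if_unique(2))
  then have d: "card T \<le> card (gaps_to t) + 1" "card (gaps_to t) \<le> card T"
    using card_mono[OF T sub] card_image[OF inj] by auto
  have "{m. - 1 / 2 \<le> \<xi> m \<and> \<xi> m \<le> t - 1 / 2} = {m. 0 \<le> \<xi> m + 1 / 2 \<and> \<xi> m + 1 / 2 \<le> t}" by auto
  then have "\<bar>real (card {m. 0 \<le> \<xi> m + 1 / 2 \<and> \<xi> m + 1 / 2 \<le> t}) - real (card T2)\<bar> \<le> 1"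
    using \<xi>_\<mu>_interlacing(2)[of "- 1 / 2" "t - 1 / 2"] unfolding T2_def by simp
  then show ?thesis using \<xi>_\<mu>_interlacing(2)[of 0 t] d cT unfolding T1_def by linarith
qed

text \<open>One argument serves the points (\<open>h = 0\<close>, \<open>f\<close> the identity) and
  the antipodes (\<open>h = 1 / 2\<close>, \<open>f = anti\<close>): lifted positions in [0,1) are
  in bijection with the samples.\<close>

lemma card_sample:
  assumes t: "0 \<le> t" "t \<le> 1"
  shows "\<bar>real (card {m. 0 \<le> \<xi> m \<and> \<xi> m \<le> t}) - real (card {k \<in> {..<n}. x k \<in> {..t}})\<bar> \<le> 1"
    "\<bar>real (card {m. 0 \<le> \<xi> m + 1 / 2 \<and> \<xi> m + 1 / 2 \<le> t}) - real (card {k \<in> {..<n}. x k \<in> {u. anti u \<le> t}})\<bar> \<le> 1"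
proof -
  have main: "\<bar>real (card {m. 0 \<le> \<xi> m + h \<and> \<xi> m + h \<le> t}) - real (card {k \<in> {..<n}. f (x k) \<le> t})\<bar> \<le> 1"
    if h: "h = 0 \<or> h = 1 / 2" and f: "inj_on f {0..<1}"
      "\<And>v. 0 \<le> v \<Longrightarrow> v < 1 \<Longrightarrow> v - h \<in> range \<xi> \<Longrightarrow> \<exists>k<n. v = f (x k)"
      "\<And>k. k < n \<Longrightarrow> 0 \<le> f (x k) \<and> f (x k) < 1 \<and> f (x k) - h \<in> range \<xi>" for h f
  proof -
    define S where "S = {m. 0 \<le> \<xi> m + h \<and> \<xi> m + h \<le> t}"
    define K where "K = {k \<in> {..<n}. f (x k) \<le> t}"
    have "S = {m. - h \<le> \<xi> m \<and> \<xi> m \<le> t - h}" by (auto simp: S_def)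
    then have fin: "finite S" using \<xi>_\<mu>_interlacing(1) by simp
    have S: "card ((\<lambda>m. \<xi> m + h) ` S) = card S" by (intro card_image) (auto simp: inj_on_def)
    have "inj_on (\<lambda>k. f (x k)) K"
    proof (rule inj_onI)
      fix k l assume kl: "k \<in> K" "l \<in> K" "f (x k) = f (x l)"
      then have "x k = x l" using inj_onD[OF f(1) kl(3)] unit[of k] unit[of l] by (auto simp: K_def)
      then show "k = l" using inj kl by (auto simp: K_def inj_on_def)
    qed
    then have K: "card ((\<lambda>k. f (x k)) ` K) = card K" by (rule card_image)
    have "(\<lambda>k. f (x k)) ` K \<subseteq> (\<lambda>m. \<xi> m + h) ` S"
    proof
      fix v assume "v \<in> (\<lambda>k. f (x k)) ` K"
      then obtain k where k: "k < n" "v = f (x k)" "v \<le> t" by (auto simp: K_def)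
      then obtain m where "v - h = \<xi> m" "0 \<le> v" using f(3)[of k] by auto
      then have "v = \<xi> m + h" "m \<in> S" using k by (auto simp: S_def)
      then show "v \<in> (\<lambda>m. \<xi> m + h) ` S" by blast
    qed
    \<comment> \<open>The position 1, possible only at \<open>t = 1\<close>, is the lift of the
      position 0 and the sole source of error.\<close>
    moreover have "(\<lambda>m. \<xi> m + h) ` S \<subseteq> (\<lambda>k. f (x k)) ` K \<union> {1}"
    proof
      fix v assume "v \<in> (\<lambda>m. \<xi> m + h) ` S"
      then have v: "0 \<le> v" "v \<le> t" "v - h \<in> range \<xi>" by (auto simp: S_def)
      show "v \<in> (\<lambda>k. f (x k)) ` K \<union> {1}"
      proof (cases "v = 1")
        case False
        then obtain k where "k < n" "v = f (x k)" using f(2)[OF v(1) _ v(3)] v t by force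
        then show ?thesis using v by (auto simp: K_def)
      qed simp
    qed
    ultimately have "\<bar>real (card ((\<lambda>m. \<xi> m + h) ` S)) - real (card ((\<lambda>k. f (x k)) ` K))\<bar> \<le> card {1 :: real}"
      using fin by (intro card_disagreement) (auto simp: K_def)
    then show ?thesis unfolding S K by (simp add: S_def K_def)
  qed
  have r: "x k \<in> range \<xi>" "x k - 1 \<in> range \<xi>" if "k < n" for k
    using x_is_\<xi>[OF that, of 0] x_is_\<xi>[OF that, of "-1"] by (metis add.right_neutral of_int_0 rangeI, metis diff_conv_add_uminus of_int_1 of_int_minus rangeI)
  show "\<bar>real (card {m. 0 \<le> \<xi> m \<and> \<xi> m \<le> t}) - real (card {k \<in> {..<n}. x k \<in> {..t}})\<bar> \<le> 1"
  proof -
    have "\<exists>k<n. v = x k" if "0 \<le> v" "v < 1" "v - 0 \<in> range \<xi>" for v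
      using that \<xi>_unit by auto
    then show ?thesis using main[of 0 "\<lambda>u. u"] r unit by auto
  qed
  show "\<bar>real (card {m. 0 \<le> \<xi> m + 1 / 2 \<and> \<xi> m + 1 / 2 \<le> t}) - real (card {k \<in> {..<n}. x k \<in> {u. anti u \<le> t}})\<bar> \<le> 1"
  proof -
    have "inj_on anti {0..<1}" by (rule inj_onI) (metis anti_anti)
    moreover have "\<exists>k<n. v = anti (x k)" if v: "0 \<le> v" "v < 1" "v - 1 / 2 \<in> range \<xi>" for v
    proof -
      obtain i where i: "v - 1 / 2 = \<xi> i" using v by blast
      show ?thesis
      proof (cases "v < 1 / 2")
        case True
        then have "0 \<le> \<xi> (i + int n)" "\<xi> (i + int n) < 1" using v i \<xi>_period[of i] by linarith+
        then obtain k where k: "k < n" "\<xi> (i + int n) = x k" using \<xi>_unit by blast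
        then have "v = anti (x k)" using True v i \<xi>_period[of i] by (simp add: anti_def)
        then show ?thesis using k by blast
      next
        case False
        then have "0 \<le> \<xi> i" "\<xi> i < 1" using v i by linarith+
        then obtain k where k: "k < n" "\<xi> i = x k" using \<xi>_unit by blast
        then have "v = anti (x k)" using False v i by (simp add: anti_def)
        then show ?thesis using k by blast
      qed
    qed
    moreover have "0 \<le> anti (x k) \<and> anti (x k) < 1 \<and> anti (x k) - 1 / 2 \<in> range \<xi>" if "k < n" for k
      using r[OF that] unit[OF that] by (auto simp: anti_def)
    ultimately show ?thesis using main[of "1 / 2" anti] by auto
  qed
qed

end

section \<open>Measure lost near the seam\<close>

lemma measure_safe_part:
  assumes r: "r > 0" and A: "A \<in> sets borel" "A \<subseteq> {0..1}"
  shows "\<bar>measure lborel (safe r \<inter> A) - measure lborel A\<bar> \<le> 12 * r"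
proof -
  have f: "B \<in> fmeasurable lborel" if "B \<in> sets borel" "B \<subseteq> {0..1}" for B :: "real set"
    by (rule fmeasurableI2[of "{0..1}"]) (use that in \<open>auto intro!: fmeasurable_compact\<close>)
  have S: "safe r \<in> sets borel" by (simp add: safe_def)
  have "measure lborel A \<le> measure lborel ((safe r \<inter> A) \<union> (A - safe r))"
    using A S by (intro measure_mono_fmeasurable f) auto
  also have "\<dots> \<le> measure lborel (safe r \<inter> A) + measure lborel (A - safe r)"
    using A S by (intro measure_Un_le) auto
  also have "measure lborel (A - safe r) \<le> 12 * r"
    using A S by (intro measure_unsafe_le r) auto
  finally have "measure lborel A \<le> measure lborel (safe r \<inter> A) + 12 * r" by simp
  moreover have "measure lborel (safe r \<inter> A) \<le> measure lborel A"
    using A S by (intro measure_mono_fmeasurable f) auto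
  ultimately show ?thesis using r by linarith
qed

lemma measure_anti_upto:
  assumes t: "0 \<le> t" "t \<le> 1"
  shows "measure lborel ({0..<1} \<inter> {u. anti u \<le> t}) = t"
proof -
  have "{0..<1} \<inter> {u. anti u \<le> t} = {u \<in> {0..<1}. anti u \<in> {0..t} \<inter> {0..<1}}"
    by (auto simp: anti_def)
  also have "measure lborel \<dots> = measure lborel ({0..t} \<inter> {0..<1})" by (rule measure_anti) auto
  also have "\<dots> = t"
  proof (cases "t = 1")
    case True
    then have "{0..t} \<inter> {0..<1} = {0..<1}" by auto
    then show ?thesis using True by simp
  next
    case False
    then have "{0..t} \<inter> {0..<1} = {0..t}" using t by auto
    then show ?thesis using t by simp
  qed
  finally show ?thesis .
qed

lemma measure_safe_upto:
  assumes r: "r > 0" and t: "0 \<le> t" "t \<le> 1"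
  shows "\<bar>measure lborel (safe r \<inter> {..t}) - t\<bar> \<le> 12 * r"
    "\<bar>measure lborel (safe r \<inter> {u. anti u \<le> t}) - t\<bar> \<le> 12 * r"
proof -
  have "safe r \<inter> {..t} = safe r \<inter> {0..t}" using r by (auto simp: safe_def)
  then show "\<bar>measure lborel (safe r \<inter> {..t}) - t\<bar> \<le> 12 * r"
    using measure_safe_part[OF r, of "{0..t}"] t by simp
  have "safe r \<inter> {u. anti u \<le> t} = safe r \<inter> ({0..<1} \<inter> {u. anti u \<le> t})" using r by (auto simp: safe_def)
  moreover have "{u \<in> space borel. anti u \<le> t} \<in> sets borel" by measurable
  then have "{0..<1} \<inter> {u. anti u \<le> t} \<in> sets borel" by simp
  ultimately show "\<bar>measure lborel (safe r \<inter> {u. anti u \<le> t}) - t\<bar> \<le> 12 * r"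
    using measure_safe_part[OF r, of "{0..<1} \<inter> {u. anti u \<le> t}"] measure_anti_upto[OF t] by force
qed

context circle_config
begin

lemma gap_type_2_iff: "g \<in> LA.gaps \<Longrightarrow> gap_type n y g = 2 \<longleftrightarrow> (\<exists>m. has_pt 0 m g) \<and> (\<exists>m. has_pt (1 / 2) m g)"
  by (simp add: gap_type_eq)

text \<open>\<open>E\<close> is the gap across the direction 0, present only at \<open>t = 1\<close>
  and if it has type \<open>k\<close>. All such gaps contain 1 in their interior, so there is at
  most one.\<close>

lemma gaps_upto_split:
  obtains E where "finite E" "card E \<le> 1" "E \<subseteq> LA.gaps" "{g \<in> gaps_to t. gap_type n y g = k} \<inter> E = {}"
    "gaps_upto k n y t = {g \<in> gaps_to t. gap_type n y g = k} \<union> E"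
proof -
  define E where "E = {g \<in> LA.gaps. gap_type n y g = k \<and> t = 1 \<and> 1 < snd g}"
  have "g \<in> LA.gaps \<and> fst g < 1 \<and> 1 < snd g" if "g \<in> E" for g
    using that by (cases g) (simp add: E_def LA.gaps_def)
  then have "g = g'" if "g \<in> E - {}" "g' \<in> E - {}" for g g'
    using gap_unique[of g g' 1] that by blast
  then have "finite E" "card E \<le> card ({} :: (real \<times> real) set) + 1"
    using card_le_Suc_if_unique[of "{}" E] by blast+
  moreover have "gaps_upto k n y t = {g \<in> gaps_to t. gap_type n y g = k} \<union> E"
    "{g \<in> gaps_to t. gap_type n y g = k} \<inter> E = {}" "E \<subseteq> LA.gaps"
    by (auto simp: gaps_upto_def E_def gaps_to_def)
  ultimately show ?thesis by (intro that[of E]) simp_all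
qed

lemma gaps_upto_count:
  "\<bar>real (card (gaps_upto k n y t)) - real (card {g \<in> gaps_to t. gap_type n y g = k})\<bar> \<le> 1"
proof -
  obtain E where E: "finite E" "card E \<le> 1" "E \<subseteq> LA.gaps" "{g \<in> gaps_to t. gap_type n y g = k} \<inter> E = {}"
    "gaps_upto k n y t = {g \<in> gaps_to t. gap_type n y g = k} \<union> E" by (rule gaps_upto_split)
  then have "card (gaps_upto k n y t) = card {g \<in> gaps_to t. gap_type n y g = k} + card E"
    using finite_gaps_to by (simp add: card_Un_disjoint)
  then show ?thesis using E by simp
qed

lemma gap_length_le: "g \<in> LA.gaps \<Longrightarrow> fst g < snd g \<and> snd g \<le> fst g + \<delta>"
proof -
  assume g: "g \<in> LA.gaps"
  obtain i where i: "fst g < \<mu> i" "\<mu> i \<le> fst g + \<delta>" by (rule cut_after)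
  have "\<mu> i \<in> cuts n y" using \<xi>_\<mu>_not_cut(1)[of 0 i] by simp
  then have "\<mu> i \<notin> {fst g<..<snd g}" using g by (auto simp: LA.gaps_def)
  then show ?thesis using i g by (auto simp: LA.gaps_def)
qed

lemma \<delta>_pos: "\<delta> > 0"
proof -
  obtain i where "0 < \<mu> i" "\<mu> i \<le> 0 + \<delta>" by (rule cut_after)
  then show ?thesis by simp
qed

lemma gaps_upto_sum:
  "\<bar>(\<Sum>g\<in>gaps_upto k n y t. snd g - fst g) - (\<Sum>g\<in>{g \<in> gaps_to t. gap_type n y g = k}. snd g - fst g)\<bar> \<le> \<delta>"
proof -
  obtain E where E: "finite E" "card E \<le> 1" "E \<subseteq> LA.gaps" "{g \<in> gaps_to t. gap_type n y g = k} \<inter> E = {}"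
    "gaps_upto k n y t = {g \<in> gaps_to t. gap_type n y g = k} \<union> E" by (rule gaps_upto_split)
  then have "(\<Sum>g\<in>gaps_upto k n y t. snd g - fst g) =
      (\<Sum>g\<in>{g \<in> gaps_to t. gap_type n y g = k}. snd g - fst g) + (\<Sum>g\<in>E. snd g - fst g)"
    using finite_gaps_to by (simp add: sum.union_disjoint)
  moreover have "0 \<le> (\<Sum>g\<in>E. snd g - fst g)" using gap_length_le E(3) by (intro sum_nonneg) force
  moreover have "(\<Sum>g\<in>E. snd g - fst g) \<le> of_nat (card E) * \<delta>"
    using gap_length_le E(3) by (intro sum_bounded_above) force
  moreover have "of_nat (card E) * \<delta> \<le> 1 * \<delta>" using E(2) \<delta>_pos by (intro mult_right_mono) auto
  ultimately show ?thesis by simp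
qed

text \<open>The type of a gap is the number of families, points or antipodes, represented in it.
  With \<open>f = 1\<close> these are the two linear relations for the counts, with the gap length
  those for the lengths.\<close>

lemma sum_gap_types:
  fixes f :: "real \<times> real \<Rightarrow> real"
  shows "(\<Sum>k\<le>2. \<Sum>g\<in>{g \<in> gaps_to t. gap_type n y g = k}. f g) = (\<Sum>g\<in>gaps_to t. f g)"
    "(\<Sum>g\<in>{g \<in> gaps_to t. gap_type n y g = 1}. f g) + 2 * (\<Sum>g\<in>{g \<in> gaps_to t. gap_type n y g = 2}. f g) =
      (\<Sum>g\<in>{g \<in> gaps_to t. \<exists>m. has_pt 0 m g}. f g) + (\<Sum>g\<in>{g \<in> gaps_to t. \<exists>m. has_pt (1 / 2) m g}. f g)"
proof -
  have as_if: "(\<Sum>g\<in>{g \<in> gaps_to t. P g}. f g) = (\<Sum>g\<in>gaps_to t. if P g then f g else 0)" for P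
    using finite_gaps_to by (simp add: sum.inter_filter)
  have ty: "gap_type n y g = of_bool (\<exists>m. has_pt 0 m g) + of_bool (\<exists>m. has_pt (1 / 2) m g)" if "g \<in> gaps_to t" for g
    using gap_type_eq that by (simp add: gaps_to_def)
  have "(\<Sum>k\<le>2. if gap_type n y g = k then f g else 0) = f g" if "g \<in> gaps_to t" for g
    using ty[OF that] by simp
  then have "(\<Sum>g\<in>gaps_to t. \<Sum>k\<le>2. if gap_type n y g = k then f g else 0) = (\<Sum>g\<in>gaps_to t. f g)"
    by (rule sum.cong[OF refl])
  then show "(\<Sum>k\<le>2. \<Sum>g\<in>{g \<in> gaps_to t. gap_type n y g = k}. f g) = (\<Sum>g\<in>gaps_to t. f g)"
    unfolding as_if by (subst sum.swap)
  show "(\<Sum>g\<in>{g \<in> gaps_to t. gap_type n y g = 1}. f g) + 2 * (\<Sum>g\<in>{g \<in> gaps_to t. gap_type n y g = 2}. f g) =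
      (\<Sum>g\<in>{g \<in> gaps_to t. \<exists>m. has_pt 0 m g}. f g) + (\<Sum>g\<in>{g \<in> gaps_to t. \<exists>m. has_pt (1 / 2) m g}. f g)"
    unfolding as_if sum_distrib_left sum.distrib[symmetric]
    by (rule sum.cong[OF refl]) (auto simp: ty)
qed

text \<open>Any location in a gap determines the same two cells, so the pair conditions become
  statements about which generators lie in the gap and hold at all its safe locations or at
  none.\<close>

lemma paired_2_iff_type:
  assumes g: "g \<in> LA.gaps" and u: "fst g < u" "u < snd g" "u \<in> safe r" and r: "r > 0" "\<delta> \<le> r"
  shows "paired 1 n r x u \<longleftrightarrow> (\<exists>m. has_pt 0 m g)"
    "paired 1 n r x (anti u) \<longleftrightarrow> (\<exists>m. has_pt (1 / 2) m g)"
    "paired 2 n r x u \<longleftrightarrow> gap_type n y g = 2"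
proof -
  have g': "(fst g, snd g) \<in> LA.gaps" using g by simp
  obtain i j where ij: "u \<in> cell i" "u - 1 / 2 \<in> cell j" using gap_has_cells[OF g' u(1,2)] .
  have un: "u \<in> cell i' \<longleftrightarrow> i' = i" "u - 1 / 2 \<in> cell j' \<longleftrightarrow> j' = j" for i' j'
    using ij cell_unique by blast+
  note P = gap_points[OF g u(1,2) ij]
  have au: "anti u \<in> safe r"
    using u(3) r(1) by (auto simp: anti_def safe_def)
  show 1: "paired 1 n r x u \<longleftrightarrow> (\<exists>m. has_pt 0 m g)"
    unfolding paired_iff[OF u(3) r] P un by simp
  show "paired 1 n r x (anti u) \<longleftrightarrow> (\<exists>m. has_pt (1 / 2) m g)"
    unfolding paired_anti_iff[OF u(3) au r] P un by simp
  show "paired 2 n r x u \<longleftrightarrow> gap_type n y g = 2"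
    unfolding paired_iff[OF u(3) r] gap_type_2_iff[OF g] P un by simp
qed

lemma \<xi>_gap_point: "has_pt 0 m g \<Longrightarrow> fst g < \<xi> m \<and> \<xi> m < snd g"
  by (simp add: has_pt_def)

text \<open>A gap of type 2 is identified with the point in it. Linked points outside counted gaps
  are among the at most two uncovered ones; in the other direction, points outside
  \<open>safe r\<close> escape the pair criterion and are counted as errors.\<close>

lemma count_type_2:
  fixes t r :: real
  assumes t: "0 \<le> t" "t \<le> 1" and r: "r > 0" "\<delta> \<le> r"
  defines "D \<equiv> {g \<in> gaps_to t. gap_type n y g = 2}" and "K \<equiv> linked n r (safe r \<inter> {..t}) x"
  shows "card K \<le> card D + 2" "card D \<le> card K + card {k \<in> {..<n}. x k \<in> - safe r}"
proof -
  define I where "I = {m. \<exists>g\<in>gaps_to t. has_pt 0 m g \<and> gap_type n y g = 2}"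
  have "{g \<in> gaps_to t. (\<exists>m. has_pt 0 m g) \<and> gap_type n y g = 2} = D"
    using gap_type_2_iff by (auto simp: D_def gaps_to_def)
  then have I: "card I = card D" "finite I"
    using card_has_pt[of 0 t "\<lambda>g. gap_type n y g = 2"] by (auto simp: I_def)
  define N where "N = {m. 0 \<le> \<xi> m + 0 \<and> \<xi> m + 0 \<le> t \<and> (\<forall>g\<in>gaps_to t. \<not> has_pt 0 m g)}"
  have N: "finite N" "card N \<le> 2" using uncovered[of 0 t] t by (simp_all add: N_def)
  have xinj: "inj_on x A" if "A \<subseteq> {..<n}" for A using inj that by (rule inj_on_subset)
  have K: "K \<subseteq> {..<n}" by (auto simp: K_def linked_def)
  have lk: "k \<in> K \<longleftrightarrow> x k \<in> safe r \<and> x k \<le> t \<and> paired 2 n r x (x k)" if "k < n" for k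
    using linked_iff_paired[OF that, of r] that by (auto simp: K_def linked_def safe_def)
  have "x ` K \<subseteq> \<xi> ` (I \<union> N)"
  proof
    fix v assume "v \<in> x ` K"
    then obtain k where k: "k < n" "k \<in> K" "v = x k" using K by blast
    then have v: "v \<in> safe r" "v \<le> t" "paired 2 n r x v" "0 \<le> v" using lk unit by auto
    obtain m where m: "\<xi> m = v" using x_is_\<xi>[OF k(1), of 0] k by auto
    have "m \<in> I" if "m \<notin> N"
    proof -
      have "\<exists>g\<in>gaps_to t. has_pt 0 m g" using that v m by (simp add: N_def)
      then obtain g where g: "g \<in> gaps_to t" "has_pt 0 m g" by blast
      then have "gap_type n y g = 2"
        using paired_2_iff_type(3)[of g v r] v r m by (simp add: gaps_to_def has_pt_def)
      then show ?thesis using g by (auto simp: I_def)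
    qed
    then show "v \<in> \<xi> ` (I \<union> N)" using m by blast
  qed
  then have "card (x ` K) \<le> card (\<xi> ` (I \<union> N))" using I N by (intro card_mono) auto
  also have "\<dots> \<le> card (I \<union> N)" using I N by (intro card_image_le) auto
  also have "\<dots> \<le> card D + 2" using card_Un_le[of I N] N I by simp
  finally show "card K \<le> card D + 2" using card_image[OF xinj[OF K]] by simp
  define W where "W = {k \<in> {..<n}. x k \<in> - safe r}"
  have "\<xi> ` I \<subseteq> x ` (K \<union> W)"
  proof
    fix v assume "v \<in> \<xi> ` I"
    then obtain m g where g: "v = \<xi> m" "g \<in> gaps_to t" "has_pt 0 m g" "gap_type n y g = 2" by (auto simp: I_def)
    have gg: "g \<in> LA.gaps" "0 \<le> fst g" "snd g \<le> t" using g by (auto simp: gaps_to_def LA.gaps_def)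
    then have v: "fst g < v" "v < snd g" "0 \<le> v" "v < 1" "v \<le> t" using \<xi>_gap_point[OF g(3)] g(1) t by auto
    then obtain k where k: "k < n" "v = x k" using \<xi>_unit g(1) by metis
    have "k \<in> K" if "k \<notin> W"
    proof -
      have "v \<in> safe r" using that k by (auto simp: W_def)
      then show ?thesis using paired_2_iff_type(3)[OF gg(1) v(1,2) _ r] g(4) lk[OF k(1)] k v by simp
    qed
    then show "v \<in> x ` (K \<union> W)" using k by blast
  qed
  then have "card (\<xi> ` I) \<le> card (x ` (K \<union> W))" using K by (intro card_mono) (auto simp: W_def finite_subset[of K])
  also have "\<dots> \<le> card (K \<union> W)" using K by (intro card_image_le) (auto simp: W_def finite_subset[of K])
  also have "\<dots> \<le> card K + card W" by (rule card_Un_le)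
  finally show "card D \<le> card K + card {k \<in> {..<n}. x k \<in> - safe r}"
    using card_image[of \<xi> I] I by (simp add: inj_on_def W_def)
qed

text \<open>These deterministic inequalities express all counts through two empirical fractions and
  the fraction of linked points; together they pin down each \<open>H k\<close> once those fractions
  converge.\<close>

lemma config_counts:
  fixes t r :: real
  assumes t: "0 \<le> t" "t \<le> 1" and r: "r > 0" "\<delta> \<le> r"
  defines "H \<equiv> \<lambda>k. real (card (gaps_upto k n y t)) / real n"
    and "F \<equiv> fraction n {..t} x + fraction n {u. anti u \<le> t} x"
    and "Q \<equiv> real (card (linked n r (safe r \<inter> {..t}) x)) / real n"
  shows "\<bar>H 0 + H 1 + H 2 - F\<bar> \<le> 10 / real n" "\<bar>H 1 + 2 * H 2 - F\<bar> \<le> 10 / real n"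
    "Q - 10 / real n \<le> H 2" "H 2 \<le> Q + fraction n (- safe r) x + 10 / real n"
proof -
  define h where "h k = real (card {g \<in> gaps_to t. gap_type n y g = k})" for k
  define G where "G k = real (card (gaps_upto k n y t))" for k
  define NA where "NA = real (card {k \<in> {..<n}. x k \<in> {..t}})"
  define NB where "NB = real (card {k \<in> {..<n}. x k \<in> {u. anti u \<le> t}})"
  define X where "X = real (card {k \<in> {..<n}. x k \<in> - safe r})"
  define C where "C = real (card (linked n r (safe r \<inter> {..t}) x))"
  have Gh: "\<bar>G k - h k\<bar> \<le> 1" for k using gaps_upto_count by (simp add: G_def h_def)
  have card_sum: "real (card S) = (\<Sum>g\<in>S. 1)" for S :: "(real \<times> real) set" by simp
  have "h 0 + h 1 + h 2 = real (card (gaps_to t))"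
    using sum_gap_types(1)[where t = t and f = "\<lambda>_. 1"] unfolding h_def card_sum by (simp add: numeral_2_eq_2)
  moreover have "h 1 + 2 * h 2 = real (card {g \<in> gaps_to t. \<exists>m. has_pt 0 m g}) + real (card {g \<in> gaps_to t. \<exists>m. has_pt (1 / 2) m g})"
    using sum_gap_types(2)[where t = t and f = "\<lambda>_. 1"] unfolding h_def card_sum by simp
  moreover note card_gaps_to[OF t] card_points_near[of 0, OF _ t] card_points_near[of "1 / 2", OF _ t] card_sample[OF t]
  \<comment> \<open>The 5 is 3 for the gaps plus 1 for each comparison with samples; the 6 is 2 + 2
    for uncovered points and antipodes plus the same 1 + 1.\<close>
  ultimately have a: "\<bar>h 0 + h 1 + h 2 - (NA + NB)\<bar> \<le> 5" "\<bar>h 1 + 2 * h 2 - (NA + NB)\<bar> \<le> 6"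
    unfolding NA_def NB_def by simp_all
  have b: "C \<le> h 2 + 2" "h 2 \<le> C + X"
    using count_type_2[OF t r] unfolding C_def h_def X_def by simp_all
  \<comment> \<open>Replacing \<open>h\<close> by \<open>G\<close> costs 1 for each occurrence of a
    type, at most 3 in all; 10 is a common bound.\<close>
  have c: "\<bar>G 0 + G 1 + G 2 - (NA + NB)\<bar> \<le> 10" "\<bar>G 1 + 2 * G 2 - (NA + NB)\<bar> \<le> 10"
    "C - 10 \<le> G 2" "G 2 \<le> C + X + 10"
    using a b Gh[of 0] Gh[of 1] Gh[of 2] by linarith+
  have H: "H k = G k / real n" for k by (simp add: H_def G_def)
  have F: "F = (NA + NB) / real n" by (simp add: F_def NA_def NB_def fraction_def add_divide_distrib)
  have Q: "Q = C / real n" by (simp add: Q_def C_def)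
  have X: "fraction n (- safe r) x = X / real n" by (simp add: X_def fraction_def)
  have scale: "\<bar>v / real n\<bar> \<le> 10 / real n" if "\<bar>v\<bar> \<le> 10" for v
    using that n0 by (simp add: abs_divide divide_right_mono)
  show "\<bar>H 0 + H 1 + H 2 - F\<bar> \<le> 10 / real n" "\<bar>H 1 + 2 * H 2 - F\<bar> \<le> 10 / real n"
    using scale[OF c(1)] scale[OF c(2)] unfolding H F by (simp_all add: add_divide_distrib diff_divide_distrib)
  show "Q - 10 / real n \<le> H 2" "H 2 \<le> Q + fraction n (- safe r) x + 10 / real n"
    using divide_right_mono[OF c(3), of "real n"] divide_right_mono[OF c(4), of "real n"] unfolding H Q X
    by (simp_all add: add_divide_distrib diff_divide_distrib)
qed

section \<open>Total lengths of the gaps of each type\<close>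

lemma measure_union_gaps:
  assumes "S \<subseteq> LA.gaps"
  shows "measure lborel (\<Union>g\<in>S. {fst g<..<snd g}) = (\<Sum>g\<in>S. snd g - fst g)"
proof -
  have "measure lborel (\<Union>g\<in>S. {fst g<..<snd g}) = (\<Sum>g\<in>S. measure lborel {fst g<..<snd g})"
  proof (rule measure_finite_Union)
    show "finite S" using assms LA.finite_gaps finite_subset by blast
    show "disjoint_family_on (\<lambda>g. {fst g<..<snd g}) S"
      unfolding disjoint_family_on_def
    proof (intro ballI impI equals0I)
      fix g g' u assume g: "g \<in> S" "g' \<in> S" "g \<noteq> g'" "u \<in> {fst g<..<snd g} \<inter> {fst g'<..<snd g'}"
      then have "g \<in> LA.gaps" "g' \<in> LA.gaps" using assms by blast+
      then show False using gap_unique[of g g' u] g by simp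
    qed
    fix g assume "g \<in> S"
    then have "fst g \<le> snd g" using gap_length_le assms by (meson less_imp_le subsetD)
    then show "emeasure lborel {fst g<..<snd g} \<noteq> \<infinity>" by simp
  qed auto
  also have "\<dots> = (\<Sum>g\<in>S. snd g - fst g)"
    using gap_length_le assms by (intro sum.cong[OF refl]) (auto simp: less_imp_le)
  finally show ?thesis .
qed

text \<open>On safe locations inside counted gaps the condition on the gap agrees with the condition
  on the location. The two sets can differ only outside \<open>safe r\<close>, at a cost of 12 r,
  and in the exceptional set \<open>B\<close>, at a cost of 2 r.\<close>

lemma sum_gap_lengths:
  assumes t: "0 \<le> t" "t \<le> 1" and r: "r > 0" "\<delta> \<le> r"
    and agree: "\<And>g u. g \<in> gaps_to t \<Longrightarrow> u \<in> safe r \<Longrightarrow> fst g < u \<Longrightarrow> u < snd g \<Longrightarrow> P g \<longleftrightarrow> R u"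
    and R: "{u \<in> safe r \<inter> {..t}. R u} \<in> sets borel"
  shows "\<bar>(\<Sum>g\<in>{g \<in> gaps_to t. P g}. snd g - fst g) - measure lborel {u \<in> safe r \<inter> {..t}. R u}\<bar> \<le> 14 * r"
proof -
  define W where "W = (\<Union>g\<in>{g \<in> gaps_to t. P g}. {fst g<..<snd g})"
  define V where "V = {u \<in> safe r \<inter> {..t}. R u}"
  \<comment> \<open>Locations possibly outside every counted gap: the cuts, which form a null set,
    and the stretches of length \<delta> at both ends of [0,t], where a surrounding cut may fall
    outside.\<close>
  define B where "B = (cuts n y \<inter> {0..t}) \<union> ({0..\<delta>} \<union> {t - \<delta>..t})"
  have Wm: "measure lborel W = (\<Sum>g\<in>{g \<in> gaps_to t. P g}. snd g - fst g)"
    unfolding W_def by (rule measure_union_gaps) (auto simp: gaps_to_def)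
  have Wb: "W \<in> sets borel" unfolding W_def using finite_gaps_to by (intro sets.finite_UN) auto
  have Wt: "W \<subseteq> {0..t}" by (force simp: W_def gaps_to_def LA.gaps_def)
  have Vt: "V \<subseteq> {0..t}" using r by (auto simp: V_def safe_def)
  have Vb: "V \<in> sets borel" using R by (simp add: V_def)
  have Wf: "W \<in> fmeasurable lborel" by (rule fmeasurableI2[of "{0..t}"]) (use Wb Wt in \<open>auto intro!: fmeasurable_compact\<close>)
  have Vf: "V \<in> fmeasurable lborel" by (rule fmeasurableI2[of "{0..t}"]) (use Vb Vt in \<open>auto intro!: fmeasurable_compact\<close>)
  define A where "A = {0..t} - safe r"
  have Ab: "A \<in> sets borel" by (simp add: A_def safe_def)
  have Af: "A \<in> fmeasurable lborel" by (rule fmeasurableI2[of "{0..t}"]) (use Ab in \<open>auto simp: A_def intro!: fmeasurable_compact\<close>)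
  have mA: "measure lborel A \<le> 12 * r" by (rule measure_unsafe_le[OF r(1) Ab]) (use t in \<open>auto simp: A_def\<close>)
  have fin: "finite (cuts n y \<inter> {0..t})" by (rule LA.fin)
  have Bf: "B \<in> fmeasurable lborel"
    unfolding B_def using fin by (intro fmeasurable_compact compact_Un finite_imp_compact compact_Icc)
  have "measure lborel B \<le> measure lborel (cuts n y \<inter> {0..t}) + measure lborel ({0..\<delta>} \<union> {t - \<delta>..t})"
    unfolding B_def using fin by (intro measure_Un_le) (auto intro: finite_imp_closed borel_closed)
  also have "measure lborel (cuts n y \<inter> {0..t}) = 0"
    using fin by (simp add: measure_def finite_imp_null_set_lborel null_setsD1)
  also have "measure lborel ({0..\<delta>} \<union> {t - \<delta>..t}) \<le> measure lborel {0..\<delta>} + measure lborel {t - \<delta>..t}"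
    by (intro measure_Un_le) auto
  finally have mB: "measure lborel B \<le> 2 * r" using \<delta>_pos r by simp
  have "W \<subseteq> V \<union> A"
  proof
    fix u assume u: "u \<in> W"
    then obtain g where g: "g \<in> gaps_to t" "P g" "fst g < u" "u < snd g" by (auto simp: W_def)
    then show "u \<in> V \<union> A" using agree[OF g(1) _ g(3,4)] u Wt by (auto simp: V_def A_def)
  qed
  then have "measure lborel W \<le> measure lborel (V \<union> A)"
    using Wb Vf Af by (intro measure_mono_fmeasurable fmeasurable.Un) auto
  also have "\<dots> \<le> measure lborel V + measure lborel A" using Vb Ab by (intro measure_Un_le) auto
  finally have 1: "measure lborel W \<le> measure lborel V + 12 * r" using mA by simp
  have "V \<subseteq> W \<union> B"
  proof
    fix u assume u: "u \<in> V"
    show "u \<in> W \<union> B"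
    proof (cases "u \<in> B")
      case False
      then have nb: "u \<notin> cuts n y" "\<delta> < u" "u + \<delta> < t" using u Vt by (auto simp: B_def)
      obtain i where i: "0 < \<mu> i" "\<mu> i \<le> 0 + \<delta>" by (rule cut_after)
      obtain j where j: "u < \<mu> j" "\<mu> j \<le> u + \<delta>" by (rule cut_after)
      have mc: "\<mu> k \<in> cuts n y" for k using \<xi>_\<mu>_not_cut(1)[of 0 k] by simp
      obtain g where g: "g \<in> gaps_to t" "fst g < u" "u < snd g"
        by (rule covered[OF nb(1) mc[of i] _ _ mc[of j] j(1) _ t(2)]) (use i j nb in auto)
      have "P g" using agree[OF g(1) _ g(2,3)] u by (auto simp: V_def)
      then show ?thesis using g unfolding W_def by (intro UnI1 UN_I[of g]) simp_all
    qed simp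
  qed
  then have "measure lborel V \<le> measure lborel (W \<union> B)"
    using Vb Wf Bf by (intro measure_mono_fmeasurable fmeasurable.Un) auto
  also have "\<dots> \<le> measure lborel W + measure lborel B" using Wb Bf by (intro measure_Un_le) auto
  finally have "measure lborel V \<le> measure lborel W + 2 * r" using mB by simp
  with 1 show ?thesis unfolding Wm V_def[symmetric] using r by linarith
qed

lemma config_lengths:
  fixes t r :: real
  assumes t: "0 \<le> t" "t \<le> 1" and r: "r > 0" "\<delta> \<le> r"
  defines "H \<equiv> \<lambda>k. \<Sum>g\<in>gaps_upto k n y t. snd g - fst g"
  shows "\<bar>H 0 + H 1 + H 2 - t\<bar> \<le> 40 * r"
    "\<bar>H 1 + 2 * H 2 - (paired_length 1 n r (safe r \<inter> {..t}) x + paired_length 1 n r (safe r \<inter> {u. anti u \<le> t}) x)\<bar> \<le> 40 * r"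
    "\<bar>H 2 - paired_length 2 n r (safe r \<inter> {..t}) x\<bar> \<le> 40 * r"
proof -
  define h where "h P = (\<Sum>g\<in>{g \<in> gaps_to t. P g}. snd g - fst g)" for P
  define T where "T k = h (\<lambda>g. gap_type n y g = k)" for k
  \<comment> \<open>An extensional copy of the configuration is an element of the product space, so
    measurability in the location follows by applying \<open>paired_measurable\<close> to a constant
    configuration.\<close>
  define x' where "x' = restrict x {..<n}"
  have x': "paired k n r x = paired k n r x'" for k
    by (intro ext) (auto simp: paired_def pair_at_def x'_def)
  have x'_space: "x' \<in> space (PU n)"
    by (auto simp: x'_def PU_def space_PiM U01_def)
  have [measurable]: "Measurable.pred borel (\<lambda>u. paired k n r x (f u))" if "f \<in> borel_measurable borel" for k f
    unfolding x' by (rule paired_measurable) (use x'_space that in simp_all)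
  have sb: "{u \<in> safe r \<inter> {..t}. R u} \<in> sets borel" if "Measurable.pred borel R" for R
  proof -
    have "safe r \<inter> {..t} \<inter> {u \<in> space borel. R u} \<in> sets borel"
      using that by (intro sets.Int) (auto simp: safe_def)
    then show ?thesis by (simp add: Int_def conj_ac)
  qed
  have T1: "\<bar>h (\<lambda>_. True) - measure lborel {u \<in> safe r \<inter> {..t}. True}\<bar> \<le> 14 * r"
    unfolding h_def by (rule sum_gap_lengths[OF t r]) (use sb[of "\<lambda>_. True"] in simp_all)
  have TA: "\<bar>h (\<lambda>g. \<exists>m. has_pt 0 m g) - measure lborel {u \<in> safe r \<inter> {..t}. paired 1 n r x u}\<bar> \<le> 14 * r"
    unfolding h_def using paired_2_iff_type(1)[OF _ _ _ _ r]
    by (intro sum_gap_lengths[OF t r] sb) (auto simp: gaps_to_def)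
  have TB: "\<bar>h (\<lambda>g. \<exists>m. has_pt (1 / 2) m g) - measure lborel {u \<in> safe r \<inter> {..t}. paired 1 n r x (anti u)}\<bar> \<le> 14 * r"
    unfolding h_def using paired_2_iff_type(2)[OF _ _ _ _ r]
    by (intro sum_gap_lengths[OF t r] sb) (auto simp: gaps_to_def)
  have T2: "\<bar>T 2 - measure lborel {u \<in> safe r \<inter> {..t}. paired 2 n r x u}\<bar> \<le> 14 * r"
    unfolding T_def h_def using paired_2_iff_type(3)[OF _ _ _ _ r]
    by (intro sum_gap_lengths[OF t r] sb) (auto simp: gaps_to_def)
  have safe_unit: "safe r \<subseteq> {0..<1}" using r by (auto simp: safe_def)
  \<comment> \<open>Substituting the antipode, which preserves Lebesgue measure, turns the condition
    at \<open>anti u\<close> into one at the location and moves the time restriction to its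
    antipode.\<close>
  have "{u \<in> safe r \<inter> {..t}. paired 1 n r x (anti u)} =
      {u \<in> {0..<1}. anti u \<in> {v \<in> safe r \<inter> {u. anti u \<le> t}. paired 1 n r x v}}"
  proof (intro set_eqI iffI)
    fix u assume u: "u \<in> {u \<in> safe r \<inter> {..t}. paired 1 n r x (anti u)}"
    then have "u \<in> {0..<1}" using safe_unit by blast
    then show "u \<in> {u \<in> {0..<1}. anti u \<in> {v \<in> safe r \<inter> {u. anti u \<le> t}. paired 1 n r x v}}"
      using u anti_safe_iff[OF r(1), of u] anti_anti[of u] by simp
  next
    fix u assume u: "u \<in> {u \<in> {0..<1}. anti u \<in> {v \<in> safe r \<inter> {u. anti u \<le> t}. paired 1 n r x v}}"
    then show "u \<in> {u \<in> safe r \<inter> {..t}. paired 1 n r x (anti u)}"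
      using anti_safe_iff[OF r(1), of u] anti_anti[of u] by simp
  qed
  also have "measure lborel \<dots> = measure lborel {v \<in> safe r \<inter> {u. anti u \<le> t}. paired 1 n r x v}"
  proof (rule measure_anti)
    have "{u \<in> space borel. paired 1 n r x u \<and> anti u \<le> t \<and> u \<in> safe r} \<in> sets borel"
      unfolding safe_def by measurable
    then show "{v \<in> safe r \<inter> {u. anti u \<le> t}. paired 1 n r x v} \<in> sets borel" by (simp add: Int_def conj_ac)
  qed (use safe_unit in auto)
  finally have B: "measure lborel {u \<in> safe r \<inter> {..t}. paired 1 n r x (anti u)} =
      paired_length 1 n r (safe r \<inter> {u. anti u \<le> t}) x" by (simp add: paired_length_def)
  have all: "\<bar>measure lborel {u \<in> safe r \<inter> {..t}. True} - t\<bar> \<le> 12 * r"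
  proof -
    have "{u \<in> safe r \<inter> {..t}. True} = safe r \<inter> {..t}" by blast
    then show ?thesis using measure_safe_upto(1)[OF r(1) t] by (simp only:)
  qed
  have Hh: "\<bar>H k - T k\<bar> \<le> r" for k using gaps_upto_sum[of k t] r by (simp add: H_def T_def h_def)
  have s1: "T 0 + T 1 + T 2 = h (\<lambda>_. True)"
    using sum_gap_types(1)[where t = t and f = "\<lambda>g. snd g - fst g"] by (simp add: T_def h_def numeral_2_eq_2)
  have s2: "T 1 + 2 * T 2 = h (\<lambda>g. \<exists>m. has_pt 0 m g) + h (\<lambda>g. \<exists>m. has_pt (1 / 2) m g)"
    using sum_gap_types(2)[where t = t and f = "\<lambda>g. snd g - fst g"] by (simp add: T_def h_def)
  \<comment> \<open>The multiples of r add up to 3 + 14 + 12 for the total, and to 15 and 3 + 14 +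
    14 for the other two relations; 40 serves all three.\<close>
  show "\<bar>H 0 + H 1 + H 2 - t\<bar> \<le> 40 * r"
    using Hh[of 0] Hh[of 1] Hh[of 2] s1 T1 all r(1) by linarith
  show "\<bar>H 2 - paired_length 2 n r (safe r \<inter> {..t}) x\<bar> \<le> 40 * r"
    using Hh[of 2] T2 r(1) unfolding paired_length_def by linarith
  show "\<bar>H 1 + 2 * H 2 - (paired_length 1 n r (safe r \<inter> {..t}) x + paired_length 1 n r (safe r \<inter> {u. anti u \<le> t}) x)\<bar> \<le> 40 * r"
    using Hh[of 1] Hh[of 2] s2 TA TB B r(1) unfolding paired_length_def by linarith
qed

end

section \<open>Convergence in distribution\<close>

text \<open>No measurability of \<open>P\<close> is required.\<close>

definition likely :: "(nat \<Rightarrow> (nat \<Rightarrow> real) \<Rightarrow> bool) \<Rightarrow> bool" where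
  "likely P \<longleftrightarrow> (\<exists>B. (\<forall>n. B n \<in> sets (PU n)) \<and> (\<lambda>n. measure (PU n) (B n)) \<longlonglongrightarrow> 0 \<and>
    (\<forall>n. \<forall>x\<in>space (PU n) - B n. P n x))"

lemma likely_mono:
  assumes P: "likely P" and PQ: "\<forall>\<^sub>F n in sequentially. \<forall>x. P n x \<longrightarrow> Q n x"
  shows "likely Q"
proof -
  obtain B where B: "\<And>n. B n \<in> sets (PU n)" "(\<lambda>n. measure (PU n) (B n)) \<longlonglongrightarrow> 0"
    "\<And>n x. x \<in> space (PU n) - B n \<Longrightarrow> P n x" using P unfolding likely_def by blast
  \<comment> \<open>At indices where the implication fails the whole space is declared bad;
    eventually there are none, so the limit is unaffected.\<close>
  define C where "C n = (if \<forall>x. P n x \<longrightarrow> Q n x then B n else space (PU n))" for n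
  have "\<forall>\<^sub>F n in sequentially. measure (PU n) (B n) = measure (PU n) (C n)"
    using PQ by eventually_elim (simp add: C_def)
  then have "(\<lambda>n. measure (PU n) (C n)) \<longlonglongrightarrow> 0" using B(2) by (rule Lim_transform_eventually[rotated])
  then show ?thesis unfolding likely_def using B(1,3) by (intro exI[of _ C]) (auto simp: C_def)
qed

lemma likely_conj:
  assumes "likely P" "likely Q"
  shows "likely (\<lambda>n x. P n x \<and> Q n x)"
proof -
  obtain B where B: "\<And>n. B n \<in> sets (PU n)" "(\<lambda>n. measure (PU n) (B n)) \<longlonglongrightarrow> 0"
    "\<And>n x. x \<in> space (PU n) - B n \<Longrightarrow> P n x" using assms(1) unfolding likely_def by blast
  obtain C where C: "\<And>n. C n \<in> sets (PU n)" "(\<lambda>n. measure (PU n) (C n)) \<longlonglongrightarrow> 0"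
    "\<And>n x. x \<in> space (PU n) - C n \<Longrightarrow> Q n x" using assms(2) unfolding likely_def by blast
  have lim: "(\<lambda>n. measure (PU n) (B n) + measure (PU n) (C n)) \<longlonglongrightarrow> 0"
    using tendsto_add[OF B(2) C(2)] by simp
  have "(\<lambda>n. measure (PU n) (B n \<union> C n)) \<longlonglongrightarrow> 0"
    by (rule tendsto_sandwich[OF _ _ tendsto_const lim]) (simp_all add: measure_Un_le B C)
  then show ?thesis
    unfolding likely_def using B C by (intro exI[of _ "\<lambda>n. B n \<union> C n"]) auto
qed

lemma likely_AE:
  assumes "\<And>n. AE x in PU n. P n x"
  shows "likely P"
proof -
  have "\<exists>N\<in>sets (PU n). emeasure (PU n) N = 0 \<and> (\<forall>x\<in>space (PU n) - N. P n x)" for n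
  proof -
    obtain N where "{x \<in> space (PU n). \<not> P n x} \<subseteq> N" "emeasure (PU n) N = 0" "N \<in> sets (PU n)"
      using assms[of n] by (rule AE_E)
    then show ?thesis by (intro bexI[of _ N]) auto
  qed
  then obtain N where N: "\<And>n. N n \<in> sets (PU n)" "\<And>n. emeasure (PU n) (N n) = 0"
    "\<And>n x. x \<in> space (PU n) - N n \<Longrightarrow> P n x" by metis
  then have "measure (PU n) (N n) = 0" for n by (simp add: measure_def)
  then show ?thesis unfolding likely_def using N by (intro exI[of _ N]) simp
qed

lemma likely_in_probability:
  assumes "\<forall>\<^sub>F n in sequentially. {x \<in> space (PU n). \<not> P n x} \<in> sets (PU n)"
    and "(\<lambda>n. measure (PU n) {x \<in> space (PU n). \<not> P n x}) \<longlonglongrightarrow> 0"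
  shows "likely P"
proof -
  define B where "B n = (if {x \<in> space (PU n). \<not> P n x} \<in> sets (PU n) then {x \<in> space (PU n). \<not> P n x} else space (PU n))" for n
  have "\<forall>\<^sub>F n in sequentially. measure (PU n) {x \<in> space (PU n). \<not> P n x} = measure (PU n) (B n)"
    using assms(1) by eventually_elim (simp add: B_def)
  then have "(\<lambda>n. measure (PU n) (B n)) \<longlonglongrightarrow> 0" using assms(2) by (rule Lim_transform_eventually[rotated])
  then show ?thesis unfolding likely_def by (intro exI[of _ B]) (auto simp: B_def)
qed

lemma likely_close:
  fixes f :: "nat \<Rightarrow> (nat \<Rightarrow> real) \<Rightarrow> real"
  assumes "\<forall>\<^sub>F n in sequentially. f n \<in> borel_measurable (PU n)"
    and "(\<lambda>n. measure (PU n) {x \<in> space (PU n). \<bar>f n x - c\<bar> > \<epsilon>}) \<longlonglongrightarrow> 0"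
  shows "likely (\<lambda>n x. \<bar>f n x - c\<bar> \<le> \<epsilon>)"
proof (rule likely_in_probability)
  show "\<forall>\<^sub>F n in sequentially. {x \<in> space (PU n). \<not> \<bar>f n x - c\<bar> \<le> \<epsilon>} \<in> sets (PU n)"
    using assms(1)
  proof eventually_elim
    case (elim n)
    then have "(\<lambda>x. \<bar>f n x - c\<bar>) \<in> borel_measurable (PU n)"
      by (intro borel_measurable_abs borel_measurable_diff borel_measurable_const)
    then have "(\<lambda>x. \<bar>f n x - c\<bar>) -` {\<epsilon><..} \<inter> space (PU n) \<in> sets (PU n)" by (rule measurable_sets) simp
    also have "(\<lambda>x. \<bar>f n x - c\<bar>) -` {\<epsilon><..} \<inter> space (PU n) = {x \<in> space (PU n). \<not> \<bar>f n x - c\<bar> \<le> \<epsilon>}" by auto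
    finally show ?case .
  qed
qed (use assms(2) in \<open>simp add: not_le\<close>)

section \<open>Typical configurations and convergence in probability of the statistics\<close>

lemma AE_PU_unit: "AE x in PU n. \<forall>i<n. 0 \<le> x i \<and> x i < 1"
proof -
  have "AE s in U01. 0 \<le> s \<and> s < 1"
    unfolding U01_def by (rule AE_uniform_measureI) auto
  then have "AE x in PU n. 0 \<le> x i \<and> x i < 1" if "i \<in> {..<n}" for i
    unfolding PU_def using that by (intro AE_PiM_component prob_space_U01) auto
  then have "AE x in PU n. \<forall>i\<in>{..<n}. 0 \<le> x i \<and> x i < 1" by (intro AE_finite_allI) auto
  then show ?thesis unfolding Ball_def lessThan_iff .
qed

text \<open>The cell starting at the first multiple of 1 / N at or after \<open>s\<close> contains a
  sample up to an integer; that cell starts within 1 / N of \<open>s\<close> and has width 1 /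
  N.\<close>

lemma cells_hit_spacing:
  assumes hit: "cells_hit n N x" and N: "N > 0"
  shows "\<exists>k<n. \<exists>z::int. s \<le> x k + of_int z \<and> x k + of_int z < s + 2 / real N"
proof -
  define j where "j = \<lceil>s * real N\<rceil>"
  define m where "m = nat (j mod int N)"
  have m: "m < N" using N by (simp add: m_def nat_less_iff)
  have jm: "j = int m + int N * (j div int N)" using N by (simp add: m_def)
  then have jr: "of_int j = real m + real N * of_int (j div int N)"
    by (metis of_int_add of_int_mult of_int_of_nat_eq)
  obtain k where k: "k < n" "real m / real N \<le> x k" "x k < real (Suc m) / real N"
    using hit m unfolding cells_hit_def by blast
  have b: "s * real N \<le> of_int j" "of_int j < s * real N + 1"
    unfolding j_def by linarith+
  have eq: "(x k + of_int (j div int N)) * real N = x k * real N + (of_int j - real m)"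
    using jr by (simp add: algebra_simps)
  have "real m \<le> x k * real N" "x k * real N < real m + 1"
    using k(2,3) N by (simp_all add: field_simps)
  then have "s * real N \<le> (x k + of_int (j div int N)) * real N"
    "(x k + of_int (j div int N)) * real N < s * real N + 2" unfolding eq using b by linarith+
  moreover have "s * real N + 2 = (s + 2 / real N) * real N" using N by (simp add: distrib_right)
  ultimately have "s \<le> x k + of_int (j div int N)" "x k + of_int (j div int N) < s + 2 / real N"
    using N by (simp_all del: distrib_right_numeral)
  then show ?thesis using k(1) by blast
qed

lemma cells_spacing: "n \<ge> 1 \<Longrightarrow> cells n > 0 \<and> 2 / real (cells n) \<le> 1 / sqrt (real n)"
proof -
  assume n: "n \<ge> 1"
  have s: "sqrt (real n) > 0" using n by simp
  moreover have "16 * sqrt (real n) \<le> real (cells n)" unfolding cells_def by linarith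
  ultimately have c: "2 * sqrt (real n) \<le> real (cells n)" and p: "real (cells n) > 0" by linarith+
  have "2 / real (cells n) \<le> 2 / (2 * sqrt (real n))" using s c p by (intro divide_left_mono mult_pos_pos) simp_all
  then show ?thesis using p by simp
qed

lemma likely_config: "likely (\<lambda>n x. circle_config n x (2 / real (cells n)) \<and> 2 / real (cells n) \<le> 1 / sqrt (real n) \<and> n \<ge> 3)"
proof (rule likely_mono[OF likely_conj[OF likely_conj[OF likely_AE[OF AE_PU_unit] likely_AE[OF AE_generic]]
      likely_in_probability[OF always_eventually cells_hit_in_probability]]])
  show "\<forall>n. {x \<in> space (PU n). \<not> cells_hit n (cells n) x} \<in> sets (PU n)" using cells_measurable by blast
  show "\<forall>\<^sub>F n in sequentially. \<forall>x. ((\<forall>i<n. 0 \<le> x i \<and> x i < 1) \<and> generic n x) \<and> cells_hit n (cells n) x \<longrightarrow>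
      circle_config n x (2 / real (cells n)) \<and> 2 / real (cells n) \<le> 1 / sqrt (real n) \<and> n \<ge> 3"
    using eventually_ge_at_top[of 3]
  proof eventually_elim
    case (elim n)
    then show ?case using cells_spacing[of n] cells_hit_spacing[of n "cells n"] by (auto intro!: circle_config.intro)
  qed
qed

definition rad :: "nat \<Rightarrow> real" where
  "rad n = 1 / sqrt (real n)"

lemma rad_pos: "n > 0 \<Longrightarrow> rad n > 0"
  by (simp add: rad_def)

lemma rad_tendsto: "rad \<longlonglongrightarrow> 0"
  unfolding rad_def by real_asymp

lemma emeasure_unit_subset: "(A :: real set) \<in> sets borel \<Longrightarrow> A \<subseteq> {0..1} \<Longrightarrow> emeasure lborel A = ennreal (measure lborel A)"
proof (rule emeasure_eq_ennreal_measure)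
  assume "A \<in> sets borel" "A \<subseteq> {0..1}"
  then have "emeasure lborel A \<le> emeasure lborel {0..1 :: real}" by (intro emeasure_mono) auto
  then have "emeasure lborel A \<le> 1" by simp
  then show "emeasure lborel A \<noteq> \<top>" using ennreal_one_neq_top by (metis top_unique)
qed

lemma safe_borel: "safe r \<in> sets borel"
  by (simp add: safe_def)

lemma anti_upto_borel: "{u. anti u \<le> t} \<in> sets borel"
proof -
  have "{u \<in> space borel. anti u \<le> t} \<in> sets borel" by measurable
  then show ?thesis by simp
qed

lemma emeasure_safe_part_tendsto:
  assumes A: "A \<in> sets borel" and c: "c \<ge> 0" and bound: "\<And>n. n \<ge> 1 \<Longrightarrow> \<bar>measure lborel (safe (rad n) \<inter> A) - c\<bar> \<le> 12 * rad n"
  shows "(\<lambda>n. emeasure lborel (safe (rad n) \<inter> A)) \<longlonglongrightarrow> ennreal c"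
proof -
  have "(\<lambda>n. 12 * rad n) \<longlonglongrightarrow> 12 * 0" by (intro tendsto_intros rad_tendsto)
  then have z: "(\<lambda>n. 12 * rad n) \<longlonglongrightarrow> 0" by simp
  have "\<forall>\<^sub>F n in sequentially. norm (measure lborel (safe (rad n) \<inter> A) - c) \<le> 12 * rad n"
    by (rule eventually_sequentiallyI[of 1]) (use bound in simp)
  then have "(\<lambda>n. measure lborel (safe (rad n) \<inter> A) - c) \<longlonglongrightarrow> 0"
    using z by (rule Lim_null_comparison)
  then have "(\<lambda>n. ennreal (measure lborel (safe (rad n) \<inter> A))) \<longlonglongrightarrow> ennreal c"
    by (intro tendsto_ennrealI) (simp add: LIM_zero_iff)
  then show ?thesis
  proof (rule Lim_transform_eventually)
    show "\<forall>\<^sub>F n in sequentially. ennreal (measure lborel (safe (rad n) \<inter> A)) = emeasure lborel (safe (rad n) \<inter> A)"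
      using eventually_ge_at_top[of 1]
    proof eventually_elim
      case (elim n)
      then have "safe (rad n) \<subseteq> {0..1}" by (intro safe_subset_unit rad_pos) simp
      then show ?case using A safe_borel by (intro emeasure_unit_subset[symmetric]) auto
    qed
  qed
qed

lemma likely_fractions:
  assumes t: "0 \<le> t" "t \<le> 1" and e: "e > 0"
  shows "likely (\<lambda>n x. \<bar>fraction n {..t} x - t\<bar> \<le> e)"
    "likely (\<lambda>n x. \<bar>fraction n {u. anti u \<le> t} x - t\<bar> \<le> e)"
    "likely (\<lambda>n x. \<bar>fraction n (- safe (rad n)) x - 0\<bar> \<le> e)"
proof -
  have part: "emeasure U01 A = ennreal (measure lborel ({0..<1} \<inter> A))" if "A \<in> sets borel" for A
    unfolding emeasure_U01[OF that] using that by (intro emeasure_unit_subset) auto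
  have "measure lborel ({0..<1} \<inter> {..t}) = t"
  proof (cases "t = 1")
    case True
    then have "{0..<1} \<inter> {..t} = {0..<1}" by auto
    then show ?thesis using True by simp
  next
    case False
    then have "{0..<1} \<inter> {..t} = {0..t}" using t by auto
    then show ?thesis using t by simp
  qed
  then have 1: "emeasure U01 {..t} = ennreal t" by (simp add: part)
  show "likely (\<lambda>n x. \<bar>fraction n {..t} x - t\<bar> \<le> e)"
    by (intro likely_close always_eventually allI fraction_measurable fraction_in_probability) (use 1 t e in simp_all)
  have 2: "emeasure U01 {u. anti u \<le> t} = ennreal t" using anti_upto_borel measure_anti_upto[OF t] by (simp add: part)
  show "likely (\<lambda>n x. \<bar>fraction n {u. anti u \<le> t} x - t\<bar> \<le> e)"
    by (intro likely_close always_eventually allI fraction_measurable fraction_in_probability anti_upto_borel) (use 2 t e in simp_all)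
  have "(\<lambda>n. measure lborel ({0..<1} \<inter> - safe (rad n))) \<longlonglongrightarrow> 0"
  proof (rule Lim_null_comparison)
    have "(\<lambda>n. 12 * rad n) \<longlonglongrightarrow> 12 * 0" by (intro tendsto_intros rad_tendsto)
    then show "(\<lambda>n. 12 * rad n) \<longlonglongrightarrow> 0" by simp
    show "\<forall>\<^sub>F n in sequentially. norm (measure lborel ({0..<1} \<inter> - safe (rad n))) \<le> 12 * rad n"
      using eventually_ge_at_top[of 1]
    proof eventually_elim
      case (elim n)
      then have "measure lborel ({0..<1} \<inter> - safe (rad n)) \<le> 12 * rad n"
        by (intro measure_unsafe_le rad_pos) (auto intro!: sets.Int borel_comp safe_borel)
      then show ?case by simp
    qed
  qed
  then have "(\<lambda>n. ennreal (measure lborel ({0..<1} \<inter> - safe (rad n)))) \<longlonglongrightarrow> ennreal 0" by (rule tendsto_ennrealI)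
  then have 3: "(\<lambda>n. emeasure U01 (- safe (rad n))) \<longlonglongrightarrow> ennreal 0"
    by (simp only: part borel_comp safe_borel)
  show "likely (\<lambda>n x. \<bar>fraction n (- safe (rad n)) x - 0\<bar> \<le> e)"
    by (intro likely_close always_eventually allI fraction_measurable fraction_in_probability) (use 3 e safe_borel in simp_all)
qed

lemma likely_paired:
  assumes A: "A \<in> sets borel" and c: "c \<ge> 0" and e: "e > 0"
    and bound: "\<And>n. n \<ge> 1 \<Longrightarrow> \<bar>measure lborel (safe (rad n) \<inter> A) - c\<bar> \<le> 12 * rad n"
  shows "likely (\<lambda>n x. \<bar>paired_length k n (rad n) (safe (rad n) \<inter> A) x - c * (if k = 2 then 3 / 8 else 5 / 8)\<bar> \<le> e)"
    "likely (\<lambda>n x. \<bar>real (card (linked n (rad n) (safe (rad n) \<inter> A) x)) / real n - c / 2\<bar> \<le> e)"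
proof -
  have b: "safe (rad n) \<inter> A \<in> sets borel" for n using A safe_borel by simp
  note lim = emeasure_safe_part_tendsto[OF A c bound]
  show "likely (\<lambda>n x. \<bar>paired_length k n (rad n) (safe (rad n) \<inter> A) x - c * (if k = 2 then 3 / 8 else 5 / 8)\<bar> \<le> e)"
  proof (rule likely_close)
    show "\<forall>\<^sub>F n in sequentially. paired_length k n (rad n) (safe (rad n) \<inter> A) \<in> borel_measurable (PU n)"
      using eventually_ge_at_top[of 1] by eventually_elim (intro paired_length_moments(1) b rad_pos; simp)
    show "(\<lambda>n. measure (PU n) {x \<in> space (PU n). e < \<bar>paired_length k n (rad n) (safe (rad n) \<inter> A) x - c * (if k = 2 then 3 / 8 else 5 / 8)\<bar>}) \<longlonglongrightarrow> 0"
      using paired_length_in_probability[of "\<lambda>n. safe (rad n) \<inter> A" c e k] lim b c e by (simp add: rad_def)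
  qed
  show "likely (\<lambda>n x. \<bar>real (card (linked n (rad n) (safe (rad n) \<inter> A) x)) / real n - c / 2\<bar> \<le> e)"
  proof (rule likely_close)
    show "\<forall>\<^sub>F n in sequentially. (\<lambda>x. real (card (linked n (rad n) (safe (rad n) \<inter> A) x)) / real n) \<in> borel_measurable (PU n)"
      using eventually_ge_at_top[of 1] by eventually_elim (intro linked_fraction_moments(1) b rad_pos; simp)
    show "(\<lambda>n. measure (PU n) {x \<in> space (PU n). e < \<bar>real (card (linked n (rad n) (safe (rad n) \<inter> A) x)) / real n - c / 2\<bar>}) \<longlonglongrightarrow> 0"
      using linked_in_probability[of "\<lambda>n. safe (rad n) \<inter> A" c e] lim b c e by (simp add: rad_def)
  qed
qed

text \<open>The statistic as a function of the unsorted angles, so that it makes sense on the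
  product space of uniform variables as well as on the given probability spaces.\<close>

definition gap_stat :: "(real \<times> real \<Rightarrow> real) \<Rightarrow> nat \<Rightarrow> nat \<Rightarrow> (nat \<Rightarrow> real) \<Rightarrow> real \<Rightarrow> real" where
  "gap_stat h k n x t = (if inj_on x {..<n} then \<Sum>g\<in>gaps_upto k n (order_stat n x) t. h g else 0)"

text \<open>Elements of the product space are extensional, whereas \<open>angles\<close> is defined
  at every index; the statistic sees only the indices below \<open>n\<close>.\<close>

lemma gap_stat_restrict: "gap_stat h k n (restrict x {..<n}) t = gap_stat h k n x t"
proof -
  have "map (restrict x {..<n}) [0..<n] = map x [0..<n]" by simp
  then have "order_stat n (restrict x {..<n}) = order_stat n x" by (intro ext) (simp only: order_stat_def)
  then show ?thesis by (simp add: gap_stat_def inj_on_restrict_eq)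
qed

lemma likely_counts:
  assumes t: "0 \<le> t" "t \<le> 1" and e: "e > 0" and k: "k \<le> 2"
  shows "likely (\<lambda>n x. \<bar>gap_stat (\<lambda>_. 1) k n x t / (2 * real n) - (if k = 1 then 1 / 2 else 1 / 4) * t\<bar> \<le> e)"
proof -
  define d where "d = e / 20"
  have d: "d > 0" using e by (simp add: d_def)
  have "\<forall>\<^sub>F n in sequentially. 10 / real n \<le> d"
    using d by real_asymp
  then show ?thesis
  proof (intro likely_mono[OF likely_conj[OF likely_config likely_conj[OF likely_conj[OF likely_fractions(1,2)[OF t d]]
      likely_conj[OF likely_fractions(3)[OF t d] likely_paired(2)[OF _ t(1) d measure_safe_upto(1)[OF rad_pos t]]]]]])
    show "\<forall>\<^sub>F n in sequentially. \<forall>x. (circle_config n x (2 / real (cells n)) \<and> 2 / real (cells n) \<le> 1 / sqrt (real n) \<and> 3 \<le> n) \<and>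
        (\<bar>fraction n {..t} x - t\<bar> \<le> d \<and> \<bar>fraction n {u. anti u \<le> t} x - t\<bar> \<le> d) \<and>
        \<bar>fraction n (- safe (rad n)) x - 0\<bar> \<le> d \<and>
        \<bar>real (card (linked n (rad n) (safe (rad n) \<inter> {..t}) x)) / real n - t / 2\<bar> \<le> d \<longrightarrow>
        \<bar>gap_stat (\<lambda>_. 1) k n x t / (2 * real n) - (if k = 1 then 1 / 2 else 1 / 4) * t\<bar> \<le> e"
      using \<open>\<forall>\<^sub>F n in sequentially. 10 / real n \<le> d\<close>
    proof eventually_elim
      case (elim n)
      show ?case
      proof (intro allI impI, elim conjE)
        fix x assume c: "circle_config n x (2 / real (cells n))" "2 / real (cells n) \<le> 1 / sqrt (real n)" "3 \<le> n"
          and f: "\<bar>fraction n {..t} x - t\<bar> \<le> d" "\<bar>fraction n {u. anti u \<le> t} x - t\<bar> \<le> d"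
          "\<bar>fraction n (- safe (rad n)) x - 0\<bar> \<le> d"
          "\<bar>real (card (linked n (rad n) (safe (rad n) \<inter> {..t}) x)) / real n - t / 2\<bar> \<le> d"
        interpret circle_config n x "2 / real (cells n)" by (rule c(1))
        have r: "rad n > 0" "2 / real (cells n) \<le> rad n" using c rad_pos by (simp_all add: rad_def)
        define H where "H k = real (card (gaps_upto k n y t)) / real n" for k
        note C = config_counts[OF t r, folded H_def]
        have "\<bar>H 2 - t / 2\<bar> \<le> 3 * d" using C(3,4) f(3,4) elim unfolding abs_le_iff by linarith
        moreover have "\<bar>H 1 + 2 * H 2 - 2 * t\<bar> \<le> 3 * d" using C(2) f(1,2) elim unfolding abs_le_iff by linarith
        moreover have "\<bar>H 0 + H 1 + H 2 - 2 * t\<bar> \<le> 3 * d" using C(1) f(1,2) elim unfolding abs_le_iff by linarith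
        \<comment> \<open>The limit t / 2 for type 2 gives 2 t - t = t for type 1 and 2 t - t - t /
          2 = t / 2 for type 0. The errors add up to 3 + 6 and 3 + 9 + 3 multiples of d; halved, the
          largest is 15 d / 2, below e for \<open>d = e / 20\<close>.\<close>
        ultimately have "\<bar>H 1 - t\<bar> \<le> 9 * d \<and> \<bar>H 0 - t / 2\<bar> \<le> 15 * d" unfolding abs_le_iff by linarith
        with \<open>\<bar>H 2 - t / 2\<bar> \<le> 3 * d\<close> have "\<bar>H k - 2 * ((if k = 1 then 1 / 2 else 1 / 4) * t)\<bar> \<le> 15 * d"
          using k d by (auto simp: le_Suc_eq numeral_2_eq_2)
        moreover have "gap_stat (\<lambda>_. 1) k n x t / (2 * real n) = H k / 2"
          using inj by (simp add: gap_stat_def H_def)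
        ultimately show "\<bar>gap_stat (\<lambda>_. 1) k n x t / (2 * real n) - (if k = 1 then 1 / 2 else 1 / 4) * t\<bar> \<le> e"
          using d unfolding d_def by linarith
      qed
    qed
  qed simp_all
qed

lemma likely_lengths:
  assumes t: "0 \<le> t" "t \<le> 1" and e: "e > 0" and k: "k \<le> 2"
  shows "likely (\<lambda>n x. \<bar>gap_stat (\<lambda>g. snd g - fst g) k n x t - (if k = 0 then 1 / 8 else if k = 1 then 1 / 2 else 3 / 8) * t\<bar> \<le> e)"
proof -
  define d where "d = e / 20"
  have d: "d > 0" using e by (simp add: d_def)
  have "(\<lambda>n. 40 * rad n) \<longlonglongrightarrow> 40 * 0" by (intro tendsto_intros rad_tendsto)
  then have ev: "\<forall>\<^sub>F n in sequentially. 40 * rad n < d" using d by (intro order_tendstoD(2)[of _ "40 * 0"]) simp_all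
  show ?thesis
  proof (intro likely_mono[OF likely_conj[OF likely_config likely_conj[OF
      likely_conj[OF likely_paired(1)[OF _ t(1) d measure_safe_upto(1)[OF rad_pos t], where k = 1]
        likely_paired(1)[OF _ t(1) d measure_safe_upto(2)[OF rad_pos t], where k = 1]]
        likely_paired(1)[OF _ t(1) d measure_safe_upto(1)[OF rad_pos t], where k = 2]]]])
    show "\<forall>\<^sub>F n in sequentially. \<forall>x. (circle_config n x (2 / real (cells n)) \<and> 2 / real (cells n) \<le> 1 / sqrt (real n) \<and> 3 \<le> n) \<and>
        (\<bar>paired_length 1 n (rad n) (safe (rad n) \<inter> {..t}) x - t * (if (1::nat) = 2 then 3 / 8 else 5 / 8)\<bar> \<le> d \<and>
         \<bar>paired_length 1 n (rad n) (safe (rad n) \<inter> {u. anti u \<le> t}) x - t * (if (1::nat) = 2 then 3 / 8 else 5 / 8)\<bar> \<le> d) \<and>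
        \<bar>paired_length 2 n (rad n) (safe (rad n) \<inter> {..t}) x - t * (if (2::nat) = 2 then 3 / 8 else 5 / 8)\<bar> \<le> d \<longrightarrow>
        \<bar>gap_stat (\<lambda>g. snd g - fst g) k n x t - (if k = 0 then 1 / 8 else if k = 1 then 1 / 2 else 3 / 8) * t\<bar> \<le> e"
      using ev
    proof eventually_elim
      case (elim n)
      show ?case
      proof (intro allI impI, elim conjE)
        fix x assume c: "circle_config n x (2 / real (cells n))" "2 / real (cells n) \<le> 1 / sqrt (real n)" "3 \<le> n"
          and f: "\<bar>paired_length 1 n (rad n) (safe (rad n) \<inter> {..t}) x - t * (if (1::nat) = 2 then 3 / 8 else 5 / 8)\<bar> \<le> d"
          "\<bar>paired_length 1 n (rad n) (safe (rad n) \<inter> {u. anti u \<le> t}) x - t * (if (1::nat) = 2 then 3 / 8 else 5 / 8)\<bar> \<le> d"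
          "\<bar>paired_length 2 n (rad n) (safe (rad n) \<inter> {..t}) x - t * (if (2::nat) = 2 then 3 / 8 else 5 / 8)\<bar> \<le> d"
        interpret circle_config n x "2 / real (cells n)" by (rule c(1))
        have r: "rad n > 0" "2 / real (cells n) \<le> rad n" using c rad_pos by (simp_all add: rad_def)
        have f': "\<bar>paired_length 1 n (rad n) (safe (rad n) \<inter> {..t}) x - 5 / 8 * t\<bar> \<le> d"
          "\<bar>paired_length 1 n (rad n) (safe (rad n) \<inter> {u. anti u \<le> t}) x - 5 / 8 * t\<bar> \<le> d"
          "\<bar>paired_length 2 n (rad n) (safe (rad n) \<inter> {..t}) x - 3 / 8 * t\<bar> \<le> d" using f by (simp_all add: mult.commute)
        define H where "H k = (\<Sum>g\<in>gaps_upto k n y t. snd g - fst g)" for k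
        note C = config_lengths[OF t r, folded H_def]
        have 2: "\<bar>H 2 - 3 / 8 * t\<bar> \<le> 2 * d" using C(3) f'(3) elim unfolding abs_le_iff by linarith
        have "\<bar>H 1 + 2 * H 2 - 5 / 4 * t\<bar> \<le> 3 * d" using C(2) f'(1,2) elim unfolding abs_le_iff by linarith
        moreover have "\<bar>H 0 + H 1 + H 2 - t\<bar> \<le> d" using C(1) elim unfolding abs_le_iff by linarith
        \<comment> \<open>Type 1 gets (5/4 - 2 * 3/8) t = t / 2 and type 0 the remaining (1 - 1/2 -
          3/8) t = t / 8. The errors add up to 3 + 4 and 1 + 7 + 2 multiples of d.\<close>
        ultimately have "\<bar>H 1 - 1 / 2 * t\<bar> \<le> 7 * d \<and> \<bar>H 0 - 1 / 8 * t\<bar> \<le> 10 * d" using 2 unfolding abs_le_iff by linarith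
        with 2 have "\<bar>H k - (if k = 0 then 1 / 8 else if k = 1 then 1 / 2 else 3 / 8) * t\<bar> \<le> 10 * d"
          using k d by (auto simp: le_Suc_eq numeral_2_eq_2)
        moreover have "gap_stat (\<lambda>g. snd g - fst g) k n x t = H k"
          using inj by (simp add: gap_stat_def H_def)
        ultimately show "\<bar>gap_stat (\<lambda>g. snd g - fst g) k n x t - (if k = 0 then 1 / 8 else if k = 1 then 1 / 2 else 3 / 8) * t\<bar> \<le> e"
          using d unfolding d_def by linarith
      qed
    qed
  qed (simp_all add: anti_upto_borel)
qed

section \<open>Transfer to the given random points\<close>

locale circle_samples =
  fixes M :: "nat \<Rightarrow> 'a measure" and Z :: "nat \<Rightarrow> nat \<Rightarrow> 'a \<Rightarrow> complex"
  assumes prob: "\<And>n. n \<ge> 3 \<Longrightarrow> prob_space (M n)"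
    and indep: "\<And>n. n \<ge> 3 \<Longrightarrow> prob_space.indep_vars (M n) (\<lambda>_. circle_space) (Z n) {..<n}"
    and unif: "\<And>n i. n \<ge> 3 \<Longrightarrow> i < n \<Longrightarrow> distr (M n) circle_space (Z n i) = uniform_circle"
begin

lemma Z_measurable: "n \<ge> 3 \<Longrightarrow> i < n \<Longrightarrow> Z n i \<in> M n \<rightarrow>\<^sub>M circle_space"
proof -
  assume n: "n \<ge> 3" and i: "i < n"
  show ?thesis using indep[OF n] i unfolding prob_space.indep_vars_def[OF prob[OF n]] by simp
qed

lemma norm_Z: "n \<ge> 3 \<Longrightarrow> i < n \<Longrightarrow> \<omega> \<in> space (M n) \<Longrightarrow> norm (Z n i \<omega>) = 1"
  using measurable_space[OF Z_measurable] by (simp add: circle_space_def space_restrict_space)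

lemma angle_circle: "angle \<in> borel_measurable circle_space"
  unfolding circle_space_def by (rule measurable_restrict_space1[OF measurable_angle])

lemma angle_Z_measurable: "n \<ge> 3 \<Longrightarrow> i < n \<Longrightarrow> (\<lambda>\<omega>. angle (Z n i \<omega>)) \<in> borel_measurable (M n)"
  using measurable_compose[OF Z_measurable angle_circle] .

lemma angle_cis: "0 \<le> u \<Longrightarrow> u < 1 \<Longrightarrow> angle (cis (2 * pi * u)) = u"
proof -
  assume u: "0 \<le> u" "u < 1"
  have "cis (2 * pi * u) = of_real 1 * exp (\<i> * of_real (2 * pi * u))" by (simp add: cis_conv_exp)
  then have "Arg2pi (cis (2 * pi * u)) = 2 * pi * u"
    using u by (intro Arg2pi_unique[of 1]) (simp_all)
  then show ?thesis by (simp add: angle_def)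
qed

text \<open>Almost surely \<open>angle\<close> inverts the parametrisation of the circle, so the
  uniform law pushed to the circle and back is unchanged.\<close>

lemma distr_angle:
  assumes n: "n \<ge> 3" "i < n"
  shows "distr (M n) U01 (\<lambda>\<omega>. angle (Z n i \<omega>)) = U01"
proof -
  have aU: "angle \<in> circle_space \<rightarrow>\<^sub>M U01"
    using angle_circle by (simp cong: measurable_cong_sets add: sets_U01)
  have cisU: "(\<lambda>u. cis (2 * pi * u)) \<in> U01 \<rightarrow>\<^sub>M circle_space"
  proof -
    have "(\<lambda>u. cis (2 * pi * u)) \<in> borel_measurable borel"
      by (intro borel_measurable_continuous_onI continuous_intros)
    then have "(\<lambda>u. cis (2 * pi * u)) \<in> borel_measurable U01" by (simp cong: measurable_cong_sets add: sets_U01)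
    then show ?thesis unfolding circle_space_def by (intro measurable_restrict_space2) auto
  qed
  have "distr (M n) U01 (\<lambda>\<omega>. angle (Z n i \<omega>)) = distr (distr (M n) circle_space (Z n i)) U01 angle"
    by (subst distr_distr[OF aU Z_measurable[OF n]]) (simp add: comp_def)
  also have "\<dots> = distr (distr U01 circle_space (\<lambda>u. cis (2 * pi * u))) U01 angle"
    using unif[OF n] by (simp add: uniform_circle_def U01_def)
  also have "\<dots> = distr U01 U01 (\<lambda>u. angle (cis (2 * pi * u)))"
    by (subst distr_distr[OF aU cisU]) (simp add: comp_def)
  also have "\<dots> = distr U01 U01 (\<lambda>u. u)"
  proof (rule distr_cong_AE)
    have "AE u in U01. 0 \<le> u \<and> u < 1" unfolding U01_def by (rule AE_uniform_measureI) auto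
    then show "AE u in U01. angle (cis (2 * pi * u)) = u" by eventually_elim (simp add: angle_cis)
    show "(\<lambda>u. angle (cis (2 * pi * u))) \<in> U01 \<rightarrow>\<^sub>M U01" using measurable_compose[OF cisU aU] .
  qed auto
  also have "\<dots> = U01" by (rule distr_id)
  finally show ?thesis .
qed

definition angles :: "nat \<Rightarrow> 'a \<Rightarrow> nat \<Rightarrow> real" where
  "angles n \<omega> = (\<lambda>i. angle (Z n i \<omega>))"

lemma distr_angles:
  assumes n: "n \<ge> 3"
  shows "distr (M n) (PU n) (\<lambda>\<omega>. restrict (angles n \<omega>) {..<n}) = PU n"
    "(\<lambda>\<omega>. restrict (angles n \<omega>) {..<n}) \<in> M n \<rightarrow>\<^sub>M PU n"
proof -
  interpret prob_space "M n" using prob n .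
  have aU: "angle \<in> circle_space \<rightarrow>\<^sub>M U01"
    using angle_circle by (simp cong: measurable_cong_sets add: sets_U01)
  have rv: "random_variable U01 (\<lambda>\<omega>. angle (Z n i \<omega>))" if "i \<in> {..<n}" for i
    using measurable_compose[OF Z_measurable aU] n that by simp
  have iv: "indep_vars (\<lambda>_. U01) (\<lambda>i \<omega>. angle (Z n i \<omega>)) {..<n}"
    using indep_vars_compose2[OF indep[OF n], of "\<lambda>_. angle" "\<lambda>_. U01"] aU by simp
  have "0 \<in> {..<n}" using n by simp
  then have ne: "{..<n} \<noteq> {}" by blast
  have "distr (M n) (PiM {..<n} (\<lambda>_. U01)) (\<lambda>\<omega>. \<lambda>i\<in>{..<n}. angle (Z n i \<omega>)) =
      PiM {..<n} (\<lambda>i. distr (M n) U01 (\<lambda>\<omega>. angle (Z n i \<omega>)))"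
    using indep_vars_iff_distr_eq_PiM'[where M' = "\<lambda>_. U01" and X = "\<lambda>i \<omega>. angle (Z n i \<omega>)", OF ne rv] iv by blast
  also have "\<dots> = PiM {..<n} (\<lambda>_. U01)" using distr_angle[OF n] by (intro PiM_cong) auto
  finally show "distr (M n) (PU n) (\<lambda>\<omega>. restrict (angles n \<omega>) {..<n}) = PU n"
    by (simp add: PU_def angles_def)
  show "(\<lambda>\<omega>. restrict (angles n \<omega>) {..<n}) \<in> M n \<rightarrow>\<^sub>M PU n"
    unfolding PU_def angles_def using rv by (intro measurable_restrict) auto
qed

text \<open>The measurable exceptional sets provided by \<open>likely\<close> are pulled back along
  the vector of angles, whose law is \<open>PU n\<close>; each pullback contains \<open>S n\<close>
  and keeps the small probability.\<close>

lemma likely_transfer: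
  assumes P: "likely P" and S: "\<And>n. n \<ge> 3 \<Longrightarrow> S n \<in> sets (M n)"
    and imp: "\<And>n \<omega>. n \<ge> 3 \<Longrightarrow> \<omega> \<in> S n \<Longrightarrow> \<not> P n (restrict (angles n \<omega>) {..<n})"
  shows "(\<lambda>n. measure (M n) (S n)) \<longlonglongrightarrow> 0"
proof -
  obtain B where B: "\<And>n. B n \<in> sets (PU n)" "(\<lambda>n. measure (PU n) (B n)) \<longlonglongrightarrow> 0"
    "\<And>n x. x \<in> space (PU n) - B n \<Longrightarrow> P n x" using P unfolding likely_def by blast
  have "\<forall>\<^sub>F n in sequentially. measure (M n) (S n) \<le> measure (PU n) (B n)"
    using eventually_ge_at_top[of 3]
  proof eventually_elim
    case (elim n)
    interpret prob_space "M n" using prob elim .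
    define X where "X \<omega> = restrict (angles n \<omega>) {..<n}" for \<omega>
    have X: "X \<in> M n \<rightarrow>\<^sub>M PU n" unfolding X_def by (rule distr_angles(2)[OF elim])
    have "S n \<subseteq> X -` B n \<inter> space (M n)"
    proof
      fix \<omega> assume \<omega>: "\<omega> \<in> S n"
      then have sp: "\<omega> \<in> space (M n)" using sets.sets_into_space[OF S[OF elim]] by blast
      then have "X \<omega> \<in> space (PU n)" using measurable_space[OF X] by blast
      moreover have "\<not> P n (X \<omega>)" using imp[OF elim \<omega>] by (simp add: X_def)
      ultimately show "\<omega> \<in> X -` B n \<inter> space (M n)" using B(3) sp by blast
    qed
    then have "measure (M n) (S n) \<le> measure (M n) (X -` B n \<inter> space (M n))"
      using measurable_sets[OF X B(1)] by (rule finite_measure_mono)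
    also have "\<dots> = measure (distr (M n) (PU n) X) (B n)" using X B(1) by (simp add: measure_distr)
    also have "distr (M n) (PU n) X = PU n" unfolding X_def by (rule distr_angles(1)[OF elim])
    finally show ?case .
  qed
  then show ?thesis
    by (rule tendsto_sandwich[OF _ _ tendsto_const B(2), rotated]) simp
qed

lemma inj_measurable:
  assumes n: "n \<ge> 3"
  shows "Measurable.pred (M n) (\<lambda>\<omega>. inj_on (angles n \<omega>) {..<n})"
proof -
  have "Measurable.pred (M n) (\<lambda>\<omega>. \<forall>i\<in>{..<n}. \<forall>j\<in>{..<n}. angle (Z n i \<omega>) = angle (Z n j \<omega>) \<longrightarrow> i = j)"
  proof (intro pred_intros_finite)
    fix i j assume "i \<in> {..<n}" "j \<in> {..<n}"
    then have [measurable]: "(\<lambda>\<omega>. angle (Z n i \<omega>)) \<in> borel_measurable (M n)" "(\<lambda>\<omega>. angle (Z n j \<omega>)) \<in> borel_measurable (M n)"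
      using angle_Z_measurable[OF n] by auto
    show "Measurable.pred (M n) (\<lambda>\<omega>. angle (Z n i \<omega>) = angle (Z n j \<omega>) \<longrightarrow> i = j)" by measurable
  qed auto
  then show ?thesis by (simp only: inj_on_def angles_def)
qed

lemma gap_stat_measurable:
  assumes n: "n \<ge> 3" and h: "h \<in> borel_measurable borel"
  shows "(\<lambda>\<omega>. gap_stat h k n (angles n \<omega>) t) \<in> borel_measurable (M n)"
proof -
  have A: "(\<lambda>\<omega>. angles n \<omega> i) \<in> borel_measurable (M n)" if "i < n" for i
    using angle_Z_measurable[OF n that] by (simp add: angles_def)
  have "0 \<le> order_stat n (angles n \<omega>) i \<and> order_stat n (angles n \<omega>) i < 1" if "i < n" for i \<omega>
  proof -
    have "order_stat n (angles n \<omega>) i \<in> angles n \<omega> ` {..<n}" using order_stat_image[of n "angles n \<omega>"] that by blast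
    then show ?thesis using angle_bounds by (auto simp: angles_def)
  qed
  then have "(\<lambda>\<omega>. \<Sum>g\<in>gaps_upto k n (order_stat n (angles n \<omega>)) t. h g) \<in> borel_measurable (M n)"
    using n by (intro measurable_sum_gaps_upto measurable_order_stat A h) auto
  then show ?thesis unfolding gap_stat_def using inj_measurable[OF n]
    by (intro measurable_If) auto
qed

text \<open>Step paths, measurability and monotonicity in time hold for sums over gaps of any
  measurable function that is nonnegative on gaps, so only the limits at fixed times remain as
  hypotheses. Counts take \<open>h = 1\<close> with normaliser 2 n, lengths take the gap length with
  normaliser 1.\<close>

lemma gap_stat_converges:
  fixes a :: "nat \<Rightarrow> 'a \<Rightarrow> nat \<Rightarrow> real \<Rightarrow> real" and c :: "nat \<Rightarrow> real"
  assumes h: "h \<in> borel_measurable borel" "\<And>a b. a < b \<Longrightarrow> h (a, b) \<ge> 0" and c: "\<And>n. n \<ge> 3 \<Longrightarrow> c n > 0"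
    and a: "\<And>n \<omega> k t. n \<ge> 3 \<Longrightarrow> \<omega> \<in> space (M n) \<Longrightarrow> t \<in> {0..1} \<Longrightarrow> a n \<omega> k t = gap_stat h k n (angles n \<omega>) t / c n"
    and \<alpha>: "\<And>k. \<alpha> k \<ge> 0"
    and lim: "\<And>k t e. k \<le> 2 \<Longrightarrow> t \<in> {0..1} \<Longrightarrow> e > 0 \<Longrightarrow> likely (\<lambda>n x. \<bar>gap_stat h k n x t / c n - \<alpha> k * t\<bar> \<le> e)"
  shows "converges_in_distribution J1_topology M (\<lambda>n \<omega>. path3 (a n \<omega> 0) (a n \<omega> 1) (a n \<omega> 2))
    (return (borel_of J1_topology) (path3 (\<lambda>t. \<alpha> 0 * t) (\<lambda>t. \<alpha> 1 * t) (\<lambda>t. \<alpha> 2 * t)))"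
proof (rule path3_converges)
  show m: "(\<lambda>\<omega>. a n \<omega> k t) \<in> borel_measurable (M n)" if "n \<ge> 3" "t \<in> {0..1}" for n k t
  proof -
    have "(\<lambda>\<omega>. gap_stat h k n (angles n \<omega>) t / c n) \<in> borel_measurable (M n)"
      using gap_stat_measurable[OF that(1) h(1)] by simp
    then show ?thesis using a that by (subst measurable_cong) auto
  qed
  show "\<exists>B. step_path B (path3 (a n \<omega> 0) (a n \<omega> 1) (a n \<omega> 2))" if "n \<ge> 3" "\<omega> \<in> space (M n)" for n \<omega>
  proof (rule step_path_gaps[of n "order_stat n (angles n \<omega>)"])
    fix s t :: real assume st: "s \<in> {0..1}" "t \<in> {0..1}"
      and eq: "\<And>k. gaps_upto k n (order_stat n (angles n \<omega>)) s = gaps_upto k n (order_stat n (angles n \<omega>)) t"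
    have "a n \<omega> k s = a n \<omega> k t" for k using a[OF that st(1)] a[OF that st(2)] eq by (simp add: gap_stat_def)
    then show "path3 (a n \<omega> 0) (a n \<omega> 1) (a n \<omega> 2) s = path3 (a n \<omega> 0) (a n \<omega> 1) (a n \<omega> 2) t"
      using st by (simp add: path3_def)
  qed (use that in simp)
  show "a n \<omega> k s \<le> a n \<omega> k t" if "n \<ge> 3" "\<omega> \<in> space (M n)" "0 \<le> s" "s \<le> t" "t \<le> 1" for n \<omega> k s t
  proof -
    have "gap_stat h k n (angles n \<omega>) s \<le> gap_stat h k n (angles n \<omega>) t"
      unfolding gap_stat_def using that h(2) by (auto intro: sum_gaps_upto_mono)
    then show ?thesis using a[OF that(1,2), of s k] a[OF that(1,2), of t k] that c[OF that(1)]
      by (simp add: divide_right_mono)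
  qed
  show "(\<lambda>n. measure (M n) {\<omega> \<in> space (M n). \<bar>a n \<omega> k t - \<alpha> k * t\<bar> > e}) \<longlonglongrightarrow> 0"
    if "k \<le> 2" "t \<in> {0..1}" "e > 0" for k t e
  proof (rule likely_transfer[OF lim[OF that]])
    fix n :: nat assume n: "n \<ge> 3"
    note m[OF n that(2), measurable]
    show "{\<omega> \<in> space (M n). \<bar>a n \<omega> k t - \<alpha> k * t\<bar> > e} \<in> sets (M n)" by measurable
    fix \<omega> assume "\<omega> \<in> {\<omega> \<in> space (M n). \<bar>a n \<omega> k t - \<alpha> k * t\<bar> > e}"
    then have \<omega>: "\<omega> \<in> space (M n)" "e < \<bar>a n \<omega> k t - \<alpha> k * t\<bar>" by simp_all
    then show "\<not> \<bar>gap_stat h k n (restrict (angles n \<omega>) {..<n}) t / c n - \<alpha> k * t\<bar> \<le> e"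
      unfolding gap_stat_restrict a[OF n \<omega>(1) that(2), symmetric] by simp
  qed
qed (use prob \<alpha> in auto)

lemma region_stats:
  assumes "n \<ge> 3" "\<omega> \<in> space (M n)" "t \<in> {0..1}"
  shows "real (region_count k n (\<lambda>i. Z n i \<omega>) t) = gap_stat (\<lambda>_. 1) k n (angles n \<omega>) t"
    "region_length k n (\<lambda>i. Z n i \<omega>) t = gap_stat (\<lambda>g. snd g - fst g) k n (angles n \<omega>) t"
  using region_stats_eq[of n "\<lambda>i. Z n i \<omega>" t k] norm_Z assms unfolding gap_stat_def angles_def by auto

end

theorem theorem11:
  fixes M :: "nat \<Rightarrow> 'a measure" and Z :: "nat \<Rightarrow> nat \<Rightarrow> 'a \<Rightarrow> complex"
  assumes prob: "\<And>n. n \<ge> 3 \<Longrightarrow> prob_space (M n)"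
    and indep: "\<And>n. n \<ge> 3 \<Longrightarrow> prob_space.indep_vars (M n) (\<lambda>_. circle_space) (Z n) {..<n}"
    and unif: "\<And>n i. n \<ge> 3 \<Longrightarrow> i < n \<Longrightarrow> distr (M n) circle_space (Z n i) = uniform_circle"
  shows "(converges_in_distribution J1_topology M
           (\<lambda>n \<omega>. path3
              (\<lambda>t. real (region_count 0 n (\<lambda>i. Z n i \<omega>) t) / (2 * real n))
              (\<lambda>t. real (region_count 1 n (\<lambda>i. Z n i \<omega>) t) / (2 * real n))
              (\<lambda>t. real (region_count 2 n (\<lambda>i. Z n i \<omega>) t) / (2 * real n)))
           (return (borel_of J1_topology) (path3 (\<lambda>t. t / 4) (\<lambda>t. t / 2) (\<lambda>t. t / 4))))
       \<and> (converges_in_distribution J1_topology M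
           (\<lambda>n \<omega>. path3
              (region_length 0 n (\<lambda>i. Z n i \<omega>))
              (region_length 1 n (\<lambda>i. Z n i \<omega>))
              (region_length 2 n (\<lambda>i. Z n i \<omega>)))
           (return (borel_of J1_topology) (path3 (\<lambda>t. t / 8) (\<lambda>t. t / 2) (\<lambda>t. 3 * t / 8))))"
proof (intro conjI, goal_cases)
  interpret circle_samples M Z using prob indep unif by (rule circle_samples.intro)
  {
    case 1
    show ?case
      using gap_stat_converges[where h = "\<lambda>_. 1" and c = "\<lambda>n. 2 * real n" and \<alpha> = "\<lambda>k. if k = 1 then 1 / 2 else 1 / 4"
          and a = "\<lambda>n \<omega> k t. real (region_count k n (\<lambda>i. Z n i \<omega>) t) / (2 * real n)"]
        region_stats(1) likely_counts by simp
  next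
    case 2
    have "(\<lambda>g :: real \<times> real. snd g - fst g) \<in> borel_measurable borel"
      by (intro borel_measurable_continuous_onI continuous_intros)
    then show ?case
      using gap_stat_converges[where h = "\<lambda>g. snd g - fst g" and c = "\<lambda>_. 1"
          and \<alpha> = "\<lambda>k. if k = 0 then 1 / 8 else if k = 1 then 1 / 2 else 3 / 8"
          and a = "\<lambda>n \<omega> k. region_length k n (\<lambda>i. Z n i \<omega>)"]
        region_stats(2) likely_lengths by simp
  }
qed

end
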